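(* Let $\varphi$ satisfy (BP) with exponent $s\in\mathbb{R}$ and suppose that $\widehat\varphi$ is continuous in a neighborhood of $\xi=0$. Let $(h_k)$ and $(\varepsilon_k)$ be scales such that $h_k/\varepsilon_k\to0$. Let $(u_k)$ be a sequence in $H^{-s}(\mathbb{R}^d)$ such that $(\langle h_kD_x\rangle^{-s}u_k)$ is bounded in $L^2(\mathbb{R}^d)$ and $\varepsilon_k$-oscillatory. (i) Then $(S_\varphi^{h_k}u_k)$ is $\varepsilon_k$-oscillatory. (ii) Suppose moreover that $m^{\varepsilon_k}[u_k]$ converges in $\mathcal{S}'(\mathbb{R}^d\times\mathbb{R}^d)$ to a Wigner measure $\mu$. Then $M^{\varepsilon_k}[S_\varphi^{h_k}u_k]$ converges in $\mathcal{S}'(\mathbb{R}^d\times\mathbb{R}^d)$ to the Wigner measure $\mu^\varphi$ given by $$\mu^\varphi=|\widehat\varphi(0)|^2\mu.$$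
   Context: A scale is a sequence of positive numbers tending to $0$. Fourier transform: $\widehat u(\xi)=\int_{\mathbb{R}^d}u(x)e^{-ix\cdot\xi}dx$; $Q=[-\pi,\pi)^d$; $\langle\xi\rangle=(1+|\xi|^2)^{1/2}$; $\langle hD_x\rangle^r$ is the Fourier multiplier with symbol $\langle h\xi\rangle^r$; $H^r(\mathbb{R}^d)$ is the Sobolev space of order $r\in\mathbb{R}$. (BP) with exponent $s$: $\varphi\in H^s(\mathbb{R}^d)$ and there is $B>0$ with $\sum_{k\in\mathbb{Z}^d}|\langle\xi+2\pi k\rangle^s\widehat\varphi(\xi+2\pi k)|^2\le B$ for a.e. $\xi\in\mathbb{R}^d$. A sequence $(v_k)$ in $L^2(\mathbb{R}^d)$ is $\varepsilon_k$-oscillatory if $\limsup_{k\to\infty}\int_{|\xi|>R/\varepsilon_k}|\widehat{v_k}(\xi)|^2d\xi\to0$ as $R\to\infty$. $L^2(h\mathbb{Z}^d)$: functions $U:\mathbb{Z}^d\to\mathbb{C}$ with $h^d\sum_n|U_n|^2<\infty$; $\widehat U(\xi)=\sum_nU_ne^{-in\cdot\xi}$. A sequence of discrete functions $U^{h_k}\in L^2(h_k\mathbb{Z}^d)$ is $\varepsilon_k$-oscillatory if $\limsup_{k\to\infty}h_k^d\int_{Q\setminus B(0;(h_k/\varepsilon_k)R)}|\widehat{U^{h_k}}(\xi)|^2d\xi\to0$ as $R\to\infty$. Sampling: $S_\varphi^hu(n)=h^{-d}\langle\overline{\varphi_n^h},u\rangle$, $n\in\mathbb{Z}^d$, with $\varphi_n^h(x)=\varphi(x/h-n)$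 and $\langle\cdot,\cdot\rangle$ the bilinear duality pairing $H^s\times H^{-s}$. For $u\in\mathcal{S}'(\mathbb{R}^d)$: $m^\varepsilon[u](x,\xi)=(2\pi\varepsilon)^{-d}\,\overline{u(x)}\,\widehat u(\xi/\varepsilon)e^{ix\cdot\xi/\varepsilon}$. For $U\in L^2(h\mathbb{Z}^d)$, $$M^\varepsilon[U](x,\xi)=\frac{h^{2d}}{(2\pi\varepsilon)^d}\sum_{m\in\mathbb{Z}^d}\overline{U_m}\,\widehat U(h\xi/\varepsilon)e^{im\cdot(h/\varepsilon)\xi}\delta_{hm}(x).$$ Both are elements of $\mathcal{S}'(\mathbb{R}^d\times\mathbb{R}^d)$; Wigner measures are the positive Radon measures obtained as their (weak) limits in $\mathcal{S}'$. *)

theory Defs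
  imports "HOL-Analysis.Analysis"
begin

text \<open>
  \<open>\<real>\<^sup>d\<close> is \<open>real ^ 'd\<close> and \<open>\<int>\<^sup>d\<close> is \<open>int ^ 'd\<close>, with \<open>d = CARD('d) \<ge> 1\<close>.  Distributions are
  functionals on functions; they are only ever evaluated at Schwartz functions, and their values
  elsewhere are irrelevant.
\<close>

section \<open>Schwartz functions and tempered distributions\<close>

fun iter_pderiv :: "'a::euclidean_space list \<Rightarrow> ('a \<Rightarrow> complex) \<Rightarrow> 'a \<Rightarrow> complex" where
  "iter_pderiv [] f = f"
| "iter_pderiv (b # bs) f = (\<lambda>x. frechet_derivative (iter_pderiv bs f) (at x) b)"

definition schwartz :: "('a::euclidean_space \<Rightarrow> complex) \<Rightarrow> bool" where
  "schwartz f \<longleftrightarrow>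
     (\<forall>bs. set bs \<subseteq> Basis \<longrightarrow>
        (\<forall>x. iter_pderiv bs f differentiable (at x)) \<and>
        (\<forall>N. bounded (range (\<lambda>x. (1 + norm x) ^ N *\<^sub>R iter_pderiv bs f x))))"

definition schwartz_seminorm :: "nat \<Rightarrow> ('a::euclidean_space \<Rightarrow> complex) \<Rightarrow> real" where
  "schwartz_seminorm N f =
     (\<Sum>bs | set bs \<subseteq> Basis \<and> length bs \<le> N. SUP x. (1 + norm x) ^ N * norm (iter_pderiv bs f x))"

type_synonym 'a distribution = "('a \<Rightarrow> complex) \<Rightarrow> complex"

definition tempered :: "'a::euclidean_space distribution \<Rightarrow> bool" where
  "tempered T \<longleftrightarrow>
     (\<forall>f g. schwartz f \<longrightarrow> schwartz g \<longrightarrow> T (\<lambda>x. f x + g x) = T f + T g) \<and>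
     (\<forall>c f. schwartz f \<longrightarrow> T (\<lambda>x. c * f x) = c * T f) \<and>
     (\<exists>C N. \<forall>f. schwartz f \<longrightarrow> norm (T f) \<le> C * schwartz_seminorm N f)"

definition tendsto_tempered ::
    "(nat \<Rightarrow> 'a::euclidean_space distribution) \<Rightarrow> 'a distribution \<Rightarrow> bool" where
  "tendsto_tempered T L \<longleftrightarrow>
     (\<forall>k. tempered (T k)) \<and> tempered L \<and> (\<forall>f. schwartz f \<longrightarrow> (\<lambda>k. T k f) \<longlonglongrightarrow> L f)"

definition represents :: "('a::euclidean_space \<Rightarrow> complex) \<Rightarrow> 'a distribution \<Rightarrow> bool" where
  "represents g T \<longleftrightarrow> g \<in> borel_measurable borel \<and>
     (\<forall>f. schwartz f \<longrightarrow> integrable lborel (\<lambda>x. g x * f x) \<and> T f = (LINT x|lborel. g x * f x))"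

text \<open>A representing function is unique up to null sets, and is used only through
  almost-everywhere statements and integrals.\<close>
definition fun_of :: "'a::euclidean_space distribution \<Rightarrow> 'a \<Rightarrow> complex" where
  "fun_of T = (SOME g. represents g T)"

definition cnj_dist :: "'a distribution \<Rightarrow> 'a distribution" where
  "cnj_dist T f = cnj (T (\<lambda>x. cnj (f x)))"

definition mult_dist :: "('a \<Rightarrow> complex) \<Rightarrow> 'a distribution \<Rightarrow> 'a distribution" where
  "mult_dist m T f = T (\<lambda>x. m x * f x)"

text \<open>The distribution \<open>T(x/h - y)\<close>, for \<open>h > 0\<close>.\<close>
definition rescale_dist ::
    "real \<Rightarrow> real ^ 'd \<Rightarrow> (real ^ 'd::finite) distribution \<Rightarrow> (real ^ 'd) distribution" where
  "rescale_dist h y T f = of_real (h ^ CARD('d)) * T (\<lambda>x. f (h *\<^sub>R (x + y)))"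

definition tensor_dist :: "'a distribution \<Rightarrow> 'b distribution \<Rightarrow> ('a \<times> 'b) distribution" where
  "tensor_dist S T a = S (\<lambda>x. T (\<lambda>\<xi>. a (x, \<xi>)))"

section \<open>Fourier transform, multipliers and Sobolev spaces\<close>

definition fourier :: "(real ^ 'd::finite \<Rightarrow> complex) \<Rightarrow> real ^ 'd \<Rightarrow> complex" where
  "fourier f \<xi> = (LINT x|lborel. f x * cis (- (x \<bullet> \<xi>)))"

definition inv_fourier :: "(real ^ 'd::finite \<Rightarrow> complex) \<Rightarrow> real ^ 'd \<Rightarrow> complex" where
  "inv_fourier f x = (LINT \<xi>|lborel. f \<xi> * cis (x \<bullet> \<xi>)) / of_real ((2 * pi) ^ CARD('d))"

definition fourier_dist :: "(real ^ 'd::finite) distribution \<Rightarrow> (real ^ 'd) distribution" where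
  "fourier_dist T f = T (fourier f)"

definition inv_fourier_dist :: "(real ^ 'd::finite) distribution \<Rightarrow> (real ^ 'd) distribution" where
  "inv_fourier_dist T f = T (inv_fourier f)"

text \<open>The Fourier transform of a distribution as a function, when it is one.\<close>
definition fourier_fun :: "(real ^ 'd::finite) distribution \<Rightarrow> real ^ 'd \<Rightarrow> complex" where
  "fourier_fun T = fun_of (fourier_dist T)"

definition bracket :: "real ^ 'd::finite \<Rightarrow> real" where
  "bracket \<xi> = sqrt (1 + (norm \<xi>)\<^sup>2)"

text \<open>\<open>\<langle>hD\<^sub>x\<rangle>\<^sup>r\<close>\<close>
definition bracket_hD ::
    "real \<Rightarrow> real \<Rightarrow> (real ^ 'd::finite) distribution \<Rightarrow> (real ^ 'd) distribution" where
  "bracket_hD h r u =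
     inv_fourier_dist (mult_dist (\<lambda>\<xi>. of_real (bracket (h *\<^sub>R \<xi>) powr r)) (fourier_dist u))"

definition sobolev :: "real \<Rightarrow> (real ^ 'd::finite) distribution \<Rightarrow> bool" where
  "sobolev r u \<longleftrightarrow> tempered u \<and>
     (\<exists>g. represents g (fourier_dist u) \<and>
          integrable lborel (\<lambda>\<xi>. (bracket \<xi> powr r * norm (g \<xi>))\<^sup>2))"

definition in_L2 :: "'a::euclidean_space distribution \<Rightarrow> bool" where
  "in_L2 v \<longleftrightarrow> tempered v \<and> (\<exists>g. represents g v \<and> integrable lborel (\<lambda>x. (norm (g x))\<^sup>2))"

definition L2_norm :: "'a::euclidean_space distribution \<Rightarrow> real" where
  "L2_norm v = sqrt (LINT x|lborel. (norm (fun_of v x))\<^sup>2)"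

definition bounded_in_L2 :: "(nat \<Rightarrow> 'a::euclidean_space distribution) \<Rightarrow> bool" where
  "bounded_in_L2 v \<longleftrightarrow> (\<forall>k. in_L2 (v k)) \<and> bdd_above (range (\<lambda>k. L2_norm (v k)))"

text \<open>The bilinear pairing of \<open>H\<^sup>s\<close> with \<open>H\<^sup>-\<^sup>s\<close>: the continuous extension of \<open>\<langle>v, f\<rangle> = v f\<close> for
  Schwartz \<open>f\<close>, that is of \<open>\<integral> v f\<close>, written on the Fourier side by Parseval's formula.  There
  is no complex conjugation, hence the reflection.\<close>
definition sobolev_pairing ::
    "(real ^ 'd::finite) distribution \<Rightarrow> (real ^ 'd) distribution \<Rightarrow> complex" where
  "sobolev_pairing v u =
     (LINT \<xi>|lborel. fourier_fun v \<xi> * fourier_fun u (- \<xi>)) / of_real ((2 * pi) ^ CARD('d))"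

section \<open>Scales, the lattice and sampling\<close>

definition is_scale :: "(nat \<Rightarrow> real) \<Rightarrow> bool" where
  "is_scale h \<longleftrightarrow> (\<forall>k. 0 < h k) \<and> h \<longlonglongrightarrow> 0"

definition lat :: "int ^ 'd::finite \<Rightarrow> real ^ 'd" where
  "lat n = (\<chi> i. real_of_int (n $ i))"

definition Q :: "(real ^ 'd::finite) set" where
  "Q = {\<xi>. \<forall>i. - pi \<le> \<xi> $ i \<and> \<xi> $ i < pi}"

definition BP :: "real \<Rightarrow> (real ^ 'd::finite) distribution \<Rightarrow> bool" where
  "BP s \<phi> \<longleftrightarrow> sobolev s \<phi> \<and>
     (\<exists>B>0. AE \<xi> in lborel.
        (\<Sum>\<^sub>\<infinity>k\<in>UNIV. ennreal ((bracket (\<xi> + (2 * pi) *\<^sub>R lat k) powr s *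
                              norm (fourier_fun \<phi> (\<xi> + (2 * pi) *\<^sub>R lat k)))\<^sup>2)) \<le> ennreal B)"

text \<open>Membership in \<open>L\<^sup>2(h\<int>\<^sup>d)\<close>, which as a set does not depend on \<open>h > 0\<close>.\<close>
definition in_l2 :: "(int ^ 'd::finite \<Rightarrow> complex) \<Rightarrow> bool" where
  "in_l2 U \<longleftrightarrow> (\<lambda>n. (norm (U n))\<^sup>2) summable_on UNIV"

text \<open>The \<open>2\<pi>\<int>\<^sup>d\<close>-periodic sum of the series \<open>\<Sum>\<^sub>n U\<^sub>n e\<^sup>-\<^sup>i\<^sup>n\<^sup>\<xi>\<close>, which converges unconditionally in
  \<open>L\<^sup>2(Q)\<close> for square-summable \<open>U\<close>; unique up to null sets.\<close>
definition lattice_fourier :: "(int ^ 'd::finite \<Rightarrow> complex) \<Rightarrow> real ^ 'd \<Rightarrow> complex" where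
  "lattice_fourier U = (SOME V. V \<in> borel_measurable borel \<and>
     (\<forall>\<xi> k. V (\<xi> + (2 * pi) *\<^sub>R lat k) = V \<xi>) \<and>
     ((\<lambda>F. \<integral>\<^sup>+\<xi>\<in>Q. ennreal ((norm (V \<xi> - (\<Sum>n\<in>F. U n * cis (- (lat n \<bullet> \<xi>)))))\<^sup>2) \<partial>lborel)
        \<longlongrightarrow> 0) (finite_subsets_at_top UNIV))"

text \<open>\<open>S\<^sub>\<phi>\<^sup>h u\<close>\<close>
definition sample ::
    "(real ^ 'd::finite) distribution \<Rightarrow> real \<Rightarrow> (real ^ 'd) distribution \<Rightarrow> int ^ 'd \<Rightarrow> complex" where
  "sample \<phi> h u n =
     sobolev_pairing (cnj_dist (rescale_dist h (lat n) \<phi>)) u / of_real (h ^ CARD('d))"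

definition oscillatory :: "(nat \<Rightarrow> real) \<Rightarrow> (nat \<Rightarrow> (real ^ 'd::finite) distribution) \<Rightarrow> bool" where
  "oscillatory \<epsilon> v \<longleftrightarrow> (\<forall>k. in_L2 (v k)) \<and>
     ((\<lambda>R. limsup (\<lambda>k. \<integral>\<^sup>+\<xi>\<in>{\<xi>. norm \<xi> > R / \<epsilon> k}.
         ennreal ((norm (fourier_fun (v k) \<xi>))\<^sup>2) \<partial>lborel)) \<longlongrightarrow> 0) at_top"

definition lattice_oscillatory ::
    "(nat \<Rightarrow> real) \<Rightarrow> (nat \<Rightarrow> real) \<Rightarrow> (nat \<Rightarrow> int ^ 'd::finite \<Rightarrow> complex) \<Rightarrow> bool" where
  "lattice_oscillatory h \<epsilon> U \<longleftrightarrow> (\<forall>k. in_l2 (U k)) \<and>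
     ((\<lambda>R. limsup (\<lambda>k. ennreal (h k ^ CARD('d)) *
         (\<integral>\<^sup>+\<xi>\<in>Q - ball 0 (h k / \<epsilon> k * R).
            ennreal ((norm (lattice_fourier (U k) \<xi>))\<^sup>2) \<partial>lborel))) \<longlongrightarrow> 0) at_top"

section \<open>Wigner transforms and measures\<close>

text \<open>\<open>m\<^sup>\<epsilon>[u]\<close>\<close>
definition wigner ::
    "real \<Rightarrow> (real ^ 'd::finite) distribution \<Rightarrow> ((real ^ 'd) \<times> (real ^ 'd)) distribution" where
  "wigner \<epsilon> u a =
     mult_dist (\<lambda>(x, \<xi>). cis (x \<bullet> \<xi> / \<epsilon>))
       (tensor_dist (cnj_dist u) (rescale_dist \<epsilon> 0 (fourier_dist u))) a
     / of_real ((2 * pi * \<epsilon>) ^ CARD('d))"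

text \<open>\<open>M\<^sup>\<epsilon>[U]\<close>, with the lattice spacing \<open>h\<close> as an explicit argument\<close>
definition lattice_wigner ::
    "real \<Rightarrow> real \<Rightarrow> (int ^ 'd::finite \<Rightarrow> complex) \<Rightarrow> ((real ^ 'd) \<times> (real ^ 'd)) distribution" where
  "lattice_wigner h \<epsilon> U a =
     of_real (h ^ (2 * CARD('d)) / (2 * pi * \<epsilon>) ^ CARD('d)) *
     (\<Sum>\<^sub>\<infinity>m\<in>UNIV. cnj (U m) *
        (LINT \<xi>|lborel. lattice_fourier U ((h / \<epsilon>) *\<^sub>R \<xi>) * cis (lat m \<bullet> ((h / \<epsilon>) *\<^sub>R \<xi>)) *
           a (h *\<^sub>R lat m, \<xi>)))"

text \<open>On a Euclidean space, the positive Radon measures are the Borel measures that are finite on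
  compact sets.\<close>
definition radon_measure :: "'a::euclidean_space measure \<Rightarrow> bool" where
  "radon_measure \<mu> \<longleftrightarrow> sets \<mu> = sets borel \<and> (\<forall>K. compact K \<longrightarrow> emeasure \<mu> K < \<infinity>)"

definition tendsto_measure ::
    "(nat \<Rightarrow> 'a::euclidean_space distribution) \<Rightarrow> 'a measure \<Rightarrow> bool" where
  "tendsto_measure T \<mu> \<longleftrightarrow> radon_measure \<mu> \<and> (\<forall>a. schwartz a \<longrightarrow> integrable \<mu> a) \<and>
     tendsto_tempered T (\<lambda>a. LINT z|\<mu>. a z)"

end

theory Submission
  imports Defs "HOL-Probability.Probability"
begin

text \<open>
  On the Fourier side the samples are the Fourier coefficients of the \<open>2\<pi>\<int>\<^sup>d\<close>-periodization of the
  symbol \<open>conj \<phi>hat(\<eta>) uhat(\<eta>/h)\<close>.  By Cauchy--Schwarz and (BP), the \<open>L\<^sup>2\<close> norm of the periodization,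
  also when the symbol is cut off outside a ball, is controlled by that of the Fourier transform of
  \<open>\<langle>hD\<rangle>\<^sup>-\<^sup>s u\<close> on the corresponding set of frequencies; this gives (i).

  For (ii), both Wigner transforms are values of one and the same sesquilinear form on functions of
  the frequency, at \<open>uhat\<close> and at the rescaled periodization \<open>w\<close>.  The form is bounded, uniformly in
  \<open>\<epsilon> \<le> 1\<close>, by \<open>L\<^sup>2\<close> norms with the weight \<open>(1 + |\<epsilon>\<xi>|)\<^sup>-\<^sup>N\<close>, and in these norms \<open>w - conj \<phi>hat(0) uhat\<close>
  tends to \<open>0\<close>: for \<open>|\<xi>| < R/\<epsilon>\<close> by continuity of \<open>\<phi>hat\<close> at \<open>0\<close>, in the rest of the fundamental cell by
  the oscillation hypothesis, and in the other cells because \<open>|\<epsilon>\<xi>|\<close> is at least of order \<open>\<epsilon>/h\<close> there.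
\<close>

section \<open>Calculus of Schwartz functions\<close>

text \<open>What shapes (ii) is that neither function of the frequency need be square integrable:
  uhat may grow like the bracket of h \<xi> to the power s, and w is periodic with period 2 pi / h.
  Moreover the test functions are not compactly supported in \<xi>, so the aliases of w away from 0
  cannot be cut off. Hence the weights, with N \<ge> |s| to absorb the bracket and N \<ge> d to make
  the sum over all cells converge; the cells other than the fundamental one then cost only a factor
  of order (h/\<epsilon>)^(2N). The factor |\<phi>hat(0)|^2 arises because conj \<phi>hat(0) enters
  once in each slot of the sesquilinear form. A second difficulty is that all Fourier transforms of
  distributions are representing functions, fixed only up to null sets. Identities between them hold
  almost everywhere and have to be carried along dilations and along all lattice translations at
  once.\<close>

definition rapid :: "('a::euclidean_space \<Rightarrow> complex) \<Rightarrow> bool" where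
  "rapid f \<longleftrightarrow> (\<forall>N. \<exists>C. \<forall>x. (1 + norm x) ^ N * norm (f x) \<le> C)"

definition slow :: "('a::euclidean_space \<Rightarrow> complex) \<Rightarrow> bool" where
  "slow f \<longleftrightarrow> (\<exists>N C. \<forall>x. norm (f x) \<le> C * (1 + norm x) ^ N)"

text \<open>One predicate serves two classes: \<open>D = rapid\<close> gives the Schwartz functions
  and \<open>D = slow\<close> their smooth multipliers. Closure under sums, products, exponentials
  and affine substitutions is then proved once for both.\<close>

definition smooth_with :: "(('a::euclidean_space \<Rightarrow> complex) \<Rightarrow> bool) \<Rightarrow> ('a \<Rightarrow> complex) \<Rightarrow> bool" where
  "smooth_with D f \<longleftrightarrow> (\<forall>bs. set bs \<subseteq> Basis \<longrightarrow>
     (\<forall>x. iter_pderiv bs f differentiable (at x)) \<and> D (iter_pderiv bs f))"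

abbreviation moderate :: "('a::euclidean_space \<Rightarrow> complex) \<Rightarrow> bool" where
  "moderate \<equiv> smooth_with slow"

text \<open>These are the closure properties that the Leibniz rule uses: a derivative of a product
  is a sum of terms, each a slow factor times a factor in \<open>D\<close>.\<close>

definition slow_module :: "(('a::euclidean_space \<Rightarrow> complex) \<Rightarrow> bool) \<Rightarrow> bool" where
  "slow_module D \<longleftrightarrow> D (\<lambda>x. 0) \<and> (\<forall>f g. D f \<longrightarrow> D g \<longrightarrow> D (\<lambda>x. f x + g x)) \<and>
     (\<forall>m f. slow m \<longrightarrow> D f \<longrightarrow> D (\<lambda>x. m x * f x))"

lemma slowE:
  assumes "slow f"
  obtains N C where "C \<ge> 0" "\<And>x. norm (f x) \<le> C * (1 + norm x) ^ N"
proof -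
  obtain N C where *: "\<And>x. norm (f x) \<le> C * (1 + norm x) ^ N"
    using assms by (auto simp: slow_def)
  have "0 \<le> norm (f 0)" by simp
  also have "\<dots> \<le> C" using *[of 0] by simp
  finally show ?thesis using * that by blast
qed

lemma slow_const [simp]: "slow (\<lambda>x. c)"
  unfolding slow_def by (intro exI[of _ 0] exI[of _ "norm c"]) auto

lemma slow_module_slow: "slow_module slow"
  unfolding slow_module_def
proof (intro conjI allI impI)
  fix f g :: "'a \<Rightarrow> complex" assume "slow f" "slow g"
  then obtain N C M D where f: "C \<ge> 0" "\<And>x. norm (f x) \<le> C * (1 + norm x) ^ N"
    and g: "D \<ge> 0" "\<And>x. norm (g x) \<le> D * (1 + norm x) ^ M"
    by (metis slowE)
  have "norm (f x + g x) \<le> (C + D) * (1 + norm x) ^ (N + M)" for x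
  proof -
    have "norm (f x + g x) \<le> C * (1 + norm x) ^ N + D * (1 + norm x) ^ M"
      using f(2)[of x] g(2)[of x] norm_triangle_ineq[of "f x" "g x"] by linarith
    also have "\<dots> \<le> C * (1 + norm x) ^ (N + M) + D * (1 + norm x) ^ (N + M)"
      using f(1) g(1) by (intro add_mono mult_left_mono power_increasing) auto
    finally show ?thesis by (simp add: algebra_simps)
  qed
  then show "slow (\<lambda>x. f x + g x)" unfolding slow_def by blast
next
  fix f g :: "'a \<Rightarrow> complex" assume "slow f" "slow g"
  then obtain N C M D where f: "C \<ge> 0" "\<And>x. norm (f x) \<le> C * (1 + norm x) ^ N"
    and g: "D \<ge> 0" "\<And>x. norm (g x) \<le> D * (1 + norm x) ^ M"
    by (metis slowE)
  have "norm (f x * g x) \<le> (C * D) * (1 + norm x) ^ (N + M)" for x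
  proof -
    have "norm (f x * g x) \<le> (C * (1 + norm x) ^ N) * (D * (1 + norm x) ^ M)"
      unfolding norm_mult using f g by (intro mult_mono) auto
    then show ?thesis by (simp add: algebra_simps power_add)
  qed
  then show "slow (\<lambda>x. f x * g x)" unfolding slow_def by blast
qed simp

lemma slow_module_rapid: "slow_module rapid"
  unfolding slow_module_def
proof (intro conjI allI impI)
  show "rapid (\<lambda>x::'a. 0)" by (auto simp: rapid_def)
next
  fix f g :: "'a \<Rightarrow> complex" assume fg: "rapid f" "rapid g"
  show "rapid (\<lambda>x. f x + g x)" unfolding rapid_def
  proof
    fix N
    obtain C D where f: "\<And>x. (1 + norm x) ^ N * norm (f x) \<le> C"
      and g: "\<And>x. (1 + norm x) ^ N * norm (g x) \<le> D"
      using fg unfolding rapid_def by metis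
    have "(1 + norm x) ^ N * norm (f x + g x) \<le> C + D" for x
    proof -
      have "(1 + norm x) ^ N * norm (f x + g x) \<le> (1 + norm x) ^ N * (norm (f x) + norm (g x))"
        by (intro mult_left_mono norm_triangle_ineq) auto
      then show ?thesis using f[of x] g[of x] by (simp add: algebra_simps)
    qed
    then show "\<exists>C. \<forall>x. (1 + norm x) ^ N * norm (f x + g x) \<le> C" by blast
  qed
next
  fix m f :: "'a \<Rightarrow> complex" assume mf: "slow m" "rapid f"
  show "rapid (\<lambda>x. m x * f x)" unfolding rapid_def
  proof
    fix N
    obtain M C where m: "C \<ge> 0" "\<And>x. norm (m x) \<le> C * (1 + norm x) ^ M"
      using mf(1) by (metis slowE)
    obtain D where f: "\<And>x. (1 + norm x) ^ (N + M) * norm (f x) \<le> D"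
      using mf(2) unfolding rapid_def by metis
    have "(1 + norm x) ^ N * norm (m x * f x) \<le> C * D" for x
    proof -
      have "(1 + norm x) ^ N * norm (m x * f x) \<le> (1 + norm x) ^ N * ((C * (1 + norm x) ^ M) * norm (f x))"
        unfolding norm_mult using m by (intro mult_left_mono mult_right_mono) auto
      also have "\<dots> = C * ((1 + norm x) ^ (N + M) * norm (f x))"
        by (simp add: power_add)
      also have "\<dots> \<le> C * D" using f m(1) by (intro mult_left_mono) auto
      finally show ?thesis .
    qed
    then show "\<exists>C. \<forall>x. (1 + norm x) ^ N * norm (m x * f x) \<le> C" by blast
  qed
qed

lemma slow_moduleD:
  assumes "slow_module D"
  shows "D (\<lambda>x. 0)" "D f \<Longrightarrow> D g \<Longrightarrow> D (\<lambda>x. f x + g x)"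
    "slow m \<Longrightarrow> D f \<Longrightarrow> D (\<lambda>x. m x * f x)"
  using assms unfolding slow_module_def by blast+

lemma slow_mult: "slow f \<Longrightarrow> slow g \<Longrightarrow> slow (\<lambda>x. f x * g x)"
  by (rule slow_moduleD(3)[OF slow_module_slow])

lemma schwartz_eq_smooth_with: "schwartz f \<longleftrightarrow> smooth_with rapid f"
proof -
  have "(\<forall>N. bounded (range (\<lambda>x. (1 + norm x) ^ N *\<^sub>R g x))) \<longleftrightarrow> rapid g" for g :: "'a \<Rightarrow> complex"
  proof -
    have "norm ((1 + norm x) ^ N *\<^sub>R g x) = (1 + norm x) ^ N * norm (g x)" for x N
    proof -
      have "\<bar>(1 + norm x) ^ N\<bar> = (1 + norm x) ^ N" by (intro abs_of_nonneg) simp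
      then show ?thesis by (simp only: norm_scaleR)
    qed
    then show ?thesis unfolding rapid_def bounded_iff by simp
  qed
  then show ?thesis unfolding schwartz_def smooth_with_def by blast
qed

text \<open>Differentiating a product or an exponential leaves the class of such functions, but
  yields a finite sum of members. The span has sums only; scalars are built into the generators
  where they occur.\<close>

inductive fspan :: "(('a \<Rightarrow> complex) \<Rightarrow> bool) \<Rightarrow> ('a \<Rightarrow> complex) \<Rightarrow> bool" for P where
  zero: "fspan P (\<lambda>x. 0)"
| add: "P f \<Longrightarrow> fspan P g \<Longrightarrow> fspan P (\<lambda>x. f x + g x)"

lemma fspan_base: "P f \<Longrightarrow> fspan P f"
  using fspan.add[OF _ fspan.zero, of P f] by simp

lemma fspan_add: "fspan P f \<Longrightarrow> fspan P g \<Longrightarrow> fspan P (\<lambda>x. f x + g x)"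
proof (induction rule: fspan.induct)
  case (add f h)
  then show ?case using fspan.add[of P f "\<lambda>x. h x + g x"] by (simp add: add.assoc)
qed simp

lemma fspan_sum: "finite A \<Longrightarrow> (\<And>a. a \<in> A \<Longrightarrow> fspan P (f a)) \<Longrightarrow> fspan P (\<lambda>x. \<Sum>a\<in>A. f a x)"
  by (induction rule: finite_induct) (auto intro: fspan.zero fspan_add)

text \<open>Coinduction for smoothness: if members of \<open>P\<close> satisfy \<open>D\<close> and
  their first partial derivatives are finite sums of members, all iterated derivatives stay in the
  span of \<open>P\<close>. No formula for a higher derivative is ever written down.\<close>

lemma smooth_with_coinduct:
  assumes D0: "D (\<lambda>x. 0)" and Dadd: "\<And>f g. D f \<Longrightarrow> D g \<Longrightarrow> D (\<lambda>x. f x + g x)"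
    and P: "P f" and PD: "\<And>f. P f \<Longrightarrow> D f"
    and step: "\<And>f. P f \<Longrightarrow> \<exists>f'. (\<forall>x. (f has_derivative f' x) (at x)) \<and> (\<forall>b\<in>Basis. fspan P (\<lambda>x. f' x b))"
  shows "smooth_with D f"
proof -
  have d: "\<exists>f'. (\<forall>x. (f has_derivative f' x) (at x)) \<and> (\<forall>b\<in>Basis. fspan P (\<lambda>x. f' x b))"
    if "fspan P f" for f
    using that
  proof induction
    case zero
    show ?case by (intro exI[of _ "\<lambda>x v. 0"]) (auto intro: fspan.zero)
  next
    case (add f g)
    obtain f' where f': "\<forall>x. (f has_derivative f' x) (at x)" "\<forall>b\<in>Basis. fspan P (\<lambda>x. f' x b)"
      using step[OF add(1)] by blast
    obtain g' where g': "\<forall>x. (g has_derivative g' x) (at x)" "\<forall>b\<in>Basis. fspan P (\<lambda>x. g' x b)"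
      using add by blast
    show ?case
      by (intro exI[of _ "\<lambda>x v. f' x v + g' x v"]) (use f' g' in \<open>auto intro!: fspan_add has_derivative_add\<close>)
  qed
  have DS: "D f" if "fspan P f" for f
    using that by induction (auto intro: D0 Dadd PD)
  have S: "fspan P (iter_pderiv bs f)" if "set bs \<subseteq> Basis" for bs
    using that
  proof (induction bs)
    case Nil
    then show ?case by (simp add: fspan_base P)
  next
    case (Cons b bs)
    obtain f' where f': "\<And>x. (iter_pderiv bs f has_derivative f' x) (at x)"
        "\<forall>b\<in>Basis. fspan P (\<lambda>x. f' x b)"
      using d[of "iter_pderiv bs f"] Cons by auto
    have "frechet_derivative (iter_pderiv bs f) (at x) = f' x" for x
      using frechet_derivative_at[OF f'(1)] by simp
    then show ?case using f'(2) Cons by simp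
  qed
  show ?thesis unfolding smooth_with_def
  proof (intro allI impI conjI)
    fix bs :: "'a list" and x assume "set bs \<subseteq> Basis"
    from d[OF S[OF this]] show "iter_pderiv bs f differentiable at x"
      unfolding differentiable_def by blast
  next
    fix bs :: "'a list" assume "set bs \<subseteq> Basis"
    then show "D (iter_pderiv bs f)" by (intro DS S)
  qed
qed

lemma module_coinduct:
  assumes D: "slow_module D" and P: "P f" "\<And>f. P f \<Longrightarrow> D f"
    "\<And>f. P f \<Longrightarrow> \<exists>f'. (\<forall>x. (f has_derivative f' x) (at x)) \<and> (\<forall>b\<in>Basis. fspan P (\<lambda>x. f' x b))"
  shows "smooth_with D f"
  by (rule smooth_with_coinduct[where P=P]) (use slow_moduleD[OF D] P in auto)

lemmas schwartz_coinduct = module_coinduct[OF slow_module_rapid, folded schwartz_eq_smooth_with]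
lemmas moderate_coinduct = module_coinduct[OF slow_module_slow]

section \<open>Algebraic closure of Schwartz functions and moderate multipliers\<close>

lemma smooth_with_has_derivative:
  "smooth_with D f \<Longrightarrow> (f has_derivative frechet_derivative f (at x)) (at x)"
  unfolding smooth_with_def frechet_derivative_works[symmetric]
  by (drule spec[of _ "[]"]) simp

lemma smooth_withD: "smooth_with D f \<Longrightarrow> D f"
  unfolding smooth_with_def by (drule spec[of _ "[]"]) simp

lemma iter_pderiv_append: "iter_pderiv (bs @ cs) f = iter_pderiv bs (iter_pderiv cs f)"
  by (induction bs) auto

lemma smooth_with_pderiv:
  assumes "smooth_with D f" "b \<in> Basis"
  shows "smooth_with D (\<lambda>x. frechet_derivative f (at x) b)"
  unfolding smooth_with_def
proof (intro allI impI)
  fix bs :: "'a list" assume "set bs \<subseteq> Basis"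
  then have "set (bs @ [b]) \<subseteq> Basis" using assms(2) by auto
  then show "(\<forall>x. iter_pderiv bs (\<lambda>x. frechet_derivative f (at x) b) differentiable at x) \<and>
      D (iter_pderiv bs (\<lambda>x. frechet_derivative f (at x) b))"
    using assms(1) unfolding smooth_with_def by (fastforce simp: iter_pderiv_append)
qed

lemma smooth_with_add:
  assumes D: "slow_module D" and fg: "smooth_with D f" "smooth_with D g"
  shows "smooth_with D (\<lambda>x. f x + g x)"
proof (rule module_coinduct[OF D, where P="\<lambda>h. \<exists>f g. smooth_with D f \<and> smooth_with D g \<and> h = (\<lambda>x. f x + g x)"])
  fix h assume "\<exists>f g. smooth_with D f \<and> smooth_with D g \<and> h = (\<lambda>x. f x + g x)"
  then obtain f g where fg: "smooth_with D f" "smooth_with D g" "h = (\<lambda>x. f x + g x)" by blast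
  then show "D h" using slow_moduleD(2)[OF D] smooth_withD by auto
  show "\<exists>h'. (\<forall>x. (h has_derivative h' x) (at x)) \<and> (\<forall>b\<in>Basis. fspan (\<lambda>h. \<exists>f g. smooth_with D f \<and> smooth_with D g \<and> h = (\<lambda>x. f x + g x)) (\<lambda>x. h' x b))"
    by (intro exI[of _ "\<lambda>x v. frechet_derivative f (at x) v + frechet_derivative g (at x) v"] conjI allI ballI fspan_base)
      (use fg in \<open>auto intro!: has_derivative_add smooth_with_has_derivative dest: smooth_with_pderiv\<close>)
qed (use fg in blast)

lemma smooth_with_mult:
  assumes D: "slow_module D" and fg: "moderate f" "smooth_with D g"
  shows "smooth_with D (\<lambda>x. f x * g x)"
proof (rule module_coinduct[OF D, where P="\<lambda>h. \<exists>f g. moderate f \<and> smooth_with D g \<and> h = (\<lambda>x. f x * g x)"])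
  fix h assume "\<exists>f g. moderate f \<and> smooth_with D g \<and> h = (\<lambda>x. f x * g x)"
  then obtain f g where fg: "moderate f" "smooth_with D g" "h = (\<lambda>x. f x * g x)" by blast
  then show "D h" using slow_moduleD(3)[OF D] smooth_withD by auto
  show "\<exists>h'. (\<forall>x. (h has_derivative h' x) (at x)) \<and> (\<forall>b\<in>Basis. fspan (\<lambda>h. \<exists>f g. moderate f \<and> smooth_with D g \<and> h = (\<lambda>x. f x * g x)) (\<lambda>x. h' x b))"
  proof (intro exI[of _ "\<lambda>x v. f x * frechet_derivative g (at x) v + frechet_derivative f (at x) v * g x"] conjI allI ballI)
    show "(h has_derivative (\<lambda>v. f x * frechet_derivative g (at x) v + frechet_derivative f (at x) v * g x)) (at x)" for x
      unfolding fg(3) using fg by (intro has_derivative_mult smooth_with_has_derivative)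
    show "fspan (\<lambda>h. \<exists>f g. moderate f \<and> smooth_with D g \<and> h = (\<lambda>x. f x * g x)) (\<lambda>x. f x * frechet_derivative g (at x) b + frechet_derivative f (at x) b * g x)"
      if "b \<in> Basis" for b
      using fg that by (intro fspan_add fspan_base) (auto dest: smooth_with_pderiv)
  qed
qed (use fg in blast)

lemma moderate_affine: "moderate (\<lambda>x. of_real (x \<bullet> b) + c)"
proof (rule moderate_coinduct[where P="\<lambda>h. \<exists>b c. h = (\<lambda>x. of_real (x \<bullet> b) + c)"])
  fix h :: "'a \<Rightarrow> complex" assume "\<exists>b c. h = (\<lambda>x. of_real (x \<bullet> b) + c)"
  then obtain b c where h: "h = (\<lambda>x. of_real (x \<bullet> b) + c)" by blast
  have "norm (h x) \<le> (norm b + norm c) * (1 + norm x) ^ 1" for x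
  proof -
    have "norm (h x) \<le> norm x * norm b + norm c"
      unfolding h using norm_triangle_ineq[of "of_real (x \<bullet> b)" c] Cauchy_Schwarz_ineq2[of x b] by simp
    also have "\<dots> \<le> norm x * norm b + norm c + norm b + norm x * norm c" by simp
    finally show ?thesis by (simp add: algebra_simps)
  qed
  then show "slow h" unfolding slow_def by blast
  show "\<exists>h'. (\<forall>x. (h has_derivative h' x) (at x)) \<and> (\<forall>v\<in>Basis. fspan (\<lambda>h. \<exists>b c. h = (\<lambda>x. of_real (x \<bullet> b) + c)) (\<lambda>x. h' x v))"
  proof (intro exI[of _ "\<lambda>x v. of_real (v \<bullet> b)"] conjI allI ballI fspan_base)
    show "(h has_derivative (\<lambda>v. of_real (v \<bullet> b))) (at x)" for x
      unfolding h by (auto intro!: derivative_eq_intros)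
    show "\<exists>d c. (\<lambda>x::'a. complex_of_real (v \<bullet> b)) = (\<lambda>x. of_real (x \<bullet> d) + c)" for v
      by (intro exI[of _ 0] exI[of _ "of_real (v \<bullet> b)"]) simp
  qed
qed blast

lemma moderate_const: "moderate (\<lambda>x. c)"
  using moderate_affine[of 0 c] by simp

lemma moderate_inner: "moderate (\<lambda>x. of_real (x \<bullet> b))"
  using moderate_affine[of b 0] by simp

lemmas moderate_mult = smooth_with_mult[OF slow_module_slow]
lemmas moderate_add = smooth_with_add[OF slow_module_slow]
lemmas schwartz_mult = smooth_with_mult[OF slow_module_rapid, folded schwartz_eq_smooth_with]
lemmas schwartz_cmult = schwartz_mult[OF moderate_const]

lemma moderate_sum: "finite A \<Longrightarrow> (\<And>a. a \<in> A \<Longrightarrow> moderate (f a)) \<Longrightarrow> moderate (\<lambda>x. \<Sum>a\<in>A. f a x)"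
proof (induction rule: finite_induct)
  case (insert a A)
  then have "moderate (\<lambda>x. f a x + (\<Sum>a\<in>A. f a x))" by (intro moderate_add) simp_all
  then show ?case using insert by simp
qed (simp add: moderate_const)

text \<open>The functions m exp f with m moderate are closed under differentiation, with new
  coefficient m' + m f'. So the only estimate left is \<open>D\<close> for exp f itself: bounded
  phases use \<open>D = slow\<close>, Gaussians use \<open>D = rapid\<close>.\<close>

lemma smooth_with_exp:
  assumes D: "slow_module D" and f: "moderate f" "D (\<lambda>x. exp (f x))"
  shows "smooth_with D (\<lambda>x. exp (f x))"
proof (rule module_coinduct[OF D, where P="\<lambda>h. \<exists>m. moderate m \<and> h = (\<lambda>x. m x * exp (f x))"])
  fix h assume "\<exists>m. moderate m \<and> h = (\<lambda>x. m x * exp (f x))"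
  then obtain m where m: "moderate m" "h = (\<lambda>x. m x * exp (f x))" by blast
  show "D h" unfolding m(2) using slow_moduleD(3)[OF D, of m "\<lambda>x. exp (f x)"] smooth_withD[OF m(1)] f(2) by blast
  show "\<exists>h'. (\<forall>x. (h has_derivative h' x) (at x)) \<and> (\<forall>b\<in>Basis. fspan (\<lambda>h. \<exists>m. moderate m \<and> h = (\<lambda>x. m x * exp (f x))) (\<lambda>x. h' x b))"
  proof (intro exI[of _ "\<lambda>x v. (frechet_derivative m (at x) v + m x * frechet_derivative f (at x) v) * exp (f x)"] conjI allI ballI)
    show "(h has_derivative (\<lambda>v. (frechet_derivative m (at x) v + m x * frechet_derivative f (at x) v) * exp (f x))) (at x)" for x
    proof -
      have "(exp has_derivative (*) (exp (f x))) (at (f x))"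
        using DERIV_exp[of "f x"] by (simp add: has_field_derivative_def)
      from has_derivative_mult[OF smooth_with_has_derivative[OF m(1)] has_derivative_compose[OF smooth_with_has_derivative[OF f(1)] this]]
      show ?thesis unfolding m(2) by (rule has_derivative_eq_rhs) (simp add: fun_eq_iff algebra_simps)
    qed
    show "fspan (\<lambda>h. \<exists>m. moderate m \<and> h = (\<lambda>x. m x * exp (f x))) (\<lambda>x. (frechet_derivative m (at x) b + m x * frechet_derivative f (at x) b) * exp (f x))"
      if "b \<in> Basis" for b
    proof -
      have mod: "moderate (\<lambda>x. frechet_derivative m (at x) b + m x * frechet_derivative f (at x) b)"
        by (rule moderate_add[OF smooth_with_pderiv[OF m(1) that] moderate_mult[OF m(1) smooth_with_pderiv[OF f(1) that]]])
      show ?thesis by (intro fspan_base exI) (rule conjI[OF mod refl])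
    qed
  qed
next
  show "\<exists>m. moderate m \<and> (\<lambda>x. exp (f x)) = (\<lambda>x. m x * exp (f x))"
    using moderate_const[of 1] by (intro exI[of _ "\<lambda>x. 1"]) simp
qed

lemma moderate_cis:
  assumes "moderate (\<lambda>x. of_real (f x))"
  shows "moderate (\<lambda>x. cis (f x))"
proof -
  have "moderate (\<lambda>x. exp (\<i> * of_real (f x)))"
    by (rule smooth_with_exp[OF slow_module_slow moderate_mult[OF moderate_const assms]])
      (auto simp: slow_def intro!: exI[of _ 0] exI[of _ 1])
  then show ?thesis by (simp add: cis_conv_exp)
qed

lemma moderate_inner_self: "moderate (\<lambda>x. of_real (x \<bullet> x))"
proof -
  have "(\<lambda>x::'a. complex_of_real (x \<bullet> x)) = (\<lambda>x. \<Sum>b\<in>Basis. of_real (x \<bullet> b) * of_real (x \<bullet> b))"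
    by (subst euclidean_inner) simp
  moreover have "moderate (\<lambda>x::'a. \<Sum>b\<in>Basis. of_real (x \<bullet> b) * of_real (x \<bullet> b))"
    by (rule moderate_sum[OF finite_Basis moderate_mult[OF moderate_inner moderate_inner]])
  ultimately show ?thesis by simp
qed

lemma moderate_inner_prod: "moderate (\<lambda>z. of_real (fst z \<bullet> snd z))"
proof -
  have "(\<lambda>z::'a\<times>'a. complex_of_real (fst z \<bullet> snd z)) = (\<lambda>z. \<Sum>b\<in>Basis. of_real (z \<bullet> (b,0)) * of_real (z \<bullet> (0,b)))"
    by (subst euclidean_inner) (simp add: inner_prod_def)
  moreover have "moderate (\<lambda>z::'a\<times>'a. \<Sum>b\<in>Basis. of_real (z \<bullet> (b,0)) * of_real (z \<bullet> (0,b)))"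
    by (rule moderate_sum[OF finite_Basis moderate_mult[OF moderate_inner moderate_inner]])
  ultimately show ?thesis by simp
qed

text \<open>Since 1 + t \<le> exp t, the product is at most exp (N t - c t^2), and completing the
  square bounds the exponent by N^2 / (4 c).\<close>

lemma poly_times_gaussian_bounded:
  fixes c :: real assumes "c > 0" shows "\<exists>C. \<forall>t\<ge>0. (1 + t) ^ N * exp (- c * t\<^sup>2) \<le> C"
proof (intro exI allI impI)
  fix t :: real assume t: "t \<ge> 0"
  have "(1 + t) ^ N \<le> exp t ^ N" using t by (intro power_mono exp_ge_add_one_self) auto
  then have "(1 + t) ^ N * exp (- c * t\<^sup>2) \<le> exp t ^ N * exp (- c * t\<^sup>2)"
    by (intro mult_right_mono) auto
  also have "\<dots> = exp (real N * t - c * t\<^sup>2)" by (simp add: exp_diff exp_minus divide_inverse exp_of_nat_mult)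
  also have "real N * t - c * t\<^sup>2 = (real N)\<^sup>2 / (4 * c) - c * (t - real N / (2 * c))\<^sup>2"
    using assms by (simp add: field_simps power2_eq_square)
  also have "exp \<dots> \<le> exp ((real N)\<^sup>2 / (4 * c))" using assms by simp
  finally show "(1 + t) ^ N * exp (- c * t\<^sup>2) \<le> exp ((real N)\<^sup>2 / (4 * c))" .
qed

lemma schwartz_gaussian: 
  assumes "c > 0"
  shows "schwartz (\<lambda>x::'a::euclidean_space. of_real (exp (- c * (norm x)\<^sup>2)))"
proof -
  have "schwartz (\<lambda>x::'a. exp (of_real (- c) * of_real (x \<bullet> x)))"
    unfolding schwartz_eq_smooth_with
  proof (rule smooth_with_exp[OF slow_module_rapid moderate_mult[OF moderate_const moderate_inner_self]])
    show "rapid (\<lambda>x::'a. exp (of_real (- c) * of_real (x \<bullet> x)))"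
      unfolding rapid_def
    proof
      fix N
      obtain C where "\<And>t. t \<ge> 0 \<Longrightarrow> (1 + t) ^ N * exp (- c * t\<^sup>2) \<le> C"
        using poly_times_gaussian_bounded[OF assms] by blast
      then show "\<exists>C. \<forall>x::'a. (1 + norm x) ^ N * norm (exp (of_real (- c) * complex_of_real (x \<bullet> x))) \<le> C"
        by (intro exI[of _ C]) (simp flip: power2_norm_eq_inner)
    qed
  qed
  then show ?thesis by (simp add: power2_norm_eq_inner exp_of_real flip: of_real_mult of_real_minus)
qed

section \<open>Composition with affine maps, conjugation and slices\<close>

lemma has_derivative_compose_affine:
  assumes "bounded_linear L" "(f has_derivative f') (at (L x + c))"
  shows "((\<lambda>x. f (L x + c)) has_derivative (\<lambda>v. f' (L v))) (at x)"
proof -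
  have "((\<lambda>x. L x + c) has_derivative L) (at x)"
    using bounded_linear_imp_has_derivative[OF assms(1)] by (auto intro!: derivative_eq_intros)
  from has_derivative_compose[OF this assms(2)] show ?thesis by simp
qed

text \<open>The coinduction class carries a real factor because the derivative of f(L x + c) along b
  is the sum over basis vectors i of (L b \<bullet> i) times the i-th partial derivative of f at L x
  + c.\<close>

lemma smooth_with_compose_affine:
  fixes L :: "'b::euclidean_space \<Rightarrow> 'a::euclidean_space"
  assumes L: "bounded_linear L" and D: "slow_module D" "slow_module D'" and f: "smooth_with D f"
    and DD: "\<And>f. D f \<Longrightarrow> D' (\<lambda>x. f (L x + c))"
  shows "smooth_with D' (\<lambda>x. f (L x + c))"
proof (rule module_coinduct[OF D(2), where P="\<lambda>h. \<exists>a f. smooth_with D f \<and> h = (\<lambda>x. of_real a * f (L x + c))"])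
  fix h assume "\<exists>a f. smooth_with D f \<and> h = (\<lambda>x. of_real a * f (L x + c))"
  then obtain a f where f: "smooth_with D f" "h = (\<lambda>x. of_real a * f (L x + c))" by blast
  show "D' h" unfolding f(2)
    using slow_moduleD(3)[OF D(2) slow_const, of "\<lambda>x. f (L x + c)" "of_real a"] DD[of f] smooth_withD[OF f(1)] by blast
  have lin: "linear (frechet_derivative f (at x))" for x
    using has_derivative_linear[OF smooth_with_has_derivative[OF f(1)]] .
  have eq: "frechet_derivative f (at x) v = (\<Sum>i\<in>Basis. of_real (v \<bullet> i) * frechet_derivative f (at x) i)" for x v
  proof -
    have "frechet_derivative f (at x) v = frechet_derivative f (at x) (\<Sum>i\<in>Basis. (v \<bullet> i) *\<^sub>R i)"
      by (simp add: euclidean_representation)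
    also have "\<dots> = (\<Sum>i\<in>Basis. of_real (v \<bullet> i) * frechet_derivative f (at x) i)"
      by (simp add: linear_sum[OF lin] linear_scale[OF lin] scaleR_conv_of_real)
    finally show ?thesis .
  qed
  show "\<exists>h'. (\<forall>x. (h has_derivative h' x) (at x)) \<and> (\<forall>b\<in>Basis. fspan (\<lambda>h. \<exists>a f. smooth_with D f \<and> h = (\<lambda>x. of_real a * f (L x + c))) (\<lambda>x. h' x b))"
  proof (intro exI[of _ "\<lambda>x v. of_real a * frechet_derivative f (at (L x + c)) (L v)"] conjI allI ballI)
    show "(h has_derivative (\<lambda>v. of_real a * frechet_derivative f (at (L x + c)) (L v))) (at x)" for x
      unfolding f(2)
      by (intro has_derivative_mult_right has_derivative_compose_affine[OF L] smooth_with_has_derivative[OF f(1)])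
    fix b :: 'b
    show "fspan (\<lambda>h. \<exists>a f. smooth_with D f \<and> h = (\<lambda>x. of_real a * f (L x + c))) (\<lambda>x. of_real a * frechet_derivative f (at (L x + c)) (L b))"
    proof (subst eq, subst sum_distrib_left, intro fspan_sum fspan_base)
      fix i :: 'a assume "i \<in> Basis"
      then show "\<exists>a' g. smooth_with D g \<and> (\<lambda>x. complex_of_real a * (of_real (L b \<bullet> i) * frechet_derivative f (at (L x + c)) i)) = (\<lambda>x. of_real a' * g (L x + c))"
        using smooth_with_pderiv[OF f(1)]
        by (intro exI[of _ "a * (L b \<bullet> i)"] exI[of _ "\<lambda>x. frechet_derivative f (at x) i"]) (auto simp: mult.assoc)
    qed simp
  qed
next
  show "\<exists>a g. smooth_with D g \<and> (\<lambda>x. f (L x + c)) = (\<lambda>x. of_real a * g (L x + c))"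
    using f by (intro exI[of _ 1] exI[of _ f]) simp
qed

text \<open>Decay survives because \<open>L\<close> is injective with the quantitative bound
  \<open>K\<close>: then 1 + |x| is at most a constant times 1 + |L x + c|. For slices
  \<open>L\<close> is an isometric embedding and \<open>K\<close> is 1.\<close>

lemma rapid_compose_affine:
  assumes K: "\<And>x. norm x \<le> K * norm (L x)" and "rapid f"
  shows "rapid (\<lambda>x. f (L x + c))"
  unfolding rapid_def
proof
  fix N
  obtain C where f: "\<And>x. (1 + norm x) ^ N * norm (f x) \<le> C" using assms(2) unfolding rapid_def by metis
  \<comment> \<open>Chosen so that 1 + |K| (t + |c|) \<le> A (1 + t) for all t \<ge> 0.\<close>
  define A where "A = 1 + \<bar>K\<bar> + \<bar>K\<bar> * norm c"
  have "(1 + norm x) ^ N * norm (f (L x + c)) \<le> A ^ N * C" for x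
  proof -
    have "norm (L x) \<le> norm (L x + c) + norm c" using norm_triangle_ineq4[of "L x + c" c] by simp
    then have "\<bar>K\<bar> * norm (L x) \<le> \<bar>K\<bar> * (norm (L x + c) + norm c)" by (intro mult_left_mono) auto
    moreover have "norm x \<le> \<bar>K\<bar> * norm (L x)" using K[of x] by (smt (verit) mult_right_mono norm_ge_zero)
    ultimately have "1 + norm x \<le> 1 + \<bar>K\<bar> * (norm (L x + c) + norm c)" by linarith
    also have "\<dots> \<le> A * (1 + norm (L x + c))" by (simp add: A_def algebra_simps)
    finally have "(1 + norm x) ^ N \<le> (A * (1 + norm (L x + c))) ^ N" by (intro power_mono) auto
    then have "(1 + norm x) ^ N * norm (f (L x + c)) \<le> (A * (1 + norm (L x + c))) ^ N * norm (f (L x + c))"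
      by (intro mult_right_mono) auto
    also have "\<dots> = A ^ N * ((1 + norm (L x + c)) ^ N * norm (f (L x + c)))" by (simp add: power_mult_distrib)
    also have "\<dots> \<le> A ^ N * C" using f by (intro mult_left_mono) (auto simp: A_def)
    finally show ?thesis .
  qed
  then show "\<exists>C. \<forall>x. (1 + norm x) ^ N * norm (f (L x + c)) \<le> C" by blast
qed

lemma schwartz_compose_affine:
  assumes "bounded_linear L" "\<And>x. norm x \<le> K * norm (L x)" "schwartz f"
  shows "schwartz (\<lambda>x. f (L x + c))"
  using assms(3) unfolding schwartz_eq_smooth_with
  by (rule smooth_with_compose_affine[OF assms(1) slow_module_rapid slow_module_rapid _ rapid_compose_affine[OF assms(2)]])

lemma schwartz_cnj:
  assumes "schwartz f" shows "schwartz (\<lambda>x. cnj (f x))"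
proof (rule schwartz_coinduct[where P="\<lambda>h. \<exists>f. schwartz f \<and> h = (\<lambda>x. cnj (f x))"])
  fix h :: "'a \<Rightarrow> complex" assume "\<exists>f. schwartz f \<and> h = (\<lambda>x. cnj (f x))"
  then obtain f where f: "smooth_with rapid f" "h = (\<lambda>x. cnj (f x))" unfolding schwartz_eq_smooth_with by blast
  show "rapid h" using smooth_withD[OF f(1)] unfolding rapid_def f(2) by simp
  show "\<exists>h'. (\<forall>x. (h has_derivative h' x) (at x)) \<and> (\<forall>b\<in>Basis. fspan (\<lambda>h. \<exists>f. schwartz f \<and> h = (\<lambda>x. cnj (f x))) (\<lambda>x. h' x b))"
  proof (intro exI[of _ "\<lambda>x v. cnj (frechet_derivative f (at x) v)"] conjI allI ballI fspan_base)
    show "(h has_derivative (\<lambda>v. cnj (frechet_derivative f (at x) v))) (at x)" for x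
      unfolding f(2) by (intro has_derivative_cnj smooth_with_has_derivative[OF f(1)])
    show "\<exists>fa. schwartz fa \<and> (\<lambda>x. cnj (frechet_derivative f (at x) b)) = (\<lambda>x. cnj (fa x))" if "b \<in> Basis" for b
      unfolding schwartz_eq_smooth_with by (intro exI) (rule conjI[OF smooth_with_pderiv[OF f(1) that] refl])
  qed
qed (use assms in blast)

lemma schwartz_slice: "schwartz a \<Longrightarrow> schwartz (\<lambda>y. a (x, y))"
  using schwartz_compose_affine[of "\<lambda>y. (0, y)" 1 a "(x, 0)"]
  by (simp add: bounded_linear_Pair bounded_linear_zero bounded_linear_ident norm_Pair)

lemma schwartz_slice': "schwartz a \<Longrightarrow> schwartz (\<lambda>x. a (x, y))"
  using schwartz_compose_affine[of "\<lambda>x. (x, 0)" 1 a "(0, y)"]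
  by (simp add: bounded_linear_Pair bounded_linear_zero bounded_linear_ident norm_Pair)

lemma schwartz_pderiv: "schwartz f \<Longrightarrow> b \<in> Basis \<Longrightarrow> schwartz (\<lambda>x. frechet_derivative f (at x) b)"
  unfolding schwartz_eq_smooth_with by (rule smooth_with_pderiv)

lemma schwartz_has_derivative: "schwartz f \<Longrightarrow> (f has_derivative frechet_derivative f (at x)) (at x)"
  unfolding schwartz_eq_smooth_with by (rule smooth_with_has_derivative)

lemma schwartz_continuous: "schwartz f \<Longrightarrow> continuous_on A f"
  by (meson schwartz_has_derivative continuous_at_imp_continuous_on has_derivative_continuous)

lemma schwartz_borel [measurable_dest]: "schwartz f \<Longrightarrow> f \<in> borel_measurable borel"
  by (intro borel_measurable_continuous_onI schwartz_continuous)

lemma schwartz_rapid: "schwartz f \<Longrightarrow> rapid f"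
  unfolding schwartz_eq_smooth_with by (rule smooth_withD)

lemma rapidE:
  assumes "rapid f"
  obtains C where "C \<ge> 0" "\<And>x. norm (f x) \<le> C / (1 + norm x) ^ N"
proof -
  obtain C where C: "\<And>x. (1 + norm x) ^ N * norm (f x) \<le> C" using assms unfolding rapid_def by metis
  have "norm (f 0) \<le> C" using C[of 0] by simp
  then have "C \<ge> 0" by (rule order_trans[OF norm_ge_zero])
  moreover have "norm (f x) \<le> C / (1 + norm x) ^ N" for x
  proof -
    have "1 + norm x > 0" using norm_ge_zero[of x] by linarith
    then show ?thesis using C[of x] by (simp add: field_simps)
  qed
  ultimately show ?thesis using that by blast
qed

text \<open>Each derivative multiplies by a polynomial and lowers the exponent by one, so the
  coinduction class ranges over all real exponents. The base is at least 1, which makes every real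
  power smooth and of at most polynomial growth, whatever the sign of r.\<close>

lemma moderate_one_plus_powr:
  fixes h r :: real
  shows "moderate (\<lambda>x::'a::euclidean_space. of_real ((1 + h\<^sup>2 * (x \<bullet> x)) powr r))"
proof (rule moderate_coinduct[where P="\<lambda>g. \<exists>m r. moderate m \<and> g = (\<lambda>x. m x * of_real ((1 + h\<^sup>2 * (x \<bullet> x)) powr r))"])
  have pos: "1 + h\<^sup>2 * (x \<bullet> x) > 0" for x :: 'a
    by (intro add_pos_nonneg) auto
  fix g :: "'a \<Rightarrow> complex" assume "\<exists>m r. moderate m \<and> g = (\<lambda>x. m x * of_real ((1 + h\<^sup>2 * (x \<bullet> x)) powr r))"
  then obtain m r where m: "moderate m" "g = (\<lambda>x. m x * of_real ((1 + h\<^sup>2 * (x \<bullet> x)) powr r))" by blast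
  have "slow (\<lambda>x::'a. of_real ((1 + h\<^sup>2 * (x \<bullet> x)) powr r))"
  proof -
    define N where "N = nat \<lceil>\<bar>r\<bar>\<rceil>"
    have "norm (complex_of_real ((1 + h\<^sup>2 * (x \<bullet> x)) powr r)) \<le> (1 + h\<^sup>2) ^ N * (1 + norm x) ^ (2 * N)" for x :: 'a
    proof -
      have ge: "1 + h\<^sup>2 * (x \<bullet> x) \<ge> 1" by simp
      have "(1 + h\<^sup>2 * (x \<bullet> x)) powr r \<le> (1 + h\<^sup>2 * (x \<bullet> x)) powr real N"
        using ge unfolding N_def by (intro powr_mono) linarith+
      also have "\<dots> = (1 + h\<^sup>2 * (x \<bullet> x)) ^ N" using pos by (intro powr_realpow)
      also have "\<dots> \<le> ((1 + h\<^sup>2) * (1 + norm x)\<^sup>2) ^ N"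
      proof (intro power_mono)
        have "(1 + h\<^sup>2) * (1 + norm x)\<^sup>2 = 1 + h\<^sup>2 * (x \<bullet> x) + (h\<^sup>2 + (1 + h\<^sup>2) * (2 * norm x) + x \<bullet> x)"
          by (simp add: power2_norm_eq_inner[symmetric] power2_eq_square algebra_simps)
        moreover have "0 \<le> h\<^sup>2 + (1 + h\<^sup>2) * (2 * norm x) + x \<bullet> x" by simp
        ultimately show "1 + h\<^sup>2 * (x \<bullet> x) \<le> (1 + h\<^sup>2) * (1 + norm x)\<^sup>2" by linarith
      qed simp
      finally show ?thesis by (simp add: power_mult_distrib power_mult)
    qed
    then show ?thesis unfolding slow_def by blast
  qed
  then show "slow g" unfolding m(2) using smooth_withD[OF m(1)] by (intro slow_mult)
  let ?q = "\<lambda>x v. frechet_derivative m (at x) v * of_real ((1 + h\<^sup>2 * (x \<bullet> x)) powr r)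
           + (of_real (2 * r * h\<^sup>2) * of_real (x \<bullet> v) * m x) * of_real ((1 + h\<^sup>2 * (x \<bullet> x)) powr (r - 1))"
  show "\<exists>g'. (\<forall>x. (g has_derivative g' x) (at x)) \<and> (\<forall>b\<in>Basis. fspan (\<lambda>g. \<exists>m r. moderate m \<and> g = (\<lambda>x. m x * of_real ((1 + h\<^sup>2 * (x \<bullet> x)) powr r))) (\<lambda>x. g' x b))"
  proof (intro exI[of _ ?q] conjI allI ballI)
    fix x :: 'a
    have 1: "((\<lambda>x. 1 + h\<^sup>2 * (x \<bullet> x)) has_derivative (\<lambda>v. (2 * h\<^sup>2) * (x \<bullet> v))) (at x)"
      by (rule has_derivative_eq_rhs[OF has_derivative_add[OF has_derivative_const has_derivative_mult_right[OF
            has_derivative_inner[OF has_derivative_ident has_derivative_ident]]]])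
        (auto simp: inner_commute)
    have "((\<lambda>y. y powr r) has_derivative (*) (r * (1 + h\<^sup>2 * (x \<bullet> x)) powr (r - 1))) (at (1 + h\<^sup>2 * (x \<bullet> x)))"
      using has_real_derivative_powr[OF pos[of x], of r] by (simp add: has_field_derivative_def)
    from has_derivative_compose[OF 1 this]
    have "((\<lambda>x. complex_of_real ((1 + h\<^sup>2 * (x \<bullet> x)) powr r)) has_derivative
       (\<lambda>v. complex_of_real (r * (1 + h\<^sup>2 * (x \<bullet> x)) powr (r - 1) * (2 * h\<^sup>2 * (x \<bullet> v))))) (at x)"
      by (rule has_derivative_of_real)
    from has_derivative_mult[OF smooth_with_has_derivative[OF m(1)] this]
    show "(g has_derivative ?q x) (at x)" unfolding m(2)
      by (rule has_derivative_eq_rhs) (simp add: fun_eq_iff algebra_simps)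
    show "fspan (\<lambda>g. \<exists>m r. moderate m \<and> g = (\<lambda>x. m x * of_real ((1 + h\<^sup>2 * (x \<bullet> x)) powr r))) (\<lambda>x. ?q x b)"
      if b: "b \<in> Basis" for b
    proof (intro fspan_add fspan_base)
      show "\<exists>m' r'. moderate m' \<and> (\<lambda>x. frechet_derivative m (at x) b * complex_of_real ((1 + h\<^sup>2 * (x \<bullet> x)) powr r)) = (\<lambda>x. m' x * of_real ((1 + h\<^sup>2 * (x \<bullet> x)) powr r'))"
        by (intro exI) (rule conjI[OF smooth_with_pderiv[OF m(1) b] refl])
      have mod: "moderate (\<lambda>x. of_real (2 * r * h\<^sup>2) * of_real (x \<bullet> b) * m x)"
        by (rule moderate_mult[OF moderate_mult[OF moderate_const moderate_inner] m(1)])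
      show "\<exists>m' r'. moderate m' \<and> (\<lambda>x. of_real (2 * r * h\<^sup>2) * of_real (x \<bullet> b) * m x * complex_of_real ((1 + h\<^sup>2 * (x \<bullet> x)) powr (r - 1))) = (\<lambda>x. m' x * of_real ((1 + h\<^sup>2 * (x \<bullet> x)) powr r'))"
        by (intro exI) (rule conjI[OF mod refl])
    qed
  qed
next
  show "\<exists>m s. moderate m \<and> (\<lambda>x::'a. complex_of_real ((1 + h\<^sup>2 * (x \<bullet> x)) powr r)) = (\<lambda>x. m x * of_real ((1 + h\<^sup>2 * (x \<bullet> x)) powr s))"
    using moderate_const[of 1] by (intro exI[of _ "\<lambda>x. 1"] exI[of _ r]) simp
qed

lemma bracket_powr_eq: "bracket (h *\<^sub>R \<xi>) powr r = (1 + h\<^sup>2 * (\<xi> \<bullet> \<xi>)) powr (r / 2)"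
proof -
  have "sqrt y powr r = y powr (r / 2)" if "y \<ge> 0" for y
    using that by (simp only: powr_half_sqrt[symmetric] powr_powr) simp
  moreover have "1 + (norm (h *\<^sub>R \<xi>))\<^sup>2 = 1 + h\<^sup>2 * (\<xi> \<bullet> \<xi>)"
    by (simp add: power_mult_distrib power2_norm_eq_inner)
  ultimately show ?thesis unfolding bracket_def by simp
qed

lemma moderate_bracket: "moderate (\<lambda>\<xi>. of_real (bracket (h *\<^sub>R \<xi>) powr r))"
  unfolding bracket_powr_eq by (rule moderate_one_plus_powr)

section \<open>Integration tools\<close>

lemma nn_integral_affine:
  fixes f :: "'a::euclidean_space \<Rightarrow> ennreal"
  assumes [measurable]: "f \<in> borel_measurable borel" and c: "c \<noteq> 0"
  shows "(\<integral>\<^sup>+x. f x \<partial>lborel) = ennreal (\<bar>c\<bar> ^ DIM('a)) * (\<integral>\<^sup>+x. f (t + c *\<^sub>R x) \<partial>lborel)"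
  by (subst lborel_affine[OF c, of t])
     (simp add: nn_integral_density nn_integral_distr nn_integral_cmult)

lemma integral_affine:
  fixes f :: "'a::euclidean_space \<Rightarrow> 'b::{banach, second_countable_topology}"
  assumes [measurable]: "f \<in> borel_measurable borel" and c: "c \<noteq> 0"
  shows "(LINT x|lborel. f x) = \<bar>c\<bar> ^ DIM('a) *\<^sub>R (LINT x|lborel. f (t + c *\<^sub>R x))"
  by (subst lborel_affine[OF c, of t]) (simp add: integral_density integral_distr)

lemma integrable_affine:
  fixes f :: "'a::euclidean_space \<Rightarrow> 'b::{banach, second_countable_topology}"
  assumes f: "integrable lborel f" and c: "c \<noteq> 0"
  shows "integrable lborel (\<lambda>x. f (t + c *\<^sub>R x))"
proof -
  have [measurable]: "f \<in> borel_measurable borel" using borel_measurable_integrable[OF f] by simp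
  have "integrable (density (distr lborel borel (\<lambda>x. t + c *\<^sub>R x)) (\<lambda>_. \<bar>c\<bar>^DIM('a))) f"
    using f lborel_affine[OF c, of t] by simp
  then have "integrable lborel (\<lambda>x. \<bar>c\<bar>^DIM('a) *\<^sub>R f (t + c *\<^sub>R x))"
    by (simp add: integrable_density integrable_distr_eq)
  from integrable_scaleR_right[OF this, of "inverse (\<bar>c\<bar>^DIM('a))"] show ?thesis using c by simp
qed

lemma AE_affine:
  fixes P :: "'a::euclidean_space \<Rightarrow> bool"
  assumes c: "c \<noteq> 0" and P: "AE x in lborel. P x"
  shows "AE x in lborel. P (t + c *\<^sub>R x)"
proof -
  obtain N where N: "N \<in> null_sets lborel" "{x. \<not> P x} \<subseteq> N"
    using P by (auto simp: eventually_ae_filter)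
  have [measurable]: "N \<in> sets borel" using N by auto
  have "(\<integral>\<^sup>+x. indicator N x \<partial>lborel) = 0" using N(1) by auto
  then have "(\<integral>\<^sup>+x. indicator N (t + c *\<^sub>R x) \<partial>lborel) = 0"
    using c by (subst (asm) nn_integral_affine[OF _ c, of _ t]) auto
  then have "AE x in lborel. indicator N (t + c *\<^sub>R x) = (0::ennreal)"
    by (subst (asm) nn_integral_0_iff_AE) auto
  then show ?thesis by (rule eventually_mono) (use N(2) in \<open>auto simp: indicator_def split: if_splits\<close>)
qed

text \<open>Compared with the product over the coordinates of 1 / (1 + x_b^2), which is integrable
  by Tonelli. Each factor 1 + x_b^2 is at most (1 + |x|)^2, and this is the source of the exponent 2
  DIM.\<close>

lemma integrable_inverse_poly:
  assumes "K \<ge> 2 * DIM('a)"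
  shows "integrable lborel (\<lambda>x::'a::euclidean_space. 1 / (1 + norm x) ^ K)"
proof (rule Bochner_Integration.integrable_bound)
  have 1: "integrable lborel (\<lambda>x::real. inverse (1 + x\<^sup>2))"
    using integrable_inverse_1_plus_square by (simp add: set_integrable_def einterval_def)
  have pos: "1 + (x::real)\<^sup>2 > 0" for x by (intro add_pos_nonneg) auto
  show "integrable lborel (\<lambda>x::'a. \<Prod>b\<in>Basis. inverse (1 + (x \<bullet> b)\<^sup>2))"
  proof (rule integrableI_nonneg)
    have "(\<integral>\<^sup>+x. ennreal (\<Prod>b\<in>(Basis::'a set). inverse (1 + (x \<bullet> b)\<^sup>2)) \<partial>lborel) =
       (\<integral>\<^sup>+x. (\<Prod>b\<in>(Basis::'a set). ennreal (inverse (1 + (x \<bullet> b)\<^sup>2))) \<partial>lborel)"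
      by (subst prod_ennreal) (simp_all add: less_imp_le[OF pos])
    also have "\<dots> = (\<Prod>b\<in>(Basis::'a set). (\<integral>\<^sup>+x. ennreal (inverse (1 + x\<^sup>2)) \<partial>lborel))"
      by (rule nn_integral_lborel_prod[where f="\<lambda>b x. ennreal (inverse (1 + x\<^sup>2))"]) auto
    also have "\<dots> < \<infinity>"
    proof -
      have "(\<integral>\<^sup>+x. ennreal (inverse (1 + (x::real)\<^sup>2)) \<partial>lborel) < top"
        using 1 unfolding integrable_iff_bounded by (simp add: less_imp_le[OF pos])
      then show ?thesis unfolding prod_constant infinity_ennreal_def by (subst power_less_top_ennreal) blast
    qed
    finally show "(\<integral>\<^sup>+x. ennreal (\<Prod>b\<in>(Basis::'a set). inverse (1 + (x \<bullet> b)\<^sup>2)) \<partial>lborel) < \<infinity>" .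
  qed (auto intro!: prod_nonneg less_imp_le[OF pos])
  show "AE x::'a in lborel. norm (1 / (1 + norm x) ^ K) \<le> norm (\<Prod>b\<in>Basis. inverse (1 + (x \<bullet> b)\<^sup>2))"
  proof (rule AE_I2)
    fix x :: 'a
    have n: "1 + norm x > 0" using norm_ge_zero[of x] by linarith
    have "(\<Prod>b\<in>(Basis::'a set). 1 + (x \<bullet> b)\<^sup>2) \<le> (\<Prod>b\<in>(Basis::'a set). (1 + norm x)\<^sup>2)"
    proof (rule prod_mono, intro conjI)
      fix b :: 'a assume b: "b \<in> Basis"
      have "(x \<bullet> b)\<^sup>2 \<le> (norm x)\<^sup>2" using Basis_le_norm[OF b, of x] by (simp add: abs_le_square_iff[symmetric])
      then show "1 + (x \<bullet> b)\<^sup>2 \<le> (1 + norm x)\<^sup>2"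
      proof -
        have "(1 + norm x)\<^sup>2 = 1 + (norm x)\<^sup>2 + 2 * norm x" by (simp add: power2_sum)
        moreover have "0 \<le> norm x" by simp
        ultimately show ?thesis using \<open>(x \<bullet> b)\<^sup>2 \<le> (norm x)\<^sup>2\<close> by linarith
      qed
      show "0 \<le> 1 + (x \<bullet> b)\<^sup>2" using pos[of "x \<bullet> b"] by simp
    qed
    also have "\<dots> = (1 + norm x) ^ (2 * DIM('a))" by (simp add: power_mult)
    also have "\<dots> \<le> (1 + norm x) ^ K" using assms by (intro power_increasing) auto
    finally have *: "(\<Prod>b\<in>(Basis::'a set). 1 + (x \<bullet> b)\<^sup>2) \<le> (1 + norm x) ^ K" .
    have "0 < (\<Prod>b\<in>(Basis::'a set). 1 + (x \<bullet> b)\<^sup>2)" by (intro prod_pos ballI pos)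
    then have "1 / (1 + norm x) ^ K \<le> 1 / (\<Prod>b\<in>(Basis::'a set). 1 + (x \<bullet> b)\<^sup>2)"
      using * by (intro divide_left_mono) auto
    also have "\<dots> = (\<Prod>b\<in>(Basis::'a set). inverse (1 + (x \<bullet> b)\<^sup>2))"
      by (simp add: divide_inverse prod_inversef[symmetric] comp_def)
    finally show "norm (1 / (1 + norm x) ^ K) \<le> norm (\<Prod>b\<in>Basis. inverse (1 + (x \<bullet> b)\<^sup>2))"
      using n by (simp add: prod_nonneg less_imp_le[OF pos])
  qed
qed simp

lemma rapid_integrable:
  assumes f: "rapid f" and [measurable]: "f \<in> borel_measurable borel"
  shows "integrable lborel (f :: 'a::euclidean_space \<Rightarrow> complex)"
proof -
  obtain C where C: "C \<ge> 0" "\<And>x. norm (f x) \<le> C / (1 + norm x) ^ (2 * DIM('a))"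
    using f by (metis rapidE)
  show ?thesis
  proof (rule Bochner_Integration.integrable_bound)
    show "integrable lborel (\<lambda>x::'a. C * (1 / (1 + norm x) ^ (2 * DIM('a))))"
      by (intro integrable_mult_right integrable_inverse_poly) auto
  qed (use C in \<open>auto simp: abs_of_nonneg\<close>)
qed

lemma schwartz_integrable: "schwartz f \<Longrightarrow> integrable lborel f"
  by (intro rapid_integrable schwartz_rapid schwartz_borel)

text \<open>Along any sequence tending to \<open>x0\<close> the quotients of the remainder are
  dominated by means of the mean value inequality on the unit ball, so dominated convergence
  applies. It is enough to dominate derivatives along basis vectors, since a linear map is
  controlled by its values there.\<close>

lemma has_derivative_integral_dominated:
  fixes A :: "'a::euclidean_space \<Rightarrow> 'b \<Rightarrow> complex"
  assumes der: "\<And>x y. ((\<lambda>x. A x y) has_derivative A' x y) (at x)"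
    and int: "\<And>x. integrable M (A x)"
    and meas: "\<And>b. b \<in> Basis \<Longrightarrow> (\<lambda>y. A' x0 y b) \<in> borel_measurable M"
    and dom: "\<And>x y b. norm (x - x0) \<le> 1 \<Longrightarrow> b \<in> Basis \<Longrightarrow> norm (A' x y b) \<le> g y"
    and g: "integrable M g"
  shows "((\<lambda>x. LINT y|M. A x y) has_derivative (\<lambda>v. LINT y|M. A' x0 y v)) (at x0)"
proof -
  let ?d = "real DIM('a)"
  have lin: "linear (A' x y)" for x y using has_derivative_linear[OF der] .
  have exp: "A' x y v = (\<Sum>b\<in>Basis. (v \<bullet> b) *\<^sub>R A' x y b)" for x y v
  proof -
    have "A' x y v = A' x y (\<Sum>b\<in>Basis. (v \<bullet> b) *\<^sub>R b)" by (simp add: euclidean_representation)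
    also have "\<dots> = (\<Sum>b\<in>Basis. (v \<bullet> b) *\<^sub>R A' x y b)"
      by (simp add: linear_sum[OF lin] linear_scale[OF lin])
    finally show ?thesis .
  qed
  have g0: "g y \<ge> 0" for y
    using dom[of x0 "SOME b. b \<in> Basis" y] by (smt (verit) SOME_Basis diff_self norm_ge_zero norm_zero)
  have bnd: "norm (A' x y v) \<le> ?d * g y * norm v" if x: "norm (x - x0) \<le> 1" for x y v
  proof -
    have "norm (A' x y v) \<le> (\<Sum>b\<in>(Basis::'a set). norm v * g y)"
      unfolding exp[of x y v]
    proof (rule sum_norm_le)
      fix b :: 'a assume b: "b \<in> Basis"
      show "norm ((v \<bullet> b) *\<^sub>R A' x y b) \<le> norm v * g y"
        unfolding norm_scaleR using Basis_le_norm[OF b, of v] dom[OF x b, of y] by (intro mult_mono) auto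
    qed
    then show ?thesis by (simp add: algebra_simps)
  qed
  have intA': "integrable M (\<lambda>y. A' x0 y v)" for v
  proof (subst exp, intro Bochner_Integration.integrable_sum integrable_scaleR_right)
    fix b :: 'a assume b: "b \<in> Basis"
    show "integrable M (\<lambda>y. A' x0 y b)"
      by (rule Bochner_Integration.integrable_bound[OF g meas[OF b]])
        (use dom[of x0 b] b g0 in auto)
  qed
  have "linear (\<lambda>v. LINT y|M. A' x0 y v)"
    by (rule linearI) (simp_all add: linear_add[OF lin] linear_scale[OF lin] Bochner_Integration.integral_add[OF intA' intA'])
  then have bl: "bounded_linear (\<lambda>v. LINT y|M. A' x0 y v)"
    by (simp add: linear_conv_bounded_linear)
  have lim: "((\<lambda>x. ((LINT y|M. A x y) - (LINT y|M. A x0 y) - (LINT y|M. A' x0 y (x - x0))) /\<^sub>R norm (x - x0)) \<longlongrightarrow> 0) (at x0)"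
    unfolding tendsto_at_iff_sequentially
  proof (intro allI impI)
    fix X assume X: "\<forall>i. X i \<in> UNIV - {x0}" "X \<longlonglongrightarrow> x0"
    obtain N where N: "\<And>i. i \<ge> N \<Longrightarrow> norm (X i - x0) \<le> 1"
      using LIMSEQ_D[OF X(2), of 1] by (auto intro: less_imp_le)
    \<comment> \<open>The first N terms are dropped so that all remaining points lie in the unit
      ball about \<open>x0\<close>, where \<open>dom\<close> is available.\<close>
    define Y where "Y = (\<lambda>i. X (i + N))"
    have Y: "Y i \<noteq> x0" "norm (Y i - x0) \<le> 1" for i using X(1) N by (auto simp: Y_def)
    have Ylim: "Y \<longlonglongrightarrow> x0" unfolding Y_def using X(2) by (rule LIMSEQ_ignore_initial_segment)
    define s where "s = (\<lambda>i y. (A (Y i) y - A x0 y - A' x0 y (Y i - x0)) /\<^sub>R norm (Y i - x0))"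
    have "(\<lambda>i. LINT y|M. s i y) \<longlonglongrightarrow> (LINT y|M. 0)"
    \<comment> \<open>One copy of \<open>?d * g y\<close> bounds the increment of \<open>A\<close>
      by the mean value inequality, the other bounds the linear term.\<close>
    proof (rule integral_dominated_convergence[where w="\<lambda>y. 2 * ?d * g y"])
      show "integrable M (\<lambda>y. 2 * ?d * g y)" using g by simp
      show "s i \<in> borel_measurable M" for i unfolding s_def
        by (intro borel_measurable_integrable Bochner_Integration.integrable_diff integrable_scaleR_right int intA')
      show "AE y in M. (\<lambda>i. s i y) \<longlonglongrightarrow> 0"
      proof (rule AE_I2)
        fix y
        have "((\<lambda>x. (A x y - A x0 y - A' x0 y (x - x0)) /\<^sub>R norm (x - x0)) \<longlongrightarrow> 0) (at x0)"
          using der[of y x0] unfolding has_derivative_at_within by blast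
        then show "(\<lambda>i. s i y) \<longlonglongrightarrow> 0"
          unfolding tendsto_at_iff_sequentially using Y(1) Ylim by (auto simp: s_def o_def)
      qed
      show "AE y in M. norm (s i y) \<le> 2 * ?d * g y" for i
      proof (rule AE_I2)
        fix y
        have "norm (A (Y i) y - A x0 y) \<le> (?d * g y) * norm (Y i - x0)"
        proof (rule differentiable_bound[where S="cball x0 1" and f'="\<lambda>x. A' x y"])
          show "onorm (A' x y) \<le> ?d * g y" if "x \<in> cball x0 1" for x
            using that bnd[of x y] g0[of y] by (intro onorm_bound) (auto simp: dist_norm norm_minus_commute)
        qed (use Y der in \<open>auto intro: has_derivative_at_withinI simp: dist_norm norm_minus_commute\<close>)
        moreover have "norm (A' x0 y (Y i - x0)) \<le> (?d * g y) * norm (Y i - x0)"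
          using bnd[of x0 y] by simp
        ultimately have "norm (A (Y i) y - A x0 y - A' x0 y (Y i - x0)) \<le> 2 * ?d * g y * norm (Y i - x0)"
          using norm_triangle_ineq4[of "A (Y i) y - A x0 y" "A' x0 y (Y i - x0)"] by linarith
        then show "norm (s i y) \<le> 2 * ?d * g y"
          using Y(1)[of i] by (simp add: s_def divide_simps)
      qed
    qed simp
    moreover have "(LINT y|M. s i y) = ((LINT y|M. A (Y i) y) - (LINT y|M. A x0 y) - (LINT y|M. A' x0 y (Y i - x0))) /\<^sub>R norm (Y i - x0)" for i
      unfolding s_def by (simp add: int intA')
    ultimately have "(\<lambda>i. ((\<lambda>x. ((LINT y|M. A x y) - (LINT y|M. A x0 y) - (LINT y|M. A' x0 y (x - x0))) /\<^sub>R norm (x - x0)) \<circ> X) (i + N)) \<longlonglongrightarrow> 0"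
      by (simp add: Y_def o_def)
    then show "((\<lambda>x. ((LINT y|M. A x y) - (LINT y|M. A x0 y) - (LINT y|M. A' x0 y (x - x0))) /\<^sub>R norm (x - x0)) \<circ> X) \<longlonglongrightarrow> 0"
      by (rule LIMSEQ_offset)
  qed
  show ?thesis unfolding has_derivative_at_within using bl lim by auto
qed

text \<open>By translation invariance the integral of f(y + x) over y does not depend on x.
  Differentiating under the integral sign at x = 0 gives the claim, with no iterated one-dimensional
  integrals.\<close>

lemma integral_schwartz_pderiv:
  fixes f :: "'a::euclidean_space \<Rightarrow> complex"
  assumes f: "schwartz f" and b: "b \<in> Basis"
  shows "(LINT x|lborel. frechet_derivative f (at x) b) = 0"
proof -
  let ?K = "2 * DIM('a)"
  have "\<exists>C. C \<ge> 0 \<and> (\<forall>x. norm (frechet_derivative f (at x) b) \<le> C / (1 + norm x) ^ ?K)" if "b \<in> Basis" for b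
    using schwartz_rapid[OF schwartz_pderiv[OF f that]] by (metis rapidE)
  then obtain C where C: "\<And>b. b \<in> Basis \<Longrightarrow> C b \<ge> 0"
      "\<And>b x. b \<in> Basis \<Longrightarrow> norm (frechet_derivative f (at x) b) \<le> C b / (1 + norm x) ^ ?K"
    by metis
  define C0 where "C0 = (\<Sum>b\<in>Basis. C b)"
  have C0: "C b \<le> C0" "C0 \<ge> 0" if "b \<in> Basis" for b
    unfolding C0_def using C(1) that by (auto intro!: member_le_sum sum_nonneg)
  have [measurable]: "f \<in> borel_measurable borel" by (rule schwartz_borel[OF f])
  have "((\<lambda>x. LINT y|lborel. f (y + x)) has_derivative (\<lambda>v. LINT y|lborel. frechet_derivative f (at (y + 0)) v)) (at 0)"
  \<comment> \<open>For |x| \<le> 1 one has 1 + |y| \<le> 2 (1 + |y + x|), whence the factor 2 to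
    the power of the decay exponent.\<close>
  proof (rule has_derivative_integral_dominated[where A'="\<lambda>x y. frechet_derivative f (at (y + x))" and g="\<lambda>y. C0 * 2 ^ ?K * (1 / (1 + norm y) ^ ?K)"])
    show "((\<lambda>x. f (y + x)) has_derivative frechet_derivative f (at (y + x))) (at x)" for x y
      using has_derivative_compose_affine[OF bounded_linear_ident, of f _ x y] schwartz_has_derivative[OF f, of "x + y"]
      by (simp add: add.commute)
    show "integrable lborel (\<lambda>y. f (y + x))" for x
      using integrable_affine[OF schwartz_integrable[OF f], of 1 x] by (simp add: add.commute)
    show "(\<lambda>y. frechet_derivative f (at (y + 0)) b) \<in> borel_measurable lborel" if "b \<in> Basis" for b
      using schwartz_borel[OF schwartz_pderiv[OF f that]] by simp
    show "integrable lborel (\<lambda>y::'a. C0 * 2 ^ ?K * (1 / (1 + norm y) ^ ?K))"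
      by (intro integrable_mult_right integrable_inverse_poly) auto
    show "norm (frechet_derivative f (at (y + x)) b) \<le> C0 * 2 ^ ?K * (1 / (1 + norm y) ^ ?K)"
      if "norm (x - 0) \<le> 1" "b \<in> Basis" for x y b
    proof -
      have "norm y \<le> norm (y + x) + norm x" using norm_triangle_ineq4[of "y + x" x] by simp
      then have "1 + norm y \<le> 2 * (1 + norm (y + x))" 
      proof -
        have "norm y \<le> norm (y + x) + 1" using that(1) \<open>norm y \<le> norm (y + x) + norm x\<close> by simp
        then have "1 + norm y \<le> 2 + norm (y + x)" by simp
        also have "\<dots> \<le> 2 * (1 + norm (y + x))" by simp
        finally show ?thesis .
      qed
      then have "(1 + norm y) ^ ?K \<le> (2 * (1 + norm (y + x))) ^ ?K"
        by (intro power_mono) auto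
      then have *: "(1 + norm y) ^ ?K \<le> 2 ^ ?K * (1 + norm (y + x)) ^ ?K" by (simp only: power_mult_distrib)
      have p: "(1 + norm y) ^ ?K > 0" "(1 + norm (y + x)) ^ ?K > 0"
        by (intro zero_less_power add_pos_nonneg; simp)+
      have "norm (frechet_derivative f (at (y + x)) b) \<le> C b / (1 + norm (y + x)) ^ ?K" using C(2)[OF that(2)] .
      also have "\<dots> \<le> C0 / (1 + norm (y + x)) ^ ?K"
        using C0(1)[OF that(2)] p by (intro divide_right_mono) auto
      also have "\<dots> = C0 * (1 / (1 + norm (y + x)) ^ ?K)" by simp
      also have "\<dots> \<le> C0 * (2 ^ ?K / (1 + norm y) ^ ?K)"
        using * p C0(2)[OF that(2)] by (intro mult_left_mono) (auto simp: divide_simps mult.commute)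
      finally show ?thesis by simp
    qed
  qed
  moreover have "(LINT y|lborel. f (y + x)) = (LINT y|lborel. f y)" for x
    using integral_affine[of f 1 x] by (simp add: add.commute)
  ultimately have "((\<lambda>x::'a. LINT y|lborel. f y) has_derivative (\<lambda>v. LINT y|lborel. frechet_derivative f (at y) v)) (at 0)"
    by simp
  from has_derivative_unique[OF this has_derivative_const] show ?thesis by (simp add: fun_eq_iff)
qed

text \<open>The decay of A in (x, y) is shared: M powers of 1 + |y| make k integrable and the others
  give decay in x. Derivatives in x are derivatives of A along (b, 0), again Schwartz, so
  coinduction applies. Mollification and the operator \<open>synth\<close> are both
  instances.\<close>

lemma schwartz_parametric_integral:
  fixes k :: "'b::euclidean_space \<Rightarrow> complex" and A :: "'a::euclidean_space \<times> 'b \<Rightarrow> complex"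
  assumes [measurable]: "k \<in> borel_measurable borel"
    and k: "integrable lborel (\<lambda>y. norm (k y) / (1 + norm y) ^ M)" and A: "schwartz A"
  shows "schwartz (\<lambda>x. LINT y|lborel. k y * A (x, y))"
proof (rule schwartz_coinduct[where P="\<lambda>h. \<exists>A. schwartz A \<and> h = (\<lambda>x. LINT y|lborel. k y * A (x, y))"])
  fix h :: "'a \<Rightarrow> complex" assume "\<exists>A. schwartz A \<and> h = (\<lambda>x. LINT y|lborel. k y * A (x, y))"
  then obtain A where A: "schwartz A" and h: "h = (\<lambda>x. LINT y|lborel. k y * A (x, y))" by blast
  have dec: "\<exists>C. C \<ge> 0 \<and> (\<forall>x y. norm (k y * B (x, y)) \<le> C / (1 + norm x) ^ N * (norm (k y) / (1 + norm y) ^ M))"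
    if B: "schwartz B" for B :: "'a \<times> 'b \<Rightarrow> complex" and N
  proof -
    obtain C where C: "C \<ge> 0" "\<And>z. norm (B z) \<le> C / (1 + norm z) ^ (N + M)"
      using schwartz_rapid[OF B] by (metis rapidE)
    have "norm (k y * B (x, y)) \<le> C / (1 + norm x) ^ N * (norm (k y) / (1 + norm y) ^ M)" for x y
    proof -
      have "(1 + norm x) ^ N * (1 + norm y) ^ M \<le> (1 + norm (x, y)) ^ N * (1 + norm (x, y)) ^ M"
        by (intro mult_mono power_mono add_left_mono norm_fst_le norm_snd_le) auto
      moreover have "0 < (1 + norm x) ^ N * (1 + norm y) ^ M"
        by (intro mult_pos_pos zero_less_power add_pos_nonneg) auto
      ultimately have "C / (1 + norm (x, y)) ^ (N + M) \<le> C / ((1 + norm x) ^ N * (1 + norm y) ^ M)"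
        using C(1) unfolding power_add by (intro divide_left_mono) auto
      then have "norm (B (x, y)) \<le> C / ((1 + norm x) ^ N * (1 + norm y) ^ M)"
        using C(2)[of "(x, y)"] by linarith
      then have "norm (k y) * norm (B (x, y)) \<le> norm (k y) * (C / ((1 + norm x) ^ N * (1 + norm y) ^ M))"
        by (intro mult_left_mono) auto
      then show ?thesis by (simp add: norm_mult mult.commute)
    qed
    then show ?thesis using C(1) by blast
  qed
  have int: "integrable lborel (\<lambda>y. k y * B (x, y))" if B: "schwartz B" for B :: "'a \<times> 'b \<Rightarrow> complex" and x
  proof -
    obtain C where C: "C \<ge> 0" "\<And>x y. norm (k y * B (x, y)) \<le> C / (1 + norm x) ^ 0 * (norm (k y) / (1 + norm y) ^ M)"
      using dec[OF B] by metis
    have [measurable]: "B \<in> borel_measurable borel" by (rule schwartz_borel[OF B])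
    show ?thesis
    proof (rule Bochner_Integration.integrable_bound)
      show "integrable lborel (\<lambda>y. C * (norm (k y) / (1 + norm y) ^ M))" using k by (rule integrable_mult_right)
    qed (use C in \<open>auto simp: abs_mult\<close>)
  qed
  show "rapid h" unfolding rapid_def
  proof
    fix N
    obtain C where C: "C \<ge> 0" "\<And>x y. norm (k y * A (x, y)) \<le> C / (1 + norm x) ^ N * (norm (k y) / (1 + norm y) ^ M)"
      using dec[OF A] by metis
    have "(1 + norm x) ^ N * norm (h x) \<le> C * (LINT y|lborel. norm (k y) / (1 + norm y) ^ M)" for x
    proof -
      have p: "0 < (1 + norm x) ^ N" by (intro zero_less_power add_pos_nonneg) auto
      have "norm (h x) \<le> (LINT y|lborel. C / (1 + norm x) ^ N * (norm (k y) / (1 + norm y) ^ M))"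
        unfolding h
        by (rule Bochner_Integration.integral_norm_bound_integral[OF int[OF A] integrable_mult_right[OF k] C(2)])
      also have "\<dots> = C / (1 + norm x) ^ N * (LINT y|lborel. norm (k y) / (1 + norm y) ^ M)"
        by (rule integral_mult_right_zero)
      finally have "(1 + norm x) ^ N * norm (h x) \<le> (1 + norm x) ^ N * (C / (1 + norm x) ^ N * (LINT y|lborel. norm (k y) / (1 + norm y) ^ M))"
        using p by (intro mult_left_mono) auto
      also have "\<dots> = C * (LINT y|lborel. norm (k y) / (1 + norm y) ^ M)" using less_imp_neq[OF p] by simp
      finally show ?thesis .
    qed
    then show "\<exists>C. \<forall>x. (1 + norm x) ^ N * norm (h x) \<le> C" by blast
  qed
  have eq: "(b, 0) \<in> (Basis :: ('a \<times> 'b) set)" if "b \<in> Basis" for b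
    using that by (auto simp: Basis_prod_def)
  let ?P = "\<lambda>h. \<exists>A. schwartz A \<and> h = (\<lambda>x. LINT y|lborel. k y * A (x, y))"
  show "\<exists>h'. (\<forall>x. (h has_derivative h' x) (at x)) \<and> (\<forall>b\<in>Basis. fspan ?P (\<lambda>x. h' x b))"
  proof (intro exI[of _ "\<lambda>x v. LINT y|lborel. k y * frechet_derivative A (at (x, y)) (v, 0)"] conjI allI ballI)
    fix b :: 'a assume b: "b \<in> Basis"
    show "fspan ?P (\<lambda>x. LINT y|lborel. k y * frechet_derivative A (at (x, y)) (b, 0))"
      by (intro fspan_base exI) (rule conjI[OF schwartz_pderiv[OF A eq[OF b]] refl])
  next
    fix x0 :: 'a
    have "\<exists>C. C \<ge> 0 \<and> (\<forall>x y. norm (k y * frechet_derivative A (at (x, y)) (b, 0)) \<le> C / (1 + norm x) ^ 0 * (norm (k y) / (1 + norm y) ^ M))"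
      if "b \<in> Basis" for b
      using dec[OF schwartz_pderiv[OF A eq[OF that]], of 0] .
    then obtain C where C: "\<And>b. b \<in> Basis \<Longrightarrow> C b \<ge> 0"
      "\<And>b x y. b \<in> Basis \<Longrightarrow> norm (k y * frechet_derivative A (at (x, y)) (b, 0)) \<le> C b / (1 + norm x) ^ 0 * (norm (k y) / (1 + norm y) ^ M)"
      by metis
    define C0 where "C0 = (\<Sum>b\<in>Basis. C b)"
    have C0: "C b \<le> C0" if "b \<in> Basis" for b
      unfolding C0_def using C(1) that by (auto intro!: member_le_sum)
    show "(h has_derivative (\<lambda>v. LINT y|lborel. k y * frechet_derivative A (at (x0, y)) (v, 0))) (at x0)"
      unfolding h
    proof (rule has_derivative_integral_dominated[where A'="\<lambda>x y v. k y * frechet_derivative A (at (x, y)) (v, 0)" and g="\<lambda>y. C0 * (norm (k y) / (1 + norm y) ^ M)"])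
      fix x :: 'a and y :: 'b and b :: 'a
      show "((\<lambda>x. k y * A (x, y)) has_derivative (\<lambda>v. k y * frechet_derivative A (at (x, y)) (v, 0))) (at x)"
        using has_derivative_compose_affine[OF bounded_linear_Pair[OF bounded_linear_ident bounded_linear_zero], of A _ x "(0, y)"]
          schwartz_has_derivative[OF A, of "(x, y)"]
        by (auto intro!: has_derivative_mult_right)
      show "integrable lborel (\<lambda>y. k y * A (x, y))" by (rule int[OF A])
      show "(\<lambda>y. k y * frechet_derivative A (at (x0, y)) (b, 0)) \<in> borel_measurable lborel" if b: "b \<in> Basis"
        using int[OF schwartz_pderiv[OF A eq[OF b]], of x0] by auto
      show "integrable lborel (\<lambda>y. C0 * (norm (k y) / (1 + norm y) ^ M))" using k by (rule integrable_mult_right)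
      show "norm (k y * frechet_derivative A (at (x, y)) (b, 0)) \<le> C0 * (norm (k y) / (1 + norm y) ^ M)"
        if b: "b \<in> Basis"
        using C(2)[OF b, of y x] mult_right_mono[OF C0[OF b], of "norm (k y) / (1 + norm y) ^ M"] by simp
    qed
  qed
qed (use A in blast)

section \<open>The Fourier transform of Schwartz functions\<close>

lemma integrable_mult_cis:
  assumes "integrable lborel f"
  shows "integrable lborel (\<lambda>x::'a::euclidean_space. f x * cis (x \<bullet> y))"
    "integrable lborel (\<lambda>x::'a. f x * cis (- (x \<bullet> y)))"
proof -
  have [measurable]: "f \<in> borel_measurable borel" using borel_measurable_integrable[OF assms] by simp
  have [measurable]: "cis \<in> borel_measurable borel"
    by (intro borel_measurable_continuous_onI continuous_intros)
  show "integrable lborel (\<lambda>x::'a. f x * cis (x \<bullet> y))" "integrable lborel (\<lambda>x::'a. f x * cis (- (x \<bullet> y)))"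
    by (rule Bochner_Integration.integrable_bound[OF assms]; simp add: norm_mult)+
qed

lemma cis_measurable [measurable]: "cis \<in> borel_measurable borel"
  by (intro borel_measurable_continuous_onI continuous_intros)

lemma has_derivative_cis_compose:
  assumes "(f has_derivative f') (at x)"
  shows "((\<lambda>x. cis (f x)) has_derivative (\<lambda>v. \<i> * of_real (f' v) * cis (f x))) (at x)"
proof -
  have e: "(exp has_derivative (*) (exp (\<i> * complex_of_real (f x)))) (at (\<i> * complex_of_real (f x)))"
    using DERIV_exp by (simp add: has_field_derivative_def)
  have "((\<lambda>x. \<i> * complex_of_real (f x)) has_derivative (\<lambda>v. \<i> * of_real (f' v))) (at x)"
    by (intro has_derivative_mult_right has_derivative_of_real assms)
  from has_derivative_compose[OF this e] show ?thesis by (simp add: cis_conv_exp mult.commute)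
qed

lemma schwartz_cis: "schwartz f \<Longrightarrow> schwartz (\<lambda>x. cis (x \<bullet> y) * f x)"
  by (intro schwartz_mult moderate_cis moderate_inner)

text \<open>The derivative of the Schwartz function exp (- i x \<xi>) f(x) integrates to zero; this
  is integration by parts with no boundary terms.\<close>

lemma fourier_pderiv:
  fixes f :: "real ^ 'd::finite \<Rightarrow> complex"
  assumes f: "schwartz f" and b: "b \<in> Basis"
  shows "fourier (\<lambda>x. frechet_derivative f (at x) b) \<xi> = \<i> * of_real (\<xi> \<bullet> b) * fourier f \<xi>"
proof -
  define g where "g = (\<lambda>x. cis (x \<bullet> (- \<xi>)) * f x)"
  have g: "schwartz g" unfolding g_def by (rule schwartz_cis[OF f])
  have der: "(g has_derivative (\<lambda>v. cis (x \<bullet> (- \<xi>)) * frechet_derivative f (at x) v + (\<i> * of_real (v \<bullet> (- \<xi>)) * cis (x \<bullet> (- \<xi>))) * f x)) (at x)" for x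
  proof -
    have "((\<lambda>x. x \<bullet> (- \<xi>)) has_derivative (\<lambda>v. v \<bullet> (- \<xi>))) (at x)"
      by (intro has_derivative_inner_left has_derivative_ident)
    from has_derivative_mult[OF has_derivative_cis_compose[OF this] schwartz_has_derivative[OF f]]
    show ?thesis unfolding g_def .
  qed
  have "frechet_derivative g (at x) b = cis (x \<bullet> (- \<xi>)) * frechet_derivative f (at x) b + (\<i> * of_real (b \<bullet> (- \<xi>)) * cis (x \<bullet> (- \<xi>))) * f x" for x
    using fun_cong[OF frechet_derivative_at[OF der], symmetric] .
  then have "frechet_derivative g (at x) b = frechet_derivative f (at x) b * cis (- (x \<bullet> \<xi>)) - (\<i> * of_real (\<xi> \<bullet> b)) * (f x * cis (- (x \<bullet> \<xi>)))" for x
    by (simp add: algebra_simps inner_commute[of b \<xi>])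
  then have "0 = (LINT x|lborel. frechet_derivative f (at x) b * cis (- (x \<bullet> \<xi>)) - (\<i> * of_real (\<xi> \<bullet> b)) * (f x * cis (- (x \<bullet> \<xi>))))"
    using integral_schwartz_pderiv[OF g b] by simp
  also have "\<dots> = (LINT x|lborel. frechet_derivative f (at x) b * cis (- (x \<bullet> \<xi>))) - (LINT x|lborel. (\<i> * of_real (\<xi> \<bullet> b)) * (f x * cis (- (x \<bullet> \<xi>))))"
    by (intro Bochner_Integration.integral_diff integrable_mult_right integrable_mult_cis schwartz_integrable f schwartz_pderiv b)
  finally show ?thesis by (simp add: fourier_def)
qed

lemma norm_fourier_le:
  assumes "integrable lborel f"
  shows "norm (fourier f \<xi>) \<le> (LINT x|lborel. norm (f x))"
  unfolding fourier_def
  using integral_norm_bound[of lborel "\<lambda>x. f x * cis (- (x \<bullet> \<xi>))"] by (simp add: norm_mult)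

lemma fourier_iter_pderiv:
  assumes f: "schwartz f" and b: "b \<in> Basis"
  shows "schwartz (iter_pderiv (replicate n b) f) \<and>
    fourier (iter_pderiv (replicate n b) f) \<xi> = (\<i> * of_real (\<xi> \<bullet> b)) ^ n * fourier f \<xi>"
  by (induction n) (use f b in \<open>auto intro: schwartz_pderiv simp: fourier_pderiv\<close>)

text \<open>Derivatives of a function control powers of single coordinates in its Fourier transform,
  and this inequality converts them into powers of the norm. It rests on |x| \<le> DIM m, with m the
  largest absolute value of a coordinate.\<close>

lemma one_plus_norm_power_le:
  "(1 + norm x) ^ N \<le> (1 + real DIM('a)) ^ N * (1 + (\<Sum>b\<in>Basis. \<bar>x \<bullet> b\<bar> ^ N))" for x :: "'a::euclidean_space"
proof -
  define m where "m = Max ((\<lambda>b. \<bar>x \<bullet> b\<bar>) ` Basis)"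
  have m: "\<bar>x \<bullet> b\<bar> \<le> m" if "b \<in> Basis" for b unfolding m_def using that by (intro Max_ge) auto
  have "m \<in> (\<lambda>b. \<bar>x \<bullet> b\<bar>) ` Basis" unfolding m_def by (intro Max_in) auto
  then obtain c where c: "c \<in> Basis" "m = \<bar>x \<bullet> c\<bar>" by auto
  have "norm x \<le> (\<Sum>b\<in>Basis. \<bar>x \<bullet> b\<bar>)" by (rule norm_le_l1)
  also have "\<dots> \<le> (\<Sum>b\<in>(Basis::'a set). m)" by (intro sum_mono m)
  finally have "1 + norm x \<le> (1 + real DIM('a)) * max 1 m"
    using c by (simp add: algebra_simps max_def)
      (smt (verit, ccfv_threshold) mult_left_mono of_nat_0_le_iff mult_cancel_left1)
  then have "(1 + norm x) ^ N \<le> ((1 + real DIM('a)) * max 1 m) ^ N" by (intro power_mono) auto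
  also have "\<dots> = (1 + real DIM('a)) ^ N * (max 1 m) ^ N" by (simp add: power_mult_distrib)
  also have "\<dots> \<le> (1 + real DIM('a)) ^ N * (1 + (\<Sum>b\<in>Basis. \<bar>x \<bullet> b\<bar> ^ N))"
  proof (intro mult_left_mono)
    have "m ^ N \<le> (\<Sum>b\<in>Basis. \<bar>x \<bullet> b\<bar> ^ N)" unfolding c(2) using c(1) by (intro member_le_sum) auto
    moreover have "0 \<le> m ^ N" using c by simp
    ultimately show "(max 1 m) ^ N \<le> 1 + (\<Sum>b\<in>Basis. \<bar>x \<bullet> b\<bar> ^ N)"
      by (cases "m \<le> 1") (auto simp: max_def intro: add_nonneg_nonneg sum_nonneg)
  qed simp
  finally show ?thesis .
qed

lemma rapid_fourier:
  fixes f :: "real ^ 'd::finite \<Rightarrow> complex"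
  assumes f: "schwartz f"
  shows "rapid (fourier f)"
  unfolding rapid_def
proof
  fix N
  define C where "C = (LINT x|lborel. norm (f x)) + (\<Sum>b\<in>Basis. LINT x|lborel. norm (iter_pderiv (replicate N b) f x))"
  have "(1 + norm \<xi>) ^ N * norm (fourier f \<xi>) \<le> (1 + real DIM(real ^ 'd)) ^ N * C" for \<xi>
  proof -
    have "(1 + norm \<xi>) ^ N * norm (fourier f \<xi>) \<le> ((1 + real DIM(real ^ 'd)) ^ N * (1 + (\<Sum>b\<in>Basis. \<bar>\<xi> \<bullet> b\<bar> ^ N))) * norm (fourier f \<xi>)"
      by (intro mult_right_mono one_plus_norm_power_le) auto
    also have "\<dots> = (1 + real DIM(real ^ 'd)) ^ N * (norm (fourier f \<xi>) + (\<Sum>b\<in>Basis. \<bar>\<xi> \<bullet> b\<bar> ^ N * norm (fourier f \<xi>)))"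
      by (simp add: algebra_simps sum_distrib_left)
    also have "\<dots> \<le> (1 + real DIM(real ^ 'd)) ^ N * C"
      unfolding C_def
    proof (intro mult_left_mono add_mono sum_mono)
      show "norm (fourier f \<xi>) \<le> (LINT x|lborel. norm (f x))" by (rule norm_fourier_le[OF schwartz_integrable[OF f]])
      fix b :: "real ^ 'd" assume b: "b \<in> Basis"
      note i = fourier_iter_pderiv[OF f b]
      have "\<bar>\<xi> \<bullet> b\<bar> ^ N * norm (fourier f \<xi>) = norm (fourier (iter_pderiv (replicate N b) f) \<xi>)"
        using i[of N \<xi>] by (simp add: norm_mult norm_power)
      also have "\<dots> \<le> (LINT x|lborel. norm (iter_pderiv (replicate N b) f x))"
        using i[of N \<xi>] by (intro norm_fourier_le schwartz_integrable) auto
      finally show "\<bar>\<xi> \<bullet> b\<bar> ^ N * norm (fourier f \<xi>) \<le> (LINT x|lborel. norm (iter_pderiv (replicate N b) f x))" .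
    qed simp
    finally show ?thesis .
  qed
  then show "\<exists>C. \<forall>\<xi>. (1 + norm \<xi>) ^ N * norm (fourier f \<xi>) \<le> C" by blast
qed

lemma has_derivative_fourier:
  fixes f :: "real ^ 'd::finite \<Rightarrow> complex"
  assumes f: "schwartz f"
  shows "(fourier f has_derivative (\<lambda>v. fourier (\<lambda>x. (- \<i>) * of_real (x \<bullet> v) * f x) \<xi>)) (at \<xi>)"
proof -
  have g: "schwartz (\<lambda>x. (- \<i>) * of_real (x \<bullet> v) * f x)" for v
    by (rule schwartz_mult[OF moderate_mult[OF moderate_const moderate_inner] f])
  have [measurable]: "f \<in> borel_measurable borel" by (rule schwartz_borel[OF f])
  have "((\<lambda>\<xi>. LINT x|lborel. f x * cis (- (x \<bullet> \<xi>))) has_derivative (\<lambda>v. LINT x|lborel. (- \<i>) * of_real (x \<bullet> v) * f x * cis (- (x \<bullet> \<xi>)))) (at \<xi>)"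
  proof (rule has_derivative_integral_dominated[where A'="\<lambda>\<xi> x v. (- \<i>) * of_real (x \<bullet> v) * f x * cis (- (x \<bullet> \<xi>))" and g="\<lambda>x. \<Sum>b\<in>Basis. norm ((- \<i>) * of_real (x \<bullet> b) * f x)"])
    fix \<xi> x :: "real ^ 'd"
    have "((\<lambda>\<xi>. - (x \<bullet> \<xi>)) has_derivative (\<lambda>v. - (x \<bullet> v))) (at \<xi>)"
      by (intro has_derivative_minus has_derivative_inner_right has_derivative_ident)
    from has_derivative_mult_right[OF has_derivative_cis_compose[OF this], of "f x"]
    show "((\<lambda>\<xi>. f x * cis (- (x \<bullet> \<xi>))) has_derivative (\<lambda>v. (- \<i>) * of_real (x \<bullet> v) * f x * cis (- (x \<bullet> \<xi>)))) (at \<xi>)"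
      by (rule has_derivative_eq_rhs) (simp add: fun_eq_iff algebra_simps)
    show "integrable lborel (\<lambda>x. f x * cis (- (x \<bullet> \<xi>)))"
      by (intro integrable_mult_cis schwartz_integrable f)
    show "integrable lborel (\<lambda>x. \<Sum>b\<in>Basis. norm ((- \<i>) * of_real (x \<bullet> b) * f x))"
      by (intro Bochner_Integration.integrable_sum integrable_norm schwartz_integrable g)
    fix b :: "real ^ 'd" assume b: "b \<in> Basis"
    show "norm ((- \<i>) * of_real (x \<bullet> b) * f x * cis (- (x \<bullet> \<xi>))) \<le> (\<Sum>b\<in>Basis. norm ((- \<i>) * of_real (x \<bullet> b) * f x))"
      using b by (subst norm_mult) (auto intro!: member_le_sum)
  qed measurable
  then show ?thesis unfolding fourier_def .
qed

text \<open>A derivative of a transform is the transform of - i x f(x), so the class of transforms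
  of Schwartz functions is closed under differentiation and only its rapid decay has to be
  supplied.\<close>

lemma schwartz_fourier:
  fixes f :: "real ^ 'd::finite \<Rightarrow> complex"
  assumes f: "schwartz f"
  shows "schwartz (fourier f)"
proof (rule schwartz_coinduct[where P="\<lambda>h. \<exists>f. schwartz f \<and> h = fourier f"])
  fix h :: "real ^ 'd \<Rightarrow> complex" assume "\<exists>f. schwartz f \<and> h = fourier f"
  then obtain f where f: "schwartz f" "h = fourier f" by blast
  show "rapid h" unfolding f(2) by (rule rapid_fourier[OF f(1)])
  show "\<exists>h'. (\<forall>x. (h has_derivative h' x) (at x)) \<and> (\<forall>b\<in>Basis. fspan (\<lambda>h. \<exists>f. schwartz f \<and> h = fourier f) (\<lambda>x. h' x b))"
  proof (intro exI[of _ "\<lambda>\<xi> v. fourier (\<lambda>x. (- \<i>) * of_real (x \<bullet> v) * f x) \<xi>"] conjI allI ballI)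
    show "(h has_derivative (\<lambda>v. fourier (\<lambda>x. (- \<i>) * of_real (x \<bullet> v) * f x) \<xi>)) (at \<xi>)" for \<xi>
      unfolding f(2) by (rule has_derivative_fourier[OF f(1)])
    have g: "schwartz (\<lambda>x. (- \<i>) * of_real (x \<bullet> b) * f x)" for b
      by (rule schwartz_mult[OF moderate_mult[OF moderate_const moderate_inner] f(1)])
    show "fspan (\<lambda>h. \<exists>f. schwartz f \<and> h = fourier f) (fourier (\<lambda>x. (- \<i>) * of_real (x \<bullet> b) * f x))" for b
      by (intro fspan_base exI) (rule conjI[OF g refl])
  qed
qed (use f in blast)

lemma inv_fourier_eq: "inv_fourier f x = fourier f (- x) / of_real ((2 * pi) ^ CARD('d))"
  for f :: "real ^ 'd::finite \<Rightarrow> complex"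
  by (simp add: inv_fourier_def fourier_def inner_commute)

lemma schwartz_inv_fourier:
  fixes f :: "real ^ 'd::finite \<Rightarrow> complex"
  assumes "schwartz f" shows "schwartz (inv_fourier f)"
proof -
  have "schwartz (\<lambda>x. (1 / of_real ((2 * pi) ^ CARD('d))) * fourier f ((- 1) *\<^sub>R x + 0))"
    by (rule schwartz_cmult[OF schwartz_compose_affine[OF bounded_linear_scaleR_right _ schwartz_fourier[OF assms], where K=1]]) simp
  then show ?thesis by (simp add: inv_fourier_eq[abs_def])
qed

section \<open>Fourier inversion and Plancherel\<close>

lemma integrable_prod_bound:
  fixes F :: "'a::euclidean_space \<Rightarrow> 'b::euclidean_space \<Rightarrow> complex"
  assumes F [measurable]: "case_prod F \<in> borel_measurable (lborel \<Otimes>\<^sub>M lborel)"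
    and f: "integrable lborel f" and g: "integrable lborel g"
    and le: "\<And>x y. norm (F x y) \<le> f x * g y"
  shows "integrable (lborel \<Otimes>\<^sub>M lborel) (case_prod F)"
proof (rule lborel_pair.Fubini_integrable)
  have [measurable]: "f \<in> borel_measurable borel" "g \<in> borel_measurable borel"
    using f g by (auto dest: borel_measurable_integrable)
  have 1: "integrable lborel (\<lambda>y. F x y)" for x
  proof (rule Bochner_Integration.integrable_bound)
    show "integrable lborel (\<lambda>y. f x * g y)" using g by simp
    show "(\<lambda>y. F x y) \<in> borel_measurable lborel" by measurable
    show "AE y in lborel. norm (F x y) \<le> norm (f x * g y)"
      using le[of x] by (intro AE_I2) (smt (verit) real_norm_def)
  qed
  then show "AE x in lborel. integrable lborel (\<lambda>y. case (x, y) of (x, y) \<Rightarrow> F x y)" by simp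
  show "integrable lborel (\<lambda>x. LINT y|lborel. norm (case (x, y) of (x, y) \<Rightarrow> F x y))"
  proof (rule Bochner_Integration.integrable_bound)
    show "integrable lborel (\<lambda>x. f x * (LINT y|lborel. g y))" using f by simp
    show "(\<lambda>x. LINT y|lborel. norm (case (x, y) of (x, y) \<Rightarrow> F x y)) \<in> borel_measurable lborel" by measurable
    show "AE x in lborel. norm (LINT y|lborel. norm (case (x, y) of (x, y) \<Rightarrow> F x y)) \<le> norm (f x * (LINT y|lborel. g y))"
    proof (rule AE_I2)
      fix x
      have "(LINT y|lborel. norm (F x y)) \<le> (LINT y|lborel. f x * g y)"
        using g by (intro integral_mono integrable_norm 1 le integrable_mult_right)
      then show "norm (LINT y|lborel. norm (case (x, y) of (x, y) \<Rightarrow> F x y)) \<le> norm (f x * (LINT y|lborel. g y))"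
        by simp
    qed
  qed
qed measurable

lemma fubini_prod_bound:
  fixes F :: "'a::euclidean_space \<Rightarrow> 'b::euclidean_space \<Rightarrow> complex"
  assumes "case_prod F \<in> borel_measurable (lborel \<Otimes>\<^sub>M lborel)"
    and "integrable lborel f" and "integrable lborel g"
    and "\<And>x y. norm (F x y) \<le> f x * g y"
  shows "(LINT y|lborel. LINT x|lborel. F x y) = (LINT x|lborel. LINT y|lborel. F x y)"
  by (rule lborel_pair.Fubini_integral[OF integrable_prod_bound[OF assms]])

lemma fourier_swap:
  fixes f g :: "real ^ 'd::finite \<Rightarrow> complex"
  assumes f: "integrable lborel f" and g: "integrable lborel g"
  shows "(LINT \<xi>|lborel. fourier f \<xi> * g \<xi>) = (LINT x|lborel. f x * fourier g x)"
proof -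
  have [measurable]: "f \<in> borel_measurable borel" "g \<in> borel_measurable borel"
    using f g by (auto dest: borel_measurable_integrable)
  have "(LINT \<xi>|lborel. fourier f \<xi> * g \<xi>) = (LINT \<xi>|lborel. LINT x|lborel. f x * cis (- (x \<bullet> \<xi>)) * g \<xi>)"
    unfolding fourier_def by (subst integral_mult_left_zero[symmetric]) simp
  also have "\<dots> = (LINT x|lborel. LINT \<xi>|lborel. f x * cis (- (x \<bullet> \<xi>)) * g \<xi>)"
    by (rule fubini_prod_bound[where f="\<lambda>x. norm (f x)" and g="\<lambda>x. norm (g x)"])
      (use f g in \<open>auto simp: norm_mult\<close>)
  also have "\<dots> = (LINT x|lborel. f x * fourier g x)"
    unfolding fourier_def
    by (subst integral_mult_right_zero[symmetric]) (simp add: algebra_simps inner_commute)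
  finally show ?thesis .
qed

text \<open>The Gaussian that the Fourier transform reproduces up to the factor (2 pi)^(d/2). It
  serves as summability factor in Fourier inversion and as mollifier.\<close>

definition gauss :: "'a::euclidean_space \<Rightarrow> complex" where
  "gauss x = of_real (exp (- ((norm x)\<^sup>2 / 2)))"

lemma schwartz_gauss: "schwartz gauss"
proof -
  have "schwartz (\<lambda>x::'a. complex_of_real (exp (- (1/2) * (norm x)\<^sup>2)))" by (rule schwartz_gaussian) simp
  then show ?thesis by (simp add: gauss_def[abs_def])
qed

lemma gauss_measurable [measurable]: "gauss \<in> borel_measurable borel"
  by (rule schwartz_borel[OF schwartz_gauss])

lemma nn_integral_gauss:
  "(\<integral>\<^sup>+x. ennreal (exp (- ((norm (x::'a::euclidean_space))\<^sup>2 / 2))) \<partial>lborel) = ennreal (sqrt (2 * pi) ^ DIM('a))"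
proof -
  have "has_bochner_integral lborel (\<lambda>x. std_normal_density x) 1"
    using std_normal_moment_even[of 0] by simp
  then have "has_bochner_integral lborel (\<lambda>x. sqrt (2 * pi) * std_normal_density x) (sqrt (2 * pi) * 1)"
    by (intro has_bochner_integral_mult_right) auto
  then have 1: "has_bochner_integral lborel (\<lambda>x::real. exp (- (x\<^sup>2 / 2))) (sqrt (2 * pi))"
    by (simp add: std_normal_density_def)
  have 2: "(\<integral>\<^sup>+x. ennreal (exp (- ((x::real)\<^sup>2 / 2))) \<partial>lborel) = ennreal (sqrt (2 * pi))"
    using 1 by (subst nn_integral_eq_integral) (auto simp: has_bochner_integral_iff)
  have "exp (- ((norm x)\<^sup>2 / 2)) = (\<Prod>b\<in>(Basis::'a set). exp (- ((x \<bullet> b)\<^sup>2 / 2)))" for x :: 'a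
  proof -
    have "(norm x)\<^sup>2 / 2 = (\<Sum>b\<in>Basis. (x \<bullet> b)\<^sup>2 / 2)"
      unfolding power2_norm_eq_inner by (subst euclidean_inner) (simp add: power2_eq_square sum_divide_distrib)
    then show ?thesis by (simp add: sum_negf[symmetric] exp_sum)
  qed
  then have "(\<integral>\<^sup>+x. ennreal (exp (- ((norm (x::'a))\<^sup>2 / 2))) \<partial>lborel) = (\<integral>\<^sup>+x. (\<Prod>b\<in>(Basis::'a set). ennreal (exp (- ((x \<bullet> b)\<^sup>2 / 2)))) \<partial>lborel)"
    by (simp add: prod_ennreal)
  also have "\<dots> = (\<Prod>b\<in>(Basis::'a set). (\<integral>\<^sup>+x. ennreal (exp (- (x\<^sup>2 / 2))) \<partial>lborel))"
    by (rule nn_integral_lborel_prod[where f="\<lambda>b x. ennreal (exp (- (x\<^sup>2 / 2)))"]) auto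
  also have "\<dots> = ennreal (sqrt (2 * pi) ^ DIM('a))"
    unfolding 2 by (simp add: ennreal_power)
  finally show ?thesis .
qed

lemma integral_gauss: "(LINT x|lborel. gauss (x::'a::euclidean_space)) = of_real (sqrt (2 * pi) ^ DIM('a))"
proof -
  have "(LINT x|lborel. exp (- ((norm (x::'a))\<^sup>2 / 2))) = sqrt (2 * pi) ^ DIM('a)"
    by (subst integral_eq_nn_integral) (auto simp: nn_integral_gauss)
  then show ?thesis unfolding gauss_def by simp
qed

text \<open>The equation saying that the derivative of the Gaussian along b is - x_b times the
  Gaussian passes to its transform by the two differentiation rules. So the transform times exp
  (|\<xi>|^2 / 2) has zero derivative, and its constant value is read off at 0.\<close>

lemma fourier_gauss: "fourier gauss \<xi> = of_real (sqrt (2 * pi) ^ CARD('d)) * gauss (\<xi> :: real ^ 'd::finite)"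
proof -
  let ?E = "\<lambda>\<xi>::real ^ 'd. exp (complex_of_real (1 / 2) * of_real (\<xi> \<bullet> \<xi>))"
  have dq: "((\<lambda>x::real ^ 'd. complex_of_real c * of_real (x \<bullet> x)) has_derivative (\<lambda>v. of_real (2 * c) * of_real (x \<bullet> v))) (at x)" for x c
  proof -
    have "((\<lambda>x::real ^ 'd. x \<bullet> x) has_derivative (\<lambda>v. x \<bullet> v + v \<bullet> x)) (at x)"
      by (intro has_derivative_inner has_derivative_ident)
    from has_derivative_mult_right[OF has_derivative_of_real[OF this], of "of_real c"]
    show ?thesis by (rule has_derivative_eq_rhs) (simp add: fun_eq_iff inner_commute)
  qed
  have dexp: "((\<lambda>x::real ^ 'd. exp (complex_of_real c * of_real (x \<bullet> x))) has_derivative (\<lambda>v. exp (of_real c * of_real (x \<bullet> x)) * (of_real (2 * c) * of_real (x \<bullet> v)))) (at x)" for x c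
  proof (rule has_derivative_compose[OF dq])
    show "(exp has_derivative (*) (exp (complex_of_real c * of_real (x \<bullet> x)))) (at (of_real c * of_real (x \<bullet> x)))"
      using DERIV_exp by (simp add: has_field_derivative_def)
  qed
  have gexp: "gauss = (\<lambda>x::real ^ 'd. exp (complex_of_real (- (1 / 2)) * of_real (x \<bullet> x)))"
  proof
    fix x :: "real ^ 'd"
    have "exp (complex_of_real (- (1 / 2)) * of_real (x \<bullet> x)) = of_real (exp (- (1 / 2) * (x \<bullet> x)))"
      by (simp only: of_real_mult[symmetric] exp_of_real)
    then show "gauss x = exp (complex_of_real (- (1 / 2)) * of_real (x \<bullet> x))"
      by (simp add: gauss_def power2_norm_eq_inner)
  qed
  have dg: "frechet_derivative gauss (at x) v = - of_real (x \<bullet> v) * gauss (x::real ^ 'd)" for x v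
    using fun_cong[OF frechet_derivative_at[OF dexp[of "- (1/2)" x]], of v] unfolding gexp by (simp add: mult.commute)
  have b: "fourier (\<lambda>x. (- \<i>) * of_real (x \<bullet> b) * gauss x) \<xi> = - of_real (\<xi> \<bullet> b) * fourier gauss \<xi>" if "b \<in> Basis" for b \<xi> :: "real ^ 'd"
  proof -
    have "fourier (\<lambda>x. (- \<i>) * of_real (x \<bullet> b) * gauss x) \<xi> = \<i> * fourier (\<lambda>x. frechet_derivative gauss (at x) b) \<xi>"
      unfolding fourier_def dg by (subst integral_mult_right_zero[symmetric]) (simp add: algebra_simps)
    then show ?thesis using fourier_pderiv[OF schwartz_gauss that, of \<xi>] by (simp flip: mult.assoc)
  qed
  have D: "((\<lambda>\<xi>. fourier gauss \<xi> * ?E \<xi>) has_derivative (\<lambda>v. 0)) (at \<xi>)" for \<xi>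
  proof -
    let ?L = "\<lambda>v. fourier gauss \<xi> * (?E \<xi> * (of_real (2 * (1/2)) * of_real (\<xi> \<bullet> v))) + fourier (\<lambda>x. (- \<i>) * of_real (x \<bullet> v) * gauss x) \<xi> * ?E \<xi>"
    have d: "((\<lambda>\<xi>. fourier gauss \<xi> * ?E \<xi>) has_derivative ?L) (at \<xi>)"
      by (rule has_derivative_mult[OF has_derivative_fourier[OF schwartz_gauss] dexp])
    have "?L b = 0" if "b \<in> Basis" for b unfolding b[OF that] by simp
    then have "?L v = 0" for v
      using linear_eq_stdbasis[OF has_derivative_linear[OF d] linear_zero] by (metis (no_types, lifting))
    then show ?thesis using d by simp
  qed
  obtain c where "\<forall>\<xi>\<in>UNIV. fourier gauss \<xi> * ?E \<xi> = c"
    using has_derivative_zero_constant[of UNIV "\<lambda>\<xi>. fourier gauss \<xi> * ?E \<xi>"] D by auto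
  then have "fourier gauss \<xi> * ?E \<xi> = c" "fourier gauss (0 :: real ^ 'd) * ?E 0 = c" by blast+
  then have "fourier gauss \<xi> * ?E \<xi> = fourier gauss (0 :: real ^ 'd) * ?E 0" by (simp only:)
  also have "\<dots> = of_real (sqrt (2 * pi) ^ CARD('d))"
    by (simp add: fourier_def integral_gauss)
  finally have "fourier gauss \<xi> * ?E \<xi> * gauss \<xi> = of_real (sqrt (2 * pi) ^ CARD('d)) * gauss \<xi>" by simp
  moreover have "?E \<xi> * gauss \<xi> = 1" unfolding gexp by (simp flip: exp_add)
  ultimately show ?thesis by (simp only: mult.assoc mult_1_right)
qed

text \<open>Dominated convergence, with the scaling placed in the argument of f. The average is not
  normalised, so the mass of the Gaussian stays as a factor in the limit.\<close>

lemma tendsto_scaled_average: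
  fixes f :: "'a::euclidean_space \<Rightarrow> complex"
  assumes f: "continuous_on UNIV f" and B: "\<And>x. norm (f x) \<le> B"
  shows "(\<lambda>n. LINT z|lborel. f (x + inverse (real (Suc n)) *\<^sub>R z) * gauss z) \<longlonglongrightarrow> f x * of_real (sqrt (2 * pi) ^ DIM('a))"
proof -
  have [measurable]: "f \<in> borel_measurable borel" using f by (rule borel_measurable_continuous_onI)
  have "(\<lambda>n. LINT z|lborel. f (x + inverse (real (Suc n)) *\<^sub>R z) * gauss z) \<longlonglongrightarrow> (LINT z|lborel. f x * gauss (z::'a))"
  proof (rule integral_dominated_convergence[where w="\<lambda>z::'a. B * norm (gauss z)"])
    show "integrable lborel (\<lambda>z::'a. B * norm (gauss z))"
      by (intro integrable_mult_right integrable_norm schwartz_integrable schwartz_gauss)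
    show "AE z in lborel. (\<lambda>n. f (x + inverse (real (Suc n)) *\<^sub>R z) * gauss z) \<longlonglongrightarrow> f x * gauss z"
    proof (rule AE_I2)
      fix z :: 'a
      have "(\<lambda>n. x + inverse (real (Suc n)) *\<^sub>R z) \<longlonglongrightarrow> x + 0 *\<^sub>R z"
        by (intro tendsto_add tendsto_const tendsto_scaleR LIMSEQ_inverse_real_of_nat)
      then have "(\<lambda>n. f (x + inverse (real (Suc n)) *\<^sub>R z)) \<longlonglongrightarrow> f x"
        using f by (intro continuous_on_tendsto_compose[of UNIV f]) auto
      then show "(\<lambda>n. f (x + inverse (real (Suc n)) *\<^sub>R z) * gauss z) \<longlonglongrightarrow> f x * gauss z"
        by (intro tendsto_mult tendsto_const)
    qed
    show "AE z in lborel. norm (f (x + inverse (real (Suc n)) *\<^sub>R z) * gauss z) \<le> B * norm (gauss z)" for n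
      using B by (auto simp: norm_mult intro!: mult_right_mono)
  qed measurable
  also have "(LINT z|lborel. f x * gauss (z::'a)) = f x * of_real (sqrt (2 * pi) ^ DIM('a))"
    by (simp add: integral_gauss)
  finally show ?thesis .
qed

lemma schwartz_bounded: "schwartz f \<Longrightarrow> \<exists>B. \<forall>x. norm (f x) \<le> B"
  using schwartz_rapid[of f] unfolding rapid_def by (metis mult_1 power_0)

text \<open>The inversion integral is damped by gauss (t \<xi>). Moving the transform onto the
  damped character turns it into an average of f around x at scale t. As t = 1/(n+1) tends to 0, the
  average tends to a multiple of f(x) and the damped integral to the undamped one.\<close>

lemma inv_fourier_fourier:
  fixes f :: "real ^ 'd::finite \<Rightarrow> complex"
  assumes f: "schwartz f"
  shows "inv_fourier (fourier f) = f"
proof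
  fix x :: "real ^ 'd"
  let ?t = "\<lambda>n. inverse (real (Suc n))"
  let ?I = "\<lambda>n. LINT \<xi>|lborel. fourier f \<xi> * (cis (\<xi> \<bullet> x) * gauss (?t n *\<^sub>R \<xi>))"
  have fi: "integrable lborel f" "integrable lborel (fourier f)"
    by (intro schwartz_integrable schwartz_fourier f)+
  have [measurable]: "f \<in> borel_measurable borel" "fourier f \<in> borel_measurable borel"
    by (intro schwartz_borel schwartz_fourier f)+
  obtain B where B: "\<And>x. norm (f x) \<le> B" using schwartz_bounded[OF f] by blast
  have g: "integrable lborel (\<lambda>\<xi>::real ^ 'd. cis (\<xi> \<bullet> x) * gauss (?t n *\<^sub>R \<xi>))" for n
    using integrable_mult_cis(1)[OF integrable_affine[OF schwartz_integrable[OF schwartz_gauss], of "?t n" 0], of x]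
    by (simp add: mult.commute)
  \<comment> \<open>The powers of t from the dilation cancel. One factor (2 pi)^(d/2) comes from the
    transform of the Gaussian; the other appears in the limit, as its mass.\<close>
  have I: "?I n = of_real (sqrt (2 * pi) ^ CARD('d)) * (LINT z|lborel. f (x + ?t n *\<^sub>R z) * gauss z)" for n
  proof -
    let ?g = "\<lambda>\<xi>::real ^ 'd. cis (\<xi> \<bullet> x) * gauss (?t n *\<^sub>R \<xi>)"
    have t: "?t n > 0" by simp
    have "fourier ?g (x + ?t n *\<^sub>R z) = of_real (1 / ?t n ^ CARD('d) * sqrt (2 * pi) ^ CARD('d)) * gauss z" for z
    proof -
      have "fourier ?g (x + ?t n *\<^sub>R z) = (LINT \<xi>|lborel. gauss (?t n *\<^sub>R \<xi>) * cis (- ((?t n *\<^sub>R \<xi>) \<bullet> z)))"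
        unfolding fourier_def
      proof (rule Bochner_Integration.integral_cong[OF refl])
        fix \<xi> :: "real ^ 'd"
        have "cis (\<xi> \<bullet> x) * cis (- (\<xi> \<bullet> (x + ?t n *\<^sub>R z))) = cis (- ((?t n *\<^sub>R \<xi>) \<bullet> z))"
          by (simp only: cis_mult) (simp add: inner_add_right)
        then show "cis (\<xi> \<bullet> x) * gauss (?t n *\<^sub>R \<xi>) * cis (- (\<xi> \<bullet> (x + ?t n *\<^sub>R z))) = gauss (?t n *\<^sub>R \<xi>) * cis (- ((?t n *\<^sub>R \<xi>) \<bullet> z))"
          by (metis (no_types, opaque_lifting) mult.assoc mult.commute)
      qed
      also have "\<dots> = of_real (1 / ?t n ^ CARD('d)) * fourier gauss z"
      proof -
        have "(LINT \<xi>|lborel. gauss (t *\<^sub>R \<xi>) * cis (- ((t *\<^sub>R \<xi>) \<bullet> z))) = of_real (1 / t ^ CARD('d)) * fourier gauss z" if "t > 0" for t :: real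
          unfolding fourier_def
          using integral_affine[of "\<lambda>\<xi>. gauss \<xi> * cis (- (\<xi> \<bullet> z))" t 0] that
          by (simp add: scaleR_conv_of_real)
        from this[OF t] show ?thesis .
      qed
      finally show ?thesis by (simp add: fourier_gauss)
    qed
    note fg = this
    have [measurable]: "fourier ?g \<in> borel_measurable borel"
      unfolding fourier_def by measurable
    have "?I n = (LINT y|lborel. f y * fourier ?g y)" by (rule fourier_swap[OF fi(1) g])
    also have "\<dots> = ?t n ^ CARD('d) *\<^sub>R (LINT z|lborel. f (x + ?t n *\<^sub>R z) * fourier ?g (x + ?t n *\<^sub>R z))"
    proof -
      have m: "(\<lambda>y. f y * fourier ?g y) \<in> borel_measurable borel" by measurable
      show ?thesis using integral_affine[OF m less_imp_neq[OF t, symmetric], of x] t by simp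
    qed
    also have "\<dots> = of_real (sqrt (2 * pi) ^ CARD('d)) * (LINT z|lborel. f (x + ?t n *\<^sub>R z) * gauss z)"
    proof -
      have c: "(LINT z|lborel. f (x + ?t n *\<^sub>R z) * (c * gauss z)) = c * (LINT z|lborel. f (x + ?t n *\<^sub>R z) * gauss z)" for c
        by (subst integral_mult_right_zero[symmetric]) (simp add: algebra_simps)
      have "r ^ CARD('d) *\<^sub>R (complex_of_real (1 / r ^ CARD('d) * q) * w) = of_real q * w" if "r > 0" for r q w
        using that by (simp add: scaleR_conv_of_real)
      from this[OF t] show ?thesis unfolding fg c .
    qed
    finally show ?thesis .
  qed
  have "?I \<longlonglongrightarrow> of_real (sqrt (2 * pi) ^ CARD('d)) * (f x * of_real (sqrt (2 * pi) ^ DIM(real ^ 'd)))"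
    unfolding I by (intro tendsto_mult tendsto_const tendsto_scaled_average[OF schwartz_continuous[OF f] B])
  also have "of_real (sqrt (2 * pi) ^ CARD('d)) * (f x * of_real (sqrt (2 * pi) ^ DIM(real ^ 'd))) = of_real ((2 * pi) ^ CARD('d)) * f x"
  proof -
    have "sqrt (2 * pi) ^ CARD('d) * sqrt (2 * pi) ^ CARD('d) = (2 * pi) ^ CARD('d)"
      unfolding power_mult_distrib[symmetric] by (subst real_sqrt_mult_self) simp
    then have "complex_of_real (sqrt (2 * pi) ^ CARD('d)) * of_real (sqrt (2 * pi) ^ CARD('d)) = of_real ((2 * pi) ^ CARD('d))"
      by (simp only: of_real_mult[symmetric])
    moreover have "a * (f x * a) = (a * a) * f x" for a by (simp add: mult_ac)
    ultimately show ?thesis by (simp only: DIM_cart DIM_real mult_1_right)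
  qed
  finally have 1: "?I \<longlonglongrightarrow> of_real ((2 * pi) ^ CARD('d)) * f x" .
  have "?I \<longlonglongrightarrow> (LINT \<xi>|lborel. fourier f \<xi> * cis (\<xi> \<bullet> x))"
  proof (rule integral_dominated_convergence[where w="\<lambda>\<xi>::real ^ 'd. norm (fourier f \<xi>)"])
    show "AE \<xi> in lborel. (\<lambda>n. fourier f \<xi> * (cis (\<xi> \<bullet> x) * gauss (?t n *\<^sub>R \<xi>))) \<longlonglongrightarrow> fourier f \<xi> * cis (\<xi> \<bullet> x)"
    proof (rule AE_I2)
      fix \<xi> :: "real ^ 'd"
      have "(\<lambda>n. ?t n *\<^sub>R \<xi>) \<longlonglongrightarrow> 0 *\<^sub>R \<xi>" by (intro tendsto_scaleR tendsto_const LIMSEQ_inverse_real_of_nat)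
      from continuous_on_tendsto_compose[OF schwartz_continuous[OF schwartz_gauss, of UNIV] this]
      have "(\<lambda>n. gauss (?t n *\<^sub>R \<xi>)) \<longlonglongrightarrow> gauss (0 :: real ^ 'd)" by simp
      then have "(\<lambda>n. fourier f \<xi> * (cis (\<xi> \<bullet> x) * gauss (?t n *\<^sub>R \<xi>))) \<longlonglongrightarrow> fourier f \<xi> * (cis (\<xi> \<bullet> x) * gauss (0 :: real ^ 'd))"
        by (intro tendsto_mult tendsto_const)
      then show "(\<lambda>n. fourier f \<xi> * (cis (\<xi> \<bullet> x) * gauss (?t n *\<^sub>R \<xi>))) \<longlonglongrightarrow> fourier f \<xi> * cis (\<xi> \<bullet> x)"
        by (simp add: gauss_def)
    qed
    show "integrable lborel (\<lambda>\<xi>. norm (fourier f \<xi>))" using fi by simp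
    show "AE \<xi> in lborel. norm (fourier f \<xi> * (cis (\<xi> \<bullet> x) * gauss (?t n *\<^sub>R \<xi>))) \<le> norm (fourier f \<xi>)" for n
      by (auto simp: norm_mult gauss_def intro!: mult_left_le)
  qed measurable
  from LIMSEQ_unique[OF this 1] show "inv_fourier (fourier f) x = f x"
    by (simp add: inv_fourier_def inner_commute)
qed

lemma fourier_inv_fourier:
  fixes f :: "real ^ 'd::finite \<Rightarrow> complex"
  assumes f: "schwartz f"
  shows "fourier (inv_fourier f) = f"
proof
  fix x :: "real ^ 'd"
  have [measurable]: "fourier f \<in> borel_measurable borel" by (intro schwartz_borel schwartz_fourier f)
  have "fourier (inv_fourier f) x = (LINT y|lborel. fourier f (- y) * cis (- (y \<bullet> x))) / of_real ((2 * pi) ^ CARD('d))"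
    by (simp add: fourier_def[of "inv_fourier f"] inv_fourier_eq)
  also have "(LINT y|lborel. fourier f (- y) * cis (- (y \<bullet> x))) = (LINT y|lborel. fourier f y * cis (y \<bullet> x))"
    using integral_affine[of "\<lambda>y. fourier f y * cis (y \<bullet> x)" "-1" 0] by simp
  also have "\<dots> / of_real ((2 * pi) ^ CARD('d)) = inv_fourier (fourier f) x"
    by (simp add: inv_fourier_def inner_commute)
  finally show "fourier (inv_fourier f) x = f x" by (simp add: inv_fourier_fourier f)
qed

lemma schwartz_square_integrable:
  assumes "schwartz f" shows "integrable lborel (\<lambda>x. (norm (f x))\<^sup>2)"
proof -
  obtain B where B: "\<And>x. norm (f x) \<le> B" using schwartz_bounded[OF assms] by blast
  have [measurable]: "f \<in> borel_measurable borel" by (rule schwartz_borel[OF assms])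
  have "integrable lborel (\<lambda>x. B * norm (f x))" by (intro integrable_mult_right integrable_norm schwartz_integrable assms)
  then show ?thesis
  proof (rule Bochner_Integration.integrable_bound)
    show "AE x in lborel. norm ((norm (f x))\<^sup>2) \<le> norm (B * norm (f x))"
    proof (rule AE_I2)
      fix x
      have "norm ((norm (f x))\<^sup>2) = norm (f x) * norm (f x)" by (simp add: power2_eq_square)
      also have "\<dots> \<le> B * norm (f x)" by (intro mult_right_mono B) auto
      also have "\<dots> \<le> norm (B * norm (f x))" by simp
      finally show "norm ((norm (f x))\<^sup>2) \<le> norm (B * norm (f x))" .
    qed
  qed measurable
qed

text \<open>By inversion the transform of the conjugate of \<open>fourier f\<close> is (2 pi)^d
  times the conjugate of f; moving the transform across the integral with
  \<open>fourier_swap\<close> gives the identity.\<close>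

lemma plancherel_schwartz:
  fixes f :: "real ^ 'd::finite \<Rightarrow> complex"
  assumes f: "schwartz f"
  shows "(LINT \<xi>|lborel. (norm (fourier f \<xi>))\<^sup>2) = (2 * pi) ^ CARD('d) * (LINT x|lborel. (norm (f x))\<^sup>2)"
proof -
  have F: "schwartz (\<lambda>\<xi>. cnj (fourier f \<xi>))" by (intro schwartz_cnj schwartz_fourier f)
  have "fourier (\<lambda>\<xi>. cnj (fourier f \<xi>)) x = of_real ((2 * pi) ^ CARD('d)) * cnj (f x)" for x
  proof -
    have "fourier (\<lambda>\<xi>. cnj (fourier f \<xi>)) x = cnj (LINT \<xi>|lborel. fourier f \<xi> * cis (\<xi> \<bullet> x))"
      unfolding fourier_def[of "\<lambda>\<xi>. cnj (fourier f \<xi>)"] by (simp add: cis_cnj flip: Bochner_Integration.integral_cnj)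
    also have "(LINT \<xi>|lborel. fourier f \<xi> * cis (\<xi> \<bullet> x)) = of_real ((2 * pi) ^ CARD('d)) * inv_fourier (fourier f) x"
      by (simp add: inv_fourier_def inner_commute)
    finally show ?thesis by (simp add: inv_fourier_fourier f)
  qed
  then have "(LINT \<xi>|lborel. fourier f \<xi> * cnj (fourier f \<xi>)) = (LINT x|lborel. of_real ((2 * pi) ^ CARD('d)) * (f x * cnj (f x)))"
    by (subst fourier_swap[OF schwartz_integrable[OF f] schwartz_integrable[OF F]]) (simp add: algebra_simps)
  then have "of_real (LINT \<xi>|lborel. (norm (fourier f \<xi>))\<^sup>2) = complex_of_real ((2 * pi) ^ CARD('d) * (LINT x|lborel. (norm (f x))\<^sup>2))"
    by (simp add: complex_norm_square[symmetric] del: of_real_power)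
  then show ?thesis using of_real_eq_iff by blast
qed

section \<open>Approximation by Schwartz functions and uniqueness of representing functions\<close>

lemma cnj_measurable [measurable]: "cnj \<in> borel_measurable borel"
  by (intro borel_measurable_continuous_onI continuous_intros)

text \<open>The kernel gauss ((y - x)/t) is not Schwartz in (x, y), because it does not decay along
  the diagonal. Multiplying it by gauss y repairs this, and the compensating factor exp (|y|^2 / 2)
  is harmless in \<open>k\<close> because q has bounded support.\<close>

lemma schwartz_mollification:
  fixes q :: "'a::euclidean_space \<Rightarrow> complex"
  assumes q: "continuous_on UNIV q" and B: "\<And>x. norm (q x) \<le> B" and R: "\<And>x. norm x > R \<Longrightarrow> q x = 0" and t: "t > 0"
  shows "schwartz (\<lambda>x. LINT z|lborel. q (x + t *\<^sub>R z) * gauss z)"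
proof -
  have [measurable]: "q \<in> borel_measurable borel" using q by (rule borel_measurable_continuous_onI)
  have B0: "B \<ge> 0" using B[of 0] norm_ge_zero order_trans by blast
  define k where "k y = of_real ((1 / t) ^ DIM('a)) * q y * of_real (exp ((norm y)\<^sup>2 / 2))" for y
  define L where "L = (\<lambda>z::'a \<times> 'a. ((1 / t) *\<^sub>R (snd z - fst z), snd z))"
  have L: "bounded_linear L" unfolding L_def
    by (intro bounded_linear_Pair bounded_linear_scaleR_right[THEN bounded_linear_compose] bounded_linear_sub
        bounded_linear_fst bounded_linear_snd)
  have k [measurable]: "k \<in> borel_measurable borel" unfolding k_def by measurable
  have ki: "integrable lborel (\<lambda>y. norm (k y) / (1 + norm y) ^ 0)"
  proof (rule Bochner_Integration.integrable_bound)
    show "integrable lborel (\<lambda>y::'a. ((1 / t) ^ DIM('a) * B * exp (R\<^sup>2 / 2)) * indicator (cball 0 R) y)"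
      by (intro integrable_mult_right integrable_real_indicator) (simp_all add: emeasure_bounded_finite[unfolded infinity_ennreal_def])
    show "AE y in lborel. norm (norm (k y) / (1 + norm y) ^ 0) \<le> norm (((1 / t) ^ DIM('a) * B * exp (R\<^sup>2 / 2)) * indicator (cball 0 R) y)"
    proof (rule AE_I2)
      fix y :: 'a
      show "norm (norm (k y) / (1 + norm y) ^ 0) \<le> norm (((1 / t) ^ DIM('a) * B * exp (R\<^sup>2 / 2)) * indicator (cball 0 R) y)"
      proof (cases "norm y > R")
        case True
        then show ?thesis by (simp add: k_def R)
      next
        case False
        then have e: "exp ((norm y)\<^sup>2 / 2) \<le> exp (R\<^sup>2 / 2)" by (simp add: power_mono)
        have "norm (k y) = (1 / t) ^ DIM('a) * norm (q y) * exp ((norm y)\<^sup>2 / 2)"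
          using t by (simp add: k_def norm_mult norm_power norm_divide)
        also have "\<dots> \<le> (1 / t) ^ DIM('a) * B * exp (R\<^sup>2 / 2)"
          using t B0 by (intro mult_mono mult_left_mono B e) auto
        finally show ?thesis using False t B0 by (simp add: abs_mult)
      qed
    qed
  qed measurable
  have A: "schwartz (\<lambda>z. gauss (L z + 0))"
  \<comment> \<open>The constant adds up |fst z| \<le> (1 + t) |L z| and |snd z| \<le> |L
    z|.\<close>
  proof (rule schwartz_compose_affine[OF L _ schwartz_gauss, where K="t + 2"])
    fix z :: "'a \<times> 'a"
    have "norm (fst z) = norm (snd z - t *\<^sub>R fst (L z))" using t by (simp add: L_def)
    also have "\<dots> \<le> norm (snd z) + t * norm (fst (L z))" using norm_triangle_ineq4[of "snd z" "t *\<^sub>R fst (L z)"] t by simp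
    also have "\<dots> \<le> norm (L z) + t * norm (L z)"
      using t norm_snd_le[of "snd (L z)" "fst (L z)"] norm_fst_le[of "fst (L z)" "snd (L z)"]
      by (intro add_mono mult_left_mono) (auto simp: L_def)
    finally have 1: "norm (fst z) \<le> norm (L z) + t * norm (L z)" .
    have 2: "norm (snd z) \<le> norm (L z)"
      using norm_snd_le[of "snd (L z)" "fst (L z)"] by (simp add: L_def)
    have "norm z \<le> norm (fst z) + norm (snd z)"
      using norm_triangle_ineq[of "(fst z, 0)" "(0, snd z)"] by (simp add: norm_Pair)
    then show "norm z \<le> (t + 2) * norm (L z)" using 1 2 by (simp add: algebra_simps)
  qed
  have "schwartz (\<lambda>x. LINT y|lborel. k y * gauss (L (x, y) + 0))"
    by (rule schwartz_parametric_integral[OF k ki A])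
  moreover have "(LINT y|lborel. k y * gauss (L (x, y) + 0)) = (LINT z|lborel. q (x + t *\<^sub>R z) * gauss z)" for x
  proof -
    have "(LINT y|lborel. k y * gauss (L (x, y) + 0)) = \<bar>t\<bar> ^ DIM('a) *\<^sub>R (LINT z|lborel. k (x + t *\<^sub>R z) * gauss (L (x, x + t *\<^sub>R z) + 0))"
    proof (rule integral_affine)
      have "(\<lambda>y. gauss (L (x, y) + 0)) \<in> borel_measurable borel"
        using schwartz_borel[OF schwartz_slice[OF A]] .
      then show "(\<lambda>y. k y * gauss (L (x, y) + 0)) \<in> borel_measurable borel" by measurable
    qed (use t in auto)
    also have "\<dots> = (LINT z|lborel. of_real (t ^ DIM('a)) * (k (x + t *\<^sub>R z) * gauss (L (x, x + t *\<^sub>R z) + 0)))"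
      using t by (simp add: scaleR_conv_of_real flip: integral_mult_right_zero)
    also have "\<dots> = (LINT z|lborel. q (x + t *\<^sub>R z) * gauss z)"
    proof (rule Bochner_Integration.integral_cong[OF refl])
      fix z :: 'a
      have 1: "of_real (exp ((norm (x + t *\<^sub>R z))\<^sup>2 / 2)) * gauss (L (x, x + t *\<^sub>R z) + 0) = gauss z"
      proof -
        have "(norm (L (x, x + t *\<^sub>R z)))\<^sup>2 = (norm z)\<^sup>2 + (norm (x + t *\<^sub>R z))\<^sup>2"
          using t by (simp add: L_def norm_Pair)
        then show ?thesis unfolding gauss_def
          by (simp add: add_divide_distrib flip: of_real_mult exp_add)
      qed
      have 2: "complex_of_real (t ^ DIM('a)) * of_real ((1 / t) ^ DIM('a)) = 1"
        using t by (simp add: power_divide flip: of_real_mult)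
      have "of_real (t ^ DIM('a)) * (k (x + t *\<^sub>R z) * gauss (L (x, x + t *\<^sub>R z) + 0)) =
        (complex_of_real (t ^ DIM('a)) * of_real ((1 / t) ^ DIM('a))) * q (x + t *\<^sub>R z) *
        (of_real (exp ((norm (x + t *\<^sub>R z))\<^sup>2 / 2)) * gauss (L (x, x + t *\<^sub>R z) + 0))"
        unfolding k_def by (simp only: mult.assoc mult.left_commute mult.commute)
      then show "of_real (t ^ DIM('a)) * (k (x + t *\<^sub>R z) * gauss (L (x, x + t *\<^sub>R z) + 0)) = q (x + t *\<^sub>R z) * gauss z"
        unfolding 1 2 by simp
    qed
    finally show ?thesis .
  qed
  ultimately show ?thesis by simp
qed

text \<open>Dominated convergence for t tending to 0 asks for a majorant uniform in t \<le> 1. On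
  the support of q one has |x| \<le> R + |z|, so |x|^2/8 \<le> R^2/4 + |z|^2/4: half of the exponent
  |z|^2/2 buys Gaussian decay in x, and the other half integrates z.\<close>

lemma mollification_bound:
  fixes q :: "'a::euclidean_space \<Rightarrow> complex"
  assumes q: "continuous_on UNIV q" and B: "\<And>x. norm (q x) \<le> B" and R: "\<And>x. norm x > R \<Longrightarrow> q x = 0"
  shows "\<exists>C. \<forall>t x. 0 < t \<longrightarrow> t \<le> 1 \<longrightarrow> norm (LINT z|lborel. q (x + t *\<^sub>R z) * gauss z) \<le> C * exp (- (1/8) * (norm x)\<^sup>2)"
proof -
  have [measurable]: "q \<in> borel_measurable borel" using q by (rule borel_measurable_continuous_onI)
  have B0: "B \<ge> 0" using B[of 0] norm_ge_zero order_trans by blast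
  define J where "J = (LINT z|lborel. exp (- (1/4) * (norm (z::'a))\<^sup>2))"
  have Ji: "integrable lborel (\<lambda>z::'a. exp (- (1/4) * (norm z)\<^sup>2))"
    using integrable_norm[OF schwartz_integrable[OF schwartz_gaussian[of "1/4", where 'a='a]]] by simp
  define C where "C = B * exp (R\<^sup>2 / 4) * J"
  have "norm (LINT z|lborel. q (x + t *\<^sub>R z) * gauss z) \<le> C * exp (- (1/8) * (norm x)\<^sup>2)" if t: "0 < t" "t \<le> 1" for t x
  proof -
    have le: "norm (q (x + t *\<^sub>R z) * gauss z) \<le> (B * exp (R\<^sup>2 / 4) * exp (- (1/8) * (norm x)\<^sup>2)) * exp (- (1/4) * (norm z)\<^sup>2)" for z
    proof (cases "norm (x + t *\<^sub>R z) > R")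
      case True
      then show ?thesis using B0 by (simp add: R)
    next
      case False
      have "norm x \<le> norm (x + t *\<^sub>R z) + norm (t *\<^sub>R z)" using norm_triangle_ineq4[of "x + t *\<^sub>R z" "t *\<^sub>R z"] by simp
      also have "\<dots> \<le> R + norm z"
        using False t mult_right_mono[of t 1 "norm z"] by simp
      finally have "(norm x)\<^sup>2 \<le> (R + norm z)\<^sup>2" by (intro power_mono) auto
      also have "\<dots> \<le> 2 * R\<^sup>2 + 2 * (norm z)\<^sup>2"
        using zero_le_power2[of "R - norm z"] by (simp add: power2_sum power2_diff)
      finally have "- ((norm z)\<^sup>2 / 2) \<le> R\<^sup>2 / 4 + - (1/8) * (norm x)\<^sup>2 + - (1/4) * (norm z)\<^sup>2"
        by simp
      then have "exp (- ((norm z)\<^sup>2 / 2)) \<le> exp (R\<^sup>2 / 4) * exp (- (1/8) * (norm x)\<^sup>2) * exp (- (1/4) * (norm z)\<^sup>2)"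
        by (simp only: exp_le_cancel_iff flip: exp_add)
      then have "norm (q (x + t *\<^sub>R z)) * exp (- ((norm z)\<^sup>2 / 2)) \<le> B * (exp (R\<^sup>2 / 4) * exp (- (1/8) * (norm x)\<^sup>2) * exp (- (1/4) * (norm z)\<^sup>2))"
        using B B0 by (intro mult_mono) auto
      then show ?thesis by (simp add: norm_mult gauss_def mult.assoc)
    qed
    have "norm (LINT z|lborel. q (x + t *\<^sub>R z) * gauss z) \<le> (LINT z|lborel. (B * exp (R\<^sup>2 / 4) * exp (- (1/8) * (norm x)\<^sup>2)) * exp (- (1/4) * (norm (z::'a))\<^sup>2))"
    proof (rule Bochner_Integration.integral_norm_bound_integral)
      show i: "integrable lborel (\<lambda>z. (B * exp (R\<^sup>2 / 4) * exp (- (1/8) * (norm x)\<^sup>2)) * exp (- (1/4) * (norm (z::'a))\<^sup>2))"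
        using Ji by (rule integrable_mult_right)
      show "integrable lborel (\<lambda>z. q (x + t *\<^sub>R z) * gauss z)"
        by (rule Bochner_Integration.integrable_bound[OF i]) (use le order_trans[OF le abs_ge_self] in auto)
    qed (rule le)
    then show ?thesis unfolding C_def J_def by (simp add: mult_ac)
  qed
  then show ?thesis by blast
qed

lemma schwartz_approx:
  fixes q :: "'a::euclidean_space \<Rightarrow> complex"
  assumes q: "continuous_on UNIV q" "\<And>x. norm (q x) \<le> B" "\<And>x. norm x > R \<Longrightarrow> q x = 0"
  obtains f C where "\<And>n. schwartz (f n)" "\<And>x. (\<lambda>n. f n x) \<longlonglongrightarrow> q x"
    "\<And>n x. norm (f n x) \<le> C * exp (- (1/8) * (norm x)\<^sup>2)"
proof -
  define c where "c = complex_of_real (sqrt (2 * pi) ^ DIM('a))"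
  have c: "c \<noteq> 0" by (simp add: c_def)
  define f where "f = (\<lambda>n x. (1 / c) * (LINT z|lborel. q (x + inverse (real (Suc n)) *\<^sub>R z) * gauss z))"
  obtain C where C: "\<And>t x. 0 < t \<Longrightarrow> t \<le> 1 \<Longrightarrow> norm (LINT z|lborel. q (x + t *\<^sub>R z) * gauss z) \<le> C * exp (- (1/8) * (norm x)\<^sup>2)"
    using mollification_bound[OF q] by blast
  show ?thesis
  proof (rule that[of f "norm (1 / c) * C"])
    show "schwartz (f n)" for n
      unfolding f_def by (rule schwartz_cmult[OF schwartz_mollification[OF q]]) simp_all
    show "(\<lambda>n. f n x) \<longlonglongrightarrow> q x" for x
    proof -
      have "(\<lambda>n. f n x) \<longlonglongrightarrow> (1 / c) * (q x * of_real (sqrt (2 * pi) ^ DIM('a)))"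
        unfolding f_def by (intro tendsto_mult tendsto_const tendsto_scaled_average[OF q(1,2)])
      then show ?thesis using c by (simp add: c_def)
    qed
    show "norm (f n x) \<le> norm (1 / c) * C * exp (- (1/8) * (norm x)\<^sup>2)" for n x
      unfolding f_def norm_mult mult.assoc
      by (intro mult_left_mono C) (auto simp: divide_simps)
  qed
qed

text \<open>A measurable function is almost everywhere a limit of continuous ones; these are
  corrected twice. Projection onto the closed disc of radius B restores the bound, and a cutoff
  makes them vanish off S.\<close>

lemma continuous_approx:
  fixes f :: "'a::euclidean_space \<Rightarrow> complex"
  assumes f [measurable]: "f \<in> borel_measurable borel" and B: "\<And>x. norm (f x) \<le> B"
    and S: "open S" "S \<noteq> UNIV" "\<And>x. x \<notin> S \<Longrightarrow> f x = 0"
  obtains g where "\<And>n. continuous_on UNIV (g n)" "\<And>n x. norm (g n x) \<le> B"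
    "\<And>n x. x \<notin> S \<Longrightarrow> g n x = 0" "AE x in lborel. (\<lambda>n. g n x) \<longlonglongrightarrow> f x"
proof -
  have B0: "B \<ge> 0" using B[of 0] norm_ge_zero order_trans by blast
  define b where "b = B + 1"
  have b: "b > 0" using B0 by (simp add: b_def)
  have "f measurable_on UNIV"
    by (rule lebesgue_measurable_imp_measurable_on) (auto intro: measurable_completion)
  then obtain N F where N: "negligible N" and F: "\<And>n. continuous_on UNIV (F n)"
    and lim: "\<And>x. x \<notin> N \<Longrightarrow> (\<lambda>n. F n x) \<longlonglongrightarrow> f x"
    unfolding measurable_on_def by auto
  \<comment> \<open>On the open set S the distance to the complement is positive, so the cutoff is
    eventually 1 at each point. The complement is nonempty, so \<open>infdist\<close> is a true
    distance and not its default value 0.\<close>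
  define \<theta> where "\<theta> = (\<lambda>n x. min 1 (real n * infdist x (- S)))"
  define cl where "cl = closest_point (cball (0::complex) B)"
  define g where "g = (\<lambda>n x. of_real (\<theta> n x) * cl (F n x))"
  have clc: "continuous_on UNIV cl" unfolding cl_def
    by (intro continuous_on_closest_point) (use B0 in auto)
  have cln: "norm (cl z) \<le> B" for z
    using closest_point_in_set[of "cball 0 B" z] B0 by (auto simp: cl_def)
  have clf: "cl z = z" if "norm z \<le> B" for z
    using that by (simp add: cl_def closest_point_self)
  have \<theta>: "0 \<le> \<theta> n x" "\<theta> n x \<le> 1" for n x by (auto simp: \<theta>_def infdist_nonneg)
  show ?thesis
  proof (rule that[of g])
    show "continuous_on UNIV (g n)" for n
      unfolding g_def \<theta>_def
      by (intro continuous_intros continuous_on_compose2[OF clc F]) auto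
    show "norm (g n x) \<le> B" for n x
      using mult_mono[OF \<theta>(2)[of n x] cln[of "F n x"]] \<theta>[of n x] by (simp add: g_def norm_mult)
    show "g n x = 0" if "x \<notin> S" for n x using that by (simp add: g_def \<theta>_def)
    have "AE x in lborel. x \<notin> N"
    proof -
      have "N \<in> null_sets lebesgue" using N by (simp add: negligible_iff_null_sets)
      then have "AE x in lebesgue. x \<notin> N" by (rule AE_not_in)
      then show ?thesis by (simp add: AE_completion_iff)
    qed
    then show "AE x in lborel. (\<lambda>n. g n x) \<longlonglongrightarrow> f x"
    proof eventually_elim
      fix x assume x: "x \<notin> N"
      show "(\<lambda>n. g n x) \<longlonglongrightarrow> f x"
      proof (cases "x \<in> S")
        case True
        have "(\<lambda>n. cl (F n x)) \<longlonglongrightarrow> cl (f x)"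
          by (rule continuous_on_tendsto_compose[OF clc lim[OF x]]) auto
        then have 1: "(\<lambda>n. cl (F n x)) \<longlonglongrightarrow> f x" using clf[OF B] by simp
        have pos: "infdist x (- S) > 0"
          using True S in_closed_iff_infdist_zero[of "- S" x] infdist_nonneg[of x "- S"] by fastforce
        obtain M where M: "real M * infdist x (- S) > 1" using ex_less_of_nat_mult[OF pos] by blast
        have "\<forall>\<^sub>F n in sequentially. \<theta> n x = 1"
          using eventually_ge_at_top[of M]
        proof eventually_elim
          case (elim n)
          have "real M * infdist x (- S) \<le> real n * infdist x (- S)" using elim pos by (intro mult_right_mono) auto
          then show ?case using M by (simp add: \<theta>_def)
        qed
        then have 2: "(\<lambda>n. \<theta> n x) \<longlonglongrightarrow> 1" by (rule tendsto_eventually)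
        have "(\<lambda>n. of_real (\<theta> n x) * cl (F n x)) \<longlonglongrightarrow> of_real 1 * f x"
          by (intro tendsto_mult tendsto_of_real 1 2)
        then show ?thesis by (simp add: g_def)
      next
        case False
        then show ?thesis by (simp add: g_def \<theta>_def S(3))
      qed
    qed
  qed
qed

text \<open>The case \<open>M = 0\<close> is the uniqueness of representing functions.\<close>
lemma L2_bound_by_testing:
  fixes G :: "'a::euclidean_space \<Rightarrow> complex"
  assumes G [measurable]: "G \<in> borel_measurable borel" and M: "M \<ge> 0"
    and int: "\<And>f. schwartz f \<Longrightarrow> integrable lborel (\<lambda>x. G x * f x)"
    and le: "\<And>f. schwartz f \<Longrightarrow> (norm (LINT x|lborel. G x * f x))\<^sup>2 \<le> M * (LINT x|lborel. (norm (f x))\<^sup>2)"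
  shows "(\<integral>\<^sup>+x. ennreal ((norm (G x))\<^sup>2) \<partial>lborel) \<le> ennreal M"
proof -
  have Gg: "integrable lborel (\<lambda>x. norm (G x) * exp (- (1/8) * (norm x)\<^sup>2))"
    using integrable_norm[OF int[OF schwartz_gaussian[of "1/8"]]] by (simp add: norm_mult)
  have gg: "integrable lborel (\<lambda>x::'a. (exp (- (1/8) * (norm x)\<^sup>2))\<^sup>2)"
    using schwartz_square_integrable[OF schwartz_gaussian[of "1/8", where 'a='a]] by simp
  \<comment> \<open>First extension of the testing inequality, to continuous functions of bounded
    support, through mollifications with a common Gaussian majorant.\<close>
  have cont: "(norm (LINT x|lborel. G x * q x))\<^sup>2 \<le> M * (LINT x|lborel. (norm (q x))\<^sup>2)"
    if q: "continuous_on UNIV q" "\<And>x. norm (q x) \<le> B" "\<And>x. norm x > R \<Longrightarrow> q x = 0" for q B R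
  proof -
    have [measurable]: "q \<in> borel_measurable borel" using q(1) by (rule borel_measurable_continuous_onI)
    obtain f C where f: "\<And>n. schwartz (f n)" "\<And>x. (\<lambda>n. f n x) \<longlonglongrightarrow> q x"
      "\<And>n x. norm (f n x) \<le> C * exp (- (1/8) * (norm x)\<^sup>2)"
      using schwartz_approx[OF q] by blast
    have [measurable]: "f n \<in> borel_measurable borel" for n by (rule schwartz_borel[OF f(1)])
    have 1: "(\<lambda>n. LINT x|lborel. G x * f n x) \<longlonglongrightarrow> (LINT x|lborel. G x * q x)"
    proof (rule integral_dominated_convergence[where w="\<lambda>x. C * (norm (G x) * exp (- (1/8) * (norm x)\<^sup>2))"])
      show "AE x in lborel. norm (G x * f n x) \<le> C * (norm (G x) * exp (- (1/8) * (norm x)\<^sup>2))" for n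
        using mult_left_mono[OF f(3) norm_ge_zero] by (auto simp: norm_mult mult_ac)
      show "integrable lborel (\<lambda>x. C * (norm (G x) * exp (- (1/8) * (norm x)\<^sup>2)))" using Gg by (rule integrable_mult_right)
    qed (auto intro!: tendsto_mult f)
    have 2: "(\<lambda>n. LINT x|lborel. (norm (f n x))\<^sup>2) \<longlonglongrightarrow> (LINT x|lborel. (norm (q x))\<^sup>2)"
    proof (rule integral_dominated_convergence[where w="\<lambda>x. C\<^sup>2 * (exp (- (1/8) * (norm x)\<^sup>2))\<^sup>2"])
      show "AE x in lborel. norm ((norm (f n x))\<^sup>2) \<le> C\<^sup>2 * (exp (- (1/8) * (norm x)\<^sup>2))\<^sup>2" for n
      proof (rule AE_I2)
        show "norm ((norm (f n x))\<^sup>2) \<le> C\<^sup>2 * (exp (- (1/8) * (norm x)\<^sup>2))\<^sup>2" for x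
          using power_mono[OF f(3)[of n x] norm_ge_zero, of 2] by (simp add: power_mult_distrib)
      qed
      show "integrable lborel (\<lambda>x::'a. C\<^sup>2 * (exp (- (1/8) * (norm x)\<^sup>2))\<^sup>2)" using gg by (rule integrable_mult_right)
    qed (auto intro!: tendsto_power tendsto_norm f)
    show ?thesis
    proof (rule LIMSEQ_le)
      show "(\<lambda>n. (norm (LINT x|lborel. G x * f n x))\<^sup>2) \<longlonglongrightarrow> (norm (LINT x|lborel. G x * q x))\<^sup>2"
        by (intro tendsto_power tendsto_norm 1)
      show "(\<lambda>n. M * (LINT x|lborel. (norm (f n x))\<^sup>2)) \<longlonglongrightarrow> M * (LINT x|lborel. (norm (q x))\<^sup>2)"
        by (intro tendsto_mult tendsto_const 2)
    qed (use le[OF f(1)] in auto)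
  qed
  have loc: "integrable lborel (\<lambda>x. norm (G x) * indicator (ball 0 r) x)" for r
  proof (rule Bochner_Integration.integrable_bound)
    show "integrable lborel (\<lambda>x. exp (r\<^sup>2 / 8) * (norm (G x) * exp (- (1/8) * (norm x)\<^sup>2)))"
      using Gg by (rule integrable_mult_right)
    have "norm (G x) * indicator (ball 0 r) x \<le> exp (r\<^sup>2 / 8) * (norm (G x) * exp (- (1/8) * (norm x)\<^sup>2))" for x
    proof (cases "norm x < r")
      case True
      then have "(norm x)\<^sup>2 \<le> r\<^sup>2" by (intro power_mono) auto
      then have "1 \<le> exp (r\<^sup>2 / 8) * exp (- (1/8) * (norm x)\<^sup>2)" by (simp flip: exp_add)
      from mult_left_mono[OF this norm_ge_zero[of "G x"]] show ?thesis using True by (simp add: mult_ac)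
    qed auto
    then show "AE x in lborel. norm (norm (G x) * indicator (ball 0 r) x) \<le> norm (exp (r\<^sup>2 / 8) * (norm (G x) * exp (- (1/8) * (norm x)\<^sup>2)))"
      by simp
  qed (auto intro!: borel_measurable_times borel_measurable_indicator)
  \<comment> \<open>Second extension, to bounded measurable functions of bounded support; the local
    integrability of G supplies the majorant.\<close>
  have bdd: "(norm (LINT x|lborel. G x * f x))\<^sup>2 \<le> M * (LINT x|lborel. (norm (f x))\<^sup>2)"
    if [measurable]: "f \<in> borel_measurable borel" and f: "\<And>x. norm (f x) \<le> B" "\<And>x. norm x \<ge> R \<Longrightarrow> f x = 0" for f B R
  proof -
    have ne: "ball (0::'a) R \<noteq> UNIV" using bounded_ball not_bounded_UNIV by metis
    obtain g where g: "\<And>n. continuous_on UNIV (g n)" "\<And>n x. norm (g n x) \<le> B"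
      "\<And>n x. x \<notin> ball 0 R \<Longrightarrow> g n x = 0" "AE x in lborel. (\<lambda>n. g n x) \<longlonglongrightarrow> f x"
      using continuous_approx[of f B "ball 0 R"] f ne by auto
    have B0: "B \<ge> 0" using f(1)[of 0] norm_ge_zero order_trans by blast
    have [measurable]: "g n \<in> borel_measurable borel" for n using g(1) by (rule borel_measurable_continuous_onI)
    have gb: "norm (g n x) \<le> B * indicator (ball 0 R) x" for n x
      using g(2)[of n x] g(3)[of x n] by (cases "x \<in> ball 0 R") auto
    have 1: "(\<lambda>n. LINT x|lborel. G x * g n x) \<longlonglongrightarrow> (LINT x|lborel. G x * f x)"
    proof (rule integral_dominated_convergence[where w="\<lambda>x. B * (norm (G x) * indicator (ball 0 R) x)"])
      show "AE x in lborel. norm (G x * g n x) \<le> B * (norm (G x) * indicator (ball 0 R) x)" for n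
        using mult_left_mono[OF gb norm_ge_zero] by (auto simp: norm_mult mult_ac)
      show "integrable lborel (\<lambda>x. B * (norm (G x) * indicator (ball 0 R) x))" using loc by (rule integrable_mult_right)
      show "AE x in lborel. (\<lambda>n. G x * g n x) \<longlonglongrightarrow> G x * f x"
        using g(4) by eventually_elim (intro tendsto_mult tendsto_const)
    qed auto
    have 2: "(\<lambda>n. LINT x|lborel. (norm (g n x))\<^sup>2) \<longlonglongrightarrow> (LINT x|lborel. (norm (f x))\<^sup>2)"
    proof (rule integral_dominated_convergence[where w="\<lambda>x. B\<^sup>2 * indicator (ball 0 R) x"])
      have "norm ((norm (g n x))\<^sup>2) \<le> B\<^sup>2 * indicator (ball 0 R) x" for n x
        using power_mono[OF gb[of n x] norm_ge_zero, of 2] by (cases "x \<in> ball 0 R") (auto simp: power_mult_distrib)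
      then show "AE x in lborel. norm ((norm (g n x))\<^sup>2) \<le> B\<^sup>2 * indicator (ball 0 R) x" for n by blast
      show "integrable lborel (\<lambda>x::'a. B\<^sup>2 * indicator (ball 0 R) x)"
        by (intro integrable_mult_right integrable_real_indicator) (simp_all add: emeasure_bounded_finite[unfolded infinity_ennreal_def])
      show "AE x in lborel. (\<lambda>n. (norm (g n x))\<^sup>2) \<longlonglongrightarrow> (norm (f x))\<^sup>2"
        using g(4) by eventually_elim (intro tendsto_power tendsto_norm)
    qed auto
    show ?thesis
    proof (rule LIMSEQ_le)
      show "(\<lambda>n. (norm (LINT x|lborel. G x * g n x))\<^sup>2) \<longlonglongrightarrow> (norm (LINT x|lborel. G x * f x))\<^sup>2"
        by (intro tendsto_power tendsto_norm 1)
      show "(\<lambda>n. M * (LINT x|lborel. (norm (g n x))\<^sup>2)) \<longlonglongrightarrow> M * (LINT x|lborel. (norm (f x))\<^sup>2)"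
        by (intro tendsto_mult tendsto_const 2)
      have "(norm (LINT x|lborel. G x * g n x))\<^sup>2 \<le> M * (LINT x|lborel. (norm (g n x))\<^sup>2)" for n
        by (rule cont[where B=B and R=R]) (use g in auto)
      then show "\<exists>N. \<forall>n\<ge>N. (norm (LINT x|lborel. G x * g n x))\<^sup>2 \<le> M * (LINT x|lborel. (norm (g n x))\<^sup>2)" by blast
    qed
  qed
  define A where "A = (\<lambda>n::nat. {x. norm (G x) \<le> real n \<and> norm x < real n})"
  have Am [measurable]: "A n \<in> sets borel" for n unfolding A_def by measurable
  have "(\<integral>\<^sup>+x. ennreal ((norm (G x))\<^sup>2) * indicator (A n) x \<partial>lborel) \<le> ennreal M" for n
  proof -
    \<comment> \<open>Tested with its own truncated conjugate, G satisfies I^2 \<le> M I for the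
      truncated square integral I, hence I \<le> M; monotone convergence in n removes the
      truncation.\<close>
    define f where "f x = cnj (G x) * indicator (A n) x" for x
    have fm [measurable]: "f \<in> borel_measurable borel" unfolding f_def by measurable
    have fb: "norm (f x) \<le> real n" for x by (auto simp: f_def A_def norm_mult indicator_def)
    have f0: "f x = 0" if "norm x \<ge> real n" for x using that by (auto simp: f_def A_def indicator_def)
    have eq: "(norm (f x))\<^sup>2 = (norm (G x))\<^sup>2 * indicator (A n) x" for x
      by (auto simp: f_def norm_mult indicator_def)
    have i: "integrable lborel (\<lambda>x. (norm (f x))\<^sup>2)"
    proof (rule Bochner_Integration.integrable_bound)
      show "integrable lborel (\<lambda>x::'a. (real n)\<^sup>2 * indicator (ball 0 (real n)) x)"
        by (intro integrable_mult_right integrable_real_indicator) (simp_all add: emeasure_bounded_finite[unfolded infinity_ennreal_def])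
      have "(norm (f x))\<^sup>2 \<le> (real n)\<^sup>2 * indicator (ball 0 (real n)) x" for x
        using power_mono[OF fb[of x] norm_ge_zero, of 2] f0[of x] by (cases "x \<in> ball 0 (real n)") auto
      then show "AE x in lborel. norm ((norm (f x))\<^sup>2) \<le> norm ((real n)\<^sup>2 * indicator (ball 0 (real n)) x)" by simp
    qed measurable
    define I where "I = (LINT x|lborel. (norm (f x))\<^sup>2)"
    have I0: "I \<ge> 0" unfolding I_def by simp
    have "(LINT x|lborel. G x * f x) = (LINT x|lborel. complex_of_real ((norm (f x))\<^sup>2))"
    proof (rule Bochner_Integration.integral_cong[OF refl])
      fix x show "G x * f x = complex_of_real ((norm (f x))\<^sup>2)"
        unfolding eq by (auto simp: f_def indicator_def complex_norm_square simp del: of_real_power)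
    qed
    also have "\<dots> = complex_of_real I" unfolding I_def by (rule integral_complex_of_real)
    finally have "I\<^sup>2 \<le> M * I" using bdd[OF fm fb f0] I0 by (simp add: I_def)
    then have "I \<le> M" using I0 M by (cases "I = 0") (auto simp: power2_eq_square)
    moreover have "(\<integral>\<^sup>+x. ennreal ((norm (G x))\<^sup>2) * indicator (A n) x \<partial>lborel) = (\<integral>\<^sup>+x. ennreal ((norm (f x))\<^sup>2) \<partial>lborel)"
      unfolding eq by (intro nn_integral_cong) (auto simp: indicator_def)
    moreover have "(\<integral>\<^sup>+x. ennreal ((norm (f x))\<^sup>2) \<partial>lborel) = ennreal I"
      unfolding I_def using i by (intro nn_integral_eq_integral) auto
    ultimately show ?thesis by (simp add: ennreal_leI)
  qed
  moreover have "(\<integral>\<^sup>+x. ennreal ((norm (G x))\<^sup>2) \<partial>lborel) = (SUP n. \<integral>\<^sup>+x. ennreal ((norm (G x))\<^sup>2) * indicator (A n) x \<partial>lborel)"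
  proof -
    have "(\<Union>n. A n) = UNIV"
    proof -
      have "\<exists>n. x \<in> A n" for x
        using real_arch_simple[of "max (norm (G x)) (norm x + 1)"] by (auto simp: A_def)
      then show ?thesis by auto
    qed
    then have sup: "ennreal ((norm (G x))\<^sup>2) = (SUP n. ennreal ((norm (G x))\<^sup>2) * indicator (A n) x)" for x
    proof -
      obtain n where "x \<in> A n" using \<open>(\<Union>n. A n) = UNIV\<close> by blast
      then show ?thesis
        by (intro antisym SUP_upper2[of n] SUP_least) (auto simp: indicator_def)
    qed
    have "incseq A" by (auto simp: incseq_def A_def)
    then have "incseq (\<lambda>n x. ennreal ((norm (G x))\<^sup>2) * indicator (A n) x)"
      by (auto simp: incseq_def le_fun_def indicator_def)
    then show ?thesis by (subst sup) (rule nn_integral_monotone_convergence_SUP, auto)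
  qed
  ultimately show ?thesis by (simp add: SUP_le_iff)
qed

lemma represents_unique:
  assumes g: "represents g T" and g': "represents g' T"
  shows "AE x in lborel. g x = g' x"
proof -
  have [measurable]: "g \<in> borel_measurable borel" "g' \<in> borel_measurable borel"
    using g g' by (auto simp: represents_def)
  have int: "integrable lborel (\<lambda>x. g x * f x)" "integrable lborel (\<lambda>x. g' x * f x)"
    "(LINT x|lborel. g x * f x) = (LINT x|lborel. g' x * f x)" if "schwartz f" for f
    using g g' that by (auto simp: represents_def)
  have "(\<integral>\<^sup>+x. ennreal ((norm (g x - g' x))\<^sup>2) \<partial>lborel) \<le> ennreal 0"
    by (rule L2_bound_by_testing) (auto simp: left_diff_distrib int)
  then have "AE x in lborel. ennreal ((norm (g x - g' x))\<^sup>2) = 0"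
    by (subst (asm) ennreal_0, simp only: le_zero_eq) (subst (asm) nn_integral_0_iff_AE, auto)
  then show ?thesis by (rule eventually_mono) simp
qed

lemma fun_of_represents: "represents g T \<Longrightarrow> represents (fun_of T) T"
  unfolding fun_of_def by (rule someI[where P="\<lambda>g. represents g T"])

lemma fun_of_AE: "represents g T \<Longrightarrow> AE x in lborel. fun_of T x = g x"
  by (rule represents_unique[OF fun_of_represents])

section \<open>Cauchy-Schwarz and the Plancherel bound for distributions\<close>

lemma norm_integral_mult_square_le:
  fixes f g :: "'a \<Rightarrow> complex"
  assumes [measurable]: "f \<in> borel_measurable M" "g \<in> borel_measurable M"
    and f: "integrable M (\<lambda>x. (norm (f x))\<^sup>2)" and g: "integrable M (\<lambda>x. (norm (g x))\<^sup>2)"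
  shows "(norm (LINT x|M. f x * g x))\<^sup>2 \<le> (LINT x|M. (norm (f x))\<^sup>2) * (LINT x|M. (norm (g x))\<^sup>2)"
proof -
  have "ennreal (norm (LINT x|M. f x * g x)) \<le> (\<integral>\<^sup>+x. ennreal (norm (f x * g x)) \<partial>M)"
    by (cases "integrable M (\<lambda>x. f x * g x)") (auto intro: integral_norm_bound_ennreal simp: not_integrable_integral_eq)
  also have "\<dots> = (\<integral>\<^sup>+x. ennreal (norm (f x)) * ennreal (norm (g x)) \<partial>M)"
    by (simp add: norm_mult ennreal_mult)
  finally have "(ennreal (norm (LINT x|M. f x * g x)))\<^sup>2 \<le> (\<integral>\<^sup>+x. ennreal (norm (f x)) * ennreal (norm (g x)) \<partial>M)\<^sup>2"
    by (intro power_mono) auto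
  also have "\<dots> \<le> (\<integral>\<^sup>+x. (ennreal (norm (f x)))\<^sup>2 \<partial>M) * (\<integral>\<^sup>+x. (ennreal (norm (g x)))\<^sup>2 \<partial>M)"
    by (rule Cauchy_Schwarz_nn_integral) auto
  also have "\<dots> = ennreal ((LINT x|M. (norm (f x))\<^sup>2) * (LINT x|M. (norm (g x))\<^sup>2))"
    using f g by (simp add: ennreal_power nn_integral_eq_integral ennreal_mult)
  finally show ?thesis by (simp add: ennreal_power)
qed

text \<open>By duality, testing G with f is testing g with the transform of f. Cauchy-Schwarz and
  Plancherel for Schwartz functions then give the hypothesis of \<open>L2_bound_by_testing\<close>
  for G.\<close>

lemma L2_fourier_bound:
  fixes v :: "(real ^ 'd::finite) distribution"
  assumes g: "represents g v" and g2: "integrable lborel (\<lambda>x. (norm (g x))\<^sup>2)" and G: "represents G (fourier_dist v)"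
  shows "(\<integral>\<^sup>+\<xi>. ennreal ((norm (G \<xi>))\<^sup>2) \<partial>lborel) \<le> ennreal ((2 * pi) ^ CARD('d) * (LINT x|lborel. (norm (g x))\<^sup>2))"
proof (rule L2_bound_by_testing)
  show "G \<in> borel_measurable borel" using G by (simp add: represents_def)
  show "0 \<le> (2 * pi) ^ CARD('d) * (LINT x|lborel. (norm (g x))\<^sup>2)" by simp
  fix f :: "real ^ 'd \<Rightarrow> complex" assume f: "schwartz f"
  show "integrable lborel (\<lambda>x. G x * f x)" using G f by (simp add: represents_def)
  have F: "schwartz (fourier f)" by (rule schwartz_fourier[OF f])
  have [measurable]: "g \<in> borel_measurable borel" "fourier f \<in> borel_measurable borel"
    using g schwartz_borel[OF F] by (auto simp: represents_def)
  have "(LINT x|lborel. G x * f x) = v (fourier f)"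
    using G f by (simp add: represents_def fourier_dist_def)
  also have "\<dots> = (LINT x|lborel. g x * fourier f x)" using g F by (simp add: represents_def)
  finally have "(norm (LINT x|lborel. G x * f x))\<^sup>2 \<le> (LINT x|lborel. (norm (g x))\<^sup>2) * (LINT x|lborel. (norm (fourier f x))\<^sup>2)"
    using norm_integral_mult_square_le[of g lborel "fourier f"] g2 schwartz_square_integrable[OF F] by simp
  then show "(norm (LINT x|lborel. G x * f x))\<^sup>2 \<le> (2 * pi) ^ CARD('d) * (LINT x|lborel. (norm (g x))\<^sup>2) * (LINT x|lborel. (norm (f x))\<^sup>2)"
    by (simp add: plancherel_schwartz[OF f] mult_ac)
qed

section \<open>The lattice and its fundamental cell\<close>

abbreviation lshift :: "int ^ 'd \<Rightarrow> real ^ 'd \<Rightarrow> real ^ 'd::finite" where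
  "lshift l \<xi> \<equiv> \<xi> + (2 * pi) *\<^sub>R lat l"

lemma lat_simps: "lat (l + m) = lat l + lat m" "lat (- l) = - lat l" "lat (l - m) = lat l - lat m" "lat 0 = 0"
  by (simp_all add: lat_def vec_eq_iff)

text \<open>In each coordinate the shift into [-pi, pi) is forced to be minus the floor of (x + pi)
  / (2 pi). That the cell is half open gives both existence and uniqueness.\<close>

lemma Q_ex1: "\<exists>!l. lshift l \<xi> \<in> Q" for \<xi> :: "real ^ 'd::finite"
proof (rule ex_ex1I)
  have *: "- pi \<le> x + 2 * pi * of_int k \<and> x + 2 * pi * of_int k < pi \<longleftrightarrow> k = - \<lfloor>(x + pi) / (2 * pi)\<rfloor>" for x :: real and k
  proof -
    have "k = - \<lfloor>(x + pi) / (2 * pi)\<rfloor> \<longleftrightarrow> \<lfloor>(x + pi) / (2 * pi)\<rfloor> = - k" by auto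
    also have "\<dots> \<longleftrightarrow> - of_int k \<le> (x + pi) / (2 * pi) \<and> (x + pi) / (2 * pi) < - of_int k + 1"
      by (simp add: floor_eq_iff)
    also have "\<dots> \<longleftrightarrow> - of_int k * (2 * pi) \<le> x + pi \<and> x + pi < (- of_int k + 1) * (2 * pi)"
      using pi_gt_zero by (simp add: pos_le_divide_eq pos_divide_less_eq)
    also have "\<dots> \<longleftrightarrow> - pi \<le> x + 2 * pi * of_int k \<and> x + 2 * pi * of_int k < pi"
      by (auto simp: algebra_simps)
    finally show ?thesis by blast
  qed
  have iff: "lshift l \<xi> \<in> Q \<longleftrightarrow> (\<forall>i. l $ i = - \<lfloor>(\<xi> $ i + pi) / (2 * pi)\<rfloor>)" for l
    using * by (simp add: Q_def lat_def)
  show "\<exists>l. lshift l \<xi> \<in> Q" unfolding iff by (rule exI[of _ "\<chi> i. - \<lfloor>(\<xi> $ i + pi) / (2 * pi)\<rfloor>"]) simp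
  show "l = m" if "lshift l \<xi> \<in> Q" "lshift m \<xi> \<in> Q" for l m
    using that unfolding iff by (simp add: vec_eq_iff)
qed

lemma Q_measurable [measurable]: "Q \<in> sets borel"
proof -
  have "Q = (\<Inter>i. {\<xi> :: real ^ 'a. - pi \<le> \<xi> \<bullet> axis i 1} \<inter> {\<xi>. \<xi> \<bullet> axis i 1 < pi})"
    by (auto simp: Q_def inner_axis)
  also have "\<dots> \<in> sets borel" by (intro sets.finite_INT sets.Int) auto
  finally show ?thesis .
qed

lemma norm_Q_le: "\<xi> \<in> Q \<Longrightarrow> norm \<xi> \<le> pi * CARD('d)" for \<xi> :: "real ^ 'd::finite"
proof -
  assume Q: "\<xi> \<in> Q"
  have "norm \<xi> \<le> (\<Sum>i\<in>UNIV. \<bar>\<xi> $ i\<bar>)" by (rule norm_le_l1_cart)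
  also have "\<dots> \<le> (\<Sum>i\<in>(UNIV :: 'd set). pi)"
    using Q by (intro sum_mono) (auto simp: Q_def abs_le_iff less_imp_le minus_le_iff)
  finally show ?thesis by (simp add: mult.commute)
qed

lemma norm_ge_if_not_Q: "\<xi> \<notin> Q \<Longrightarrow> pi \<le> norm \<xi>"
proof -
  assume "\<xi> \<notin> Q"
  then obtain i where "\<xi> $ i < - pi \<or> pi \<le> \<xi> $ i" by (auto simp: Q_def not_le not_less)
  then have "pi \<le> \<bar>\<xi> $ i\<bar>" by linarith
  then show ?thesis using component_le_norm_cart[of \<xi> i] by linarith
qed

lemma emeasure_Q: "emeasure lborel (Q :: (real ^ 'd::finite) set) = ennreal ((2 * pi) ^ CARD('d))"
proof -
  define p where "p = (vec pi :: real ^ 'd)"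
  have p: "p $ i = pi" for i by (simp add: p_def)
  have ip: "p \<bullet> b = pi" if "b \<in> Basis" for b
    using that by (auto simp: Basis_vec_def inner_axis p)
  have mb: "box (- p) p \<subseteq> Q" "Q \<subseteq> cbox (- p) p"
    unfolding Q_def by (auto simp: mem_box_cart p less_imp_le)
  have "(\<Prod>b\<in>Basis. (p - - p) \<bullet> b) = (\<Prod>b\<in>(Basis :: (real ^ 'd) set). 2 * pi)"
  proof (rule prod.cong[OF refl])
    fix b :: "real ^ 'd" assume "b \<in> Basis"
    then show "(p - - p) \<bullet> b = 2 * pi" using ip[of b] by (simp only: inner_diff_left inner_minus_left)
  qed
  then have eqp: "(\<Prod>b\<in>Basis. (p - - p) \<bullet> b) = (2 * pi) ^ CARD('d)" by (simp only: prod_constant DIM_cart DIM_real mult_1_right)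
  have "emeasure lborel (box (- p) p) = ennreal ((2 * pi) ^ CARD('d))"
    by (subst emeasure_lborel_box) (simp_all only: eqp, simp add: ip)
  moreover have "emeasure lborel (cbox (- p) p) = ennreal ((2 * pi) ^ CARD('d))"
    by (subst emeasure_lborel_cbox) (simp_all only: eqp, simp add: ip)
  moreover have "emeasure lborel (box (- p) p) \<le> emeasure lborel (Q :: (real ^ 'd) set)"
    "emeasure lborel (Q :: (real ^ 'd) set) \<le> emeasure lborel (cbox (- p) p)"
    using mb by (auto intro!: emeasure_mono)
  ultimately show ?thesis by simp
qed

lemma cis_lat_lshift: "cis (lat n \<bullet> lshift l \<xi>) = cis (lat n \<bullet> \<xi>)"
proof -
  have "lat n \<bullet> lat l = of_int (\<Sum>i\<in>UNIV. n $ i * l $ i)" by (simp add: inner_vec_def lat_def)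
  then have "lat n \<bullet> lshift l \<xi> = lat n \<bullet> \<xi> + 2 * pi * of_int (\<Sum>i\<in>UNIV. n $ i * l $ i)"
    by (simp add: inner_add_right)
  then show ?thesis by (simp only: cis_mult[symmetric] cis_multiple_2pi[OF Ints_of_int] mult_1_right)
qed

text \<open>(BP) is stated with an unordered sum, whereas Tonelli, Cauchy-Schwarz and measurability
  are at hand for integrals against the counting measure. The comparison exhausts the index set by
  finite sets of an enumeration.\<close>

lemma nn_integral_count_space_infsum:
  fixes f :: "'i::countable \<Rightarrow> ennreal"
  shows "(\<integral>\<^sup>+i. f i \<partial>count_space UNIV) \<le> (\<Sum>\<^sub>\<infinity>i\<in>UNIV. f i)"
proof -
  define A where "A n = {i::'i. to_nat i < n}" for n
  have fin: "finite (A n)" for n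
    unfolding A_def by (rule finite_imageD[of to_nat]) (auto intro: finite_subset[of _ "{..<n}"] simp: inj_on_def)
  have "f i = (SUP n. f i * indicator (A n) i)" for i
    by (intro antisym SUP_upper2[of "Suc (to_nat i)"] SUP_least) (auto simp: indicator_def A_def)
  then have "(\<integral>\<^sup>+i. f i \<partial>count_space UNIV) = (\<integral>\<^sup>+i. (SUP n. f i * indicator (A n) i) \<partial>count_space UNIV)" by simp
  also have "\<dots> = (SUP n. \<integral>\<^sup>+i. f i * indicator (A n) i \<partial>count_space UNIV)"
    by (rule nn_integral_monotone_convergence_SUP) (auto simp: incseq_def le_fun_def indicator_def A_def)
  also have "\<dots> = (SUP n. \<Sum>i\<in>A n. f i)"
  proof -
    have "(\<integral>\<^sup>+i. f i * indicator (A n) i \<partial>count_space UNIV) = (\<Sum>i\<in>A n. f i)" for n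
      by (subst nn_integral_count_space'[OF fin[of n]]) auto
    then show ?thesis by simp
  qed
  also have "\<dots> \<le> (\<Sum>\<^sub>\<infinity>i\<in>UNIV. f i)"
    by (subst nonneg_infsum_complete) (auto intro!: SUP_least SUP_upper fin)
  finally show ?thesis .
qed

text \<open>Each point has exactly one lattice translate in Q, so the indicators of the translated
  cells add up to 1. Inserting this sum, exchanging the integrals and translating each term gives
  the formula.\<close>

lemma nn_integral_tile:
  fixes f :: "real ^ 'd::finite \<Rightarrow> ennreal"
  assumes [measurable]: "f \<in> borel_measurable borel"
  shows "(\<integral>\<^sup>+\<xi>. f \<xi> \<partial>lborel) = (\<integral>\<^sup>+\<xi>\<in>Q. (\<integral>\<^sup>+l. f (lshift l \<xi>) \<partial>count_space UNIV) \<partial>lborel)"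
proof -
  have one: "(\<integral>\<^sup>+l. f \<xi> * indicator Q (lshift l \<xi>) \<partial>count_space UNIV) = f \<xi>" for \<xi>
  proof -
    obtain l0 where l0: "\<And>l. lshift l \<xi> \<in> Q \<longleftrightarrow> l = l0" using Q_ex1[of \<xi>] by metis
    show ?thesis by (subst nn_integral_count_space'[of "{l0}"]) (auto simp: l0 indicator_def)
  qed
  have "(\<integral>\<^sup>+\<xi>. f \<xi> \<partial>lborel) = (\<integral>\<^sup>+\<xi>. (\<integral>\<^sup>+l. f \<xi> * indicator Q (lshift l \<xi>) \<partial>count_space UNIV) \<partial>lborel)"
    by (simp add: one)
  also have "\<dots> = (\<integral>\<^sup>+l. (\<integral>\<^sup>+\<xi>. f \<xi> * indicator Q (lshift l \<xi>) \<partial>lborel) \<partial>count_space UNIV)"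
    by (rule nn_integral_count_space_nn_integral) auto
  also have "\<dots> = (\<integral>\<^sup>+l. (\<integral>\<^sup>+\<xi>. f (lshift (- l) \<xi>) * indicator Q \<xi> \<partial>lborel) \<partial>count_space UNIV)"
  proof (rule nn_integral_cong)
    fix l :: "int ^ 'd"
    show "(\<integral>\<^sup>+\<xi>. f \<xi> * indicator Q (lshift l \<xi>) \<partial>lborel) = (\<integral>\<^sup>+\<xi>. f (lshift (- l) \<xi>) * indicator Q \<xi> \<partial>lborel)"
      by (subst nn_integral_affine[of _ 1 "(2 * pi) *\<^sub>R lat (- l)"]) (auto simp: lat_simps algebra_simps)
  qed
  also have "\<dots> = (\<integral>\<^sup>+l. (\<integral>\<^sup>+\<xi>. f (lshift l \<xi>) * indicator Q \<xi> \<partial>lborel) \<partial>count_space UNIV)"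
    by (rule nn_integral_bij_count_space) (auto intro!: bij_uminus)
  also have "\<dots> = (\<integral>\<^sup>+\<xi>. (\<integral>\<^sup>+l. f (lshift l \<xi>) * indicator Q \<xi> \<partial>count_space UNIV) \<partial>lborel)"
    by (rule nn_integral_count_space_nn_integral[symmetric]) auto
  also have "\<dots> = (\<integral>\<^sup>+\<xi>\<in>Q. (\<integral>\<^sup>+l. f (lshift l \<xi>) \<partial>count_space UNIV) \<partial>lborel)"
    by (simp add: nn_integral_multc)
  finally show ?thesis .
qed

section \<open>Periodization over the lattice\<close>

lemma AE_lshift:
  assumes "AE \<xi> in lborel. P \<xi>"
  shows "AE \<xi> in lborel. \<forall>l. P (lshift l \<xi>)"
proof -
  have "AE \<xi> in lborel. P (lshift l \<xi>)" for l
    using AE_affine[OF one_neq_zero assms, of "(2 * pi) *\<^sub>R lat l"] by (simp add: add.commute)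
  then show ?thesis by (simp add: AE_all_countable)
qed

text \<open>As a Bochner integral over the counting measure, the periodization is 0 wherever the
  series is not absolutely summable. It is thereby a total Borel function which is periodic at every
  point and not merely almost everywhere.\<close>

definition per :: "(real ^ 'd::finite \<Rightarrow> complex) \<Rightarrow> real ^ 'd \<Rightarrow> complex" where
  "per f \<xi> = (LINT l|count_space UNIV. f (lshift l \<xi>))"

lemma lshift_lshift: "lshift l (lshift m \<xi>) = lshift (m + l) \<xi>"
  by (simp add: lat_simps algebra_simps)

lemma per_lshift: "per f (lshift m \<xi>) = per f \<xi>"
proof -
  have "bij ((+) m)" by (rule bij_betwI[where g="\<lambda>l. l - m"]) auto
  then have "distr (count_space UNIV) (count_space UNIV) ((+) m) = count_space UNIV"
    using distr_bij_count_space[of "(+) m" UNIV UNIV] by simp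
  then have "(LINT l|count_space UNIV. f (lshift l \<xi>)) = (LINT l|count_space UNIV. f (lshift (m + l) \<xi>))"
    by (metis integral_distr[of "(+) m" "count_space UNIV" "count_space UNIV" "\<lambda>l. f (lshift l \<xi>)"] measurable_count_space borel_measurable_count_space measurable_count_space_eq1 Pi_I UNIV_I space_count_space)
  then show ?thesis unfolding per_def lshift_lshift by simp
qed

lemma integral_lattice_single:
  assumes "\<And>l. P l \<longleftrightarrow> l = l0"
  shows "(LINT l|count_space UNIV. (if P l then c else 0)) = (c::complex)"
  using lebesgue_integral_count_space_finite_support[of UNIV "\<lambda>l. if P l then c else 0"] assms
  by (cases "c = 0") (auto simp: Collect_conv_if)

lemma measurable_lattice_pair:
  assumes "\<And>l. (\<lambda>\<xi>. F l \<xi>) \<in> borel_measurable borel"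
  shows "case_prod F \<in> borel_measurable (count_space (UNIV :: (int ^ 'd::finite) set) \<Otimes>\<^sub>M lborel)"
  by (rule measurable_pair_measure_countable1) (use assms in auto)

lemma nn_integral_lattice_measurable:
  fixes F :: "int ^ 'd::finite \<Rightarrow> real ^ 'd \<Rightarrow> ennreal"
  assumes "\<And>l. (\<lambda>\<xi>. F l \<xi>) \<in> borel_measurable borel"
  shows "(\<lambda>\<xi>. \<integral>\<^sup>+l. F l \<xi> \<partial>count_space UNIV) \<in> borel_measurable borel"
proof -
  have "case_prod F \<in> borel_measurable (count_space UNIV \<Otimes>\<^sub>M lborel)"
    by (rule measurable_pair_measure_countable1) (use assms in auto)
  from measurable_pair_swap[OF this]
  have "(\<lambda>\<xi>. \<integral>\<^sup>+l. F l \<xi> \<partial>count_space UNIV) \<in> borel_measurable lborel"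
    by (intro sigma_finite_measure.borel_measurable_nn_integral[OF sigma_finite_measure_count_space_countable])
      (auto simp: case_prod_beta')
  then show ?thesis by simp
qed

lemma integral_lattice_measurable:
  fixes F :: "int ^ 'd::finite \<Rightarrow> real ^ 'd \<Rightarrow> complex"
  assumes "\<And>l. (\<lambda>\<xi>. F l \<xi>) \<in> borel_measurable borel"
  shows "(\<lambda>\<xi>. LINT l|count_space UNIV. F l \<xi>) \<in> borel_measurable borel"
proof -
  have "case_prod F \<in> borel_measurable (count_space UNIV \<Otimes>\<^sub>M lborel)"
    by (rule measurable_lattice_pair[OF assms])
  from measurable_pair_swap[OF this]
  have "(\<lambda>\<xi>. LINT l|count_space UNIV. F l \<xi>) \<in> borel_measurable lborel"
    by (intro sigma_finite_measure.borel_measurable_lebesgue_integral[OF sigma_finite_measure_count_space_countable])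
      (auto simp: case_prod_beta')
  then show ?thesis by simp
qed

lemma pair_lattice: "pair_sigma_finite (count_space (UNIV :: (int ^ 'd::finite) set)) (lborel :: (real ^ 'd) measure)"
  by (intro pair_sigma_finite.intro sigma_finite_measure_count_space_countable sigma_finite_lborel) auto

text \<open>\<open>H\<close> restricts the translates of F to Q, while \<open>K\<close> restricts F
  to the translates of Q. For each l they have equal integrals in \<xi>, and for fixed \<xi> the sum
  of \<open>K\<close> over l has at most one nonzero term. So the integrability of \<open>K\<close>
  on the product space is plain and passes to \<open>H\<close>, and Fubini applies to both.\<close>

lemma integral_tile:
  fixes F :: "real ^ 'd::finite \<Rightarrow> complex"
  assumes F: "integrable lborel F"
  shows "AE \<xi> in lborel. \<xi> \<in> Q \<longrightarrow> integrable (count_space UNIV) (\<lambda>l. F (lshift l \<xi>))"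
    and "integrable lborel (\<lambda>\<xi>. indicator Q \<xi> *\<^sub>R per F \<xi>)"
    and "(LINT \<xi>|lborel. indicator Q \<xi> *\<^sub>R per F \<xi>) = (LINT \<xi>|lborel. F \<xi>)"
proof -
  interpret PS: pair_sigma_finite "count_space (UNIV :: (int ^ 'd) set)" "lborel :: (real ^ 'd) measure"
    by (rule pair_lattice)
  have Fm [measurable]: "F \<in> borel_measurable borel" using F by auto
  define H where "H = (\<lambda>l \<xi>. indicator Q \<xi> *\<^sub>R F (lshift l \<xi>))"
  define K where "K = (\<lambda>l \<xi>. indicator Q (lshift (- l) \<xi>) *\<^sub>R F \<xi>)"
  have Hm [measurable]: "case_prod H \<in> borel_measurable (count_space UNIV \<Otimes>\<^sub>M lborel)"
    unfolding H_def by (rule measurable_lattice_pair) measurable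
  have Km [measurable]: "case_prod K \<in> borel_measurable (count_space UNIV \<Otimes>\<^sub>M lborel)"
    unfolding K_def by (rule measurable_lattice_pair) measurable
  have HK: "(\<integral>\<^sup>+\<xi>. ennreal (norm (H l \<xi>)) \<partial>lborel) = (\<integral>\<^sup>+\<xi>. ennreal (norm (K l \<xi>)) \<partial>lborel)"
    "(LINT \<xi>|lborel. H l \<xi>) = (LINT \<xi>|lborel. K l \<xi>)" for l
  proof -
    have e: "K l ((2 * pi) *\<^sub>R lat l + 1 *\<^sub>R \<xi>) = H l \<xi>" for \<xi>
      by (simp add: K_def H_def lat_simps algebra_simps)
    have [measurable]: "K l \<in> borel_measurable borel" unfolding K_def by measurable
    show "(\<integral>\<^sup>+\<xi>. ennreal (norm (H l \<xi>)) \<partial>lborel) = (\<integral>\<^sup>+\<xi>. ennreal (norm (K l \<xi>)) \<partial>lborel)"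
      by (subst nn_integral_affine[of "\<lambda>\<xi>. ennreal (norm (K l \<xi>))" 1 "(2 * pi) *\<^sub>R lat l"]) (auto simp only: e, auto)
    show "(LINT \<xi>|lborel. H l \<xi>) = (LINT \<xi>|lborel. K l \<xi>)"
      by (subst integral_affine[of "K l" 1 "(2 * pi) *\<^sub>R lat l"]) (auto simp only: e, auto)
  qed
  have ex: "\<exists>l0. \<forall>l. lshift (- l) \<xi> \<in> Q \<longleftrightarrow> l = l0" for \<xi>
    using Q_ex1[of \<xi>] by (metis minus_minus)
  have K1: "(\<integral>\<^sup>+l. ennreal (norm (K l \<xi>)) \<partial>count_space UNIV) = ennreal (norm (F \<xi>))" for \<xi>
  proof -
    obtain l0 where l0: "\<And>l. lshift (- l) \<xi> \<in> Q \<longleftrightarrow> l = l0" using ex by blast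
    show ?thesis by (subst nn_integral_count_space'[of "{l0}"]) (auto simp: l0 indicator_def K_def)
  qed
  have Fb: "(\<integral>\<^sup>+\<xi>. ennreal (norm (F \<xi>)) \<partial>lborel) < \<infinity>" using F by (simp add: integrable_iff_bounded)
  have Kn: "(\<integral>\<^sup>+z. ennreal (norm (case_prod K z)) \<partial>(count_space UNIV \<Otimes>\<^sub>M lborel)) = (\<integral>\<^sup>+\<xi>. ennreal (norm (F \<xi>)) \<partial>lborel)"
    by (subst PS.nn_integral_snd[symmetric]) (auto simp: K1)
  have Ki: "integrable (count_space UNIV \<Otimes>\<^sub>M lborel) (case_prod K)"
    using Fb Kn by (intro integrableI_bounded) auto
  have "(\<integral>\<^sup>+z. ennreal (norm (case_prod H z)) \<partial>(count_space UNIV \<Otimes>\<^sub>M lborel)) = (\<integral>\<^sup>+z. ennreal (norm (case_prod K z)) \<partial>(count_space UNIV \<Otimes>\<^sub>M lborel))"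
    by (subst (1 2) lborel.nn_integral_fst[symmetric]) (auto simp: HK)
  then have Hi: "integrable (count_space UNIV \<Otimes>\<^sub>M lborel) (case_prod H)"
    using Fb Kn by (intro integrableI_bounded) auto
  have ind: "(LINT l|count_space UNIV. H l \<xi>) = indicator Q \<xi> *\<^sub>R per F \<xi>" for \<xi>
    unfolding per_def by (cases "\<xi> \<in> Q") (auto simp: H_def)
  show "AE \<xi> in lborel. \<xi> \<in> Q \<longrightarrow> integrable (count_space UNIV) (\<lambda>l. F (lshift l \<xi>))"
    using PS.AE_integrable_snd[OF Hi] by eventually_elim (auto simp: H_def)
  show "integrable lborel (\<lambda>\<xi>. indicator Q \<xi> *\<^sub>R per F \<xi>)"
    using PS.integrable_snd[OF Hi] by (simp add: ind)
  have "(LINT \<xi>|lborel. indicator Q \<xi> *\<^sub>R per F \<xi>) = (LINT l|count_space UNIV. LINT \<xi>|lborel. H l \<xi>)"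
    using PS.Fubini_integral[OF Hi] by (simp add: ind)
  also have "\<dots> = (LINT l|count_space UNIV. LINT \<xi>|lborel. K l \<xi>)" by (simp add: HK)
  also have "\<dots> = (LINT \<xi>|lborel. LINT l|count_space UNIV. K l \<xi>)"
    using PS.Fubini_integral[OF Ki] by simp
  also have "\<dots> = (LINT \<xi>|lborel. F \<xi>)"
  proof (rule Bochner_Integration.integral_cong[OF refl])
    fix \<xi> :: "real ^ 'd"
    obtain l0 where l0: "\<And>l. lshift (- l) \<xi> \<in> Q \<longleftrightarrow> l = l0" using ex by blast
    have "K l \<xi> = (if lshift (- l) \<xi> \<in> Q then F \<xi> else 0)" for l by (simp add: K_def indicator_def)
    then show "(LINT l|count_space UNIV. K l \<xi>) = F \<xi>"
      using integral_lattice_single[of "\<lambda>l. lshift (- l) \<xi> \<in> Q" l0 "F \<xi>"] l0 by simp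
  qed
  finally show "(LINT \<xi>|lborel. indicator Q \<xi> *\<^sub>R per F \<xi>) = (LINT \<xi>|lborel. F \<xi>)" .
qed

lemma per_measurable [measurable]:
  assumes [measurable]: "f \<in> borel_measurable borel"
  shows "per f \<in> borel_measurable borel"
  unfolding per_def[abs_def] by (rule integral_lattice_measurable) measurable

text \<open>For \<xi> in Q each summand is comparable with the summand at 0, up to the factor c^K.
  Hence it suffices to bound the average of the sum over Q, which by tiling is an integral over the
  whole space.\<close>

lemma lattice_sum_bound:
  assumes K: "K \<ge> 2 * CARD('d)"
  obtains C where "C \<ge> 0"
    "\<And>\<xi> :: real ^ 'd::finite. \<xi> \<in> Q \<Longrightarrow> (\<integral>\<^sup>+l. ennreal (1 / (1 + norm (lshift l \<xi>)) ^ K) \<partial>count_space UNIV) \<le> ennreal C"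
proof -
  \<comment> \<open>\<open>c - 1\<close> bounds the norm on Q.\<close>
  define c where "c = 1 + pi * real CARD('d)"
  have c: "c \<ge> 1" by (simp add: c_def)
  have pos: "1 + norm y > 0" for y :: "real ^ 'd" using norm_ge_zero[of y] by linarith
  have cmp: "1 / (1 + norm (lshift l \<xi>)) ^ K \<le> c ^ K * (1 / (1 + norm ((2 * pi) *\<^sub>R lat l)) ^ K)"
    "1 / (1 + norm ((2 * pi) *\<^sub>R lat l)) ^ K \<le> c ^ K * (1 / (1 + norm (lshift l \<xi>)) ^ K)"
    if "\<xi> \<in> Q" for \<xi> :: "real ^ 'd" and l
  proof -
    have gen: "1 / (1 + norm x) ^ K \<le> c ^ K * (1 / (1 + norm y) ^ K)" if "norm y \<le> norm x + norm \<xi>" for x y :: "real ^ 'd"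
    proof -
      have "norm \<xi> \<le> c - 1" using norm_Q_le[OF \<open>\<xi> \<in> Q\<close>] by (simp add: c_def)
      then have "1 + norm y \<le> c + norm x" using that by linarith
      also have "\<dots> \<le> c * (1 + norm x)" using c mult_right_mono[of 1 c "norm x"] by (simp add: algebra_simps)
      finally have "(1 + norm y) ^ K \<le> (c * (1 + norm x)) ^ K" using pos[of y] by (intro power_mono) auto
      then have "(1 + norm y) ^ K \<le> c ^ K * (1 + norm x) ^ K" by (simp add: power_mult_distrib)
      moreover have "0 < (1 + norm y) ^ K" "0 < (1 + norm x) ^ K" using pos by (auto intro: zero_less_power)
      ultimately show ?thesis by (simp add: divide_simps)
    qed
    show "1 / (1 + norm (lshift l \<xi>)) ^ K \<le> c ^ K * (1 / (1 + norm ((2 * pi) *\<^sub>R lat l)) ^ K)"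
      using norm_triangle_ineq4[of "lshift l \<xi>" \<xi>] by (intro gen) simp
    show "1 / (1 + norm ((2 * pi) *\<^sub>R lat l)) ^ K \<le> c ^ K * (1 / (1 + norm (lshift l \<xi>)) ^ K)"
      using norm_triangle_ineq[of \<xi> "(2 * pi) *\<^sub>R lat l"] by (intro gen) simp
  qed
  let ?S = "\<integral>\<^sup>+l. ennreal (1 / (1 + norm ((2 * pi) *\<^sub>R lat l :: real ^ 'd)) ^ K) \<partial>count_space UNIV"
  have ck: "c ^ K \<ge> 0" using c by simp
  have 1: "(\<integral>\<^sup>+l. ennreal (1 / (1 + norm (lshift l \<xi>)) ^ K) \<partial>count_space UNIV) \<le> ennreal (c ^ K) * ?S"
    "?S \<le> ennreal (c ^ K) * (\<integral>\<^sup>+l. ennreal (1 / (1 + norm (lshift l \<xi>)) ^ K) \<partial>count_space UNIV)"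
    if "\<xi> \<in> Q" for \<xi> :: "real ^ 'd"
    using cmp[OF that] ck
    by (subst nn_integral_cmult[symmetric]; auto simp: ennreal_mult[symmetric] intro!: nn_integral_mono ennreal_leI)+
  have "?S * ennreal ((2 * pi) ^ CARD('d)) = (\<integral>\<^sup>+\<xi>\<in>(Q :: (real ^ 'd) set). ?S \<partial>lborel)"
    by (subst nn_integral_cmult_indicator) (auto simp: emeasure_Q)
  also have "\<dots> \<le> (\<integral>\<^sup>+\<xi>\<in>(Q :: (real ^ 'd) set). ennreal (c ^ K) * (\<integral>\<^sup>+l. ennreal (1 / (1 + norm (lshift l \<xi>)) ^ K) \<partial>count_space UNIV) \<partial>lborel)"
    using 1(2) by (intro nn_integral_mono) (auto simp: indicator_def)
  also have "\<dots> = ennreal (c ^ K) * (\<integral>\<^sup>+\<xi>. ennreal (1 / (1 + norm (\<xi> :: real ^ 'd)) ^ K) \<partial>lborel)"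
  proof -
    have m: "(\<lambda>\<xi>::real ^ 'd. \<integral>\<^sup>+l. ennreal (1 / (1 + norm (lshift l \<xi>)) ^ K) \<partial>count_space UNIV) \<in> borel_measurable borel"
      by (rule nn_integral_lattice_measurable) auto
    show ?thesis
      by (subst nn_integral_tile[of "\<lambda>\<xi>::real ^ 'd. ennreal (1 / (1 + norm \<xi>) ^ K)"], measurable)
        (use m in \<open>subst nn_integral_cmult[symmetric], auto simp: mult.assoc\<close>)
  qed
  also have "\<dots> < \<infinity>"
    using integrable_inverse_poly[of K, where 'a="real ^ 'd"] K
    by (auto simp: integrable_iff_bounded ennreal_mult_less_top)
  finally have "?S < \<infinity>" by (auto simp: ennreal_mult_less_top)
  then obtain s where s: "s \<ge> 0" "?S = ennreal s" by (cases ?S) auto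
  show ?thesis
  proof (rule that[of "c ^ K * s"])
    show "c ^ K * s \<ge> 0" using s ck by simp
    show "(\<integral>\<^sup>+l. ennreal (1 / (1 + norm (lshift l \<xi>)) ^ K) \<partial>count_space UNIV) \<le> ennreal (c ^ K * s)" if "\<xi> \<in> Q" for \<xi> :: "real ^ 'd"
      using 1(1)[OF that] s ck by (simp add: ennreal_mult)
  qed
qed

section \<open>Fourier series on the cell\<close>

abbreviation MQ :: "(real ^ 'd::finite) measure" where
  "MQ \<equiv> restrict_space lborel Q"

abbreviation chr :: "int ^ 'd::finite \<Rightarrow> real ^ 'd \<Rightarrow> complex" where
  "chr n \<xi> \<equiv> cis (- (lat n \<bullet> \<xi>))"

text \<open>Sign and normalisation are such that V is the sum of \<open>fcoef V n * chr n\<close>,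
  in accordance with the discrete Fourier transform built from exp (- i n \<xi>).\<close>

definition fcoef :: "(real ^ 'd::finite \<Rightarrow> complex) \<Rightarrow> int ^ 'd \<Rightarrow> complex" where
  "fcoef V n = (LINT \<xi>|MQ. V \<xi> * cnj (chr n \<xi>)) / of_real ((2 * pi) ^ CARD('d))"

lemma space_MQ: "space MQ = Q"
  by (simp add: space_restrict_space)

lemma integral_MQ: "(LINT \<xi>|MQ. f \<xi>) = (LINT \<xi>|lborel. indicator Q \<xi> *\<^sub>R f \<xi>)"
  for f :: "real ^ 'd::finite \<Rightarrow> 'b::{banach, second_countable_topology}"
  by (rule integral_restrict_space) simp

lemma integrable_MQ: "integrable MQ f \<longleftrightarrow> integrable lborel (\<lambda>\<xi>. indicator Q \<xi> *\<^sub>R f \<xi>)"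
  for f :: "real ^ 'd::finite \<Rightarrow> 'b::{banach, second_countable_topology}"
  by (rule integrable_restrict_space) simp

lemma nn_integral_MQ: "(\<integral>\<^sup>+\<xi>. f \<xi> \<partial>MQ) = (\<integral>\<^sup>+\<xi>\<in>Q. f \<xi> \<partial>lborel)"
  by (rule nn_integral_restrict_space) simp

lemma MQ_measurable: "f \<in> borel_measurable borel \<Longrightarrow> f \<in> borel_measurable MQ"
  by (rule measurable_restrict_space1) simp

lemma finite_measure_MQ: "finite_measure (MQ :: (real ^ 'd::finite) measure)"
  by (rule finite_measureI) (simp add: space_MQ emeasure_restrict_space emeasure_Q)

lemma integrable_MQ_bounded:
  fixes f :: "real ^ 'd::finite \<Rightarrow> 'b::{banach, second_countable_topology}"
  assumes "f \<in> borel_measurable borel" "\<And>x. norm (f x) \<le> B"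
  shows "integrable MQ f"
  by (rule finite_measure.integrable_const_bound[OF finite_measure_MQ AE_I2[OF assms(2)] MQ_measurable[OF assms(1)]])

lemma measure_MQ: "(LINT \<xi>|(MQ :: (real ^ 'd::finite) measure). c) = (2 * pi) ^ CARD('d) *\<^sub>R c" for c :: complex
proof -
  have "measure (MQ :: (real ^ 'd) measure) (space MQ) = (2 * pi) ^ CARD('d)"
    unfolding measure_def by (simp add: space_MQ emeasure_restrict_space emeasure_Q)
  then show ?thesis by (simp add: lebesgue_integral_const)
qed

text \<open>Cutting F off to the translated cell gives a function \<open>J\<close> whose
  periodization is F, since every orbit meets that cell exactly once. Tiling then identifies the
  integral of \<open>J\<close> with that of F over Q.\<close>

lemma MQ_integral_translate:
  fixes F :: "real ^ 'd::finite \<Rightarrow> complex"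
  assumes [measurable]: "F \<in> borel_measurable borel" and B: "\<And>\<xi>. norm (F \<xi>) \<le> B" and per: "\<And>\<xi> l. F (lshift l \<xi>) = F \<xi>"
  shows "(LINT \<xi>|MQ. F (\<xi> + t)) = (LINT \<xi>|MQ. F \<xi>)"
proof -
  define J where "J \<xi> = indicator Q (\<xi> - t) *\<^sub>R F \<xi>" for \<xi>
  have [measurable]: "J \<in> borel_measurable borel" unfolding J_def by measurable
  have Je: "J (t + 1 *\<^sub>R \<xi>) = indicator Q \<xi> *\<^sub>R F (\<xi> + t)" for \<xi> by (simp add: J_def add.commute)
  have i: "integrable lborel (\<lambda>\<xi>. indicator Q \<xi> *\<^sub>R F (\<xi> + t))"
    using integrable_MQ_bounded[of "\<lambda>\<xi>. F (\<xi> + t)" B] B by (simp add: integrable_MQ)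
  have "integrable lborel J"
    using integrable_affine[OF i, of 1 "- t"] by (simp add: J_def[abs_def])
  from integral_tile(3)[OF this]
  have "(LINT \<xi>|lborel. J \<xi>) = (LINT \<xi>|lborel. indicator Q \<xi> *\<^sub>R per J \<xi>)" by simp
  also have "per J = F"
  proof
    fix \<xi> :: "real ^ 'd"
    have "\<exists>l0. \<forall>l. lshift l (\<xi> - t) \<in> Q \<longleftrightarrow> l = l0" using Q_ex1[of "\<xi> - t"] by metis
    then obtain l0 where l0: "\<And>l. lshift l (\<xi> - t) \<in> Q \<longleftrightarrow> l = l0" by blast
    have "J (lshift l \<xi>) = (if lshift l (\<xi> - t) \<in> Q then F \<xi> else 0)" for l
    proof -
      have "lshift l \<xi> - t = lshift l (\<xi> - t)" by simp
      then show ?thesis unfolding J_def per by (simp only: indicator_def) simp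
    qed
    then show "per J \<xi> = F \<xi>"
      unfolding per_def using integral_lattice_single[of "\<lambda>l. lshift l (\<xi> - t) \<in> Q" l0 "F \<xi>"] l0 by simp
  qed
  finally have "(LINT \<xi>|lborel. J \<xi>) = (LINT \<xi>|MQ. F \<xi>)" by (simp add: integral_MQ)
  moreover have "(LINT \<xi>|lborel. J \<xi>) = (LINT \<xi>|MQ. F (\<xi> + t))"
    by (subst integral_affine[of J 1 t]) (auto simp only: Je integral_MQ, auto)
  ultimately show ?thesis by simp
qed

text \<open>A translation by t with (m - n) \<bullet> t = pi changes the sign of the integrand but
  not the integral, which therefore vanishes. No integral of a nontrivial character is
  computed.\<close>

lemma chr_orthogonal:
  "(LINT \<xi>|MQ. chr n \<xi> * cnj (chr m \<xi>)) = (if n = m then of_real ((2 * pi) ^ CARD('d)) else 0)"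
  for n m :: "int ^ 'd::finite"
proof (cases "n = m")
  case True
  then show ?thesis using measure_MQ[of 1, where 'd='d] by (simp add: cis_cnj cis_mult scaleR_conv_of_real)
next
  case False
  then obtain i where "m $ i \<noteq> n $ i" by (metis vec_eq_iff)
  then have i: "(m - n) $ i \<noteq> 0" by simp
  define k where "k = m - n"
  define t :: "real ^ 'd" where "t = axis i (pi / real_of_int (k $ i))"
  let ?I = "LINT \<xi>|MQ. cis (lat k \<bullet> \<xi>)"
  have eq: "chr n \<xi> * cnj (chr m \<xi>) = cis (lat k \<bullet> \<xi>)" for \<xi>
    by (simp add: cis_cnj cis_mult k_def lat_simps inner_diff_left)
  have "lat k \<bullet> t = pi" using i by (simp add: t_def inner_axis lat_def k_def)
  then have "cis (lat k \<bullet> (\<xi> + t)) = - cis (lat k \<bullet> \<xi>)" for \<xi>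
    by (simp add: inner_add_right flip: cis_mult)
  moreover have "(LINT \<xi>|MQ. cis (lat k \<bullet> (\<xi> + t))) = ?I"
    by (rule MQ_integral_translate[where B=1]) (auto simp only: cis_lat_lshift, auto)
  ultimately have "- ?I = ?I" by simp
  then have "?I = 0" by simp
  then show ?thesis using False by (simp add: eq)
qed

lemma square_integrable_MQ_imp_integrable:
  fixes V :: "real ^ 'd::finite \<Rightarrow> complex"
  assumes [measurable]: "V \<in> borel_measurable borel" and V: "integrable MQ (\<lambda>\<xi>. (norm (V \<xi>))\<^sup>2)"
    and [measurable]: "g \<in> borel_measurable borel" and g: "\<And>x. norm (g x :: complex) \<le> B"
  shows "integrable MQ (\<lambda>\<xi>. V \<xi> * g \<xi>)"
proof (rule Bochner_Integration.integrable_bound)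
  show "integrable MQ (\<lambda>\<xi>. (1 + (norm (V \<xi>))\<^sup>2) * B)"
    by (rule integrable_mult_left[OF Bochner_Integration.integrable_add[OF integrable_MQ_bounded[where B=1] V]]) auto
  show "AE \<xi> in MQ. norm (V \<xi> * g \<xi>) \<le> norm ((1 + (norm (V \<xi>))\<^sup>2) * B)"
  proof (rule AE_I2)
    fix \<xi>
    have "norm (V \<xi>) \<le> 1 + (norm (V \<xi>))\<^sup>2"
      using zero_le_power2[of "norm (V \<xi>) - 1"] by (simp add: power2_diff)
        (smt (verit) norm_ge_zero)
    then have "norm (V \<xi> * g \<xi>) \<le> (1 + (norm (V \<xi>))\<^sup>2) * B"
      unfolding norm_mult using g[of \<xi>] by (intro mult_mono) auto
    then show "norm (V \<xi> * g \<xi>) \<le> norm ((1 + (norm (V \<xi>))\<^sup>2) * B)" by simp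
  qed
qed (auto intro!: MQ_measurable)

text \<open>One expansion with two uses: for arbitrary coefficients it shows that the Fourier
  coefficients are the best choice, and for the Fourier coefficients themselves it is Bessel's
  inequality.\<close>

lemma square_dist_trig:
  fixes V :: "real ^ 'd::finite \<Rightarrow> complex"
  assumes V [measurable]: "V \<in> borel_measurable borel" and Vi: "integrable MQ (\<lambda>\<xi>. (norm (V \<xi>))\<^sup>2)" and F: "finite F"
  shows "(LINT \<xi>|MQ. (norm (V \<xi> - (\<Sum>n\<in>F. a n * chr n \<xi>)))\<^sup>2) =
    (LINT \<xi>|MQ. (norm (V \<xi>))\<^sup>2) - (2 * pi) ^ CARD('d) * (\<Sum>n\<in>F. (norm (fcoef V n))\<^sup>2)
      + (2 * pi) ^ CARD('d) * (\<Sum>n\<in>F. (norm (a n - fcoef V n))\<^sup>2)"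
proof -
  let ?D = "complex_of_real ((2 * pi) ^ CARD('d))"
  let ?P = "\<lambda>\<xi>. \<Sum>n\<in>F. a n * chr n \<xi>"
  have D0: "?D \<noteq> 0" by simp
  have Pb: "norm (?P \<xi>) \<le> (\<Sum>n\<in>F. norm (a n))" for \<xi>
    by (rule order_trans[OF norm_sum]) (simp add: norm_mult)
  have Pm [measurable]: "?P \<in> borel_measurable borel" by measurable
  have c: "(LINT \<xi>|MQ. V \<xi> * cnj (chr n \<xi>)) = ?D * fcoef V n" for n
    unfolding fcoef_def using D0 by simp
  have iV: "integrable MQ (\<lambda>\<xi>. V \<xi> * cnj (chr n \<xi>))" for n
    by (rule square_integrable_MQ_imp_integrable[OF V Vi, where B=1]) auto
  have 1: "(LINT \<xi>|MQ. V \<xi> * cnj (?P \<xi>)) = (\<Sum>n\<in>F. ?D * (cnj (a n) * fcoef V n))"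
  proof -
    have "(LINT \<xi>|MQ. V \<xi> * cnj (?P \<xi>)) = (LINT \<xi>|MQ. (\<Sum>n\<in>F. cnj (a n) * (V \<xi> * cnj (chr n \<xi>))))"
      by (simp add: sum_distrib_left algebra_simps)
    also have "\<dots> = (\<Sum>n\<in>F. cnj (a n) * (LINT \<xi>|MQ. V \<xi> * cnj (chr n \<xi>)))"
      by (subst Bochner_Integration.integral_sum) (use iV in \<open>auto intro!: integrable_mult_right\<close>)
    finally show ?thesis by (simp add: c algebra_simps)
  qed
  have 2: "(LINT \<xi>|MQ. ?P \<xi> * cnj (V \<xi>)) = (\<Sum>n\<in>F. ?D * (a n * cnj (fcoef V n)))"
  proof -
    have "(LINT \<xi>|MQ. ?P \<xi> * cnj (V \<xi>)) = cnj (LINT \<xi>|MQ. V \<xi> * cnj (?P \<xi>))"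
      by (subst Bochner_Integration.integral_cnj[symmetric]) (simp add: mult.commute)
    then show ?thesis unfolding 1 by (simp add: cnj_sum)
  qed
  have 3: "(LINT \<xi>|MQ. ?P \<xi> * cnj (?P \<xi>)) = (\<Sum>n\<in>F. ?D * (a n * cnj (a n)))"
  proof -
    have "(LINT \<xi>|MQ. ?P \<xi> * cnj (?P \<xi>)) = (LINT \<xi>|MQ. (\<Sum>n\<in>F. \<Sum>m\<in>F. (a n * cnj (a m)) * (chr n \<xi> * cnj (chr m \<xi>))))"
      by (simp add: sum_product algebra_simps)
    also have "\<dots> = (\<Sum>n\<in>F. \<Sum>m\<in>F. (a n * cnj (a m)) * (LINT \<xi>|MQ. chr n \<xi> * cnj (chr m \<xi>)))"
    proof -
      have i: "integrable MQ (\<lambda>\<xi>. (a n * cnj (a m)) * (chr n \<xi> * cnj (chr m \<xi>)))" for n m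
        by (intro integrable_mult_right integrable_MQ_bounded[where B=1]) (auto simp: norm_mult)
      show ?thesis
        by (subst Bochner_Integration.integral_sum, intro Bochner_Integration.integrable_sum i,
            subst Bochner_Integration.integral_sum, rule i, simp)
    qed
    also have "\<dots> = (\<Sum>n\<in>F. \<Sum>m\<in>F. if n = m then ?D * (a n * cnj (a n)) else 0)"
      unfolding chr_orthogonal by (intro sum.cong refl) auto
    also have "\<dots> = (\<Sum>n\<in>F. ?D * (a n * cnj (a n)))" using F by (intro sum.cong refl) (subst sum.delta'; simp)
    finally show ?thesis .
  qed
  have i1: "integrable MQ (\<lambda>\<xi>. V \<xi> * cnj (V \<xi>))"
  proof -
    have "integrable MQ (\<lambda>\<xi>. complex_of_real ((norm (V \<xi>))\<^sup>2))" using Vi by (rule integrable_of_real)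
    then show ?thesis by (simp only: complex_norm_square)
  qed
  have i2: "integrable MQ (\<lambda>\<xi>. V \<xi> * cnj (?P \<xi>))"
    by (rule square_integrable_MQ_imp_integrable[OF V Vi, where B="\<Sum>n\<in>F. norm (a n)"]) (use Pb in \<open>auto simp del: complex_cnj_mult cnj_sum\<close>)
  have i3: "integrable MQ (\<lambda>\<xi>. ?P \<xi> * cnj (V \<xi>))"
    using integrable_cnj[OF i2] by (simp add: mult.commute)
  have i4: "integrable MQ (\<lambda>\<xi>. ?P \<xi> * cnj (?P \<xi>))"
  proof (rule integrable_MQ_bounded)
    show "norm (?P \<xi> * cnj (?P \<xi>)) \<le> (\<Sum>n\<in>F. norm (a n)) * (\<Sum>n\<in>F. norm (a n))" for \<xi>
      unfolding norm_mult complex_mod_cnj by (intro mult_mono Pb) (auto intro: sum_nonneg)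
  qed measurable
  have "complex_of_real (LINT \<xi>|MQ. (norm (V \<xi> - ?P \<xi>))\<^sup>2) = (LINT \<xi>|MQ. (V \<xi> * cnj (V \<xi>) - V \<xi> * cnj (?P \<xi>)) - (?P \<xi> * cnj (V \<xi>) - ?P \<xi> * cnj (?P \<xi>)))"
  proof -
    have "complex_of_real ((norm (v - p))\<^sup>2) = (v * cnj v - v * cnj p) - (p * cnj v - p * cnj p)" for v p
      unfolding complex_norm_square by (simp add: algebra_simps)
    then show ?thesis by (simp only: integral_complex_of_real[symmetric])
  qed
  also have "\<dots> = (LINT \<xi>|MQ. V \<xi> * cnj (V \<xi>)) - (LINT \<xi>|MQ. V \<xi> * cnj (?P \<xi>)) - ((LINT \<xi>|MQ. ?P \<xi> * cnj (V \<xi>)) - (LINT \<xi>|MQ. ?P \<xi> * cnj (?P \<xi>)))"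
    by (simp only: Bochner_Integration.integral_diff i1 i2 i3 i4 Bochner_Integration.integrable_diff)
  also have "(LINT \<xi>|MQ. V \<xi> * cnj (V \<xi>)) = complex_of_real (LINT \<xi>|MQ. (norm (V \<xi>))\<^sup>2)"
    by (simp only: complex_norm_square integral_complex_of_real[symmetric])
  finally have A: "complex_of_real (LINT \<xi>|MQ. (norm (V \<xi> - ?P \<xi>))\<^sup>2) = complex_of_real (LINT \<xi>|MQ. (norm (V \<xi>))\<^sup>2)
      - (\<Sum>n\<in>F. ?D * (cnj (a n) * fcoef V n)) - ((\<Sum>n\<in>F. ?D * (a n * cnj (fcoef V n))) - (\<Sum>n\<in>F. ?D * (a n * cnj (a n))))"
    unfolding 1 2 3 .
  have B: "complex_of_real ((2 * pi) ^ CARD('d) * (\<Sum>n\<in>F. (norm (a n - fcoef V n))\<^sup>2) - (2 * pi) ^ CARD('d) * (\<Sum>n\<in>F. (norm (fcoef V n))\<^sup>2))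
      = (\<Sum>n\<in>F. ?D * (a n * cnj (a n))) - (\<Sum>n\<in>F. ?D * (a n * cnj (fcoef V n))) - (\<Sum>n\<in>F. ?D * (cnj (a n) * fcoef V n))"
  proof -
    have "complex_of_real ((2 * pi) ^ CARD('d) * (\<Sum>n\<in>F. (norm (a n - fcoef V n))\<^sup>2) - (2 * pi) ^ CARD('d) * (\<Sum>n\<in>F. (norm (fcoef V n))\<^sup>2))
      = ?D * (\<Sum>n\<in>F. complex_of_real ((norm (a n - fcoef V n))\<^sup>2)) - ?D * (\<Sum>n\<in>F. complex_of_real ((norm (fcoef V n))\<^sup>2))"
      by (simp only: of_real_diff of_real_mult of_real_sum)
    also have "\<dots> = (\<Sum>n\<in>F. ?D * ((a n - fcoef V n) * cnj (a n - fcoef V n)) - ?D * (fcoef V n * cnj (fcoef V n)))"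
      unfolding complex_norm_square sum_distrib_left sum_subtractf ..
    also have "\<dots> = (\<Sum>n\<in>F. ?D * (a n * cnj (a n)) - ?D * (a n * cnj (fcoef V n)) - ?D * (cnj (a n) * fcoef V n))"
      by (intro sum.cong refl) (simp only: complex_cnj_diff, simp only: ring_distribs, simp add: mult.commute)
    finally show ?thesis by (simp only: sum_subtractf)
  qed
  have "complex_of_real (LINT \<xi>|MQ. (norm (V \<xi> - ?P \<xi>))\<^sup>2) = complex_of_real ((LINT \<xi>|MQ. (norm (V \<xi>))\<^sup>2)
      + ((2 * pi) ^ CARD('d) * (\<Sum>n\<in>F. (norm (a n - fcoef V n))\<^sup>2) - (2 * pi) ^ CARD('d) * (\<Sum>n\<in>F. (norm (fcoef V n))\<^sup>2)))"
    unfolding A of_real_add[of "LINT \<xi>|MQ. (norm (V \<xi>))\<^sup>2"] B by (simp only: algebra_simps)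
  then show ?thesis by (simp only: of_real_eq_iff)
qed

section \<open>Density of trigonometric polynomials in the square integrable functions on the
  cell\<close>

definition monochr :: "(real ^ 'd::finite \<Rightarrow> complex) \<Rightarrow> bool" where
  "monochr f \<longleftrightarrow> (\<exists>c n. f = (\<lambda>\<xi>. c * chr n \<xi>))"

lemma monochrI: "monochr (\<lambda>\<xi>. c * chr n \<xi>)"
  unfolding monochr_def by (intro exI) (rule refl)

lemma monochrE:
  assumes "monochr f" obtains c n where "f = (\<lambda>\<xi>. c * chr n \<xi>)"
  using assms unfolding monochr_def by blast

lemma fspan_monochr_sum:
  "fspan monochr f \<Longrightarrow> \<exists>F a. finite F \<and> f = (\<lambda>\<xi>. \<Sum>n\<in>F. a n * chr n \<xi>)"
proof (induction rule: fspan.induct)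
  case zero
  show ?case by (intro exI[of _ "{}"]) simp
next
  case (add f g)
  obtain c m where f: "f = (\<lambda>\<xi>. c * chr m \<xi>)" using add(1) by (rule monochrE)
  obtain F a where g: "finite F" "g = (\<lambda>\<xi>. \<Sum>n\<in>F. a n * chr n \<xi>)" using add(3) by blast
  \<comment> \<open>The new frequency m may already occur in F; then the two coefficients
    add.\<close>
  define b where "b n = (if n \<in> F then a n else 0) + (if n = m then c else 0)" for n
  have "(\<Sum>n\<in>insert m F. b n * chr n \<xi>) = c * chr m \<xi> + (\<Sum>n\<in>F. a n * chr n \<xi>)" for \<xi>
  proof -
    have "(\<Sum>n\<in>insert m F. b n * chr n \<xi>) = (\<Sum>n\<in>insert m F. (if n \<in> F then a n * chr n \<xi> else 0)) + (\<Sum>n\<in>insert m F. (if n = m then c * chr n \<xi> else 0))"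
      unfolding sum.distrib[symmetric] b_def by (intro sum.cong refl) (auto simp: algebra_simps)
    also have "(\<Sum>n\<in>insert m F. (if n \<in> F then a n * chr n \<xi> else 0)) = (\<Sum>n\<in>F. a n * chr n \<xi>)"
      using g(1) by (intro sum.mono_neutral_cong_right) auto
    also have "(\<Sum>n\<in>insert m F. (if n = m then c * chr n \<xi> else 0)) = c * chr m \<xi>"
      using g(1) by (subst sum.delta) auto
    finally show ?thesis by simp
  qed
  then show ?case unfolding f g(2) using g(1) by (intro exI[of _ "insert m F"] exI[of _ b]) auto
qed

lemma fspan_mult:
  assumes P: "\<And>f g. P f \<Longrightarrow> P g \<Longrightarrow> P (\<lambda>x. f x * g x)"
  shows "fspan P f \<Longrightarrow> fspan P g \<Longrightarrow> fspan P (\<lambda>x. f x * g x)"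
proof (induction rule: fspan.induct)
  case zero
  show ?case by (simp add: fspan.zero)
next
  case (add f h)
  have "fspan P (\<lambda>x. f x * g x)" using add(4)
  proof (induction rule: fspan.induct)
    case zero
    show ?case by (simp add: fspan.zero)
  next
    case (add g k)
    have "fspan P (\<lambda>x. f x * g x + f x * k x)" by (intro fspan.add P add \<open>P f\<close>)
    then show ?case by (simp add: algebra_simps)
  qed
  from fspan_add[OF this add(3)[OF add(4)]] show ?case by (simp add: algebra_simps)
qed

lemma monochr_mult:
  assumes "monochr f" "monochr g" shows "monochr (\<lambda>x. f x * g x)"
proof -
  obtain c n where f: "f = (\<lambda>\<xi>. c * chr n \<xi>)" using assms(1) by (rule monochrE)
  obtain d m where g: "g = (\<lambda>\<xi>. d * chr m \<xi>)" using assms(2) by (rule monochrE)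
  have "chr n x * chr m x = chr (n + m) x" for x by (simp add: cis_mult lat_simps inner_add_left)
  then have "(c * chr n x) * (d * chr m x) = (c * d) * chr (n + m) x" for x by (metis mult.assoc mult.left_commute)
  with f g have "(\<lambda>x. f x * g x) = (\<lambda>\<xi>. (c * d) * chr (n + m) \<xi>)"
    by (simp only:)
  then show ?thesis by (simp only: monochrI)
qed

lemma monochr_span_mult: "fspan monochr f \<Longrightarrow> fspan monochr g \<Longrightarrow> fspan monochr (\<lambda>x. f x * g x)"
  by (rule fspan_mult[where P=monochr]) (rule monochr_mult)

text \<open>Realises the torus as a compact subset of complex d-space, where polynomial
  Stone-Weierstrass applies. Polynomials in the real coordinates there are polynomials in cosines
  and sines, that is, trigonometric polynomials.\<close>

definition torus_emb :: "real ^ 'd::finite \<Rightarrow> complex ^ 'd" where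
  "torus_emb \<xi> = (\<chi> i. cis (\<xi> $ i))"

lemma fspan_monochr_cmult: "fspan monochr f \<Longrightarrow> fspan monochr (\<lambda>x. c * f x)"
proof -
  assume f: "fspan monochr f"
  have "monochr (\<lambda>\<xi>. c * chr 0 \<xi>)" by (rule monochrI)
  then have "fspan monochr (\<lambda>\<xi>. c * chr 0 \<xi>)" by (rule fspan_base)
  then have "fspan monochr (\<lambda>x. c * chr 0 x * f x)" by (rule monochr_span_mult) (rule f)
  then show ?thesis by (simp only: lat_simps inner_zero_left minus_zero cis_zero mult_1_right)
qed

lemma fspan_monochr_cis: "fspan monochr (\<lambda>\<xi>. cis (\<xi> $ i))" "fspan monochr (\<lambda>\<xi>. cis (- (\<xi> $ i)))"
proof -
  have "lat (axis i 1) \<bullet> \<xi> = \<xi> $ i" for \<xi> :: "real ^ 'a"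
  proof -
    have "lat (axis i 1) = axis i (1::real)" by (simp add: lat_def axis_def vec_eq_iff)
    then show ?thesis by (simp add: inner_axis' )
  qed
  then have "(\<lambda>\<xi>. cis (\<xi> $ i)) = (\<lambda>\<xi>. 1 * chr (- axis i 1) \<xi>)" "(\<lambda>\<xi>. cis (- (\<xi> $ i))) = (\<lambda>\<xi>. 1 * chr (axis i 1) \<xi>)"
    by (auto simp: lat_simps)
  then have "monochr (\<lambda>\<xi>. cis (\<xi> $ i))" "monochr (\<lambda>\<xi>. cis (- (\<xi> $ i)))" by (simp_all only: monochrI)
  then show "fspan monochr (\<lambda>\<xi>. cis (\<xi> $ i))" "fspan monochr (\<lambda>\<xi>. cis (- (\<xi> $ i)))"
    by (simp_all only: fspan_base)
qed

lemma real_polynomial_torus: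
  assumes "real_polynomial_function p"
  shows "fspan monochr (\<lambda>\<xi>. of_real (p (torus_emb \<xi>)))"
  using assms
proof induction
  case (linear p)
  have lin: "linear p" using linear by (rule bounded_linear.linear)
  have b: "fspan monochr (\<lambda>\<xi>. of_real (torus_emb \<xi> \<bullet> b))" if bB: "b \<in> Basis" for b :: "complex ^ 'a"
  proof -
    obtain i u where iu: "b = axis i u" "u \<in> Basis" using bB by (auto simp: Basis_vec_def)
    have cR: "complex_of_real (cos t) = (1/2) * cis t + (1/2) * cis (- t)"
      and cI: "complex_of_real (sin t) = (- \<i>/2) * cis t + (\<i>/2) * cis (- t)" for t
      by (simp_all add: complex_eq_iff)
    have tt: "torus_emb \<xi> \<bullet> b = cis (\<xi> $ i) \<bullet> u" for \<xi> by (simp add: iu(1) inner_axis torus_emb_def)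
    from iu(2) have "u = 1 \<or> u = \<i>" by (auto simp: Basis_complex_def)
    then show ?thesis
    proof
      assume "u = 1"
      then have "(\<lambda>\<xi>. complex_of_real (torus_emb \<xi> \<bullet> b)) = (\<lambda>\<xi>. (1/2) * cis (\<xi> $ i) + (1/2) * cis (- (\<xi> $ i)))"
        by (simp add: tt inner_complex_def fun_eq_iff cR)
      then show ?thesis
        by (simp only: fspan_add[OF fspan_monochr_cmult[OF fspan_monochr_cis(1)] fspan_monochr_cmult[OF fspan_monochr_cis(2)]])
    next
      assume "u = \<i>"
      then have "(\<lambda>\<xi>. complex_of_real (torus_emb \<xi> \<bullet> b)) = (\<lambda>\<xi>. (- \<i>/2) * cis (\<xi> $ i) + (\<i>/2) * cis (- (\<xi> $ i)))"
        by (simp add: tt inner_complex_def fun_eq_iff cI)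
      then show ?thesis
        by (simp only: fspan_add[OF fspan_monochr_cmult[OF fspan_monochr_cis(1)] fspan_monochr_cmult[OF fspan_monochr_cis(2)]])
    qed
  qed
  have "p z = (\<Sum>b\<in>Basis. p b * (z \<bullet> b))" for z
  proof -
    have "p z = p (\<Sum>b\<in>Basis. (z \<bullet> b) *\<^sub>R b)" by (simp add: euclidean_representation)
    then show ?thesis by (simp add: linear_sum[OF lin] linear_scale[OF lin] mult.commute)
  qed
  note pz = this
  have "(\<lambda>\<xi>. complex_of_real (p (torus_emb \<xi>))) = (\<lambda>\<xi>. \<Sum>b\<in>Basis. of_real (p b) * of_real (torus_emb \<xi> \<bullet> b))"
    by (subst pz) (simp only: of_real_sum of_real_mult)
  moreover have "fspan monochr (\<lambda>\<xi>::real ^ 'a. \<Sum>b\<in>Basis. of_real (p b) * of_real (torus_emb \<xi> \<bullet> b))"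
  proof (rule fspan_sum[where P=monochr and f="\<lambda>b \<xi>. of_real (p b) * of_real (torus_emb \<xi> \<bullet> b)"])
    fix v :: "complex ^ 'a" assume "v \<in> Basis"
    from fspan_monochr_cmult[OF b[OF this], of "of_real (p v)"]
    show "fspan monochr (\<lambda>\<xi>::real ^ 'a. of_real (p v) * of_real (torus_emb \<xi> \<bullet> v))" .
  qed simp
  ultimately show ?case by (simp only:)
next
  case (const c)
  have "monochr (\<lambda>\<xi>. of_real c * chr 0 \<xi>)" by (rule monochrI)
  then have "fspan monochr (\<lambda>\<xi>. of_real c * chr 0 \<xi>)" by (rule fspan_base)
  then show ?case by (simp only: lat_simps inner_zero_left minus_zero cis_zero mult_1_right)
next
  case (add f g)
  show ?case unfolding of_real_add by (rule fspan_add[OF add(3,4)])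
next
  case (mult f g)
  show ?case unfolding of_real_mult by (rule monochr_span_mult[OF mult(3,4)])
qed

text \<open>A continuous function vanishing on the boundary of the closed cube is constant on the fibres of
  the quotient map onto the torus, so it descends to a continuous function there.\<close>
lemma trig_approx_continuous:
  fixes q :: "real ^ 'd::finite \<Rightarrow> complex"
  assumes q: "continuous_on UNIV q" and q0: "\<And>\<xi> i. pi \<le> \<bar>\<xi> $ i\<bar> \<Longrightarrow> q \<xi> = 0" and e: "e > 0"
  obtains F a where "finite F" "\<And>\<xi>. \<xi> \<in> Q \<Longrightarrow> norm (q \<xi> - (\<Sum>n\<in>F. a n * chr n \<xi>)) < e"
proof -
  define K where "K = cbox (vec (- pi)) (vec pi :: real ^ 'd)"
  have K: "\<xi> \<in> K \<longleftrightarrow> (\<forall>i. \<bar>\<xi> $ i\<bar> \<le> pi)" for \<xi>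
    by (auto simp: K_def mem_box_cart abs_le_iff minus_le_iff)
  have Kc: "compact K" by (simp add: K_def compact_cbox)
  let ?E = torus_emb
  have Ec: "continuous_on K ?E" unfolding torus_emb_def
    by (intro continuous_on_vec_lambda continuous_intros)
  define G where "G z = q (inv_into K ?E z)" for z
  have GE: "G (?E x) = q x" if x: "x \<in> K" for x
  proof -
    define y where "y = inv_into K ?E (?E x)"
    have y: "y \<in> K" "?E y = ?E x" unfolding y_def using x by (auto intro: inv_into_into f_inv_into_f)
    show ?thesis
    proof (cases "x = y")
      \<comment> \<open>Two different points of the closed cube in one fibre differ in some
        coordinate by a nonzero multiple of 2 pi. So they lie on opposite faces, where q
        vanishes.\<close>
      case False
      then obtain i where i: "x $ i \<noteq> y $ i" by (auto simp: vec_eq_iff)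
      have "cis (x $ i) = cis (y $ i)" using y(2) by (simp add: torus_emb_def vec_eq_iff)
      then have "cis (x $ i - y $ i) = 1" by (simp add: cis_divide[symmetric])
      then have "cos (x $ i - y $ i) = 1" by (metis cis.sel(1) one_complex.sel(1))
      then obtain n :: int where n: "x $ i - y $ i = of_int n * 2 * pi" using cos_one_2pi_int by blast
      have le: "\<bar>x $ i\<bar> \<le> pi" "\<bar>y $ i\<bar> \<le> pi" using x y K by auto
      have "n \<noteq> 0" using i n by auto
      then have "1 \<le> \<bar>real_of_int n\<bar>" by linarith
      then have "2 * pi \<le> \<bar>x $ i - y $ i\<bar>" unfolding n by (simp add: abs_mult)
      then have "pi \<le> \<bar>x $ i\<bar>" "pi \<le> \<bar>y $ i\<bar>" using le by linarith+
      then have "q x = 0" "q y = 0" using q0 by auto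
      then show ?thesis by (simp add: G_def y_def)
    qed (simp add: G_def y_def)
  qed
  have "continuous_on (?E ` K) G"
  \<comment> \<open>No continuous inverse of \<open>torus_emb\<close> is used: the graph of
    \<open>G\<close> is the image of the compact cube under a continuous map, hence closed, and
    \<open>G\<close> takes values in a compact set.\<close>
  proof (rule continuous_from_closed_graph)
    show "compact (q ` K)" by (intro compact_continuous_image continuous_on_subset[OF q] Kc) auto
    show "G \<in> ?E ` K \<rightarrow> q ` K" using GE by auto
    have "(\<lambda>z. (z, G z)) ` ?E ` K = (\<lambda>x. (?E x, q x)) ` K" using GE by (auto simp: image_image)
    moreover have "compact ((\<lambda>x. (?E x, q x)) ` K)"
      by (intro compact_continuous_image continuous_on_Pair Ec continuous_on_subset[OF q] Kc) auto
    ultimately show "closed ((\<lambda>z. (z, G z)) ` ?E ` K)" by (simp add: compact_imp_closed)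
  qed
  then obtain g where g: "polynomial_function g" "\<And>z. z \<in> ?E ` K \<Longrightarrow> norm (G z - g z) < e"
    using Stone_Weierstrass_polynomial_function[OF compact_continuous_image[OF Ec Kc] _ e, of G] by blast
  have "real_polynomial_function (Re \<circ> g)" "real_polynomial_function (Im \<circ> g)"
    using g(1) bounded_linear_Re bounded_linear_Im unfolding polynomial_function_def by blast+
  from fspan_add[OF real_polynomial_torus[OF this(1)] fspan_monochr_cmult[OF real_polynomial_torus[OF this(2)], of \<i>]]
  have "fspan monochr (\<lambda>\<xi>. of_real ((Re \<circ> g) (?E \<xi>)) + \<i> * of_real ((Im \<circ> g) (?E \<xi>)))" .
  moreover have "(\<lambda>\<xi>. of_real ((Re \<circ> g) (?E \<xi>)) + \<i> * of_real ((Im \<circ> g) (?E \<xi>))) = (\<lambda>\<xi>. g (?E \<xi>))"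
    by (simp add: fun_eq_iff complex_eq_iff)
  ultimately have "fspan monochr (\<lambda>\<xi>. g (?E \<xi>))" by simp
  from fspan_monochr_sum[OF this] obtain F a where F: "finite F" "(\<lambda>\<xi>. g (?E \<xi>)) = (\<lambda>\<xi>. \<Sum>n\<in>F. a n * chr n \<xi>)" by blast
  show ?thesis
  proof (rule that[OF F(1)])
    fix \<xi> :: "real ^ 'd" assume "\<xi> \<in> Q"
    then have "\<xi> \<in> K" by (auto simp: K Q_def abs_le_iff less_imp_le minus_le_iff)
    then show "norm (q \<xi> - (\<Sum>n\<in>F. a n * chr n \<xi>)) < e"
      using g(2)[of "?E \<xi>"] GE[of \<xi>] fun_cong[OF F(2), of \<xi>] by auto
  qed
qed

text \<open>Three approximations in a row: V is truncated in size and to the open cube, then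
  replaced by a continuous function vanishing off the cube, then by a trigonometric polynomial
  uniformly close on Q. The part of Q outside the open cube consists of faces and is a null
  set.\<close>

lemma trig_dense:
  fixes V :: "real ^ 'd::finite \<Rightarrow> complex"
  assumes V [measurable]: "V \<in> borel_measurable borel" and Vi: "integrable MQ (\<lambda>\<xi>. (norm (V \<xi>))\<^sup>2)" and e: "e > 0"
  obtains F a where "finite F" "(LINT \<xi>|MQ. (norm (V \<xi> - (\<Sum>n\<in>F. a n * chr n \<xi>)))\<^sup>2) < e"
proof -
  define S where "S = box (vec (- pi)) (vec pi :: real ^ 'd)"
  have S: "\<xi> \<in> S \<longleftrightarrow> (\<forall>i. \<bar>\<xi> $ i\<bar> < pi)" for \<xi>
    by (auto simp: S_def mem_box_cart abs_less_iff minus_less_iff)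
  have Sm [measurable]: "S \<in> sets borel" by (simp add: S_def)
  have AES: "AE \<xi> in MQ. \<xi> \<in> S"
  proof -
    have "AE \<xi> in lborel. \<forall>b\<in>(Basis :: (real ^ 'd) set). \<xi> \<bullet> b \<noteq> - pi"
      using AE_lborel_inner_neq by (subst AE_ball_countable) (auto intro: countable_finite)
    then have "AE \<xi> in (lborel :: (real ^ 'd) measure). \<xi> \<in> Q \<longrightarrow> \<xi> \<in> S"
    proof eventually_elim
      fix \<xi> :: "real ^ 'd" assume h: "\<forall>b\<in>Basis. \<xi> \<bullet> b \<noteq> - pi"
      have "\<xi> $ i \<noteq> - pi" for i using h[rule_format, of "axis i 1"] by (simp add: axis_in_Basis_iff inner_axis)
      then show "\<xi> \<in> Q \<longrightarrow> \<xi> \<in> S" by (auto simp: S Q_def abs_less_iff) (metis less_eq_real_def minus_less_iff)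
    qed
    then show ?thesis by (subst AE_restrict_space_iff) auto
  qed
  define W where "W = (\<lambda>N::nat. \<lambda>\<xi>. if norm (V \<xi>) \<le> real N \<and> \<xi> \<in> S then V \<xi> else 0)"
  have Wm [measurable]: "W N \<in> borel_measurable borel" for N unfolding W_def by measurable
  have "(\<lambda>N. LINT \<xi>|MQ. (norm (V \<xi> - W N \<xi>))\<^sup>2) \<longlonglongrightarrow> (LINT \<xi>|(MQ :: (real ^ 'd) measure). 0)"
  proof (rule integral_dominated_convergence[where w="\<lambda>\<xi>. (norm (V \<xi>))\<^sup>2"])
    show "AE \<xi> in MQ. norm ((norm (V \<xi> - W N \<xi>))\<^sup>2) \<le> (norm (V \<xi>))\<^sup>2" for N by (auto simp: W_def)
    show "AE \<xi> in MQ. (\<lambda>N. (norm (V \<xi> - W N \<xi>))\<^sup>2) \<longlonglongrightarrow> 0"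
      using AES
    proof eventually_elim
      fix \<xi> assume "\<xi> \<in> S"
      obtain M where M: "norm (V \<xi>) \<le> real M" using real_arch_simple by blast
      have "\<forall>\<^sub>F N in sequentially. (norm (V \<xi> - W N \<xi>))\<^sup>2 = 0"
        using eventually_ge_at_top[of M]
      proof eventually_elim
        case (elim N)
        have "norm (V \<xi>) \<le> real N" using M elim by linarith
        then show ?case using \<open>\<xi> \<in> S\<close> by (simp add: W_def)
      qed
      then show "(\<lambda>N. (norm (V \<xi> - W N \<xi>))\<^sup>2) \<longlonglongrightarrow> 0" by (rule tendsto_eventually)
    qed
  qed (use Vi in \<open>auto intro!: MQ_measurable\<close>)
  then have "(\<lambda>N. LINT \<xi>|MQ. (norm (V \<xi> - W N \<xi>))\<^sup>2) \<longlonglongrightarrow> 0" by simp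
  from order_tendstoD(2)[OF this, of "e / 9"] e obtain N where N: "(LINT \<xi>|MQ. (norm (V \<xi> - W N \<xi>))\<^sup>2) < e / 9"
    by (auto simp: eventually_sequentially)
  have ne: "S \<noteq> UNIV" unfolding S_def using bounded_box not_bounded_UNIV by metis
  obtain g where g: "\<And>n. continuous_on UNIV (g n)" "\<And>n x. norm (g n x) \<le> real N"
    "\<And>n x. x \<notin> S \<Longrightarrow> g n x = 0" "AE x in lborel. (\<lambda>n. g n x) \<longlonglongrightarrow> W N x"
  proof (rule continuous_approx[of "W N" "real N" S])
    show "norm (W N x) \<le> real N" for x by (simp add: W_def)
    show "open S" by (simp add: S_def open_box)
    show "W N x = 0" if "x \<notin> S" for x using that by (simp add: W_def)
  qed (use ne Wm in auto)
  have gm [measurable]: "g n \<in> borel_measurable borel" for n using g(1) by (rule borel_measurable_continuous_onI)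
  have Wb: "norm (W N x) \<le> real N" for x by (simp add: W_def)
  have db: "norm ((norm (W N \<xi> - g n \<xi>))\<^sup>2) \<le> (2 * real N)\<^sup>2" for n \<xi>
  proof -
    have "norm (W N \<xi> - g n \<xi>) \<le> 2 * real N"
      using norm_triangle_ineq4[of "W N \<xi>" "g n \<xi>"] g(2)[of n \<xi>] Wb[of \<xi>] by linarith
    then have "(norm (W N \<xi> - g n \<xi>))\<^sup>2 \<le> (2 * real N)\<^sup>2" by (intro power_mono) auto
    then show ?thesis by simp
  qed
  have "(\<lambda>n. LINT \<xi>|MQ. (norm (W N \<xi> - g n \<xi>))\<^sup>2) \<longlonglongrightarrow> (LINT \<xi>|(MQ :: (real ^ 'd) measure). 0)"
  proof (rule integral_dominated_convergence[where w="\<lambda>\<xi>. (2 * real N)\<^sup>2"])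
    show "AE \<xi> in MQ. (\<lambda>n. (norm (W N \<xi> - g n \<xi>))\<^sup>2) \<longlonglongrightarrow> 0"
    proof (subst AE_restrict_space_iff)
      show "AE \<xi> in lborel. \<xi> \<in> Q \<longrightarrow> (\<lambda>n. (norm (W N \<xi> - g n \<xi>))\<^sup>2) \<longlonglongrightarrow> 0"
        using g(4)
      proof eventually_elim
        fix \<xi> assume "(\<lambda>n. g n \<xi>) \<longlonglongrightarrow> W N \<xi>"
        then have "(\<lambda>n. (norm (W N \<xi> - g n \<xi>))\<^sup>2) \<longlonglongrightarrow> (norm (W N \<xi> - W N \<xi>))\<^sup>2"
          by (intro tendsto_intros)
        then show "\<xi> \<in> Q \<longrightarrow> (\<lambda>n. (norm (W N \<xi> - g n \<xi>))\<^sup>2) \<longlonglongrightarrow> 0" by simp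
      qed
    qed simp
    show "integrable MQ (\<lambda>\<xi>::real ^ 'd. (2 * real N)\<^sup>2)" by (rule integrable_MQ_bounded[where B="(2 * real N)\<^sup>2"]) auto
  qed (use db in \<open>auto intro!: MQ_measurable\<close>)
  then have "(\<lambda>n. LINT \<xi>|MQ. (norm (W N \<xi> - g n \<xi>))\<^sup>2) \<longlonglongrightarrow> 0" by simp
  from order_tendstoD(2)[OF this, of "e / 9"] e obtain n where n: "(LINT \<xi>|MQ. (norm (W N \<xi> - g n \<xi>))\<^sup>2) < e / 9"
    by (auto simp: eventually_sequentially)
  \<comment> \<open>Since (x + y + z)^2 \<le> 3 (x^2 + y^2 + z^2), the three approximations
    contribute less than e/3, less than e/3 and 3e/10, in all less than e.\<close>
  define \<delta> where "\<delta> = sqrt (e / (10 * (2 * pi) ^ CARD('d)))"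
  have \<delta>: "\<delta> > 0" using e by (simp add: \<delta>_def)
  obtain F a where F: "finite F" "\<And>\<xi>. \<xi> \<in> Q \<Longrightarrow> norm (g n \<xi> - (\<Sum>m\<in>F. a m * chr m \<xi>)) < \<delta>"
  proof (rule trig_approx_continuous[OF g(1)[of n] _ \<delta>])
    show "g n \<xi> = 0" if "pi \<le> \<bar>\<xi> $ i\<bar>" for \<xi> i using that by (intro g(3)) (auto simp: S not_less)
  qed blast
  let ?P = "\<lambda>\<xi>. \<Sum>m\<in>F. a m * chr m \<xi>"
  have Pb: "norm (?P \<xi>) \<le> (\<Sum>n\<in>F. norm (a n))" for \<xi>
    by (rule order_trans[OF norm_sum]) (simp add: norm_mult)
  have iVW: "integrable MQ (\<lambda>\<xi>. (norm (V \<xi> - W N \<xi>))\<^sup>2)"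
    by (rule Bochner_Integration.integrable_bound[OF Vi]) (auto simp: W_def intro!: MQ_measurable)
  have iWg: "integrable MQ (\<lambda>\<xi>. (norm (W N \<xi> - g n \<xi>))\<^sup>2)"
    by (rule integrable_MQ_bounded[OF _ db]) measurable
  have "(LINT \<xi>|MQ. (norm (V \<xi> - ?P \<xi>))\<^sup>2) \<le> (LINT \<xi>|MQ. 3 * (norm (V \<xi> - W N \<xi>))\<^sup>2 + 3 * (norm (W N \<xi> - g n \<xi>))\<^sup>2 + 3 * \<delta>\<^sup>2)"
  proof (rule integral_mono_AE')
    have ic: "integrable MQ (\<lambda>\<xi>::real ^ 'd. 3 * \<delta>\<^sup>2)" by (rule integrable_MQ_bounded[where B="3 * \<delta>\<^sup>2"]) auto
    show "integrable MQ (\<lambda>\<xi>. 3 * (norm (V \<xi> - W N \<xi>))\<^sup>2 + 3 * (norm (W N \<xi> - g n \<xi>))\<^sup>2 + 3 * \<delta>\<^sup>2)"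
      by (intro Bochner_Integration.integrable_add integrable_mult_right iVW iWg ic)
    show "AE \<xi> in MQ. (norm (V \<xi> - ?P \<xi>))\<^sup>2 \<le> 3 * (norm (V \<xi> - W N \<xi>))\<^sup>2 + 3 * (norm (W N \<xi> - g n \<xi>))\<^sup>2 + 3 * \<delta>\<^sup>2"
    proof (rule AE_I2)
      fix \<xi> assume "\<xi> \<in> space (MQ :: (real ^ 'd) measure)"
      then have "norm (g n \<xi> - ?P \<xi>) \<le> \<delta>" using F(2)[of \<xi>] by (simp add: space_MQ)
      moreover have "norm (V \<xi> - ?P \<xi>) \<le> norm (V \<xi> - W N \<xi>) + norm (W N \<xi> - g n \<xi>) + norm (g n \<xi> - ?P \<xi>)"
        using norm_triangle_ineq[of "V \<xi> - W N \<xi>" "W N \<xi> - g n \<xi>"] norm_triangle_ineq[of "V \<xi> - g n \<xi>" "g n \<xi> - ?P \<xi>"] by simp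
      ultimately have "norm (V \<xi> - ?P \<xi>) \<le> norm (V \<xi> - W N \<xi>) + norm (W N \<xi> - g n \<xi>) + \<delta>" by linarith
      then have "(norm (V \<xi> - ?P \<xi>))\<^sup>2 \<le> (norm (V \<xi> - W N \<xi>) + norm (W N \<xi> - g n \<xi>) + \<delta>)\<^sup>2" by (intro power_mono) auto
      moreover have "(x + y + z)\<^sup>2 \<le> 3 * x\<^sup>2 + 3 * y\<^sup>2 + 3 * z\<^sup>2" for x y z :: real
      proof -
        have "3 * x\<^sup>2 + 3 * y\<^sup>2 + 3 * z\<^sup>2 - (x + y + z)\<^sup>2 = (x - y)\<^sup>2 + (y - z)\<^sup>2 + (x - z)\<^sup>2"
          by (simp add: power2_eq_square algebra_simps)
        then show ?thesis by (smt (verit) zero_le_power2)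
      qed
      ultimately show "(norm (V \<xi> - ?P \<xi>))\<^sup>2 \<le> 3 * (norm (V \<xi> - W N \<xi>))\<^sup>2 + 3 * (norm (W N \<xi> - g n \<xi>))\<^sup>2 + 3 * \<delta>\<^sup>2"
        by (rule order_trans)
    qed
  qed auto
  also have "\<dots> = 3 * (LINT \<xi>|MQ. (norm (V \<xi> - W N \<xi>))\<^sup>2) + 3 * (LINT \<xi>|MQ. (norm (W N \<xi> - g n \<xi>))\<^sup>2) + 3 * \<delta>\<^sup>2 * (2 * pi) ^ CARD('d)"
  proof -
    have m: "measure (MQ :: (real ^ 'd) measure) (space MQ) = (2 * pi) ^ CARD('d)"
      unfolding measure_def by (simp add: space_MQ emeasure_restrict_space emeasure_Q)
    have ic: "integrable MQ (\<lambda>\<xi>::real ^ 'd. 3 * \<delta>\<^sup>2)" by (rule integrable_MQ_bounded[where B="3 * \<delta>\<^sup>2"]) auto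
    show ?thesis
      by (subst Bochner_Integration.integral_add, intro Bochner_Integration.integrable_add integrable_mult_right iVW iWg, rule ic,
          subst Bochner_Integration.integral_add, intro integrable_mult_right iVW, intro integrable_mult_right iWg)
        (simp add: lebesgue_integral_const m[unfolded space_MQ])
  qed
  also have "3 * \<delta>\<^sup>2 * (2 * pi) ^ CARD('d) = 3 * e / 10"
    using e by (simp add: \<delta>_def real_sqrt_pow2 field_simps)
  finally have "(LINT \<xi>|MQ. (norm (V \<xi> - ?P \<xi>))\<^sup>2) < e" using N n e by linarith
  then show ?thesis by (rule that[OF F(1)])
qed

text \<open>Density provides one finite F with error below e. By \<open>square_dist_trig\<close>,
  passing to the Fourier coefficients and enlarging F can only decrease the error, so the whole net
  is eventually below e.\<close>

lemma fourier_series_L2: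
  fixes V :: "real ^ 'd::finite \<Rightarrow> complex"
  assumes V: "V \<in> borel_measurable borel" and Vi: "integrable MQ (\<lambda>\<xi>. (norm (V \<xi>))\<^sup>2)"
  shows "((\<lambda>F. LINT \<xi>|MQ. (norm (V \<xi> - (\<Sum>n\<in>F. fcoef V n * chr n \<xi>)))\<^sup>2) \<longlongrightarrow> 0) (finite_subsets_at_top UNIV)"
proof (rule order_tendstoI)
  let ?G = "\<lambda>F. LINT \<xi>|MQ. (norm (V \<xi> - (\<Sum>n\<in>F. fcoef V n * chr n \<xi>)))\<^sup>2"
  show "\<forall>\<^sub>F F in finite_subsets_at_top UNIV. a < ?G F" if "a < 0" for a
    using that by (intro always_eventually allI order.strict_trans2[OF that]) auto
  show "\<forall>\<^sub>F F in finite_subsets_at_top UNIV. ?G F < e" if e: "0 < e" for e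
  proof -
    obtain F a where F: "finite F" "(LINT \<xi>|MQ. (norm (V \<xi> - (\<Sum>n\<in>F. a n * chr n \<xi>)))\<^sup>2) < e"
      using trig_dense[OF V Vi e] by blast
    have "?G F' < e" if "finite F'" "F \<subseteq> F'" for F'
    proof -
      have s: "(\<Sum>n\<in>F. (norm (fcoef V n))\<^sup>2) \<le> (\<Sum>n\<in>F'. (norm (fcoef V n))\<^sup>2)"
        using that by (intro sum_mono2) auto
      have "(2 * pi) ^ CARD('d) * (\<Sum>n\<in>F. (norm (fcoef V n))\<^sup>2) \<le> (2 * pi) ^ CARD('d) * (\<Sum>n\<in>F'. (norm (fcoef V n))\<^sup>2)"
        by (rule mult_left_mono[OF s]) simp
      moreover have "0 \<le> (2 * pi) ^ CARD('d) * (\<Sum>n\<in>F. (norm (a n - fcoef V n))\<^sup>2)"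
        by (intro mult_nonneg_nonneg sum_nonneg) auto
      ultimately have "?G F' \<le> (LINT \<xi>|MQ. (norm (V \<xi> - (\<Sum>n\<in>F. a n * chr n \<xi>)))\<^sup>2)"
        unfolding square_dist_trig[OF V Vi F(1)] square_dist_trig[OF V Vi that(1)] diff_self norm_zero
        by (simp only: power_zero_numeral sum.neutral_const mult_zero_right)
      then show ?thesis using F(2) by linarith
    qed
    then show ?thesis unfolding eventually_finite_subsets_at_top using F(1) by blast
  qed
qed

lemma bessel:
  fixes V :: "real ^ 'd::finite \<Rightarrow> complex"
  assumes V: "V \<in> borel_measurable borel" and Vi: "integrable MQ (\<lambda>\<xi>. (norm (V \<xi>))\<^sup>2)"
  shows "in_l2 (fcoef V)"
  unfolding in_l2_def
proof (rule nonneg_bdd_above_summable_on)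
  show "bdd_above (sum (\<lambda>n. (norm (fcoef V n))\<^sup>2) ` {F. F \<subseteq> UNIV \<and> finite F})"
  proof (rule bdd_aboveI2)
    fix F :: "(int ^ 'd) set" assume "F \<in> {F. F \<subseteq> UNIV \<and> finite F}"
    then have F: "finite F" by simp
    have "0 \<le> (LINT \<xi>|MQ. (norm (V \<xi> - (\<Sum>n\<in>F. fcoef V n * chr n \<xi>)))\<^sup>2)" by simp
    then have "(\<Sum>n\<in>F. (norm (fcoef V n))\<^sup>2) * (2 * pi) ^ CARD('d) \<le> (LINT \<xi>|MQ. (norm (V \<xi>))\<^sup>2)"
      unfolding square_dist_trig[OF V Vi F] diff_self norm_zero
      by (simp only: power_zero_numeral sum.neutral_const mult_zero_right mult.commute[of "(2 * pi) ^ CARD('d)"])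
    moreover have "(2 * pi) ^ CARD('d) > 0" by simp
    ultimately show "(\<Sum>n\<in>F. (norm (fcoef V n))\<^sup>2) \<le> (LINT \<xi>|MQ. (norm (V \<xi>))\<^sup>2) / (2 * pi) ^ CARD('d)"
      by (subst pos_le_divide_eq)
  qed
qed simp

text \<open>With V replaced by a partial Fourier sum, the pairing with W is a finite sum of products
  of coefficients; by Cauchy-Schwarz the error is at most the square distance of V from that sum
  times the square norm of W.\<close>

lemma parseval:
  fixes V W :: "real ^ 'd::finite \<Rightarrow> complex"
  assumes V [measurable]: "V \<in> borel_measurable borel" and Vi: "integrable MQ (\<lambda>\<xi>. (norm (V \<xi>))\<^sup>2)"
    and W [measurable]: "W \<in> borel_measurable borel" and Wi: "integrable MQ (\<lambda>\<xi>. (norm (W \<xi>))\<^sup>2)"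
  shows "((\<lambda>n. cnj (fcoef V n) * fcoef W n) has_sum ((LINT \<xi>|MQ. cnj (V \<xi>) * W \<xi>) / of_real ((2 * pi) ^ CARD('d)))) UNIV"
proof -
  let ?D = "complex_of_real ((2 * pi) ^ CARD('d))"
  let ?S = "\<lambda>F \<xi>. \<Sum>n\<in>F. fcoef V n * chr n \<xi>"
  define G where "G F = (LINT \<xi>|MQ. (norm (V \<xi> - ?S F \<xi>))\<^sup>2)" for F
  have iWc: "integrable MQ (\<lambda>\<xi>. W \<xi> * cnj (chr n \<xi>))" for n
    by (rule square_integrable_MQ_imp_integrable[OF W Wi, where B=1]) auto
  have S: "(LINT \<xi>|MQ. cnj (?S F \<xi>) * W \<xi>) = (\<Sum>n\<in>F. ?D * (cnj (fcoef V n) * fcoef W n))" for F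
  proof -
    have "(LINT \<xi>|MQ. cnj (?S F \<xi>) * W \<xi>) = (LINT \<xi>|MQ. (\<Sum>n\<in>F. cnj (fcoef V n) * (W \<xi> * cnj (chr n \<xi>))))"
      by (simp add: sum_distrib_right sum_distrib_left mult_ac)
    also have "\<dots> = (\<Sum>n\<in>F. cnj (fcoef V n) * (LINT \<xi>|MQ. W \<xi> * cnj (chr n \<xi>)))"
      by (subst Bochner_Integration.integral_sum) (use iWc in \<open>auto intro!: integrable_mult_right\<close>)
    also have "\<dots> = (\<Sum>n\<in>F. ?D * (cnj (fcoef V n) * fcoef W n))"
      by (intro sum.cong refl) (simp add: fcoef_def[of W])
    finally show ?thesis .
  qed
  have Sb: "norm (?S F \<xi>) \<le> (\<Sum>n\<in>F. norm (fcoef V n))" for F \<xi>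
    by (rule order_trans[OF norm_sum]) (simp add: norm_mult)
  have iVW: "integrable MQ (\<lambda>\<xi>. cnj (V \<xi>) * W \<xi>)"
  proof (rule Bochner_Integration.integrable_bound)
    show "integrable MQ (\<lambda>\<xi>. (norm (V \<xi>))\<^sup>2 + (norm (W \<xi>))\<^sup>2)" using Vi Wi by simp
    show "AE \<xi> in MQ. norm (cnj (V \<xi>) * W \<xi>) \<le> norm ((norm (V \<xi>))\<^sup>2 + (norm (W \<xi>))\<^sup>2)"
    proof (rule AE_I2)
      fix \<xi>
      have "2 * (norm (V \<xi>) * norm (W \<xi>)) \<le> (norm (V \<xi>))\<^sup>2 + (norm (W \<xi>))\<^sup>2"
        using sum_squares_bound[of "norm (V \<xi>)" "norm (W \<xi>)"] by (simp add: mult.assoc)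
      moreover have "0 \<le> norm (V \<xi>) * norm (W \<xi>)" by simp
      ultimately show "norm (cnj (V \<xi>) * W \<xi>) \<le> norm ((norm (V \<xi>))\<^sup>2 + (norm (W \<xi>))\<^sup>2)"
        unfolding norm_mult complex_mod_cnj real_norm_def by linarith
    qed
  qed (auto intro!: MQ_measurable)
  have iSW: "integrable MQ (\<lambda>\<xi>. cnj (?S F \<xi>) * W \<xi>)" for F
  proof -
    have "integrable MQ (\<lambda>\<xi>. W \<xi> * cnj (?S F \<xi>))"
      by (rule square_integrable_MQ_imp_integrable[OF W Wi, where B="\<Sum>n\<in>F. norm (fcoef V n)"]) (use Sb in \<open>auto simp del: cnj_sum complex_cnj_mult\<close>)
    then show ?thesis by (simp add: mult.commute)
  qed
  have iVS: "integrable MQ (\<lambda>\<xi>. (norm (cnj (V \<xi> - ?S F \<xi>)))\<^sup>2)" for F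
  proof (rule Bochner_Integration.integrable_bound)
    show "integrable MQ (\<lambda>\<xi>. 2 * (norm (V \<xi>))\<^sup>2 + 2 * (\<Sum>n\<in>F. norm (fcoef V n))\<^sup>2)"
      by (rule Bochner_Integration.integrable_add[OF integrable_mult_right[OF Vi] integrable_MQ_bounded[where B="2 * (\<Sum>n\<in>F. norm (fcoef V n))\<^sup>2"]]) auto
    show "AE \<xi> in MQ. norm ((norm (cnj (V \<xi> - ?S F \<xi>)))\<^sup>2) \<le> norm (2 * (norm (V \<xi>))\<^sup>2 + 2 * (\<Sum>n\<in>F. norm (fcoef V n))\<^sup>2)"
    proof (rule AE_I2)
      fix \<xi>
      have "norm (V \<xi> - ?S F \<xi>) \<le> norm (V \<xi>) + (\<Sum>n\<in>F. norm (fcoef V n))"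
        using norm_triangle_ineq4[of "V \<xi>" "?S F \<xi>"] Sb[of \<xi> F] by linarith
      then have "(norm (V \<xi> - ?S F \<xi>))\<^sup>2 \<le> (norm (V \<xi>) + (\<Sum>n\<in>F. norm (fcoef V n)))\<^sup>2" by (intro power_mono) auto
      also have "\<dots> \<le> 2 * (norm (V \<xi>))\<^sup>2 + 2 * (\<Sum>n\<in>F. norm (fcoef V n))\<^sup>2"
        using zero_le_power2[of "norm (V \<xi>) - (\<Sum>n\<in>F. norm (fcoef V n))"] by (simp add: power2_sum power2_diff)
      finally show "norm ((norm (cnj (V \<xi> - ?S F \<xi>)))\<^sup>2) \<le> norm (2 * (norm (V \<xi>))\<^sup>2 + 2 * (\<Sum>n\<in>F. norm (fcoef V n))\<^sup>2)"
        by (simp only: complex_mod_cnj) simp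
    qed
  qed (auto intro!: MQ_measurable)
  define I where "I = (LINT \<xi>|MQ. cnj (V \<xi>) * W \<xi>)"
  have le: "(norm (I - (\<Sum>n\<in>F. ?D * (cnj (fcoef V n) * fcoef W n))))\<^sup>2 \<le> G F * (LINT \<xi>|MQ. (norm (W \<xi>))\<^sup>2)" for F
  proof -
    have "I - (\<Sum>n\<in>F. ?D * (cnj (fcoef V n) * fcoef W n)) = (LINT \<xi>|MQ. cnj (V \<xi> - ?S F \<xi>) * W \<xi>)"
      unfolding I_def S[symmetric] by (subst Bochner_Integration.integral_diff[symmetric, OF iVW iSW]) (simp add: algebra_simps)
    also have "(norm \<dots>)\<^sup>2 \<le> (LINT \<xi>|MQ. (norm (cnj (V \<xi> - ?S F \<xi>)))\<^sup>2) * (LINT \<xi>|MQ. (norm (W \<xi>))\<^sup>2)"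
      by (rule norm_integral_mult_square_le[OF _ _ iVS Wi]) (auto intro!: MQ_measurable)
    finally show ?thesis by (simp only: complex_mod_cnj G_def)
  qed
  have "((\<lambda>F. G F * (LINT \<xi>|MQ. (norm (W \<xi>))\<^sup>2)) \<longlongrightarrow> 0 * (LINT \<xi>|MQ. (norm (W \<xi>))\<^sup>2)) (finite_subsets_at_top UNIV)"
    unfolding G_def by (intro tendsto_mult tendsto_const fourier_series_L2[OF V Vi])
  then have "((\<lambda>F. (norm (I - (\<Sum>n\<in>F. ?D * (cnj (fcoef V n) * fcoef W n))))\<^sup>2) \<longlongrightarrow> 0) (finite_subsets_at_top UNIV)"
    by - (rule tendsto_sandwich[OF _ always_eventually[OF allI[OF le]] tendsto_const], simp_all)
  then have "((\<lambda>F. sqrt ((norm (I - (\<Sum>n\<in>F. ?D * (cnj (fcoef V n) * fcoef W n))))\<^sup>2)) \<longlongrightarrow> sqrt 0) (finite_subsets_at_top UNIV)"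
    by (rule tendsto_real_sqrt)
  then have "((\<lambda>F. I - (\<Sum>n\<in>F. ?D * (cnj (fcoef V n) * fcoef W n))) \<longlongrightarrow> 0) (finite_subsets_at_top UNIV)"
    by (simp add: tendsto_norm_zero_iff)
  from tendsto_diff[OF tendsto_const[of I] this]
  have "((\<lambda>n. ?D * (cnj (fcoef V n) * fcoef W n)) has_sum I) UNIV" by (simp add: has_sum_def)
  from has_sum_cmult_right[OF this, of "1 / ?D"] show ?thesis by (simp add: I_def)
qed

text \<open>\<open>lattice_fourier\<close> selects some periodic limit of the partial sums in the
  square mean. V is such a limit, so the selection succeeds; two limits agree almost everywhere on Q
  and, being periodic, almost everywhere.\<close>

lemma lattice_fourier_AE:
  fixes V :: "real ^ 'd::finite \<Rightarrow> complex"
  assumes V: "V \<in> borel_measurable borel" and Vi: "integrable MQ (\<lambda>\<xi>. (norm (V \<xi>))\<^sup>2)" and per: "\<And>\<xi> l. V (lshift l \<xi>) = V \<xi>"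
  shows "lattice_fourier (fcoef V) \<in> borel_measurable borel" and "lattice_fourier (fcoef V) (lshift l \<xi>) = lattice_fourier (fcoef V) \<xi>"
    and "AE \<xi> in lborel. lattice_fourier (fcoef V) \<xi> = V \<xi>"
proof -
  let ?S = "\<lambda>F \<xi>. \<Sum>n\<in>F. fcoef V n * chr n \<xi>"
  define A where "A W \<longleftrightarrow> W \<in> borel_measurable borel \<and> (\<forall>\<xi> k. W (lshift k \<xi>) = W \<xi>) \<and>
     ((\<lambda>F. \<integral>\<^sup>+\<xi>\<in>Q. ennreal ((norm (W \<xi> - ?S F \<xi>))\<^sup>2) \<partial>lborel) \<longlongrightarrow> 0) (finite_subsets_at_top UNIV)" for W
  have "A V" unfolding A_def
  proof (intro conjI allI V per)
    have i: "integrable MQ (\<lambda>\<xi>. (norm (V \<xi> - ?S F \<xi>))\<^sup>2)" for F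
    proof (rule Bochner_Integration.integrable_bound)
      show "integrable MQ (\<lambda>\<xi>. 2 * (norm (V \<xi>))\<^sup>2 + 2 * (\<Sum>n\<in>F. norm (fcoef V n))\<^sup>2)"
        by (rule Bochner_Integration.integrable_add[OF integrable_mult_right[OF Vi] integrable_MQ_bounded[where B="2 * (\<Sum>n\<in>F. norm (fcoef V n))\<^sup>2"]]) auto
      show "AE \<xi> in MQ. norm ((norm (V \<xi> - ?S F \<xi>))\<^sup>2) \<le> norm (2 * (norm (V \<xi>))\<^sup>2 + 2 * (\<Sum>n\<in>F. norm (fcoef V n))\<^sup>2)"
      proof (rule AE_I2)
        fix \<xi>
        have "norm (?S F \<xi>) \<le> (\<Sum>n\<in>F. norm (fcoef V n))"
          by (rule order_trans[OF norm_sum]) (simp add: norm_mult)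
        then have "norm (V \<xi> - ?S F \<xi>) \<le> norm (V \<xi>) + (\<Sum>n\<in>F. norm (fcoef V n))"
          using norm_triangle_ineq4[of "V \<xi>" "?S F \<xi>"] by linarith
        then have "(norm (V \<xi> - ?S F \<xi>))\<^sup>2 \<le> (norm (V \<xi>) + (\<Sum>n\<in>F. norm (fcoef V n)))\<^sup>2" by (intro power_mono) auto
        also have "\<dots> \<le> 2 * (norm (V \<xi>))\<^sup>2 + 2 * (\<Sum>n\<in>F. norm (fcoef V n))\<^sup>2"
          using zero_le_power2[of "norm (V \<xi>) - (\<Sum>n\<in>F. norm (fcoef V n))"] by (simp add: power2_sum power2_diff)
        finally show "norm ((norm (V \<xi> - ?S F \<xi>))\<^sup>2) \<le> norm (2 * (norm (V \<xi>))\<^sup>2 + 2 * (\<Sum>n\<in>F. norm (fcoef V n))\<^sup>2)" by simp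
      qed
    qed (use V in \<open>auto intro!: MQ_measurable\<close>)
    have "(\<integral>\<^sup>+\<xi>\<in>Q. ennreal ((norm (V \<xi> - ?S F \<xi>))\<^sup>2) \<partial>lborel) = ennreal (LINT \<xi>|MQ. (norm (V \<xi> - ?S F \<xi>))\<^sup>2)" for F
      unfolding nn_integral_MQ[symmetric] by (rule nn_integral_eq_integral[OF i]) simp
    then show "((\<lambda>F. \<integral>\<^sup>+\<xi>\<in>Q. ennreal ((norm (V \<xi> - ?S F \<xi>))\<^sup>2) \<partial>lborel) \<longlongrightarrow> 0) (finite_subsets_at_top UNIV)"
      using tendsto_ennrealI[OF fourier_series_L2[OF V Vi]] by simp
  qed
  moreover have lf: "lattice_fourier (fcoef V) = (SOME W. A W)"
    unfolding lattice_fourier_def A_def ..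
  ultimately have AL: "A (lattice_fourier (fcoef V))" by (metis someI)
  then show 1: "lattice_fourier (fcoef V) \<in> borel_measurable borel"
    and 2: "lattice_fourier (fcoef V) (lshift l \<xi>) = lattice_fourier (fcoef V) \<xi>" for l \<xi>
    by (auto simp: A_def)
  let ?W = "lattice_fourier (fcoef V)"
  note [measurable] = V 1
  have le: "(\<integral>\<^sup>+\<xi>\<in>Q. ennreal ((norm (?W \<xi> - V \<xi>))\<^sup>2) \<partial>lborel) \<le>
    2 * (\<integral>\<^sup>+\<xi>\<in>Q. ennreal ((norm (?W \<xi> - ?S F \<xi>))\<^sup>2) \<partial>lborel) + 2 * (\<integral>\<^sup>+\<xi>\<in>Q. ennreal ((norm (V \<xi> - ?S F \<xi>))\<^sup>2) \<partial>lborel)" for F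
  proof -
    have "(\<integral>\<^sup>+\<xi>\<in>Q. ennreal ((norm (?W \<xi> - V \<xi>))\<^sup>2) \<partial>lborel) \<le>
      (\<integral>\<^sup>+\<xi>\<in>Q. (2 * ennreal ((norm (?W \<xi> - ?S F \<xi>))\<^sup>2) + 2 * ennreal ((norm (V \<xi> - ?S F \<xi>))\<^sup>2)) \<partial>lborel)"
    proof (intro nn_integral_mono mult_right_mono)
      fix \<xi>
      have "norm (?W \<xi> - V \<xi>) \<le> norm (?W \<xi> - ?S F \<xi>) + norm (V \<xi> - ?S F \<xi>)"
        using norm_triangle_ineq4[of "?W \<xi> - ?S F \<xi>" "V \<xi> - ?S F \<xi>"] by simp
      then have "(norm (?W \<xi> - V \<xi>))\<^sup>2 \<le> (norm (?W \<xi> - ?S F \<xi>) + norm (V \<xi> - ?S F \<xi>))\<^sup>2" by (intro power_mono) auto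
      also have "\<dots> \<le> 2 * (norm (?W \<xi> - ?S F \<xi>))\<^sup>2 + 2 * (norm (V \<xi> - ?S F \<xi>))\<^sup>2"
        using zero_le_power2[of "norm (?W \<xi> - ?S F \<xi>) - norm (V \<xi> - ?S F \<xi>)"] by (simp add: power2_sum power2_diff)
      finally have "ennreal ((norm (?W \<xi> - V \<xi>))\<^sup>2) \<le> ennreal (2 * (norm (?W \<xi> - ?S F \<xi>))\<^sup>2 + 2 * (norm (V \<xi> - ?S F \<xi>))\<^sup>2)" by (rule ennreal_leI)
      then show "ennreal ((norm (?W \<xi> - V \<xi>))\<^sup>2) \<le> 2 * ennreal ((norm (?W \<xi> - ?S F \<xi>))\<^sup>2) + 2 * ennreal ((norm (V \<xi> - ?S F \<xi>))\<^sup>2)"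
        by (simp add: ennreal_mult ennreal_plus)
    qed auto
    also have "\<dots> = 2 * (\<integral>\<^sup>+\<xi>\<in>Q. ennreal ((norm (?W \<xi> - ?S F \<xi>))\<^sup>2) \<partial>lborel) + 2 * (\<integral>\<^sup>+\<xi>\<in>Q. ennreal ((norm (V \<xi> - ?S F \<xi>))\<^sup>2) \<partial>lborel)"
      unfolding distrib_right by (subst nn_integral_add) (auto simp: mult.assoc nn_integral_cmult)
    finally show ?thesis .
  qed
  have "((\<lambda>F. 2 * (\<integral>\<^sup>+\<xi>\<in>Q. ennreal ((norm (?W \<xi> - ?S F \<xi>))\<^sup>2) \<partial>lborel) + 2 * (\<integral>\<^sup>+\<xi>\<in>Q. ennreal ((norm (V \<xi> - ?S F \<xi>))\<^sup>2) \<partial>lborel)) \<longlongrightarrow> 2 * 0 + 2 * 0) (finite_subsets_at_top UNIV)"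
    using AL \<open>A V\<close> unfolding A_def by (intro tendsto_add ennreal_tendsto_cmult) simp_all
  then have "(\<integral>\<^sup>+\<xi>\<in>Q. ennreal ((norm (?W \<xi> - V \<xi>))\<^sup>2) \<partial>lborel) \<le> 2 * 0 + 2 * 0"
    by (rule tendsto_lowerbound) (auto intro: always_eventually le)
  then have z: "(\<integral>\<^sup>+\<xi>\<in>Q. ennreal ((norm (?W \<xi> - V \<xi>))\<^sup>2) \<partial>lborel) = 0" by simp
  have "(\<integral>\<^sup>+\<xi>. ennreal ((norm (?W \<xi> - V \<xi>))\<^sup>2) \<partial>lborel) = (\<integral>\<^sup>+\<xi>\<in>Q. (\<integral>\<^sup>+(l::int^'d). ennreal ((norm (?W \<xi> - V \<xi>))\<^sup>2) \<partial>count_space UNIV) \<partial>lborel)"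
    by (subst nn_integral_tile) (auto simp: 2 per)
  also have "\<dots> = 0"
  proof -
    have "AE \<xi> in lborel. ennreal ((norm (?W \<xi> - V \<xi>))\<^sup>2) * indicator Q \<xi> = 0"
      using z by (subst (asm) nn_integral_0_iff_AE) auto
    then have "AE \<xi> in lborel. (\<integral>\<^sup>+(l::int^'d). ennreal ((norm (?W \<xi> - V \<xi>))\<^sup>2) \<partial>count_space UNIV) * indicator Q \<xi> = 0"
      by eventually_elim auto
    then show ?thesis by (subst nn_integral_cong_AE) auto
  qed
  finally have "AE \<xi> in lborel. ennreal ((norm (?W \<xi> - V \<xi>))\<^sup>2) = 0"
    by (subst (asm) nn_integral_0_iff_AE) auto
  then show "AE \<xi> in lborel. ?W \<xi> = V \<xi>" by (rule eventually_mono) auto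
qed

section \<open>Sampling on the Fourier side\<close>

lemma bracket_pos: "bracket \<xi> > 0"
  unfolding bracket_def by (intro real_sqrt_gt_zero add_pos_nonneg) auto

lemma bracket_measurable [measurable]: "bracket \<in> borel_measurable borel"
  unfolding bracket_def[abs_def] by measurable

text \<open>The multiplier meets the test function as \<open>inv_fourier (fourier f)\<close>, which
  is f by inversion. It is then moved onto f, and the product is Schwartz because powers of the
  bracket are moderate.\<close>

lemma represents_bracket_hD:
  assumes U: "represents U (fourier_dist u)"
  shows "represents (\<lambda>\<xi>. of_real (bracket (h *\<^sub>R \<xi>) powr r) * U \<xi>) (fourier_dist (bracket_hD h r u))"
  unfolding represents_def
proof (intro conjI allI impI)
  have [measurable]: "U \<in> borel_measurable borel" using U by (simp add: represents_def)
  show "(\<lambda>\<xi>. complex_of_real (bracket (h *\<^sub>R \<xi>) powr r) * U \<xi>) \<in> borel_measurable borel" by measurable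
  fix f :: "real ^ 'a \<Rightarrow> complex" assume f: "schwartz f"
  have m: "schwartz (\<lambda>\<xi>. of_real (bracket (h *\<^sub>R \<xi>) powr r) * f \<xi>)"
    by (rule schwartz_mult[OF moderate_bracket f])
  have e: "U x * (of_real (bracket (h *\<^sub>R x) powr r) * f x) = of_real (bracket (h *\<^sub>R x) powr r) * U x * f x" for x
    by (simp add: mult_ac)
  show "integrable lborel (\<lambda>x. of_real (bracket (h *\<^sub>R x) powr r) * U x * f x)"
    using U m unfolding represents_def e[symmetric] by blast
  have "fourier_dist (bracket_hD h r u) f = fourier_dist u (\<lambda>\<xi>. of_real (bracket (h *\<^sub>R \<xi>) powr r) * f \<xi>)"
    by (simp add: fourier_dist_def bracket_hD_def inv_fourier_dist_def mult_dist_def inv_fourier_fourier[OF f])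
  also have "\<dots> = (LINT x|lborel. U x * (of_real (bracket (h *\<^sub>R x) powr r) * f x))"
    using U m by (simp add: represents_def)
  finally show "fourier_dist (bracket_hD h r u) f = (LINT x|lborel. of_real (bracket (h *\<^sub>R x) powr r) * U x * f x)"
    unfolding e .
qed

lemma schwartz_scale:
  assumes "c \<noteq> 0" "schwartz f" shows "schwartz (\<lambda>x. f (c *\<^sub>R x))"
  using schwartz_compose_affine[OF bounded_linear_scaleR_right[of c] _ assms(2), of "1 / \<bar>c\<bar>" 0] assms(1) by simp

text \<open>Conjugation reflects the frequency, translation gives the phase and dilation the factor
  h^d. As \<phi> is only a functional, the computation is done on test functions: \<open>g\<close>
  is built so that its Fourier transform is the conjugated and rescaled function at which \<phi> is
  evaluated.\<close>

lemma represents_cnj_rescale: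
  fixes \<phi> :: "(real ^ 'd::finite) distribution"
  assumes p: "represents p (fourier_dist \<phi>)" and h: "h > 0"
  shows "represents (\<lambda>\<xi>. of_real (h ^ CARD('d)) * cis (- (y \<bullet> (h *\<^sub>R \<xi>))) * cnj (p (- (h *\<^sub>R \<xi>))))
    (fourier_dist (cnj_dist (rescale_dist h y \<phi>)))"
  unfolding represents_def
proof (intro conjI allI impI)
  have pm [measurable]: "p \<in> borel_measurable borel" using p by (simp add: represents_def)
  show "(\<lambda>\<xi>. complex_of_real (h ^ CARD('d)) * cis (- (y \<bullet> (h *\<^sub>R \<xi>))) * cnj (p (- (h *\<^sub>R \<xi>)))) \<in> borel_measurable borel"
    by measurable
  fix f :: "real ^ 'd \<Rightarrow> complex" assume f: "schwartz f"
  have fm [measurable]: "f \<in> borel_measurable borel" by (rule schwartz_borel[OF f])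
  define d where "d = complex_of_real (h ^ CARD('d))"
  have d0: "d \<noteq> 0" using h by (simp add: d_def)
  have cd: "cnj d = d" by (simp add: d_def)
  define g where "g z = (1 / d) * (cis (z \<bullet> (- y)) * cnj (f ((- 1 / h) *\<^sub>R z)))" for z
  have g: "schwartz g" unfolding g_def
    using h by (intro schwartz_cmult schwartz_cis schwartz_cnj schwartz_scale[OF _ f]) auto
  have gm [measurable]: "g \<in> borel_measurable borel" by (rule schwartz_borel[OF g])
  have sub: "0 + (- h) *\<^sub>R w = - (h *\<^sub>R w)" "(- 1 / h) *\<^sub>R (- (h *\<^sub>R w)) = w" for w :: "real ^ 'd"
    using h by auto
  have hd: "\<bar>- h\<bar> ^ DIM(real ^ 'd) = h ^ CARD('d)" using h by simp
  have Fg: "fourier g x = cnj (fourier f (h *\<^sub>R (x + y)))" for x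
  proof -
    have "fourier g x = d * (LINT w|lborel. g (- (h *\<^sub>R w)) * cis (- (- (h *\<^sub>R w) \<bullet> x)))"
      unfolding fourier_def using h
      by (subst integral_affine[of _ "- h" 0], measurable) (simp_all only: hd sub scaleR_conv_of_real d_def, simp?)
    also have "\<dots> = (LINT w|lborel. cnj (f w * cis (- (w \<bullet> (h *\<^sub>R (x + y))))))"
    proof (subst integral_mult_right_zero[symmetric], rule Bochner_Integration.integral_cong[OF refl])
      fix w :: "real ^ 'd"
      have "cis (- (h *\<^sub>R w) \<bullet> (- y)) * cis (- (- (h *\<^sub>R w) \<bullet> x)) = cis (w \<bullet> (h *\<^sub>R (x + y)))"
        by (simp add: cis_mult inner_add_right algebra_simps)
      moreover have "cnj (cis (- (w \<bullet> (h *\<^sub>R (x + y))))) = cis (w \<bullet> (h *\<^sub>R (x + y)))" by (simp add: cis_cnj)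
      ultimately show "d * (g (- (h *\<^sub>R w)) * cis (- (- (h *\<^sub>R w) \<bullet> x))) = cnj (f w * cis (- (w \<bullet> (h *\<^sub>R (x + y)))))"
        using d0 unfolding g_def sub complex_cnj_mult by (simp add: mult_ac)
    qed
    also have "\<dots> = cnj (fourier f (h *\<^sub>R (x + y)))"
      unfolding fourier_def by (rule Bochner_Integration.integral_cnj)
    finally show ?thesis .
  qed
  have pt: "d * cis (- (y \<bullet> (h *\<^sub>R \<xi>))) * cnj (p (- (h *\<^sub>R \<xi>))) * f \<xi> = d * cnj (d * (p (- (h *\<^sub>R \<xi>)) * g (- (h *\<^sub>R \<xi>))))" for \<xi>
  proof -
    have "cnj (cis (- (h *\<^sub>R \<xi>) \<bullet> (- y))) = cis (- (y \<bullet> (h *\<^sub>R \<xi>)))" by (simp add: cis_cnj inner_commute)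
    then show ?thesis using d0 unfolding g_def sub by (simp add: cd mult_ac)
  qed
  have pg: "integrable lborel (\<lambda>z. p z * g z)" using p g by (simp add: represents_def)
  have "integrable lborel (\<lambda>\<xi>. p (- (h *\<^sub>R \<xi>)) * g (- (h *\<^sub>R \<xi>)))"
    using integrable_affine[OF pg, of "- h" 0] h by (simp only: sub)
  then have "integrable lborel (\<lambda>\<xi>. d * cnj (d * (p (- (h *\<^sub>R \<xi>)) * g (- (h *\<^sub>R \<xi>)))))"
    by (intro integrable_mult_right integrable_cnj)
  then show "integrable lborel (\<lambda>\<xi>. of_real (h ^ CARD('d)) * cis (- (y \<bullet> (h *\<^sub>R \<xi>))) * cnj (p (- (h *\<^sub>R \<xi>))) * f \<xi>)"
    unfolding d_def[symmetric] pt .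
  have "fourier_dist (cnj_dist (rescale_dist h y \<phi>)) f = cnj (d * \<phi> (fourier g))"
    by (simp add: fourier_dist_def cnj_dist_def rescale_dist_def d_def Fg[abs_def])
  also have "\<phi> (fourier g) = (LINT z|lborel. p z * g z)"
    using p g by (simp add: represents_def fourier_dist_def)
  also have "\<dots> = d * (LINT \<xi>|lborel. p (- (h *\<^sub>R \<xi>)) * g (- (h *\<^sub>R \<xi>)))"
  proof -
    have m: "(\<lambda>z. p z * g z) \<in> borel_measurable borel" by measurable
    have "- h \<noteq> 0" using h by simp
    from integral_affine[OF m this, of 0] show ?thesis unfolding hd sub by (simp add: scaleR_conv_of_real d_def)
  qed
  also have "cnj (d * \<dots>) = d * cnj (LINT \<xi>|lborel. d * (p (- (h *\<^sub>R \<xi>)) * g (- (h *\<^sub>R \<xi>))))"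
    by (simp add: cd)
  also have "\<dots> = (LINT \<xi>|lborel. d * cnj (d * (p (- (h *\<^sub>R \<xi>)) * g (- (h *\<^sub>R \<xi>)))))"
    by (simp only: integral_mult_right_zero Bochner_Integration.integral_cnj)
  finally show "fourier_dist (cnj_dist (rescale_dist h y \<phi>)) f =
      (LINT \<xi>|lborel. of_real (h ^ CARD('d)) * cis (- (y \<bullet> (h *\<^sub>R \<xi>))) * cnj (p (- (h *\<^sub>R \<xi>))) * f \<xi>)"
    unfolding d_def[symmetric] pt .
qed

definition sampled_symbol :: "(real ^ 'd::finite \<Rightarrow> complex) \<Rightarrow> real \<Rightarrow> (real ^ 'd \<Rightarrow> complex) \<Rightarrow> real ^ 'd \<Rightarrow> complex" where
  "sampled_symbol p h U \<eta> = cnj (p \<eta>) * U ((1 / h) *\<^sub>R \<eta>)"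

text \<open>The bilinear pairing evaluates the transform of u at - \<xi>, and conjugation has put
  \<phi>hat at - h \<xi>; the substitution \<eta> = - h \<xi> removes both reflections. Its Jacobian
  is the factor h^d in the transform of the dilated \<phi>.\<close>

lemma sample_eq_integral:
  fixes \<phi> u :: "(real ^ 'd::finite) distribution"
  assumes p: "represents p (fourier_dist \<phi>)" and U: "represents U (fourier_dist u)" and h: "h > 0"
  shows "sample \<phi> h u n = (LINT \<eta>|lborel. sampled_symbol p h U \<eta> * cnj (chr n \<eta>)) / of_real ((2 * pi) ^ CARD('d)) / of_real (h ^ CARD('d))"
proof -
  have [measurable]: "p \<in> borel_measurable borel" "U \<in> borel_measurable borel" using p U by (auto simp: represents_def)
  let ?d = "complex_of_real (h ^ CARD('d))"
  let ?v = "cnj_dist (rescale_dist h (lat n) \<phi>)"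
  let ?G = "\<lambda>\<xi>. ?d * cis (- (lat n \<bullet> (h *\<^sub>R \<xi>))) * cnj (p (- (h *\<^sub>R \<xi>)))"
  have G: "represents ?G (fourier_dist ?v)" by (rule represents_cnj_rescale[OF p h])
  have 1: "AE \<xi> in lborel. fourier_fun ?v \<xi> = ?G \<xi>" unfolding fourier_fun_def by (rule fun_of_AE[OF G])
  have 2: "AE \<xi> in lborel. fourier_fun u (- \<xi>) = U (- \<xi>)"
    using AE_affine[of "-1" "\<lambda>\<xi>. fourier_fun u \<xi> = U \<xi>" 0] fun_of_AE[OF U] unfolding fourier_fun_def by simp
  have [measurable]: "fourier_fun ?v \<in> borel_measurable borel" "fourier_fun u \<in> borel_measurable borel"
    using fun_of_represents[OF G] fun_of_represents[OF U] unfolding fourier_fun_def by (auto simp: represents_def)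
  have "(LINT \<xi>|lborel. fourier_fun ?v \<xi> * fourier_fun u (- \<xi>)) = (LINT \<xi>|lborel. ?G \<xi> * U (- \<xi>))"
  proof (rule integral_cong_AE)
    from 1 2 show "AE \<xi> in lborel. fourier_fun ?v \<xi> * fourier_fun u (- \<xi>) = ?G \<xi> * U (- \<xi>)"
      by eventually_elim simp
  qed measurable
  also have "\<dots> = ?d * (LINT \<xi>|lborel. cis (- (lat n \<bullet> (h *\<^sub>R \<xi>))) * cnj (p (- (h *\<^sub>R \<xi>))) * U (- \<xi>))"
    by (simp add: mult.assoc)
  also have "\<dots> = (LINT \<eta>|lborel. sampled_symbol p h U \<eta> * cnj (chr n \<eta>))"
  proof -
    have m: "(\<lambda>\<eta>. sampled_symbol p h U \<eta> * cnj (chr n \<eta>)) \<in> borel_measurable borel"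
      unfolding sampled_symbol_def by measurable
    have e: "sampled_symbol p h U (0 + (- h) *\<^sub>R \<xi>) * cnj (chr n (0 + (- h) *\<^sub>R \<xi>)) = cis (- (lat n \<bullet> (h *\<^sub>R \<xi>))) * cnj (p (- (h *\<^sub>R \<xi>))) * U (- \<xi>)" for \<xi>
      using h by (simp add: sampled_symbol_def cis_cnj)
    have "(LINT \<eta>|lborel. sampled_symbol p h U \<eta> * cnj (chr n \<eta>)) = \<bar>- h\<bar> ^ DIM(real ^ 'd) *\<^sub>R (LINT \<xi>|lborel. cis (- (lat n \<bullet> (h *\<^sub>R \<xi>))) * cnj (p (- (h *\<^sub>R \<xi>))) * U (- \<xi>))"
      using integral_affine[OF m, of "- h" 0] h unfolding e by simp
    then show ?thesis using h by (simp add: scaleR_conv_of_real)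
  qed
  finally show ?thesis unfolding sample_def sobolev_pairing_def by simp
qed

text \<open>The characters are periodic and pass through the periodization, so tiling folds the
  frequency integral of each sample into an integral over Q.\<close>

lemma sample_eq_fcoef:
  fixes \<phi> u :: "(real ^ 'd::finite) distribution"
  assumes p: "represents p (fourier_dist \<phi>)" and U: "represents U (fourier_dist u)" and h: "h > 0"
    and i: "integrable lborel (sampled_symbol p h U)"
  shows "sample \<phi> h u = fcoef (\<lambda>\<eta>. per (sampled_symbol p h U) \<eta> / of_real (h ^ CARD('d)))"
proof
  fix n :: "int ^ 'd"
  let ?P = "sampled_symbol p h U"
  have ip: "integrable lborel (\<lambda>\<eta>. ?P \<eta> * cnj (chr n \<eta>))"
    using integrable_mult_cis(1)[OF i, of "lat n"] by (simp add: cis_cnj inner_commute)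
  have pp: "per (\<lambda>\<eta>. ?P \<eta> * cnj (chr n \<eta>)) \<eta> = per ?P \<eta> * cnj (chr n \<eta>)" for \<eta>
    unfolding per_def cis_cnj minus_minus cis_lat_lshift by simp
  have "(LINT \<eta>|lborel. ?P \<eta> * cnj (chr n \<eta>)) = (LINT \<eta>|MQ. per ?P \<eta> * cnj (chr n \<eta>))"
    using integral_tile(3)[OF ip] unfolding pp integral_MQ by simp
  then show "sample \<phi> h u n = fcoef (\<lambda>\<eta>. per ?P \<eta> / of_real (h ^ CARD('d))) n"
    unfolding sample_eq_integral[OF p U h] fcoef_def by (simp add: divide_inverse mult_ac)
qed

text \<open>(BP) speaks of the selected representative of \<phi>hat. It is transferred to
  \<open>p\<close> almost everywhere, for all lattice translates at once.\<close>

lemma BP_AE: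
  assumes BP: "BP s \<phi>" and p: "represents p (fourier_dist \<phi>)"
  obtains B where "B > 0"
    "AE \<xi> in lborel. (\<integral>\<^sup>+l. ennreal ((bracket (lshift l \<xi>) powr s * norm (p (lshift l \<xi>)))\<^sup>2) \<partial>count_space UNIV) \<le> ennreal B"
proof -
  obtain B where B: "B > 0" "AE \<xi> in lborel. (\<Sum>\<^sub>\<infinity>k\<in>UNIV. ennreal ((bracket (lshift k \<xi>) powr s * norm (fourier_fun \<phi> (lshift k \<xi>)))\<^sup>2)) \<le> ennreal B"
    using BP unfolding BP_def by blast
  have "AE \<xi> in lborel. \<forall>l. fourier_fun \<phi> (lshift l \<xi>) = p (lshift l \<xi>)"
    using fun_of_AE[OF p] unfolding fourier_fun_def by (rule AE_lshift)
  with B(2) have "AE \<xi> in lborel. (\<integral>\<^sup>+l. ennreal ((bracket (lshift l \<xi>) powr s * norm (p (lshift l \<xi>)))\<^sup>2) \<partial>count_space UNIV) \<le> ennreal B"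
  proof eventually_elim
    case (elim \<xi>)
    have "(\<integral>\<^sup>+l. ennreal ((bracket (lshift l \<xi>) powr s * norm (p (lshift l \<xi>)))\<^sup>2) \<partial>count_space UNIV) \<le>
      (\<Sum>\<^sub>\<infinity>k\<in>UNIV. ennreal ((bracket (lshift k \<xi>) powr s * norm (p (lshift k \<xi>)))\<^sup>2))"
      by (rule nn_integral_count_space_infsum)
    also have "\<dots> \<le> ennreal B" using elim by simp
    finally show ?case .
  qed
  then show ?thesis using that B(1) by blast
qed

text \<open>Cauchy-Schwarz over the translates of \<xi>. Where the series is not absolutely
  summable, the periodization is 0 and the bound is trivial.\<close>

lemma norm_per_square_le:
  fixes a b :: "real ^ 'd::finite \<Rightarrow> complex"
  assumes "(\<integral>\<^sup>+l. ennreal ((norm (a (lshift l \<xi>)))\<^sup>2) \<partial>count_space UNIV) \<le> ennreal B"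
  shows "ennreal ((norm (per (\<lambda>\<eta>. a \<eta> * b \<eta>) \<xi>))\<^sup>2) \<le> ennreal B * (\<integral>\<^sup>+l. ennreal ((norm (b (lshift l \<xi>)))\<^sup>2) \<partial>count_space UNIV)"
proof -
  let ?C = "count_space (UNIV :: (int ^ 'd) set)"
  have "ennreal (norm (LINT l|?C. a (lshift l \<xi>) * b (lshift l \<xi>))) \<le> (\<integral>\<^sup>+l. ennreal (norm (a (lshift l \<xi>) * b (lshift l \<xi>))) \<partial>?C)"
    by (cases "integrable ?C (\<lambda>l. a (lshift l \<xi>) * b (lshift l \<xi>))") (auto intro: integral_norm_bound_ennreal simp: not_integrable_integral_eq)
  also have "\<dots> = (\<integral>\<^sup>+l. ennreal (norm (a (lshift l \<xi>))) * ennreal (norm (b (lshift l \<xi>))) \<partial>?C)"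
    by (simp add: norm_mult ennreal_mult)
  finally have "(ennreal (norm (per (\<lambda>\<eta>. a \<eta> * b \<eta>) \<xi>)))\<^sup>2 \<le> (\<integral>\<^sup>+l. ennreal (norm (a (lshift l \<xi>))) * ennreal (norm (b (lshift l \<xi>))) \<partial>?C)\<^sup>2"
    unfolding per_def by (intro power_mono) auto
  also have "\<dots> \<le> (\<integral>\<^sup>+l. (ennreal (norm (a (lshift l \<xi>))))\<^sup>2 \<partial>?C) * (\<integral>\<^sup>+l. (ennreal (norm (b (lshift l \<xi>))))\<^sup>2 \<partial>?C)"
    by (rule Cauchy_Schwarz_nn_integral) auto
  also have "\<dots> \<le> ennreal B * (\<integral>\<^sup>+l. ennreal ((norm (b (lshift l \<xi>)))\<^sup>2) \<partial>?C)"
    using assms by (intro mult_mono) (auto simp: ennreal_power)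
  finally show ?thesis by (simp add: ennreal_power)
qed

lemma integrable_product_L2:
  fixes a b :: "'a \<Rightarrow> complex"
  assumes [measurable]: "a \<in> borel_measurable M" "b \<in> borel_measurable M"
    and a: "(\<integral>\<^sup>+x. ennreal ((norm (a x))\<^sup>2) \<partial>M) < \<infinity>" and b: "(\<integral>\<^sup>+x. ennreal ((norm (b x))\<^sup>2) \<partial>M) < \<infinity>"
  shows "integrable M (\<lambda>x. a x * b x)"
proof (rule integrableI_bounded)
  have "(\<integral>\<^sup>+x. ennreal (norm (a x)) * ennreal (norm (b x)) \<partial>M)\<^sup>2 \<le> (\<integral>\<^sup>+x. (ennreal (norm (a x)))\<^sup>2 \<partial>M) * (\<integral>\<^sup>+x. (ennreal (norm (b x)))\<^sup>2 \<partial>M)"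
    by (rule Cauchy_Schwarz_nn_integral) auto
  also have "\<dots> < top" using a b by (simp add: ennreal_power ennreal_mult_less_top)
  finally have "(\<integral>\<^sup>+x. ennreal (norm (a x)) * ennreal (norm (b x)) \<partial>M) < top"
    by (simp add: power_less_top_ennreal)
  then show "(\<integral>\<^sup>+x. ennreal (norm (a x * b x)) \<partial>M) < \<infinity>" by (simp add: norm_mult ennreal_mult)
qed measurable

lemma nn_integral_Q_per_square_le:
  fixes a b :: "real ^ 'd::finite \<Rightarrow> complex"
  assumes a: "AE \<xi> in lborel. (\<integral>\<^sup>+l. ennreal ((norm (a (lshift l \<xi>)))\<^sup>2) \<partial>count_space UNIV) \<le> ennreal B"
    and [measurable]: "b \<in> borel_measurable borel"
  shows "(\<integral>\<^sup>+\<xi>\<in>Q. ennreal ((norm (per (\<lambda>\<eta>. a \<eta> * b \<eta>) \<xi>))\<^sup>2) \<partial>lborel) \<le> ennreal B * (\<integral>\<^sup>+\<xi>. ennreal ((norm (b \<xi>))\<^sup>2) \<partial>lborel)"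
proof -
  have m: "(\<lambda>\<xi>. \<integral>\<^sup>+l. ennreal ((norm (b (lshift l \<xi>)))\<^sup>2) \<partial>count_space UNIV) \<in> borel_measurable borel"
    by (rule nn_integral_lattice_measurable) measurable
  have "(\<integral>\<^sup>+\<xi>\<in>Q. ennreal ((norm (per (\<lambda>\<eta>. a \<eta> * b \<eta>) \<xi>))\<^sup>2) \<partial>lborel) \<le>
    (\<integral>\<^sup>+\<xi>\<in>Q. ennreal B * (\<integral>\<^sup>+l. ennreal ((norm (b (lshift l \<xi>)))\<^sup>2) \<partial>count_space UNIV) \<partial>lborel)"
  proof (rule nn_integral_mono_AE)
    from a show "AE \<xi> in lborel. ennreal ((norm (per (\<lambda>\<eta>. a \<eta> * b \<eta>) \<xi>))\<^sup>2) * indicator Q \<xi> \<le>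
      ennreal B * (\<integral>\<^sup>+l. ennreal ((norm (b (lshift l \<xi>)))\<^sup>2) \<partial>count_space UNIV) * indicator Q \<xi>"
      by eventually_elim (intro mult_right_mono norm_per_square_le, auto)
  qed
  also have "\<dots> = ennreal B * (\<integral>\<^sup>+\<xi>. ennreal ((norm (b \<xi>))\<^sup>2) \<partial>lborel)"
    using m by (subst nn_integral_tile[of "\<lambda>\<xi>. ennreal ((norm (b \<xi>))\<^sup>2)"]) (auto simp: mult.assoc nn_integral_cmult)
  finally show ?thesis .
qed

section \<open>Quadratic forms on the Fourier side\<close>

lemma one_plus_norm_pos: "1 + norm x > 0"
  using norm_ge_zero[of x] by linarith

lemma one_plus_norm_mult_le: "1 + norm (x + y) \<le> (1 + norm x) * (1 + norm y)"
proof -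
  have "0 \<le> norm x * norm y" by simp
  moreover have "(1 + norm x) * (1 + norm y) = 1 + (norm x + norm y) + norm x * norm y" by (simp add: algebra_simps)
  ultimately show ?thesis using norm_triangle_ineq[of x y] by linarith
qed

lemma inverse_power_pair_le:
  "1 / (1 + norm (x, y)) ^ (K + L) \<le> 1 / (1 + norm x) ^ K * (1 / (1 + norm y) ^ L)"
proof -
  have "(1 + norm x) ^ K * (1 + norm y) ^ L \<le> (1 + norm (x, y)) ^ K * (1 + norm (x, y)) ^ L"
    by (intro mult_mono power_mono add_left_mono norm_fst_le norm_snd_le) auto
  moreover have "0 < (1 + norm x) ^ K * (1 + norm y) ^ L"
    by (intro mult_pos_pos zero_less_power one_plus_norm_pos)
  ultimately show ?thesis unfolding power_add by (simp add: frac_le)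
qed

lemma slice_iter_pderiv:
  assumes a: "schwartz a" and b: "b \<in> Basis"
  shows "schwartz (iter_pderiv (replicate n (b, 0)) a) \<and>
    iter_pderiv (replicate n b) (\<lambda>x. a (x, \<zeta>)) = (\<lambda>x. iter_pderiv (replicate n (b, 0)) a (x, \<zeta>))"
proof (induction n)
  case (Suc n)
  let ?A = "iter_pderiv (replicate n (b, 0)) a"
  have s: "schwartz ?A" using Suc by simp
  have B: "(b, 0) \<in> (Basis :: ('a \<times> 'b) set)" using b by (auto simp: Basis_prod_def)
  have hd: "((\<lambda>x. ?A (x, \<zeta>)) has_derivative (\<lambda>v. frechet_derivative ?A (at (x, \<zeta>)) (v, 0))) (at x)" for x
    using has_derivative_compose_affine[OF bounded_linear_Pair[OF bounded_linear_ident bounded_linear_zero], of ?A _ x "(0, \<zeta>)"]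
      schwartz_has_derivative[OF s, of "(x, \<zeta>)"] by simp
  have "frechet_derivative (\<lambda>x. ?A (x, \<zeta>)) (at x) b = frechet_derivative ?A (at (x, \<zeta>)) (b, 0)" for x
    using fun_cong[OF frechet_derivative_at[OF hd[of x]], of b] by simp
  then show ?case using Suc schwartz_pderiv[OF s B] by simp
qed (use a in simp)

text \<open>Derivatives along (b, 0) give powers of the dual variable \<theta>, and the integral of
  the absolute value over a slice decays in \<zeta> because a Schwartz bound in (x, \<zeta>) splits
  into a product of bounds in x and in \<zeta>.\<close>

lemma partial_fourier_decay:
  fixes a :: "(real ^ 'd::finite) \<times> 'b::euclidean_space \<Rightarrow> complex"
  assumes a: "schwartz a"
  obtains C where "C \<ge> 0" "\<And>\<theta> \<zeta>. norm (fourier (\<lambda>x. a (x, \<zeta>)) \<theta>) \<le> C * (1 / (1 + norm \<theta>) ^ K * (1 / (1 + norm \<zeta>) ^ L))"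
proof -
  let ?n = "2 * CARD('d)"
  define J where "J = (LINT x|lborel. 1 / (1 + norm (x :: real ^ 'd)) ^ ?n)"
  have Ji: "integrable lborel (\<lambda>x :: real ^ 'd. 1 / (1 + norm x) ^ ?n)" by (rule integrable_inverse_poly) simp
  have J0: "J \<ge> 0" unfolding J_def by (intro Bochner_Integration.integral_nonneg_AE AE_I2) (auto intro: less_imp_le[OF one_plus_norm_pos])
  have int: "\<exists>C\<ge>0. \<forall>\<zeta>. (LINT x|lborel. norm (b (x, \<zeta>))) \<le> C * (1 / (1 + norm \<zeta>) ^ L)" if b: "schwartz b"
    for b :: "(real ^ 'd) \<times> 'b \<Rightarrow> complex"
  proof -
    obtain C where C: "C \<ge> 0" "\<And>z. norm (b z) \<le> C / (1 + norm z) ^ (?n + L)" using schwartz_rapid[OF b] by (metis rapidE)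
    have "(LINT x|lborel. norm (b (x, \<zeta>))) \<le> (LINT x|lborel. (C * (1 / (1 + norm \<zeta>) ^ L)) * (1 / (1 + norm (x :: real ^ 'd)) ^ ?n))" for \<zeta>
    proof (rule integral_mono)
      show "integrable lborel (\<lambda>x. norm (b (x, \<zeta>)))"
        by (intro integrable_norm schwartz_integrable schwartz_slice'[OF b])
      show "norm (b (x, \<zeta>)) \<le> (C * (1 / (1 + norm \<zeta>) ^ L)) * (1 / (1 + norm x) ^ ?n)" for x
        using C(2)[of "(x, \<zeta>)"] mult_left_mono[OF inverse_power_pair_le[of x \<zeta> ?n L] C(1)] by (simp add: mult_ac)
    qed (use Ji in \<open>rule integrable_mult_right\<close>)
    then have "(LINT x|lborel. norm (b (x, \<zeta>))) \<le> (C * J) * (1 / (1 + norm \<zeta>) ^ L)" for \<zeta>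
      unfolding integral_mult_right_zero J_def[symmetric] by (simp only: mult_ac)
    then show ?thesis using C(1) J0 by (intro exI[of _ "C * J"]) auto
  qed
  obtain C0 where C0: "C0 \<ge> 0" "\<And>\<zeta>. (LINT x|lborel. norm (a (x, \<zeta>))) \<le> C0 * (1 / (1 + norm \<zeta>) ^ L)" using int[OF a] by blast
  have "\<forall>b\<in>(Basis :: (real ^ 'd) set). \<exists>C\<ge>0. \<forall>\<zeta>. (LINT x|lborel. norm (iter_pderiv (replicate K (b, 0)) a (x, \<zeta>))) \<le> C * (1 / (1 + norm \<zeta>) ^ L)"
    using int slice_iter_pderiv[OF a] by blast
  then obtain C where C: "\<And>b. b \<in> Basis \<Longrightarrow> C b \<ge> 0"
    "\<And>b \<zeta>. b \<in> (Basis :: (real ^ 'd) set) \<Longrightarrow> (LINT x|lborel. norm (iter_pderiv (replicate K (b, 0)) a (x, \<zeta>))) \<le> C b * (1 / (1 + norm \<zeta>) ^ L)"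
    by metis
  define E where "E = (1 + real DIM(real ^ 'd)) ^ K"
  have E: "E \<ge> 0" by (simp add: E_def)
  show ?thesis
  proof (rule that[of "E * (C0 + (\<Sum>b\<in>Basis. C b))"])
    show "E * (C0 + (\<Sum>b\<in>Basis. C b)) \<ge> 0" using E C0(1) C(1) by (intro mult_nonneg_nonneg add_nonneg_nonneg sum_nonneg) auto
    fix \<theta> :: "real ^ 'd" and \<zeta> :: 'b
    let ?g = "\<lambda>x. a (x, \<zeta>)"
    have g: "schwartz ?g" by (rule schwartz_slice'[OF a])
    have "(1 + norm \<theta>) ^ K * norm (fourier ?g \<theta>) \<le> (E * (1 + (\<Sum>b\<in>Basis. \<bar>\<theta> \<bullet> b\<bar> ^ K))) * norm (fourier ?g \<theta>)"
      unfolding E_def by (intro mult_right_mono one_plus_norm_power_le) auto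
    also have "\<dots> = E * (norm (fourier ?g \<theta>) + (\<Sum>b\<in>Basis. \<bar>\<theta> \<bullet> b\<bar> ^ K * norm (fourier ?g \<theta>)))"
      by (simp add: algebra_simps sum_distrib_left)
    also have "\<dots> \<le> E * (C0 * (1 / (1 + norm \<zeta>) ^ L) + (\<Sum>b\<in>Basis. C b * (1 / (1 + norm \<zeta>) ^ L)))"
    proof (intro mult_left_mono add_mono sum_mono E)
      show "norm (fourier ?g \<theta>) \<le> C0 * (1 / (1 + norm \<zeta>) ^ L)"
        using norm_fourier_le[OF schwartz_integrable[OF g], of \<theta>] C0(2)[of \<zeta>] by linarith
      fix b :: "real ^ 'd" assume b: "b \<in> Basis"
      note i = fourier_iter_pderiv[OF g b, of K \<theta>]
      have "\<bar>\<theta> \<bullet> b\<bar> ^ K * norm (fourier ?g \<theta>) = norm (fourier (iter_pderiv (replicate K b) ?g) \<theta>)"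
        using i by (simp add: norm_mult norm_power)
      also have "\<dots> \<le> (LINT x|lborel. norm (iter_pderiv (replicate K b) ?g x))"
        using i by (intro norm_fourier_le schwartz_integrable) auto
      also have "\<dots> \<le> C b * (1 / (1 + norm \<zeta>) ^ L)"
        using C(2)[OF b, of \<zeta>] slice_iter_pderiv[OF a b, of K \<zeta>] by simp
      finally show "\<bar>\<theta> \<bullet> b\<bar> ^ K * norm (fourier ?g \<theta>) \<le> C b * (1 / (1 + norm \<zeta>) ^ L)" .
    qed
    also have "\<dots> = E * (C0 + (\<Sum>b\<in>Basis. C b)) * (1 / (1 + norm \<zeta>) ^ L)"
      by (simp only: sum_distrib_right[symmetric] ring_distribs mult.assoc)
    finally have *: "(1 + norm \<theta>) ^ K * norm (fourier ?g \<theta>) \<le> E * (C0 + (\<Sum>b\<in>Basis. C b)) * (1 / (1 + norm \<zeta>) ^ L)" .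
    have p: "(1 + norm \<theta>) ^ K > 0" by (intro zero_less_power one_plus_norm_pos)
    have "norm (fourier ?g \<theta>) \<le> E * (C0 + (\<Sum>b\<in>Basis. C b)) * (1 / (1 + norm \<zeta>) ^ L) / (1 + norm \<theta>) ^ K"
      using * p by (subst pos_le_divide_eq) (simp_all only: mult.commute)
    then show "norm (fourier ?g \<theta>) \<le> E * (C0 + (\<Sum>b\<in>Basis. C b)) * (1 / (1 + norm \<theta>) ^ K * (1 / (1 + norm \<zeta>) ^ L))"
      by (simp add: mult_ac)
  qed
qed

definition weighted_sq :: "real \<Rightarrow> nat \<Rightarrow> ('a::euclidean_space \<Rightarrow> complex) \<Rightarrow> ennreal" where
  "weighted_sq \<epsilon> N f = (\<integral>\<^sup>+\<xi>. ennreal ((norm (f \<xi>) / (1 + norm (\<epsilon> *\<^sub>R \<xi>)) ^ N)\<^sup>2) \<partial>lborel)"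

text \<open>Up to the factor (2 pi)^d, the standard semiclassical quantization a(x, \<epsilon> D)
  applied to the function with Fourier transform g.\<close>

definition synth :: "real \<Rightarrow> ((real ^ 'd) \<times> (real ^ 'd) \<Rightarrow> complex) \<Rightarrow> (real ^ 'd::finite \<Rightarrow> complex) \<Rightarrow> real ^ 'd \<Rightarrow> complex" where
  "synth \<epsilon> a g x = (LINT \<xi>|lborel. g \<xi> * (cis (x \<bullet> \<xi>) * a (x, \<epsilon> *\<^sub>R \<xi>)))"

text \<open>Up to constants, a(x, \<epsilon> D) applied to the inverse transform of g and paired
  with that of f, but written on the Fourier side so that f and g may be merely square integrable
  with a weight. It is conjugate linear in f.\<close>

definition wform :: "real \<Rightarrow> ((real ^ 'd) \<times> (real ^ 'd) \<Rightarrow> complex) \<Rightarrow> (real ^ 'd::finite \<Rightarrow> complex) \<Rightarrow> (real ^ 'd \<Rightarrow> complex) \<Rightarrow> complex" where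
  "wform \<epsilon> a f g = (LINT \<eta>|lborel. cnj (f \<eta>) * fourier (synth \<epsilon> a g) \<eta>)"

text \<open>The 2 DIM additional powers form an integrable function, and x y \<le> x^2 + y whenever
  x \<ge> 0 and 0 \<le> y \<le> 1.\<close>

lemma weighted_integrable:
  fixes g :: "'a::euclidean_space \<Rightarrow> complex"
  assumes [measurable]: "g \<in> borel_measurable borel" and g: "weighted_sq \<epsilon> N g < \<infinity>" and e: "\<epsilon> > 0"
  shows "integrable lborel (\<lambda>\<xi>. norm (g \<xi>) / (1 + norm (\<epsilon> *\<^sub>R \<xi>)) ^ (N + 2 * DIM('a)))"
proof (rule Bochner_Integration.integrable_bound)
  let ?n = "2 * DIM('a)"
  have 1: "integrable lborel (\<lambda>\<xi>. (norm (g \<xi>) / (1 + norm (\<epsilon> *\<^sub>R \<xi>)) ^ N)\<^sup>2)"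
    using g unfolding weighted_sq_def by (intro integrableI_bounded) auto
  have 2: "integrable lborel (\<lambda>\<xi>::'a. 1 / (1 + norm (\<epsilon> *\<^sub>R \<xi>)) ^ ?n)"
    using integrable_affine[OF integrable_inverse_poly[of ?n, where 'a='a], of \<epsilon> 0] e by simp
  show "integrable lborel (\<lambda>\<xi>. (norm (g \<xi>) / (1 + norm (\<epsilon> *\<^sub>R \<xi>)) ^ N)\<^sup>2 + 1 / (1 + norm (\<epsilon> *\<^sub>R \<xi>)) ^ ?n)"
    using 1 2 by (rule Bochner_Integration.integrable_add)
  show "AE \<xi> in lborel. norm (norm (g \<xi>) / (1 + norm (\<epsilon> *\<^sub>R \<xi>)) ^ (N + ?n)) \<le> norm ((norm (g \<xi>) / (1 + norm (\<epsilon> *\<^sub>R \<xi>)) ^ N)\<^sup>2 + 1 / (1 + norm (\<epsilon> *\<^sub>R \<xi>)) ^ ?n)"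
  proof (rule AE_I2)
    fix \<xi> :: 'a
    let ?x = "norm (g \<xi>) / (1 + norm (\<epsilon> *\<^sub>R \<xi>)) ^ N" and ?y = "1 / (1 + norm (\<epsilon> *\<^sub>R \<xi>)) ^ ?n"
    have x: "?x \<ge> 0" by (intro divide_nonneg_nonneg zero_le_power less_imp_le[OF one_plus_norm_pos]) auto
    have y: "?y \<ge> 0" "?y \<le> 1" using one_le_power[of "1 + norm (\<epsilon> *\<^sub>R \<xi>)" ?n] by (auto simp: divide_simps)
    have "?x * ?y \<le> ?x\<^sup>2 + ?y"
    proof (cases "?x \<le> 1")
      case True
      then show ?thesis using mult_right_mono[OF True y(1)] zero_le_power2[of ?x] by linarith
    next
      case False
      then have "?x * ?y \<le> ?x * ?x" using y x by (intro mult_left_mono) linarith+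
      then show ?thesis using y(1) unfolding power2_eq_square by linarith
    qed
    moreover have "norm (g \<xi>) / (1 + norm (\<epsilon> *\<^sub>R \<xi>)) ^ (N + ?n) = ?x * ?y"
      by (simp only: power_add times_divide_times_eq mult_1_right)
    moreover have "0 \<le> ?x * ?y" using x y(1) by (rule mult_nonneg_nonneg)
    ultimately show "norm (norm (g \<xi>) / (1 + norm (\<epsilon> *\<^sub>R \<xi>)) ^ (N + ?n)) \<le> norm (?x\<^sup>2 + ?y)"
      unfolding real_norm_def by linarith
  qed
qed measurable

context
  fixes a :: "(real ^ 'd::finite) \<times> (real ^ 'd) \<Rightarrow> complex" and \<epsilon> :: real
  assumes a: "schwartz a" and e: "\<epsilon> > 0"
begin

lemma schwartz_synth_kernel: "schwartz (\<lambda>z. cis (fst z \<bullet> snd z) * a (fst z, \<epsilon> *\<^sub>R snd z))"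
proof (rule schwartz_mult[OF moderate_cis[OF moderate_inner_prod]])
  have L: "bounded_linear (\<lambda>z::(real ^ 'd) \<times> (real ^ 'd). (fst z, \<epsilon> *\<^sub>R snd z))"
    by (intro bounded_linear_Pair bounded_linear_fst bounded_linear_scaleR_right[THEN bounded_linear_compose] bounded_linear_snd)
  have "norm z \<le> (1 + 1 / \<epsilon>) * norm (fst z, \<epsilon> *\<^sub>R snd z)" for z :: "(real ^ 'd) \<times> (real ^ 'd)"
  proof -
    have "norm z \<le> norm (fst z) + norm (snd z)"
      using norm_triangle_ineq[of "(fst z, 0)" "(0, snd z)"] by (simp add: norm_Pair)
    also have "norm (fst z) \<le> norm (fst z, \<epsilon> *\<^sub>R snd z)" by (rule norm_fst_le)
    also have "norm (snd z) = (1 / \<epsilon>) * norm (\<epsilon> *\<^sub>R snd z)" using e by simp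
    also have "\<dots> \<le> (1 / \<epsilon>) * norm (fst z, \<epsilon> *\<^sub>R snd z)" using e by (intro mult_left_mono norm_snd_le) auto
    finally show ?thesis by (simp add: algebra_simps)
  qed
  from schwartz_compose_affine[OF L this a, of 0] show "schwartz (\<lambda>z. a (fst z, \<epsilon> *\<^sub>R snd z))" by simp
qed

lemma schwartz_synth:
  assumes gm [measurable]: "g \<in> borel_measurable borel" and g: "weighted_sq \<epsilon> N g < \<infinity>"
  shows "schwartz (synth \<epsilon> a g)"
proof -
  let ?M = "N + 2 * DIM(real ^ 'd)"
  have "integrable lborel (\<lambda>\<xi>. norm (g \<xi>) / (1 + norm \<xi>) ^ ?M)"
  proof (rule Bochner_Integration.integrable_bound)
    show "integrable lborel (\<lambda>\<xi>. (1 + \<epsilon>) ^ ?M * (norm (g \<xi>) / (1 + norm (\<epsilon> *\<^sub>R \<xi>)) ^ ?M))"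
      using weighted_integrable[OF gm g e] by (rule integrable_mult_right)
    show "AE \<xi> in lborel. norm (norm (g \<xi>) / (1 + norm \<xi>) ^ ?M) \<le> norm ((1 + \<epsilon>) ^ ?M * (norm (g \<xi>) / (1 + norm (\<epsilon> *\<^sub>R \<xi>)) ^ ?M))"
    proof (rule AE_I2)
      fix \<xi> :: "real ^ 'd"
      have "1 + norm (\<epsilon> *\<^sub>R \<xi>) \<le> (1 + \<epsilon>) * (1 + norm \<xi>)" using e by (simp add: algebra_simps)
      then have "(1 + norm (\<epsilon> *\<^sub>R \<xi>)) ^ ?M \<le> (1 + \<epsilon>) ^ ?M * (1 + norm \<xi>) ^ ?M"
        unfolding power_mult_distrib[symmetric] by (intro power_mono less_imp_le[OF one_plus_norm_pos])
      moreover have "0 < (1 + norm (\<epsilon> *\<^sub>R \<xi>)) ^ ?M" "0 < (1 + norm \<xi>) ^ ?M" by (intro zero_less_power one_plus_norm_pos)+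
      ultimately have "1 / (1 + norm \<xi>) ^ ?M \<le> (1 + \<epsilon>) ^ ?M / (1 + norm (\<epsilon> *\<^sub>R \<xi>)) ^ ?M" by (simp add: divide_simps mult.commute)
      from mult_left_mono[OF this norm_ge_zero[of "g \<xi>"]]
      have "norm (g \<xi>) / (1 + norm \<xi>) ^ ?M \<le> (1 + \<epsilon>) ^ ?M * (norm (g \<xi>) / (1 + norm (\<epsilon> *\<^sub>R \<xi>)) ^ ?M)" by (simp add: mult_ac)
      moreover have "0 \<le> norm (g \<xi>) / (1 + norm \<xi>) ^ ?M" by simp
      ultimately show "norm (norm (g \<xi>) / (1 + norm \<xi>) ^ ?M) \<le> norm ((1 + \<epsilon>) ^ ?M * (norm (g \<xi>) / (1 + norm (\<epsilon> *\<^sub>R \<xi>)) ^ ?M))"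
        unfolding real_norm_def by linarith
    qed
  qed measurable
  from schwartz_parametric_integral[OF gm this schwartz_synth_kernel]
  show ?thesis unfolding synth_def[abs_def] by simp
qed

lemma synth_integrable:
  assumes gm [measurable]: "g \<in> borel_measurable borel" and g: "weighted_sq \<epsilon> N g < \<infinity>"
  shows "integrable lborel (\<lambda>\<xi>. g \<xi> * (cis (x \<bullet> \<xi>) * a (x, \<epsilon> *\<^sub>R \<xi>)))"
proof -
  let ?M = "N + 2 * DIM(real ^ 'd)"
  have am [measurable]: "a \<in> borel_measurable borel" by (rule schwartz_borel[OF a])
  obtain C where C: "C \<ge> 0" "\<And>z. norm (a z) \<le> C / (1 + norm z) ^ (0 + ?M)" using schwartz_rapid[OF a] by (metis rapidE)
  have iC: "integrable lborel (\<lambda>\<xi>. C * (norm (g \<xi>) / (1 + norm (\<epsilon> *\<^sub>R \<xi>)) ^ ?M))"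
    using weighted_integrable[OF gm g e] by (rule integrable_mult_right)
  have "norm (g \<xi> * (cis (x \<bullet> \<xi>) * a (x, \<epsilon> *\<^sub>R \<xi>))) \<le> C * (norm (g \<xi>) / (1 + norm (\<epsilon> *\<^sub>R \<xi>)) ^ ?M)" for \<xi>
  proof -
    have "norm (a (x, \<epsilon> *\<^sub>R \<xi>)) \<le> C * (1 / (1 + norm (\<epsilon> *\<^sub>R \<xi>)) ^ ?M)"
      using C(2)[of "(x, \<epsilon> *\<^sub>R \<xi>)"] mult_left_mono[OF inverse_power_pair_le[of x "\<epsilon> *\<^sub>R \<xi>" 0 ?M] C(1)] by simp
    from mult_left_mono[OF this norm_ge_zero[of "g \<xi>"]] show ?thesis by (simp add: norm_mult mult_ac)
  qed
  then have AEC: "AE \<xi> in lborel. norm (g \<xi> * (cis (x \<bullet> \<xi>) * a (x, \<epsilon> *\<^sub>R \<xi>))) \<le> norm (C * (norm (g \<xi>) / (1 + norm (\<epsilon> *\<^sub>R \<xi>)) ^ ?M))"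
    unfolding real_norm_def by (intro AE_I2 order_trans[OF _ abs_ge_self])
  have "(\<lambda>\<xi>. a (x, \<epsilon> *\<^sub>R \<xi>)) \<in> borel_measurable borel"
    using measurable_compose[OF _ schwartz_borel[OF schwartz_slice[OF a]], of "\<lambda>\<xi>. \<epsilon> *\<^sub>R \<xi>" borel x] by simp
  then have "(\<lambda>\<xi>. g \<xi> * (cis (x \<bullet> \<xi>) * a (x, \<epsilon> *\<^sub>R \<xi>))) \<in> borel_measurable lborel" by measurable
  from Bochner_Integration.integrable_bound[OF iC this AEC] show ?thesis .
qed

text \<open>Fubini, with the two phases combined into exp (- i x (\<eta> - \<xi>)), exhibits the
  quantization as an integral operator in frequency whose kernel is the partial transform of a at
  (\<eta> - \<xi>, \<epsilon> \<xi>).\<close>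

lemma fourier_synth:
  assumes gm [measurable]: "g \<in> borel_measurable borel" and g: "weighted_sq \<epsilon> N g < \<infinity>"
  shows "fourier (synth \<epsilon> a g) \<eta> = (LINT \<xi>|lborel. g \<xi> * fourier (\<lambda>x. a (x, \<epsilon> *\<^sub>R \<xi>)) (\<eta> - \<xi>))"
proof -
  let ?M = "N + 2 * DIM(real ^ 'd)" and ?n = "2 * DIM(real ^ 'd)"
  let ?F = "\<lambda>\<xi> x. g \<xi> * (cis (x \<bullet> \<xi>) * a (x, \<epsilon> *\<^sub>R \<xi>)) * cis (- (x \<bullet> \<eta>))"
  obtain C where C: "C \<ge> 0" "\<And>z. norm (a z) \<le> C / (1 + norm z) ^ (?n + ?M)" using schwartz_rapid[OF a] by (metis rapidE)
  have "fourier (synth \<epsilon> a g) \<eta> = (LINT x|lborel. LINT \<xi>|lborel. ?F \<xi> x)"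
    unfolding fourier_def synth_def by simp
  also have "\<dots> = (LINT \<xi>|lborel. LINT x|lborel. ?F \<xi> x)"
  proof (rule fubini_prod_bound[where f="\<lambda>\<xi>. C * (norm (g \<xi>) / (1 + norm (\<epsilon> *\<^sub>R \<xi>)) ^ ?M)" and g="\<lambda>x. 1 / (1 + norm x) ^ ?n"])
    show "integrable lborel (\<lambda>\<xi>. C * (norm (g \<xi>) / (1 + norm (\<epsilon> *\<^sub>R \<xi>)) ^ ?M))"
      using weighted_integrable[OF gm g e] by (rule integrable_mult_right)
    show "integrable lborel (\<lambda>x::real ^ 'd. 1 / (1 + norm x) ^ ?n)" by (rule integrable_inverse_poly) simp
    show "norm (?F \<xi> x) \<le> C * (norm (g \<xi>) / (1 + norm (\<epsilon> *\<^sub>R \<xi>)) ^ ?M) * (1 / (1 + norm x) ^ ?n)" for \<xi> x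
    proof -
      have "norm (a (x, \<epsilon> *\<^sub>R \<xi>)) \<le> C * (1 / (1 + norm x) ^ ?n * (1 / (1 + norm (\<epsilon> *\<^sub>R \<xi>)) ^ ?M))"
        using C(2)[of "(x, \<epsilon> *\<^sub>R \<xi>)"] mult_left_mono[OF inverse_power_pair_le[of x "\<epsilon> *\<^sub>R \<xi>" ?n ?M] C(1)] by simp
      from mult_left_mono[OF this norm_ge_zero[of "g \<xi>"]] show ?thesis by (simp add: norm_mult mult_ac)
    qed
    have "(\<lambda>z::(real ^ 'd) \<times> (real ^ 'd). a (snd z, \<epsilon> *\<^sub>R fst z)) \<in> borel_measurable borel"
    proof (rule borel_measurable_continuous_onI)
      show "continuous_on UNIV (\<lambda>z::(real ^ 'd) \<times> (real ^ 'd). a (snd z, \<epsilon> *\<^sub>R fst z))"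
        by (rule continuous_on_compose2[OF schwartz_continuous[OF a, of UNIV]]) (auto intro!: continuous_intros)
    qed
    then have [measurable]: "(\<lambda>z::(real ^ 'd) \<times> (real ^ 'd). a (snd z, \<epsilon> *\<^sub>R fst z)) \<in> borel_measurable (borel \<Otimes>\<^sub>M borel)"
      by (simp add: borel_prod)
    have "(\<lambda>z. g (fst z) * (cis (snd z \<bullet> fst z) * a (snd z, \<epsilon> *\<^sub>R fst z)) * cis (- (snd z \<bullet> \<eta>))) \<in> borel_measurable (borel \<Otimes>\<^sub>M borel)"
      by measurable
    then show "case_prod ?F \<in> borel_measurable (lborel \<Otimes>\<^sub>M lborel)" by (simp add: case_prod_beta')
  qed
  also have "\<dots> = (LINT \<xi>|lborel. g \<xi> * fourier (\<lambda>x. a (x, \<epsilon> *\<^sub>R \<xi>)) (\<eta> - \<xi>))"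
  proof (rule Bochner_Integration.integral_cong[OF refl])
    fix \<xi> :: "real ^ 'd"
    have "?F \<xi> x = g \<xi> * (a (x, \<epsilon> *\<^sub>R \<xi>) * cis (- (x \<bullet> (\<eta> - \<xi>))))" for x
    proof -
      have "cis (- (x \<bullet> (\<eta> - \<xi>))) = cis (x \<bullet> \<xi>) * cis (- (x \<bullet> \<eta>))" by (simp add: cis_mult inner_diff_right)
      then show ?thesis by (simp only: mult_ac)
    qed
    then show "(LINT x|lborel. ?F \<xi> x) = g \<xi> * fourier (\<lambda>x. a (x, \<epsilon> *\<^sub>R \<xi>)) (\<eta> - \<xi>)"
      unfolding fourier_def by (simp only: integral_mult_right_zero)
  qed
  finally show ?thesis .
qed

end

text \<open>Schur's test for a convolution kernel: q^2 is written as q times q, one factor going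
  with F and one with G. Cauchy-Schwarz on the product space then leaves marginals of q^2 that are
  constant by translation and reflection.\<close>

lemma nn_integral_convolution_le:
  fixes F G q :: "real ^ 'd::finite \<Rightarrow> ennreal"
  assumes [measurable]: "F \<in> borel_measurable borel" "G \<in> borel_measurable borel" "q \<in> borel_measurable borel"
  shows "(\<integral>\<^sup>+\<eta>. (\<integral>\<^sup>+\<xi>. F \<eta> * G \<xi> * (q (\<eta> - \<xi>))\<^sup>2 \<partial>lborel) \<partial>lborel)\<^sup>2
    \<le> (\<integral>\<^sup>+\<theta>. (q \<theta>)\<^sup>2 \<partial>lborel)\<^sup>2 * ((\<integral>\<^sup>+\<eta>. (F \<eta>)\<^sup>2 \<partial>lborel) * (\<integral>\<^sup>+\<xi>. (G \<xi>)\<^sup>2 \<partial>lborel))"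
proof -
  let ?\<kappa> = "\<integral>\<^sup>+\<theta>. (q \<theta>)\<^sup>2 \<partial>lborel"
  have k1: "(\<integral>\<^sup>+\<xi>. (q (\<eta> - \<xi>))\<^sup>2 \<partial>lborel) = ?\<kappa>" for \<eta>
    by (subst nn_integral_affine[of "\<lambda>\<theta>. (q \<theta>)\<^sup>2" "-1" \<eta>]) auto
  have k2: "(\<integral>\<^sup>+\<eta>. (q (\<eta> - \<xi>))\<^sup>2 \<partial>lborel) = ?\<kappa>" for \<xi>
    by (subst nn_integral_affine[of "\<lambda>\<theta>. (q \<theta>)\<^sup>2" 1 "- \<xi>"]) auto
  have 1: "(\<integral>\<^sup>+z. (F (fst z) * q (fst z - snd z))\<^sup>2 \<partial>(lborel \<Otimes>\<^sub>M lborel)) = ?\<kappa> * (\<integral>\<^sup>+\<eta>. (F \<eta>)\<^sup>2 \<partial>lborel)"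
    by (subst lborel.nn_integral_fst[symmetric], measurable)
      (simp add: power_mult_distrib nn_integral_cmult k1 nn_integral_multc mult.commute)
  have 2: "(\<integral>\<^sup>+z. (G (snd z) * q (fst z - snd z))\<^sup>2 \<partial>(lborel \<Otimes>\<^sub>M lborel)) = ?\<kappa> * (\<integral>\<^sup>+\<xi>. (G \<xi>)\<^sup>2 \<partial>lborel)"
    by (subst lborel_pair.nn_integral_snd[symmetric], measurable)
      (simp add: power_mult_distrib nn_integral_cmult k2 nn_integral_multc mult.commute)
  have "(\<integral>\<^sup>+\<eta>. (\<integral>\<^sup>+\<xi>. F \<eta> * G \<xi> * (q (\<eta> - \<xi>))\<^sup>2 \<partial>lborel) \<partial>lborel) =
     (\<integral>\<^sup>+z. (F (fst z) * q (fst z - snd z)) * (G (snd z) * q (fst z - snd z)) \<partial>(lborel \<Otimes>\<^sub>M lborel))"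
    by (subst lborel.nn_integral_fst[symmetric], measurable) (simp add: power2_eq_square mult_ac)
  also have "\<dots>\<^sup>2 \<le> (\<integral>\<^sup>+z. (F (fst z) * q (fst z - snd z))\<^sup>2 \<partial>(lborel \<Otimes>\<^sub>M lborel)) * (\<integral>\<^sup>+z. (G (snd z) * q (fst z - snd z))\<^sup>2 \<partial>(lborel \<Otimes>\<^sub>M lborel))"
    by (rule Cauchy_Schwarz_nn_integral) measurable
  also have "\<dots> = ?\<kappa>\<^sup>2 * ((\<integral>\<^sup>+\<eta>. (F \<eta>)\<^sup>2 \<partial>lborel) * (\<integral>\<^sup>+\<xi>. (G \<xi>)\<^sup>2 \<partial>lborel))"
    unfolding 1 2 by (simp add: power2_eq_square mult_ac)
  finally show ?thesis .
qed

lemma inverse_power_split: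
  "1 / x ^ (N + 2 * n) * (1 / y ^ (2 * N)) = (1 / x ^ N * (1 / y ^ N)) * (1 / y ^ N * (1 / x ^ n)\<^sup>2)" for x y :: real
  by (simp add: mult_2 power_add power2_eq_square)

text \<open>The weight is absorbed by half of the decay of the partial Fourier transform in its second
  argument, because \<open>1 + |\<epsilon>\<eta>| \<le> (1 + |\<epsilon>\<xi>|) (1 + |\<eta> - \<xi>|)\<close> when \<open>\<epsilon> \<le> 1\<close>.\<close>
lemma wform_bound:
  fixes a :: "(real ^ 'd::finite) \<times> (real ^ 'd) \<Rightarrow> complex"
  assumes a: "schwartz a"
  obtains C where "\<And>\<epsilon> f g. 0 < \<epsilon> \<Longrightarrow> \<epsilon> \<le> 1 \<Longrightarrow> f \<in> borel_measurable borel \<Longrightarrow> g \<in> borel_measurable borel \<Longrightarrow>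
      weighted_sq \<epsilon> N f < \<infinity> \<Longrightarrow> weighted_sq \<epsilon> N g < \<infinity> \<Longrightarrow>
      integrable lborel (\<lambda>\<eta>. cnj (f \<eta>) * fourier (synth \<epsilon> a g) \<eta>) \<and>
      (ennreal (norm (wform \<epsilon> a f g)))\<^sup>2 \<le> ennreal C * (weighted_sq \<epsilon> N f * weighted_sq \<epsilon> N g)"
proof -
  let ?n = "2 * CARD('d)"
  \<comment> \<open>Of the 2N powers in the second variable, N are the weight at \<xi>; the other N,
    together with N powers of 1 + |\<eta> - \<xi>|, give the weight at \<eta>. The remaining 2 * ?n
    powers are q^2, with q integrable.\<close>
  obtain C0 where C0: "C0 \<ge> 0" "\<And>\<theta> \<zeta>. norm (fourier (\<lambda>x. a (x, \<zeta>)) \<theta>) \<le> C0 * (1 / (1 + norm \<theta>) ^ (N + 2 * ?n) * (1 / (1 + norm \<zeta>) ^ (2 * N)))"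
    using partial_fourier_decay[OF a, of "N + 2 * ?n" "2 * N"] by blast
  define q where "q = (\<lambda>\<theta>::real ^ 'd. 1 / (1 + norm \<theta>) ^ ?n)"
  have q0: "q \<theta> \<ge> 0" "q \<theta> \<le> 1" for \<theta>
    using one_le_power[of "1 + norm \<theta>" ?n] by (auto simp: q_def divide_simps)
  have qm [measurable]: "q \<in> borel_measurable borel" unfolding q_def by measurable
  have "(\<integral>\<^sup>+\<theta>. (ennreal (q \<theta>))\<^sup>2 \<partial>lborel) \<le> (\<integral>\<^sup>+\<theta>. ennreal (q \<theta>) \<partial>lborel)"
  proof (rule nn_integral_mono)
    fix \<theta>
    have "(q \<theta>)\<^sup>2 \<le> q \<theta>" using mult_left_mono[OF q0(2) q0(1), of \<theta> \<theta>] by (simp add: power2_eq_square)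
    then show "(ennreal (q \<theta>))\<^sup>2 \<le> ennreal (q \<theta>)" using q0 by (simp add: ennreal_power ennreal_leI)
  qed
  also have "\<dots> < \<infinity>"
    using integrable_inverse_poly[of ?n, where 'a="real ^ 'd"] q0 unfolding integrable_iff_bounded q_def by simp
  finally obtain \<kappa> where \<kappa>: "\<kappa> \<ge> 0" "(\<integral>\<^sup>+\<theta>. (ennreal (q \<theta>))\<^sup>2 \<partial>lborel) = ennreal \<kappa>" by (auto simp: less_top_ennreal)
  show ?thesis
  proof (rule that[of "C0\<^sup>2 * \<kappa>\<^sup>2"])
    fix \<epsilon> :: real and f g :: "real ^ 'd \<Rightarrow> complex"
    assume e: "0 < \<epsilon>" "\<epsilon> \<le> 1" and fm [measurable]: "f \<in> borel_measurable borel" and gm [measurable]: "g \<in> borel_measurable borel"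
      and f: "weighted_sq \<epsilon> N f < \<infinity>" and g: "weighted_sq \<epsilon> N g < \<infinity>"
    define w where "w \<xi> = (1 + norm (\<epsilon> *\<^sub>R \<xi>)) ^ N" for \<xi> :: "real ^ 'd"
    have w: "w \<xi> > 0" for \<xi> unfolding w_def by (intro zero_less_power one_plus_norm_pos)
    have wm [measurable]: "w \<in> borel_measurable borel" unfolding w_def by measurable
    have kern: "norm (fourier (\<lambda>x. a (x, \<epsilon> *\<^sub>R \<xi>)) (\<eta> - \<xi>)) \<le> C0 * (1 / w \<eta> * (1 / w \<xi>) * (q (\<eta> - \<xi>))\<^sup>2)" for \<eta> \<xi>
    proof -
      have "1 + norm (\<epsilon> *\<^sub>R \<eta>) \<le> (1 + norm (\<epsilon> *\<^sub>R \<xi>)) * (1 + norm (\<epsilon> *\<^sub>R (\<eta> - \<xi>)))"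
        using one_plus_norm_mult_le[of "\<epsilon> *\<^sub>R \<xi>" "\<epsilon> *\<^sub>R (\<eta> - \<xi>)"] by (simp add: algebra_simps)
      also have "\<dots> \<le> (1 + norm (\<epsilon> *\<^sub>R \<xi>)) * (1 + norm (\<eta> - \<xi>))"
        using e mult_right_mono[of \<epsilon> 1 "norm (\<eta> - \<xi>)"] by (intro mult_left_mono less_imp_le[OF one_plus_norm_pos]) auto
      finally have le: "w \<eta> \<le> w \<xi> * (1 + norm (\<eta> - \<xi>)) ^ N"
        unfolding w_def power_mult_distrib[symmetric] by (intro power_mono less_imp_le[OF one_plus_norm_pos])
      have p: "0 < (1 + norm (\<eta> - \<xi>)) ^ N" by (intro zero_less_power one_plus_norm_pos)
      have "1 / (1 + norm (\<eta> - \<xi>)) ^ N * (1 / w \<xi>) \<le> 1 / w \<eta>"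
        using le p w[of \<eta>] w[of \<xi>] by (simp add: divide_simps mult.commute)
      then have "(1 / (1 + norm (\<eta> - \<xi>)) ^ N * (1 / w \<xi>)) * ((1 / w \<xi>) * (q (\<eta> - \<xi>))\<^sup>2) \<le> 1 / w \<eta> * ((1 / w \<xi>) * (q (\<eta> - \<xi>))\<^sup>2)"
        using w[of \<xi>] by (intro mult_right_mono) auto
      moreover have "1 / (1 + norm (\<eta> - \<xi>)) ^ (N + 2 * ?n) * (1 / (1 + norm (\<epsilon> *\<^sub>R \<xi>)) ^ (2 * N)) =
         (1 / (1 + norm (\<eta> - \<xi>)) ^ N * (1 / w \<xi>)) * ((1 / w \<xi>) * (q (\<eta> - \<xi>))\<^sup>2)"
        unfolding w_def q_def by (rule inverse_power_split)
      ultimately have "1 / (1 + norm (\<eta> - \<xi>)) ^ (N + 2 * ?n) * (1 / (1 + norm (\<epsilon> *\<^sub>R \<xi>)) ^ (2 * N)) \<le> 1 / w \<eta> * (1 / w \<xi>) * (q (\<eta> - \<xi>))\<^sup>2"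
        by (simp add: mult_ac)
      from mult_left_mono[OF this C0(1)] C0(2)[of "\<epsilon> *\<^sub>R \<xi>" "\<eta> - \<xi>"] show ?thesis by linarith
    qed
    define F where "F \<eta> = ennreal (norm (f \<eta>) / w \<eta>)" for \<eta>
    define G where "G \<xi> = ennreal (norm (g \<xi>) / w \<xi>)" for \<xi>
    have [measurable]: "F \<in> borel_measurable borel" "G \<in> borel_measurable borel" unfolding F_def G_def by measurable
    have sq: "(\<integral>\<^sup>+\<eta>. (F \<eta>)\<^sup>2 \<partial>lborel) = weighted_sq \<epsilon> N f" "(\<integral>\<^sup>+\<eta>. (G \<eta>)\<^sup>2 \<partial>lborel) = weighted_sq \<epsilon> N g"
      unfolding F_def G_def weighted_sq_def w_def by (simp_all add: ennreal_power)
    define I where "I = (\<integral>\<^sup>+\<eta>. (\<integral>\<^sup>+\<xi>. F \<eta> * G \<xi> * (ennreal (q (\<eta> - \<xi>)))\<^sup>2 \<partial>lborel) \<partial>lborel)"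
    have I2: "I\<^sup>2 \<le> ennreal (\<kappa>\<^sup>2) * (weighted_sq \<epsilon> N f * weighted_sq \<epsilon> N g)"
      using nn_integral_convolution_le[of F G "\<lambda>\<theta>. ennreal (q \<theta>)"] \<kappa> unfolding I_def sq by (simp add: ennreal_power)
    have Sm: "fourier (synth \<epsilon> a g) \<in> borel_measurable borel"
      by (rule schwartz_borel[OF schwartz_fourier[OF schwartz_synth[OF a e(1) gm g]]])
    have "(\<integral>\<^sup>+\<eta>. ennreal (norm (cnj (f \<eta>) * fourier (synth \<epsilon> a g) \<eta>)) \<partial>lborel) \<le>
      (\<integral>\<^sup>+\<eta>. (\<integral>\<^sup>+\<xi>. ennreal C0 * (F \<eta> * G \<xi> * (ennreal (q (\<eta> - \<xi>)))\<^sup>2) \<partial>lborel) \<partial>lborel)"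
    proof (rule nn_integral_mono)
      fix \<eta> :: "real ^ 'd"
      let ?A = "\<lambda>\<xi>. fourier (\<lambda>x. a (x, \<epsilon> *\<^sub>R \<xi>)) (\<eta> - \<xi>)"
      have "ennreal (norm (fourier (synth \<epsilon> a g) \<eta>)) \<le> (\<integral>\<^sup>+\<xi>. ennreal (norm (g \<xi> * ?A \<xi>)) \<partial>lborel)"
        unfolding fourier_synth[OF a e(1) gm g]
        by (cases "integrable lborel (\<lambda>\<xi>. g \<xi> * ?A \<xi>)") (auto intro: integral_norm_bound_ennreal simp: not_integrable_integral_eq)
      then have "ennreal (norm (f \<eta>)) * ennreal (norm (fourier (synth \<epsilon> a g) \<eta>)) \<le> ennreal (norm (f \<eta>)) * (\<integral>\<^sup>+\<xi>. ennreal (norm (g \<xi> * ?A \<xi>)) \<partial>lborel)"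
        by (rule mult_left_mono) simp
      also have "\<dots> \<le> ennreal (norm (f \<eta>)) * (\<integral>\<^sup>+\<xi>. ennreal (norm (g \<xi>) * (C0 * (1 / w \<eta> * (1 / w \<xi>) * (q (\<eta> - \<xi>))\<^sup>2))) \<partial>lborel)"
      proof (intro mult_left_mono nn_integral_mono ennreal_leI)
        fix \<xi>
        show "norm (g \<xi> * ?A \<xi>) \<le> norm (g \<xi>) * (C0 * (1 / w \<eta> * (1 / w \<xi>) * (q (\<eta> - \<xi>))\<^sup>2))"
          unfolding norm_mult by (rule mult_left_mono[OF kern norm_ge_zero])
      qed simp
      also have "\<dots> = (\<integral>\<^sup>+\<xi>. ennreal (norm (f \<eta>)) * ennreal (norm (g \<xi>) * (C0 * (1 / w \<eta> * (1 / w \<xi>) * (q (\<eta> - \<xi>))\<^sup>2))) \<partial>lborel)"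
        by (rule nn_integral_cmult[symmetric]) measurable
      also have "\<dots> = (\<integral>\<^sup>+\<xi>. ennreal C0 * (F \<eta> * G \<xi> * (ennreal (q (\<eta> - \<xi>)))\<^sup>2) \<partial>lborel)"
      proof (rule nn_integral_cong)
        fix \<xi>
        have pos: "w \<eta> \<ge> 0" "w \<xi> \<ge> 0" using w by (auto intro: less_imp_le)
        show "ennreal (norm (f \<eta>)) * ennreal (norm (g \<xi>) * (C0 * (1 / w \<eta> * (1 / w \<xi>) * (q (\<eta> - \<xi>))\<^sup>2))) = ennreal C0 * (F \<eta> * G \<xi> * (ennreal (q (\<eta> - \<xi>)))\<^sup>2)"
          unfolding F_def G_def using pos C0(1) q0
          by (simp add: ennreal_power ennreal_mult[symmetric] mult_ac)
      qed
      finally show "ennreal (norm (cnj (f \<eta>) * fourier (synth \<epsilon> a g) \<eta>)) \<le> (\<integral>\<^sup>+\<xi>. ennreal C0 * (F \<eta> * G \<xi> * (ennreal (q (\<eta> - \<xi>)))\<^sup>2) \<partial>lborel)"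
        by (simp add: norm_mult ennreal_mult)
    qed
    also have "\<dots> = ennreal C0 * I"
    proof -
      have "(\<lambda>\<eta>. \<integral>\<^sup>+\<xi>. F \<eta> * G \<xi> * (ennreal (q (\<eta> - \<xi>)))\<^sup>2 \<partial>lborel) \<in> borel_measurable lborel"
        by measurable
      then show ?thesis unfolding I_def by (simp add: nn_integral_cmult)
    qed
    finally have le: "(\<integral>\<^sup>+\<eta>. ennreal (norm (cnj (f \<eta>) * fourier (synth \<epsilon> a g) \<eta>)) \<partial>lborel) \<le> ennreal C0 * I" .
    have "I\<^sup>2 < top" using I2 f g by (auto simp: ennreal_mult_less_top intro: le_less_trans)
    then have "I < top" by (simp add: power_less_top_ennreal)
    then have fin: "ennreal C0 * I < \<infinity>" by (simp add: ennreal_mult_less_top)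
    have i: "integrable lborel (\<lambda>\<eta>. cnj (f \<eta>) * fourier (synth \<epsilon> a g) \<eta>)"
      using le fin Sm by (intro integrableI_bounded) (measurable, auto intro: le_less_trans)
    have "ennreal (norm (wform \<epsilon> a f g)) \<le> ennreal C0 * I"
      unfolding wform_def using integral_norm_bound_ennreal[OF i] le by (rule order_trans)
    then have "(ennreal (norm (wform \<epsilon> a f g)))\<^sup>2 \<le> (ennreal C0 * I)\<^sup>2" by (intro power_mono) auto
    also have "\<dots> \<le> ennreal (C0\<^sup>2) * (ennreal (\<kappa>\<^sup>2) * (weighted_sq \<epsilon> N f * weighted_sq \<epsilon> N g))"
      unfolding power_mult_distrib using I2 C0(1) by (simp add: ennreal_power mult_left_mono)
    also have "\<dots> = ennreal (C0\<^sup>2 * \<kappa>\<^sup>2) * (weighted_sq \<epsilon> N f * weighted_sq \<epsilon> N g)"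
      by (simp add: ennreal_mult mult.assoc)
    finally show "integrable lborel (\<lambda>\<eta>. cnj (f \<eta>) * fourier (synth \<epsilon> a g) \<eta>) \<and>
      (ennreal (norm (wform \<epsilon> a f g)))\<^sup>2 \<le> ennreal (C0\<^sup>2 * \<kappa>\<^sup>2) * (weighted_sq \<epsilon> N f * weighted_sq \<epsilon> N g)"
      using i by blast
  qed
qed

section \<open>Wigner transforms as quadratic forms\<close>

text \<open>The inner distribution yields \<epsilon>^d times \<open>synth\<close>. The outer one is
  conj u, which becomes an integral against \<open>U\<close> once its test function is written as a
  Fourier transform. The powers of \<epsilon> cancel; one factor (2 pi)^d is the prefactor of the
  Wigner transform and one comes from inversion.\<close>

lemma wigner_eq_wform:
  fixes u :: "(real ^ 'd::finite) distribution"
  assumes U: "represents U (fourier_dist u)" and e: "\<epsilon> > 0" and a: "schwartz a" and w: "weighted_sq \<epsilon> N U < \<infinity>"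
  shows "wigner \<epsilon> u a = wform \<epsilon> a U U / of_real ((2 * pi) ^ (2 * CARD('d)))"
proof -
  have Um: "U \<in> borel_measurable borel" using U by (simp add: represents_def)
  let ?b = "synth \<epsilon> a U" and ?d = "complex_of_real (\<epsilon> ^ CARD('d))" and ?D = "complex_of_real ((2 * pi) ^ CARD('d))"
  have b: "schwartz ?b" by (rule schwartz_synth[OF a e Um w])
  have inner: "fourier_dist u (\<lambda>\<xi>. cis (x \<bullet> (\<epsilon> *\<^sub>R (\<xi> + 0)) / \<epsilon>) * a (x, \<epsilon> *\<^sub>R (\<xi> + 0))) = ?b x" for x
  proof -
    have f: "(\<lambda>\<xi>. cis (x \<bullet> (\<epsilon> *\<^sub>R (\<xi> + 0)) / \<epsilon>) * a (x, \<epsilon> *\<^sub>R (\<xi> + 0))) = (\<lambda>\<xi>. cis (x \<bullet> \<xi>) * a (x, \<epsilon> *\<^sub>R \<xi>))"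
      using e by simp
    have "schwartz (\<lambda>\<xi>. cis (x \<bullet> \<xi>) * a (x, \<epsilon> *\<^sub>R \<xi>))"
      using schwartz_slice[OF schwartz_synth_kernel[OF a e], of x] by simp
    then show ?thesis unfolding f synth_def using U by (simp add: represents_def)
  qed
  define S where "S x = cnj (?d * ?b x)" for x
  have S: "schwartz S" unfolding S_def by (intro schwartz_cnj schwartz_cmult b)
  have cS: "cnj (inv_fourier S \<eta>) = ?d * fourier ?b \<eta> / ?D" for \<eta>
  proof -
    have "cnj (LINT x|lborel. S x * cis (\<eta> \<bullet> x)) = (LINT x|lborel. ?d * (?b x * cis (- (x \<bullet> \<eta>))))"
      by (subst Bochner_Integration.integral_cnj[symmetric]) (simp add: S_def cis_cnj inner_commute mult_ac)
    then show ?thesis unfolding inv_fourier_def fourier_def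
      by (simp only: complex_cnj_divide complex_cnj_complex_of_real integral_mult_right_zero)
  qed
  have "wigner \<epsilon> u a = cnj (u S) / of_real ((2 * pi * \<epsilon>) ^ CARD('d))"
    unfolding wigner_def mult_dist_def tensor_dist_def cnj_dist_def rescale_dist_def S_def
    by (simp add: inner[simplified])
  also have "u S = (LINT \<eta>|lborel. U \<eta> * inv_fourier S \<eta>)"
  proof -
    have "u (fourier (inv_fourier S)) = (LINT \<eta>|lborel. U \<eta> * inv_fourier S \<eta>)"
      using U schwartz_inv_fourier[OF S] by (simp add: represents_def fourier_dist_def)
    then show ?thesis by (simp only: fourier_inv_fourier[OF S])
  qed
  also have "cnj \<dots> = (LINT \<eta>|lborel. (?d / ?D) * (cnj (U \<eta>) * fourier ?b \<eta>))"
    by (subst Bochner_Integration.integral_cnj[symmetric]) (simp add: cS mult_ac)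
  also have "\<dots> = (?d / ?D) * wform \<epsilon> a U U"
    unfolding wform_def by (rule integral_mult_right_zero)
  finally have w: "wigner \<epsilon> u a = (?d / ?D) * wform \<epsilon> a U U / (?D * ?d)"
    by (simp only: power_mult_distrib[of "2 * pi" \<epsilon>] of_real_mult)
  have cancel: "(x / y) * z / (y * x) = z / (y * y)" if "x \<noteq> 0" for x y z :: complex
    using that by (simp add: field_simps)
  show ?thesis unfolding w mult_2[of "CARD('d)"] power_add of_real_mult
    by (rule cancel) (use e in simp)
qed

section \<open>Weighted norms of rescaled periodic functions\<close>

lemma weighted_sq_scale:
  fixes V :: "real ^ 'd::finite \<Rightarrow> complex"
  assumes [measurable]: "V \<in> borel_measurable borel" and h: "h > 0"
  shows "ennreal (h ^ CARD('d)) * weighted_sq \<epsilon> N (\<lambda>\<xi>. V (h *\<^sub>R \<xi>)) = weighted_sq (\<epsilon> / h) N V"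
  unfolding weighted_sq_def using h
  by (subst (2) nn_integral_affine[of _ h 0]) auto

text \<open>Periodicity reduces the integral to one over Q times the lattice sum of the weights. The
  comparison constant c on A stays explicit because it is used in two ways: on the whole space for
  mere finiteness, and off Q with c of order r, where it produces a negative power of r.\<close>

lemma weighted_sq_tile:
  fixes V :: "real ^ 'd::finite \<Rightarrow> complex"
  assumes [measurable]: "V \<in> borel_measurable borel" "A \<in> sets borel" and per: "\<And>\<xi> l. V (lshift l \<xi>) = V \<xi>"
    and r: "r > 0" and C: "\<And>\<xi> :: real ^ 'd. \<xi> \<in> Q \<Longrightarrow> (\<integral>\<^sup>+l. ennreal (1 / (1 + norm (lshift l \<xi>)) ^ (2 * N)) \<partial>count_space UNIV) \<le> ennreal C"
    and c: "\<And>\<eta>. \<eta> \<in> A \<Longrightarrow> c * (1 + norm \<eta>) \<le> 1 + norm (r *\<^sub>R \<eta>)" "c > 0"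
  shows "(\<integral>\<^sup>+\<eta>. ennreal ((norm (V \<eta>) / (1 + norm (r *\<^sub>R \<eta>)) ^ N)\<^sup>2) * indicator A \<eta> \<partial>lborel)
     \<le> ennreal ((1 / c) ^ (2 * N)) * ennreal C * (\<integral>\<^sup>+\<eta>\<in>Q. ennreal ((norm (V \<eta>))\<^sup>2) \<partial>lborel)"
proof -
  let ?k = "(1 / c) ^ (2 * N)"
  have k0: "?k \<ge> 0" using c(2) by simp
  have le: "ennreal ((norm (V \<eta>) / (1 + norm (r *\<^sub>R \<eta>)) ^ N)\<^sup>2) * indicator A \<eta> \<le> ennreal ?k * (ennreal ((norm (V \<eta>))\<^sup>2) * ennreal (1 / (1 + norm \<eta>) ^ (2 * N)))" for \<eta>
  proof (cases "\<eta> \<in> A")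
    case True
    have "(c * (1 + norm \<eta>)) ^ (2 * N) \<le> (1 + norm (r *\<^sub>R \<eta>)) ^ (2 * N)"
      using c(1)[OF True] c(2) one_plus_norm_pos[of \<eta>] by (intro power_mono) auto
    moreover have "0 < (c * (1 + norm \<eta>)) ^ (2 * N)" using c(2) one_plus_norm_pos[of \<eta>] by (intro zero_less_power mult_pos_pos)
    ultimately have "1 / (1 + norm (r *\<^sub>R \<eta>)) ^ (2 * N) \<le> 1 / (c * (1 + norm \<eta>)) ^ (2 * N)" by (intro frac_le) auto
    from mult_left_mono[OF this, of "(norm (V \<eta>))\<^sup>2"]
    have "(norm (V \<eta>) / (1 + norm (r *\<^sub>R \<eta>)) ^ N)\<^sup>2 \<le> ?k * ((norm (V \<eta>))\<^sup>2 * (1 / (1 + norm \<eta>) ^ (2 * N)))"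
      by (simp add: power_divide power_mult_distrib mult_ac flip: power_mult)
    then show ?thesis using True k0 by (simp add: ennreal_leI flip: ennreal_mult)
  qed simp
  have [measurable]: "(\<lambda>\<eta>. \<integral>\<^sup>+l. ennreal (1 / (1 + norm (lshift l \<eta>)) ^ (2 * N)) \<partial>count_space UNIV) \<in> borel_measurable (borel :: (real ^ 'd) measure)"
    by (rule nn_integral_lattice_measurable) measurable
  have "(\<integral>\<^sup>+\<eta>. ennreal ((norm (V \<eta>) / (1 + norm (r *\<^sub>R \<eta>)) ^ N)\<^sup>2) * indicator A \<eta> \<partial>lborel) \<le>
     (\<integral>\<^sup>+\<eta>. ennreal ?k * (ennreal ((norm (V \<eta>))\<^sup>2) * ennreal (1 / (1 + norm \<eta>) ^ (2 * N))) \<partial>lborel)"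
    by (rule nn_integral_mono) (rule le)
  also have "\<dots> = ennreal ?k * (\<integral>\<^sup>+\<eta>. ennreal ((norm (V \<eta>))\<^sup>2) * ennreal (1 / (1 + norm \<eta>) ^ (2 * N)) \<partial>lborel)"
    by (rule nn_integral_cmult) measurable
  also have "(\<integral>\<^sup>+\<eta>. ennreal ((norm (V \<eta>))\<^sup>2) * ennreal (1 / (1 + norm \<eta>) ^ (2 * N)) \<partial>lborel) =
     (\<integral>\<^sup>+\<eta>\<in>Q. ennreal ((norm (V \<eta>))\<^sup>2) * (\<integral>\<^sup>+l. ennreal (1 / (1 + norm (lshift l \<eta>)) ^ (2 * N)) \<partial>count_space UNIV) \<partial>lborel)"
    by (subst nn_integral_tile, measurable) (simp add: per nn_integral_cmult)
  also have "\<dots> \<le> (\<integral>\<^sup>+\<eta>\<in>Q. ennreal C * ennreal ((norm (V \<eta>))\<^sup>2) \<partial>lborel)"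
  proof (rule nn_integral_mono)
    fix \<eta> :: "real ^ 'd"
    let ?X = "ennreal ((norm (V \<eta>))\<^sup>2)" and ?S = "\<integral>\<^sup>+l. ennreal (1 / (1 + norm (lshift l \<eta>)) ^ (2 * N)) \<partial>count_space UNIV"
    show "?X * ?S * indicator Q \<eta> \<le> ennreal C * ?X * indicator Q \<eta>"
    proof (cases "\<eta> \<in> Q")
      case True
      have "?X * ?S \<le> ?X * ennreal C" by (rule mult_left_mono[OF C[OF True]]) simp
      then have "?X * ?S \<le> ennreal C * ?X" by (subst mult.commute[of "ennreal C"])
      then show ?thesis by (rule mult_right_mono) simp
    qed simp
  qed
  also have "\<dots> = ennreal C * (\<integral>\<^sup>+\<eta>\<in>Q. ennreal ((norm (V \<eta>))\<^sup>2) \<partial>lborel)"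
    by (subst nn_integral_cmult[symmetric], measurable) (simp add: mult.assoc)
  finally show ?thesis by (simp add: mult.assoc mult_left_mono)
qed

lemma weighted_sq_periodic_finite:
  fixes V :: "real ^ 'd::finite \<Rightarrow> complex"
  assumes [measurable]: "V \<in> borel_measurable borel" and per: "\<And>\<xi> l. V (lshift l \<xi>) = V \<xi>"
    and V: "(\<integral>\<^sup>+\<eta>\<in>Q. ennreal ((norm (V \<eta>))\<^sup>2) \<partial>lborel) < \<infinity>" and h: "h > 0" and e: "\<epsilon> > 0" and N: "N \<ge> CARD('d)"
  shows "weighted_sq \<epsilon> N (\<lambda>\<xi>. V (h *\<^sub>R \<xi>)) < \<infinity>"
proof -
  obtain C where C: "C \<ge> 0" "\<And>\<xi> :: real ^ 'd. \<xi> \<in> Q \<Longrightarrow> (\<integral>\<^sup>+l. ennreal (1 / (1 + norm (lshift l \<xi>)) ^ (2 * N)) \<partial>count_space UNIV) \<le> ennreal C"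
    using lattice_sum_bound[of "2 * N", where 'd='d] N by auto
  define c where "c = min 1 (\<epsilon> / h)"
  have c: "c > 0" using h e by (simp add: c_def)
  have cc: "c * (1 + norm \<eta>) \<le> 1 + norm ((\<epsilon> / h) *\<^sub>R \<eta>)" for \<eta> :: "real ^ 'd"
  proof -
    have c1: "c \<le> 1" "c \<le> \<epsilon> / h" by (simp_all add: c_def)
    then have "c * norm \<eta> \<le> (\<epsilon> / h) * norm \<eta>" by (intro mult_right_mono) auto
    moreover have "norm ((\<epsilon> / h) *\<^sub>R \<eta>) = (\<epsilon> / h) * norm \<eta>" using h e by simp
    ultimately show ?thesis using c1(1) by (simp only: ring_distribs mult_1_right)
  qed
  have "weighted_sq (\<epsilon> / h) N V \<le> ennreal ((1 / c) ^ (2 * N)) * ennreal C * (\<integral>\<^sup>+\<eta>\<in>Q. ennreal ((norm (V \<eta>))\<^sup>2) \<partial>lborel)"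
    using weighted_sq_tile[of V UNIV "\<epsilon> / h" N C c] per C(2) cc c h e by (simp add: weighted_sq_def)
  also have "\<dots> < \<infinity>" using V by (simp add: ennreal_mult_less_top)
  finally have "ennreal (h ^ CARD('d)) * weighted_sq \<epsilon> N (\<lambda>\<xi>. V (h *\<^sub>R \<xi>)) < \<infinity>"
    unfolding weighted_sq_scale[OF assms(1) h] .
  then show ?thesis using h by (auto simp: ennreal_mult_less_top)
qed

lemma per_schwartz_square_integrable:
  fixes B :: "real ^ 'd::finite \<Rightarrow> complex"
  assumes B: "schwartz B"
  shows "integrable MQ (\<lambda>\<eta>. (norm (per B \<eta>))\<^sup>2)"
proof -
  obtain C where C: "C \<ge> 0" "\<And>z. norm (B z) \<le> C / (1 + norm z) ^ (2 * CARD('d))" using schwartz_rapid[OF B] by (metis rapidE)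
  obtain E where E: "E \<ge> 0" "\<And>\<xi> :: real ^ 'd. \<xi> \<in> Q \<Longrightarrow> (\<integral>\<^sup>+l. ennreal (1 / (1 + norm (lshift l \<xi>)) ^ (2 * CARD('d))) \<partial>count_space UNIV) \<le> ennreal E"
    using lattice_sum_bound[of "2 * CARD('d)", where 'd='d] by auto
  have le: "norm (per B \<eta>) \<le> C * E" if "\<eta> \<in> Q" for \<eta>
  proof -
    let ?C = "count_space (UNIV :: (int ^ 'd) set)"
    have "ennreal (norm (per B \<eta>)) \<le> (\<integral>\<^sup>+l. ennreal (norm (B (lshift l \<eta>))) \<partial>?C)"
      unfolding per_def
      by (cases "integrable ?C (\<lambda>l. B (lshift l \<eta>))") (auto intro: integral_norm_bound_ennreal simp: not_integrable_integral_eq)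
    also have "\<dots> \<le> (\<integral>\<^sup>+l. ennreal C * ennreal (1 / (1 + norm (lshift l \<eta>)) ^ (2 * CARD('d))) \<partial>?C)"
    proof (rule nn_integral_mono)
      fix l :: "int ^ 'd"
      have "ennreal (norm (B (lshift l \<eta>))) \<le> ennreal (C * (1 / (1 + norm (lshift l \<eta>)) ^ (2 * CARD('d))))"
        using C(2)[of "lshift l \<eta>"] by (intro ennreal_leI) simp
      then show "ennreal (norm (B (lshift l \<eta>))) \<le> ennreal C * ennreal (1 / (1 + norm (lshift l \<eta>)) ^ (2 * CARD('d)))"
        using C(1) by (simp only: ennreal_mult'[symmetric])
    qed
    also have "\<dots> \<le> ennreal C * ennreal E"
      by (subst nn_integral_cmult) (use E(2)[OF that] in \<open>auto intro: mult_left_mono\<close>)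
    finally show ?thesis using C(1) E(1) by (simp flip: ennreal_mult)
  qed
  show ?thesis
  proof (rule finite_measure.integrable_const_bound[OF finite_measure_MQ, where B="(C * E)\<^sup>2"])
    show "AE \<eta> in MQ. norm ((norm (per B \<eta>))\<^sup>2) \<le> (C * E)\<^sup>2"
      by (rule AE_I2) (use le in \<open>auto simp: space_MQ intro!: power_mono\<close>)
    have [measurable]: "B \<in> borel_measurable borel" by (rule schwartz_borel[OF B])
    show "(\<lambda>\<eta>. (norm (per B \<eta>))\<^sup>2) \<in> borel_measurable MQ" by (intro MQ_measurable) measurable
  qed
qed

text \<open>Parseval's formula on the lattice turns the sum over the lattice into an integral over the
  cell, which is unfolded to the whole space because the symbol of the sampled function is periodic.\<close>
lemma lattice_wigner_eq_wform:
  fixes P :: "real ^ 'd::finite \<Rightarrow> complex"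
  assumes Pm [measurable]: "P \<in> borel_measurable borel" and h: "h > 0" and e: "0 < \<epsilon>" "\<epsilon> \<le> 1" and a: "schwartz a"
    and V2: "integrable MQ (\<lambda>\<eta>. (norm (per P \<eta>))\<^sup>2)"
  shows "lattice_wigner h \<epsilon> (fcoef (\<lambda>\<eta>. per P \<eta> / of_real (h ^ CARD('d)))) a =
    wform \<epsilon> a (\<lambda>\<xi>. per P (h *\<^sub>R \<xi>)) (\<lambda>\<xi>. per P (h *\<^sub>R \<xi>)) / of_real ((2 * pi) ^ (2 * CARD('d)))"
proof -
  let ?w = "\<lambda>\<xi>. per P (h *\<^sub>R \<xi>)"
  let ?D = "complex_of_real ((2 * pi) ^ CARD('d))"
  define H where "H = complex_of_real (h ^ CARD('d))"
  define E where "E = complex_of_real (\<epsilon> ^ CARD('d))"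
  have H0: "H \<noteq> 0" using h by (simp add: H_def)
  have E0: "E \<noteq> 0" using e by (simp add: E_def)
  have D0: "?D \<noteq> 0" by simp
  define V where "V \<eta> = per P \<eta> / H" for \<eta>
  have Vm [measurable]: "V \<in> borel_measurable borel" unfolding V_def by measurable
  have Vi: "integrable MQ (\<lambda>\<eta>. (norm (V \<eta>))\<^sup>2)"
    unfolding V_def norm_divide power_divide using V2 by simp
  have Vp: "V (lshift l \<eta>) = V \<eta>" for l \<eta> unfolding V_def per_lshift ..
  have fin: "(\<integral>\<^sup>+\<eta>\<in>Q. ennreal ((norm (per P \<eta>))\<^sup>2) \<partial>lborel) < \<infinity>"
    using V2 unfolding nn_integral_MQ[symmetric] by (simp add: integrable_iff_bounded)
  have w: "weighted_sq \<epsilon> CARD('d) ?w < \<infinity>"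
    by (rule weighted_sq_periodic_finite[OF per_measurable[OF Pm] per_lshift fin h e(1)]) simp
  have wm [measurable]: "?w \<in> borel_measurable borel" by measurable
  obtain C where "\<And>\<epsilon> f g. 0 < \<epsilon> \<Longrightarrow> \<epsilon> \<le> 1 \<Longrightarrow> f \<in> borel_measurable borel \<Longrightarrow> g \<in> borel_measurable borel \<Longrightarrow>
      weighted_sq \<epsilon> CARD('d) f < \<infinity> \<Longrightarrow> weighted_sq \<epsilon> CARD('d) g < \<infinity> \<Longrightarrow>
      integrable lborel (\<lambda>\<eta>. cnj (f \<eta>) * fourier (synth \<epsilon> a g) \<eta>) \<and>
      (ennreal (norm (wform \<epsilon> a f g)))\<^sup>2 \<le> ennreal C * (weighted_sq \<epsilon> CARD('d) f * weighted_sq \<epsilon> CARD('d) g)"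
    using wform_bound[OF a, of "CARD('d)"] by blast
  from this[OF e wm wm w w] have iw: "integrable lborel (\<lambda>\<eta>. cnj (?w \<eta>) * fourier (synth \<epsilon> a ?w) \<eta>)" by blast
  let ?b = "synth \<epsilon> a ?w"
  have b: "schwartz ?b" by (rule schwartz_synth[OF a e(1) wm w])
  define B where "B \<eta> = fourier ?b ((1 / h) *\<^sub>R \<eta>)" for \<eta>
  have B: "schwartz B" unfolding B_def using h by (intro schwartz_scale schwartz_fourier b) auto
  have Bm [measurable]: "B \<in> borel_measurable borel" by (rule schwartz_borel[OF B])
  have Bh: "B (0 + h *\<^sub>R \<xi>) = fourier ?b \<xi>" for \<xi> using h by (simp add: B_def)
  have hH: "\<bar>h\<bar> ^ DIM(real ^ 'd) *\<^sub>R z = H * z" for z :: complex using h by (simp add: H_def scaleR_conv_of_real)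
  \<comment> \<open>Poisson summation: by Fourier inversion the samples of \<open>?b\<close> on the
    lattice are, up to 1 / H, the Fourier coefficients of the periodization of its rescaled
    transform \<open>B\<close>.\<close>
  have beta: "?b (h *\<^sub>R lat m) = fcoef (per B) m / H" for m
  proof -
    have iB: "integrable lborel (\<lambda>\<eta>. B \<eta> * cnj (chr m \<eta>))"
      using integrable_mult_cis(1)[OF schwartz_integrable[OF B], of "lat m"] by (simp add: cis_cnj inner_commute)
    have pB: "per (\<lambda>\<eta>. B \<eta> * cnj (chr m \<eta>)) \<eta> = per B \<eta> * cnj (chr m \<eta>)" for \<eta>
      unfolding per_def cis_cnj minus_minus cis_lat_lshift by simp
    have "?D * fcoef (per B) m = (LINT \<eta>|MQ. per B \<eta> * cnj (chr m \<eta>))" unfolding fcoef_def using D0 by simp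
    also have "\<dots> = (LINT \<eta>|lborel. B \<eta> * cnj (chr m \<eta>))"
      using integral_tile(3)[OF iB] unfolding pB integral_MQ by simp
    also have "\<dots> = H * (LINT \<xi>|lborel. B (0 + h *\<^sub>R \<xi>) * cnj (chr m (0 + h *\<^sub>R \<xi>)))"
      unfolding hH[symmetric] by (intro integral_affine) (measurable, use h in simp)
    also have "(LINT \<xi>|lborel. B (0 + h *\<^sub>R \<xi>) * cnj (chr m (0 + h *\<^sub>R \<xi>))) = ?D * inv_fourier (fourier ?b) (h *\<^sub>R lat m)"
      unfolding Bh inv_fourier_def using D0 by (simp add: cis_cnj inner_commute)
    also have "inv_fourier (fourier ?b) = ?b" by (rule inv_fourier_fourier[OF b])
    finally show ?thesis using D0 H0 by (simp add: field_simps)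
  qed
  have LF: "lattice_fourier (fcoef V) \<in> borel_measurable borel" "AE \<eta> in lborel. lattice_fourier (fcoef V) \<eta> = V \<eta>"
    using lattice_fourier_AE[OF Vm Vi Vp] by blast+
  note [measurable] = LF(1)
  have am [measurable]: "(\<lambda>\<xi>. a (x, \<xi>)) \<in> borel_measurable borel" for x
    by (rule schwartz_borel[OF schwartz_slice[OF a]])
  \<comment> \<open>The substitution \<xi> = \<epsilon> \<zeta> turns the inner integral into a
    value of \<open>synth\<close> at a lattice point. The selected \<open>lattice_fourier\<close> is
    replaced by \<open>V\<close> almost everywhere.\<close>
  have c: "(LINT \<xi>|lborel. lattice_fourier (fcoef V) ((h / \<epsilon>) *\<^sub>R \<xi>) * cis (lat m \<bullet> ((h / \<epsilon>) *\<^sub>R \<xi>)) * a (h *\<^sub>R lat m, \<xi>)) = (E / H) * ?b (h *\<^sub>R lat m)" for m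
  proof -
    have eE: "\<bar>\<epsilon>\<bar> ^ DIM(real ^ 'd) *\<^sub>R z = E * z" for z :: complex using e by (simp add: E_def scaleR_conv_of_real)
    have he: "(h / \<epsilon>) *\<^sub>R (0 + \<epsilon> *\<^sub>R \<zeta>) = h *\<^sub>R \<zeta>" for \<zeta> :: "real ^ 'd" using e by simp
    have "(LINT \<xi>|lborel. lattice_fourier (fcoef V) ((h / \<epsilon>) *\<^sub>R \<xi>) * cis (lat m \<bullet> ((h / \<epsilon>) *\<^sub>R \<xi>)) * a (h *\<^sub>R lat m, \<xi>)) =
      E * (LINT \<zeta>|lborel. lattice_fourier (fcoef V) (h *\<^sub>R \<zeta>) * cis (lat m \<bullet> (h *\<^sub>R \<zeta>)) * a (h *\<^sub>R lat m, 0 + \<epsilon> *\<^sub>R \<zeta>))"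
      unfolding eE[symmetric] he[symmetric] by (intro integral_affine) (measurable, use e in simp)
    also have "(LINT \<zeta>|lborel. lattice_fourier (fcoef V) (h *\<^sub>R \<zeta>) * cis (lat m \<bullet> (h *\<^sub>R \<zeta>)) * a (h *\<^sub>R lat m, 0 + \<epsilon> *\<^sub>R \<zeta>)) =
      (LINT \<zeta>|lborel. (1 / H) * (?w \<zeta> * (cis ((h *\<^sub>R lat m) \<bullet> \<zeta>) * a (h *\<^sub>R lat m, \<epsilon> *\<^sub>R \<zeta>))))"
    proof (rule integral_cong_AE)
      have "AE \<zeta> in lborel. lattice_fourier (fcoef V) (0 + h *\<^sub>R \<zeta>) = V (0 + h *\<^sub>R \<zeta>)"
        using h by (intro AE_affine LF(2)) simp
      then show "AE \<zeta> in lborel. lattice_fourier (fcoef V) (h *\<^sub>R \<zeta>) * cis (lat m \<bullet> (h *\<^sub>R \<zeta>)) * a (h *\<^sub>R lat m, 0 + \<epsilon> *\<^sub>R \<zeta>) =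
        (1 / H) * (?w \<zeta> * (cis ((h *\<^sub>R lat m) \<bullet> \<zeta>) * a (h *\<^sub>R lat m, \<epsilon> *\<^sub>R \<zeta>)))"
        by eventually_elim (simp add: V_def)
    qed measurable
    also have "\<dots> = (1 / H) * ?b (h *\<^sub>R lat m)" unfolding synth_def by (rule integral_mult_right_zero)
    finally show ?thesis by simp
  qed
  have pBm [measurable]: "per B \<in> borel_measurable borel" by measurable
  \<comment> \<open>Unfolding: \<open>V\<close> is periodic, so conj V times the periodization of
    \<open>B\<close> is the periodization of the product.\<close>
  have PB: "(LINT \<eta>|MQ. cnj (V \<eta>) * per B \<eta>) = wform \<epsilon> a ?w ?w"
  proof -
    let ?G = "\<lambda>\<eta>. cnj (V \<eta>) * B \<eta>"
    have VH: "V (0 + h *\<^sub>R \<xi>) = ?w \<xi> / H" for \<xi> by (simp add: V_def)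
    have iG: "integrable lborel ?G"
    proof -
      have "integrable lborel (\<lambda>\<xi>. (1 / cnj H) * (cnj (?w \<xi>) * fourier ?b \<xi>))" using iw by (rule integrable_mult_right)
      from integrable_affine[OF this, of "1 / h" 0] h show ?thesis by (simp add: V_def B_def)
    qed
    have pG: "per ?G \<eta> = cnj (V \<eta>) * per B \<eta>" for \<eta> unfolding per_def Vp by simp
    have "(LINT \<eta>|MQ. cnj (V \<eta>) * per B \<eta>) = (LINT \<eta>|lborel. ?G \<eta>)"
      using integral_tile(3)[OF iG] unfolding pG integral_MQ by simp
    also have "\<dots> = H * (LINT \<xi>|lborel. cnj (V (0 + h *\<^sub>R \<xi>)) * B (0 + h *\<^sub>R \<xi>))"
      unfolding hH[symmetric] by (intro integral_affine) (measurable, use h in simp)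
    also have "\<dots> = H * (LINT \<xi>|lborel. (1 / H) * (cnj (?w \<xi>) * fourier ?b \<xi>))"
      unfolding Bh VH by (simp add: H_def)
    also have "\<dots> = wform \<epsilon> a ?w ?w" unfolding wform_def integral_mult_right_zero using H0 by simp
    finally show ?thesis .
  qed
  have hs: "((\<lambda>m. cnj (fcoef V m) * fcoef (per B) m) has_sum (wform \<epsilon> a ?w ?w / ?D)) UNIV"
    using parseval[OF Vm Vi pBm per_schwartz_square_integrable[OF B]] unfolding PB .
  have "(\<Sum>\<^sub>\<infinity>m\<in>UNIV. cnj (fcoef V m) * ((E / H) * (fcoef (per B) m / H))) = (E / (H * H)) * (wform \<epsilon> a ?w ?w / ?D)"
    using infsumI[OF has_sum_cmult_right[OF hs, of "E / (H * H)"]] by (simp add: mult_ac)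
  then have "lattice_wigner h \<epsilon> (fcoef V) a = of_real (h ^ (2 * CARD('d)) / (2 * pi * \<epsilon>) ^ CARD('d)) * ((E / (H * H)) * (wform \<epsilon> a ?w ?w / ?D))"
    unfolding lattice_wigner_def c beta by simp
  also have "of_real (h ^ (2 * CARD('d)) / (2 * pi * \<epsilon>) ^ CARD('d)) = (H * H) / (?D * E)"
  proof -
    have 1: "h ^ (2 * CARD('d)) = h ^ CARD('d) * h ^ CARD('d)" by (simp only: mult_2 power_add)
    show ?thesis unfolding H_def E_def 1 power_mult_distrib[of "2 * pi" \<epsilon>] of_real_mult of_real_divide ..
  qed
  also have "(H * H) / (?D * E) * ((E / (H * H)) * (wform \<epsilon> a ?w ?w / ?D)) = wform \<epsilon> a ?w ?w / (?D * ?D)"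
    using H0 E0 D0 by (simp add: field_simps)
  also have "?D * ?D = of_real ((2 * pi) ^ (2 * CARD('d)))" by (simp only: mult_2 power_add of_real_mult)
  finally show ?thesis unfolding V_def H_def .
qed

section \<open>Temperedness of the lattice Wigner transform\<close>

lemma schwartz_seminorm_bound:
  assumes a: "schwartz a"
  shows "(1 + norm z) ^ N * norm (a z) \<le> schwartz_seminorm N a"
proof -
  let ?S = "{bs. set bs \<subseteq> (Basis :: 'a set) \<and> length bs \<le> N}"
  let ?t = "\<lambda>bs. SUP x. (1 + norm x) ^ N * norm (iter_pderiv bs a x)"
  have bd: "bdd_above (range (\<lambda>x. (1 + norm x) ^ N * norm (iter_pderiv bs a x)))" if "set bs \<subseteq> Basis" for bs
  proof -
    have "rapid (iter_pderiv bs a)" using a that unfolding schwartz_eq_smooth_with smooth_with_def by blast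
    then obtain C where "\<And>x. (1 + norm x) ^ N * norm (iter_pderiv bs a x) \<le> C" unfolding rapid_def by metis
    then show ?thesis by (intro bdd_aboveI2)
  qed
  have "(1 + norm z) ^ N * norm (a z) \<le> ?t []" using cSUP_upper[OF UNIV_I bd[of "[]"], of z] by simp
  also have "\<dots> \<le> (\<Sum>bs\<in>?S. ?t bs)"
  proof (rule member_le_sum)
    show "finite ?S" by (rule finite_lists_length_le) simp
    show "0 \<le> ?t bs" if "bs \<in> ?S - {[]}" for bs
      using that by (intro cSUP_upper2[OF bd, of _ 0]) auto
  qed simp
  finally show ?thesis unfolding schwartz_seminorm_def .
qed

lemma summable_on_lattice_nn:
  fixes f :: "'i::countable \<Rightarrow> real"
  assumes f: "\<And>l. f l \<ge> 0" and C: "(\<integral>\<^sup>+l. ennreal (f l) \<partial>count_space UNIV) \<le> ennreal C" "C \<ge> 0"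
  shows "f summable_on UNIV"
proof (rule nonneg_bdd_above_summable_on)
  show "bdd_above (sum f ` {F. F \<subseteq> UNIV \<and> finite F})"
  proof (rule bdd_aboveI2)
    fix F :: "'i set" assume "F \<in> {F. F \<subseteq> UNIV \<and> finite F}"
    then have F: "finite F" by simp
    have "ennreal (sum f F) = (\<Sum>l\<in>F. ennreal (f l))" using f by simp
    also have "\<dots> = (\<integral>\<^sup>+l. ennreal (f l) * indicator F l \<partial>count_space UNIV)"
      using F by (subst nn_integral_count_space'[of F]) auto
    also have "\<dots> \<le> (\<integral>\<^sup>+l. ennreal (f l) \<partial>count_space UNIV)"
      by (intro nn_integral_mono) (auto simp: indicator_def)
    also have "\<dots> \<le> ennreal C" by (rule C(1))
    finally show "sum f F \<le> C" using C(2) by simp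
  qed
qed (use f in auto)

text \<open>\<open>lattice_sum_bound\<close> at \<xi> = 0 treats the spacing 2 pi; the constant c =
  min 1 (h / (2 pi)) changes it to h at the cost of a factor (1 / c)^K.\<close>

lemma lattice_decay_summable:
  assumes h: "h > 0" and K: "K \<ge> 2 * CARD('d)"
  shows "(\<lambda>m::int ^ 'd::finite. 1 / (1 + norm (h *\<^sub>R lat m)) ^ K) summable_on UNIV"
proof -
  obtain C where C: "C \<ge> 0" "\<And>\<xi> :: real ^ 'd. \<xi> \<in> Q \<Longrightarrow> (\<integral>\<^sup>+l. ennreal (1 / (1 + norm (lshift l \<xi>)) ^ K) \<partial>count_space UNIV) \<le> ennreal C"
    using lattice_sum_bound[of K, where 'd='d] K by auto
  have "(0 :: real ^ 'd) \<in> Q" by (simp add: Q_def)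
  from C(2)[OF this] have 0: "(\<lambda>m::int ^ 'd. 1 / (1 + norm ((2 * pi) *\<^sub>R lat m)) ^ K) summable_on UNIV"
    using C(1) by (intro summable_on_lattice_nn[of _ C]) (auto intro: less_imp_le[OF zero_less_power[OF one_plus_norm_pos]])
  define c where "c = min 1 (h / (2 * pi))"
  have c: "c > 0" using h by (simp add: c_def)
  show ?thesis
  proof (rule summable_on_comparison_test[OF summable_on_cmult_right[OF 0, of "(1 / c) ^ K"]])
    fix m :: "int ^ 'd"
    have "c * (1 + norm ((2 * pi) *\<^sub>R lat m)) \<le> 1 + norm (h *\<^sub>R lat m)"
    proof -
      have "c * norm ((2 * pi) *\<^sub>R lat m) \<le> (h / (2 * pi)) * norm ((2 * pi) *\<^sub>R lat m)"
        by (intro mult_right_mono) (auto simp: c_def)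
      also have "\<dots> = norm (h *\<^sub>R lat m)" using h by simp
      finally have "c * norm ((2 * pi) *\<^sub>R lat m) \<le> norm (h *\<^sub>R lat m)" .
      moreover have "c \<le> 1" by (simp add: c_def)
      ultimately show ?thesis by (simp only: ring_distribs mult_1_right)
    qed
    then have "(c * (1 + norm ((2 * pi) *\<^sub>R lat m))) ^ K \<le> (1 + norm (h *\<^sub>R lat m)) ^ K"
      using c one_plus_norm_pos[of "(2 * pi) *\<^sub>R lat m"] by (intro power_mono mult_nonneg_nonneg) auto
    moreover have "0 < (c * (1 + norm ((2 * pi) *\<^sub>R lat m))) ^ K"
      using c by (intro zero_less_power mult_pos_pos one_plus_norm_pos)
    ultimately have "1 / (1 + norm (h *\<^sub>R lat m)) ^ K \<le> 1 / (c * (1 + norm ((2 * pi) *\<^sub>R lat m))) ^ K"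
      by (intro frac_le) auto
    then show "1 / (1 + norm (h *\<^sub>R lat m)) ^ K \<le> (1 / c) ^ K * (1 / (1 + norm ((2 * pi) *\<^sub>R lat m)) ^ K)"
      by (simp only: power_mult_distrib power_divide power_one times_divide_times_eq mult_1_right)
  qed (auto intro: less_imp_le[OF zero_less_power[OF one_plus_norm_pos]])
qed

text \<open>Convergence as tempered distributions asks for this at every index, also where
  \<epsilon> > 1 and \<open>wform_bound\<close> does not apply; hence a direct estimate. Square
  summable coefficients are bounded, the inner integrals decay in the lattice point because a does,
  and the resulting lattice sum converges.\<close>

lemma tempered_lattice_wigner:
  fixes V :: "real ^ 'd::finite \<Rightarrow> complex"
  assumes Vm: "V \<in> borel_measurable borel" and Vi: "integrable MQ (\<lambda>\<eta>. (norm (V \<eta>))\<^sup>2)" and Vp: "\<And>\<xi> l. V (lshift l \<xi>) = V \<xi>"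
    and h: "h > 0" and e: "\<epsilon> > 0"
  shows "tempered (lattice_wigner h \<epsilon> (fcoef V))"
proof -
  let ?L = "lattice_fourier (fcoef V)"
  define g where "g \<xi> = ?L ((h / \<epsilon>) *\<^sub>R \<xi>)" for \<xi>
  note LF = lattice_fourier_AE[OF Vm Vi Vp]
  have Lm [measurable]: "?L \<in> borel_measurable borel" by (rule LF(1))
  have gm [measurable]: "g \<in> borel_measurable borel" unfolding g_def by measurable
  have "(\<integral>\<^sup>+\<eta>\<in>Q. ennreal ((norm (?L \<eta>))\<^sup>2) \<partial>lborel) = (\<integral>\<^sup>+\<eta>\<in>Q. ennreal ((norm (V \<eta>))\<^sup>2) \<partial>lborel)"
  proof (rule nn_integral_cong_AE)
    show "AE \<eta> in lborel. ennreal ((norm (?L \<eta>))\<^sup>2) * indicator Q \<eta> = ennreal ((norm (V \<eta>))\<^sup>2) * indicator Q \<eta>"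
      using LF(3) by eventually_elim simp
  qed
  also have "\<dots> < \<infinity>" using Vi unfolding nn_integral_MQ[symmetric] by (simp add: integrable_iff_bounded)
  finally have Lf: "(\<integral>\<^sup>+\<eta>\<in>Q. ennreal ((norm (?L \<eta>))\<^sup>2) \<partial>lborel) < \<infinity>" .
  have "weighted_sq 1 CARD('d) g < \<infinity>"
    unfolding g_def by (rule weighted_sq_periodic_finite[OF Lm LF(2) Lf]) (use h e in auto)
  let ?M = "CARD('d) + 2 * DIM(real ^ 'd)" and ?n = "2 * CARD('d)"
  have gi: "integrable lborel (\<lambda>\<xi>. norm (g \<xi>) / (1 + norm \<xi>) ^ ?M)"
    using weighted_integrable[OF gm \<open>weighted_sq 1 CARD('d) g < \<infinity>\<close>] by simp
  define J where "J = (LINT \<xi>|lborel. norm (g \<xi>) / (1 + norm \<xi>) ^ ?M)"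
  have J0: "J \<ge> 0" unfolding J_def
    by (intro Bochner_Integration.integral_nonneg_AE AE_I2 divide_nonneg_nonneg) (auto intro: less_imp_le[OF zero_less_power[OF one_plus_norm_pos]])
  define c where "c a m = (LINT \<xi>|lborel. g \<xi> * cis (lat m \<bullet> ((h / \<epsilon>) *\<^sub>R \<xi>)) * a (h *\<^sub>R lat m, \<xi>))" for a :: "(real ^ 'd) \<times> (real ^ 'd) \<Rightarrow> complex" and m
  have pt: "norm (g \<xi> * cis (lat m \<bullet> ((h / \<epsilon>) *\<^sub>R \<xi>)) * a (x, \<xi>)) \<le> (schwartz_seminorm (?n + ?M) a * (1 / (1 + norm x) ^ ?n)) * (norm (g \<xi>) / (1 + norm \<xi>) ^ ?M)"
    if a: "schwartz a" for a :: "(real ^ 'd) \<times> (real ^ 'd) \<Rightarrow> complex" and m x \<xi>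
  proof -
    have p: "0 < (1 + norm (x, \<xi>)) ^ (?n + ?M)" by (intro zero_less_power one_plus_norm_pos)
    have s0: "schwartz_seminorm (?n + ?M) a \<ge> 0"
    proof -
      have "norm (a 0) \<le> schwartz_seminorm (?n + ?M) a" using schwartz_seminorm_bound[OF a, of 0 "?n + ?M"] by simp
      then show ?thesis by (rule order_trans[OF norm_ge_zero])
    qed
    have "norm (a (x, \<xi>)) \<le> schwartz_seminorm (?n + ?M) a / (1 + norm (x, \<xi>)) ^ (?n + ?M)"
      using schwartz_seminorm_bound[OF a, of "(x, \<xi>)" "?n + ?M"] p by (simp add: pos_le_divide_eq mult.commute)
    also have "\<dots> \<le> schwartz_seminorm (?n + ?M) a * (1 / (1 + norm x) ^ ?n * (1 / (1 + norm \<xi>) ^ ?M))"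
      using mult_left_mono[OF inverse_power_pair_le[of x \<xi> ?n ?M] s0] by simp
    finally have "norm (g \<xi>) * norm (a (x, \<xi>)) \<le> norm (g \<xi>) * (schwartz_seminorm (?n + ?M) a * (1 / (1 + norm x) ^ ?n * (1 / (1 + norm \<xi>) ^ ?M)))"
      by (intro mult_left_mono) auto
    then show ?thesis by (simp add: norm_mult mult_ac)
  qed
  have ci: "integrable lborel (\<lambda>\<xi>. g \<xi> * cis (lat m \<bullet> ((h / \<epsilon>) *\<^sub>R \<xi>)) * a (x, \<xi>))" if a: "schwartz a" for a :: "(real ^ 'd) \<times> (real ^ 'd) \<Rightarrow> complex" and m x
  proof (rule Bochner_Integration.integrable_bound)
    show "integrable lborel (\<lambda>\<xi>. (schwartz_seminorm (?n + ?M) a * (1 / (1 + norm x) ^ ?n)) * (norm (g \<xi>) / (1 + norm \<xi>) ^ ?M))"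
      using gi by (rule integrable_mult_right)
    show "AE \<xi> in lborel. norm (g \<xi> * cis (lat m \<bullet> ((h / \<epsilon>) *\<^sub>R \<xi>)) * a (x, \<xi>)) \<le> norm ((schwartz_seminorm (?n + ?M) a * (1 / (1 + norm x) ^ ?n)) * (norm (g \<xi>) / (1 + norm \<xi>) ^ ?M))"
      unfolding real_norm_def by (intro AE_I2 order_trans[OF pt[OF a] abs_ge_self])
    have "(\<lambda>\<xi>. a (x, \<xi>)) \<in> borel_measurable borel" by (rule schwartz_borel[OF schwartz_slice[OF a]])
    then show "(\<lambda>\<xi>. g \<xi> * cis (lat m \<bullet> ((h / \<epsilon>) *\<^sub>R \<xi>)) * a (x, \<xi>)) \<in> borel_measurable lborel" by measurable
  qed
  have cb: "norm (c a m) \<le> schwartz_seminorm (?n + ?M) a * J * (1 / (1 + norm (h *\<^sub>R lat m)) ^ ?n)" if a: "schwartz a" for a m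
  proof -
    have "norm (c a m) \<le> (LINT \<xi>|lborel. (schwartz_seminorm (?n + ?M) a * (1 / (1 + norm (h *\<^sub>R lat m)) ^ ?n)) * (norm (g \<xi>) / (1 + norm \<xi>) ^ ?M))"
      unfolding c_def
      by (rule Bochner_Integration.integral_norm_bound_integral[OF ci[OF a] integrable_mult_right[OF gi] pt[OF a]])
    also have "\<dots> = schwartz_seminorm (?n + ?M) a * J * (1 / (1 + norm (h *\<^sub>R lat m)) ^ ?n)"
      unfolding integral_mult_right_zero J_def[symmetric] by (simp only: mult_ac)
    finally show ?thesis .
  qed
  have l2: "(\<lambda>n. (norm (fcoef V n))\<^sup>2) summable_on UNIV" using bessel[OF Vm Vi] by (simp add: in_l2_def)
  \<comment> \<open>The summand 1 goes with 2 t \<le> 1 + t^2, which bounds a single coefficient by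
    the sum of squares without a square root.\<close>
  define A where "A = 1 + (\<Sum>\<^sub>\<infinity>n\<in>UNIV. (norm (fcoef V n))\<^sup>2)"
  have A: "norm (fcoef V m) \<le> A" for m
  proof -
    have "(norm (fcoef V m))\<^sup>2 = (\<Sum>n\<in>{m}. (norm (fcoef V n))\<^sup>2)" by simp
    also have "\<dots> \<le> (\<Sum>\<^sub>\<infinity>n\<in>UNIV. (norm (fcoef V n))\<^sup>2)" by (rule finite_sum_le_infsum[OF l2]) auto
    finally have s: "(norm (fcoef V m))\<^sup>2 \<le> A - 1" by (simp add: A_def)
    have "2 * norm (fcoef V m) \<le> 1 + (norm (fcoef V m))\<^sup>2"
      using sum_squares_bound[of 1 "norm (fcoef V m)"] by simp
    moreover have "0 \<le> norm (fcoef V m)" by simp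
    ultimately show ?thesis using s by linarith
  qed
  have A0: "A \<ge> 0" using A[of 0] norm_ge_zero order_trans by blast
  define Z where "Z = (\<Sum>\<^sub>\<infinity>m\<in>(UNIV :: (int ^ 'd) set). 1 / (1 + norm (h *\<^sub>R lat m)) ^ ?n)"
  note Zs = lattice_decay_summable[OF h order_refl, where 'd='d]
  have tb: "norm (cnj (fcoef V m) * c a m) \<le> A * (schwartz_seminorm (?n + ?M) a * J) * (1 / (1 + norm (h *\<^sub>R lat m)) ^ ?n)" if a: "schwartz a" for a m
    using mult_mono[OF A cb[OF a] A0 norm_ge_zero, of m m] by (simp only: norm_mult complex_mod_cnj mult.assoc)
  have abs: "(\<lambda>m. norm (cnj (fcoef V m) * c a m)) summable_on UNIV" if a: "schwartz a" for a
    by (rule summable_on_comparison_test[OF summable_on_cmult_right[OF Zs] tb[OF a]]) simp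
  have sm: "(\<lambda>m. cnj (fcoef V m) * c a m) summable_on UNIV" if a: "schwartz a" for a
    by (rule abs_summable_summable[OF abs[OF a]])
  define k where "k = complex_of_real (h ^ (2 * CARD('d)) / (2 * pi * \<epsilon>) ^ CARD('d))"
  have lw: "lattice_wigner h \<epsilon> (fcoef V) a = k * (\<Sum>\<^sub>\<infinity>m\<in>UNIV. cnj (fcoef V m) * c a m)" for a
    unfolding lattice_wigner_def k_def c_def g_def ..
  show ?thesis unfolding tempered_def
  proof (intro conjI allI impI)
    fix a b :: "(real ^ 'd) \<times> (real ^ 'd) \<Rightarrow> complex" assume ab: "schwartz a" "schwartz b"
    have "c (\<lambda>x. a x + b x) m = c a m + c b m" for m
      unfolding c_def distrib_left by (rule Bochner_Integration.integral_add[OF ci[OF ab(1)] ci[OF ab(2)]])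
    then show "lattice_wigner h \<epsilon> (fcoef V) (\<lambda>x. a x + b x) = lattice_wigner h \<epsilon> (fcoef V) a + lattice_wigner h \<epsilon> (fcoef V) b"
      unfolding lw by (simp add: distrib_left infsum_add[OF sm[OF ab(1)] sm[OF ab(2)]])
  next
    fix z and a :: "(real ^ 'd) \<times> (real ^ 'd) \<Rightarrow> complex" assume a: "schwartz a"
    have "c (\<lambda>x. z * a x) m = z * c a m" for m
      unfolding c_def by (subst integral_mult_right_zero[symmetric]) (simp add: mult_ac)
    then have "(\<lambda>m. cnj (fcoef V m) * c (\<lambda>x. z * a x) m) = (\<lambda>m. z * (cnj (fcoef V m) * c a m))"
      by (simp add: mult_ac)
    then show "lattice_wigner h \<epsilon> (fcoef V) (\<lambda>x. z * a x) = z * lattice_wigner h \<epsilon> (fcoef V) a"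
      unfolding lw by (simp add: infsum_cmult_right[OF sm[OF a]])
  next
    have "norm (lattice_wigner h \<epsilon> (fcoef V) a) \<le> (norm k * (A * J * Z)) * schwartz_seminorm (?n + ?M) a" if a: "schwartz a" for a
    proof -
      have "norm (\<Sum>\<^sub>\<infinity>m\<in>UNIV. cnj (fcoef V m) * c a m) \<le> (\<Sum>\<^sub>\<infinity>m\<in>UNIV. norm (cnj (fcoef V m) * c a m))"
        by (rule norm_infsum_bound[OF abs[OF a]])
      also have "\<dots> \<le> (\<Sum>\<^sub>\<infinity>m\<in>UNIV. A * (schwartz_seminorm (?n + ?M) a * J) * (1 / (1 + norm (h *\<^sub>R lat m :: real ^ 'd)) ^ ?n))"
        by (rule infsum_mono[OF abs[OF a] summable_on_cmult_right[OF Zs] tb[OF a]])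
      also have "\<dots> = A * (schwartz_seminorm (?n + ?M) a * J) * Z"
        unfolding Z_def by (rule infsum_cmult_right[OF Zs])
      finally have "norm k * norm (\<Sum>\<^sub>\<infinity>m\<in>UNIV. cnj (fcoef V m) * c a m) \<le> norm k * (A * (schwartz_seminorm (?n + ?M) a * J) * Z)"
        by (rule mult_left_mono) simp
      then show ?thesis unfolding lw norm_mult by (simp only: mult_ac)
    qed
    then show "\<exists>C N. \<forall>f. schwartz f \<longrightarrow> norm (lattice_wigner h \<epsilon> (fcoef V) f) \<le> C * schwartz_seminorm N f" by blast
  qed
qed

section \<open>Comparison of the two symbols\<close>

text \<open>Both signs of s are covered because the bracket lies between 1 and 1 + |\<eta>|.\<close>

lemma bracket_powr_le:
  assumes "\<bar>s\<bar> \<le> real N"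
  shows "bracket \<eta> powr s \<le> (1 + norm \<eta>) ^ N"
proof -
  have b1: "1 \<le> bracket \<eta>" by (simp add: bracket_def)
  have "bracket \<eta> \<le> sqrt ((1 + norm \<eta>)\<^sup>2)"
    unfolding bracket_def by (intro real_sqrt_le_mono) (simp add: power2_sum)
  then have b2: "bracket \<eta> \<le> 1 + norm \<eta>" by simp
  have "bracket \<eta> powr s \<le> bracket \<eta> powr real N" using b1 assms by (intro powr_mono) linarith+
  also have "\<dots> = bracket \<eta> ^ N" using b1 by (intro powr_realpow) linarith
  also have "\<dots> \<le> (1 + norm \<eta>) ^ N" using b1 b2 by (intro power_mono) auto
  finally show ?thesis .
qed

lemma bracket_powr_cancel: "bracket \<eta> powr s * bracket \<eta> powr (- s) = 1"
  using bracket_pos[of \<eta>] by (simp flip: powr_add)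

lemma wform_add_left:
  assumes "integrable lborel (\<lambda>\<eta>. cnj (f \<eta>) * fourier (synth \<epsilon> a g) \<eta>)" "integrable lborel (\<lambda>\<eta>. cnj (f' \<eta>) * fourier (synth \<epsilon> a g) \<eta>)"
  shows "wform \<epsilon> a (\<lambda>\<xi>. f \<xi> + c * f' \<xi>) g = wform \<epsilon> a f g + cnj c * wform \<epsilon> a f' g"
proof -
  have "wform \<epsilon> a (\<lambda>\<xi>. f \<xi> + c * f' \<xi>) g = (LINT \<eta>|lborel. cnj (f \<eta>) * fourier (synth \<epsilon> a g) \<eta> + cnj c * (cnj (f' \<eta>) * fourier (synth \<epsilon> a g) \<eta>))"
    unfolding wform_def by (simp add: algebra_simps)
  also have "\<dots> = wform \<epsilon> a f g + cnj c * wform \<epsilon> a f' g"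
    unfolding wform_def by (subst Bochner_Integration.integral_add[OF assms(1) integrable_mult_right[OF assms(2)]]) (simp only: integral_mult_right_zero)
  finally show ?thesis .
qed

lemma wform_add_right:
  fixes a :: "(real ^ 'd::finite) \<times> (real ^ 'd) \<Rightarrow> complex"
  assumes a: "schwartz a" and e: "\<epsilon> > 0"
    and g: "g \<in> borel_measurable borel" "weighted_sq \<epsilon> N g < \<infinity>" and g': "g' \<in> borel_measurable borel" "weighted_sq \<epsilon> N g' < \<infinity>"
    and i: "integrable lborel (\<lambda>\<eta>. cnj (f \<eta>) * fourier (synth \<epsilon> a g) \<eta>)" "integrable lborel (\<lambda>\<eta>. cnj (f \<eta>) * fourier (synth \<epsilon> a g') \<eta>)"
  shows "wform \<epsilon> a f (\<lambda>\<xi>. g \<xi> + c * g' \<xi>) = wform \<epsilon> a f g + c * wform \<epsilon> a f g'"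
proof -
  have s: "synth \<epsilon> a (\<lambda>\<xi>. g \<xi> + c * g' \<xi>) x = synth \<epsilon> a g x + c * synth \<epsilon> a g' x" for x
  proof -
    have "synth \<epsilon> a (\<lambda>\<xi>. g \<xi> + c * g' \<xi>) x = (LINT \<xi>|lborel. g \<xi> * (cis (x \<bullet> \<xi>) * a (x, \<epsilon> *\<^sub>R \<xi>)) + c * (g' \<xi> * (cis (x \<bullet> \<xi>) * a (x, \<epsilon> *\<^sub>R \<xi>))))"
      unfolding synth_def by (simp add: algebra_simps)
    then show ?thesis unfolding synth_def
      by (simp only: Bochner_Integration.integral_add[OF synth_integrable[OF a e g] integrable_mult_right[OF synth_integrable[OF a e g']]] integral_mult_right_zero)
  qed
  have si: "integrable lborel (synth \<epsilon> a g)" "integrable lborel (synth \<epsilon> a g')"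
    by (rule schwartz_integrable[OF schwartz_synth[OF a e g]], rule schwartz_integrable[OF schwartz_synth[OF a e g']])
  have F: "fourier (synth \<epsilon> a (\<lambda>\<xi>. g \<xi> + c * g' \<xi>)) \<eta> = fourier (synth \<epsilon> a g) \<eta> + c * fourier (synth \<epsilon> a g') \<eta>" for \<eta>
  proof -
    have "fourier (synth \<epsilon> a (\<lambda>\<xi>. g \<xi> + c * g' \<xi>)) \<eta> = (LINT x|lborel. synth \<epsilon> a g x * cis (- (x \<bullet> \<eta>)) + c * (synth \<epsilon> a g' x * cis (- (x \<bullet> \<eta>))))"
      unfolding fourier_def s by (simp add: algebra_simps)
    then show ?thesis unfolding fourier_def
      by (simp only: Bochner_Integration.integral_add[OF integrable_mult_cis(2)[OF si(1)] integrable_mult_right[OF integrable_mult_cis(2)[OF si(2)]]] integral_mult_right_zero)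
  qed
  have "wform \<epsilon> a f (\<lambda>\<xi>. g \<xi> + c * g' \<xi>) = (LINT \<eta>|lborel. cnj (f \<eta>) * fourier (synth \<epsilon> a g) \<eta> + c * (cnj (f \<eta>) * fourier (synth \<epsilon> a g') \<eta>))"
    unfolding wform_def F by (simp add: algebra_simps)
  then show ?thesis unfolding wform_def
    by (simp only: Bochner_Integration.integral_add[OF i(1) integrable_mult_right[OF i(2)]] integral_mult_right_zero)
qed

lemma ennreal_square_sum_le:
  fixes x y z :: real
  assumes "0 \<le> x" "x \<le> y + z"
  shows "ennreal (x\<^sup>2) \<le> 2 * ennreal (y\<^sup>2) + 2 * ennreal (z\<^sup>2)"
proof -
  have "x\<^sup>2 \<le> (y + z)\<^sup>2" using assms by (intro power_mono)
  also have "\<dots> \<le> 2 * y\<^sup>2 + 2 * z\<^sup>2" using zero_le_power2[of "y - z"] by (simp add: power2_sum power2_diff)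
  finally have "ennreal (x\<^sup>2) \<le> ennreal (2 * y\<^sup>2 + 2 * z\<^sup>2)" by (rule ennreal_leI)
  then show ?thesis by (simp add: ennreal_plus ennreal_mult)
qed

text \<open>The sampling data: \<open>p\<close> is the Fourier transform of the sampling function and \<open>U\<close> that of the
  sampled distribution.  The symbol \<open>conj p(\<eta>) U(\<eta>/h)\<close> is split into two factors by moving the
  power of the bracket from one to the other.\<close>
locale sampling =
  fixes p U :: "real ^ 'd::finite \<Rightarrow> complex" and s B h :: real
  assumes p_meas [measurable]: "p \<in> borel_measurable borel" and U_meas [measurable]: "U \<in> borel_measurable borel"
    and h: "h > 0" and B: "B > 0"
    and BP: "AE \<xi> in lborel. (\<integral>\<^sup>+l. ennreal ((bracket (lshift l \<xi>) powr s * norm (p (lshift l \<xi>)))\<^sup>2) \<partial>count_space UNIV) \<le> ennreal B"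
    and L2: "(\<integral>\<^sup>+\<xi>. ennreal ((norm (of_real (bracket (h *\<^sub>R \<xi>) powr (- s)) * U \<xi>))\<^sup>2) \<partial>lborel) < \<infinity>"
begin

definition "left \<eta> = of_real (bracket \<eta> powr s) * cnj (p \<eta>)"
text \<open>When \<open>U\<close> is the transform of u, this is the transform of <hD>^(-s) u, the
  object of the boundedness and oscillation hypotheses; \<open>right\<close> is the same function in
  the lattice frequency \<eta> = h \<xi>.\<close>

definition "\<nu> \<xi> = of_real (bracket (h *\<^sub>R \<xi>) powr (- s)) * U \<xi>"
definition "right \<eta> = \<nu> ((1 / h) *\<^sub>R \<eta>)"

abbreviation "P \<equiv> sampled_symbol p h U"

lemma meas [measurable]: "left \<in> borel_measurable borel" "\<nu> \<in> borel_measurable borel" "right \<in> borel_measurable borel" "P \<in> borel_measurable borel"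
  unfolding left_def right_def \<nu>_def sampled_symbol_def by measurable

lemma P_eq: "P = (\<lambda>\<eta>. left \<eta> * right \<eta>)"
proof
  fix \<eta> :: "real ^ 'd"
  have "complex_of_real (bracket \<eta> powr s) * of_real (bracket \<eta> powr (- s)) = 1"
    unfolding of_real_mult[symmetric] bracket_powr_cancel by simp
  moreover have "h *\<^sub>R (1 / h) *\<^sub>R \<eta> = \<eta>" using h by simp
  ultimately show "P \<eta> = left \<eta> * right \<eta>"
    unfolding sampled_symbol_def left_def right_def \<nu>_def by (simp add: mult_ac)
qed

lemma norm_U_eq: "norm (U ((1 / h) *\<^sub>R \<eta>)) = bracket \<eta> powr s * norm (right \<eta>)"
proof -
  have "h *\<^sub>R (1 / h) *\<^sub>R \<eta> = \<eta>" using h by simp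
  then have "bracket \<eta> powr s * norm (right \<eta>) = (bracket \<eta> powr s * bracket \<eta> powr (- s)) * norm (U ((1 / h) *\<^sub>R \<eta>))"
    unfolding right_def \<nu>_def by (simp add: norm_mult)
  then show ?thesis unfolding bracket_powr_cancel by simp
qed

lemma BP_left: "AE \<xi> in lborel. (\<integral>\<^sup>+l. ennreal ((norm (left (lshift l \<xi>)))\<^sup>2) \<partial>count_space UNIV) \<le> ennreal B"
  using BP unfolding left_def by (simp add: norm_mult)

lemma right_scale:
  assumes [measurable]: "A \<in> sets borel"
  shows "(\<integral>\<^sup>+\<eta>. ennreal ((norm (right \<eta>))\<^sup>2) * indicator A \<eta> \<partial>lborel) = ennreal (h ^ CARD('d)) * (\<integral>\<^sup>+\<xi>. ennreal ((norm (\<nu> \<xi>))\<^sup>2) * indicator A (h *\<^sub>R \<xi>) \<partial>lborel)"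
  using h by (subst nn_integral_affine[of _ h 0]) (auto simp: right_def)

lemma right_L2: "(\<integral>\<^sup>+\<eta>. ennreal ((norm (right \<eta>))\<^sup>2) \<partial>lborel) = ennreal (h ^ CARD('d)) * (\<integral>\<^sup>+\<xi>. ennreal ((norm (\<nu> \<xi>))\<^sup>2) \<partial>lborel)"
  using right_scale[of UNIV] by simp

lemma right_fin: "(\<integral>\<^sup>+\<eta>. ennreal ((norm (right \<eta>))\<^sup>2) \<partial>lborel) < \<infinity>"
  unfolding right_L2 using L2 unfolding \<nu>_def by (simp add: ennreal_mult_less_top)

text \<open>(BP) integrated over the cell is, by tiling, a square integral over the whole space.
  Together with \<open>right_fin\<close> it makes the symbol integrable, which is what folding the
  samples into the cell requires.\<close>

lemma left_fin: "(\<integral>\<^sup>+\<eta>. ennreal ((norm (left \<eta>))\<^sup>2) \<partial>lborel) < \<infinity>"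
proof -
  have "(\<integral>\<^sup>+\<eta>. ennreal ((norm (left \<eta>))\<^sup>2) \<partial>lborel) = (\<integral>\<^sup>+\<xi>\<in>Q. (\<integral>\<^sup>+l. ennreal ((norm (left (lshift l \<xi>)))\<^sup>2) \<partial>count_space UNIV) \<partial>lborel)"
    by (rule nn_integral_tile) measurable
  also have "\<dots> \<le> (\<integral>\<^sup>+\<xi>\<in>(Q :: (real ^ 'd) set). ennreal B \<partial>lborel)"
  proof (rule nn_integral_mono_AE)
    from BP_left show "AE \<xi> in lborel. (\<integral>\<^sup>+l. ennreal ((norm (left (lshift l \<xi>)))\<^sup>2) \<partial>count_space UNIV) * indicator Q \<xi> \<le> ennreal B * indicator Q \<xi>"
      by eventually_elim (intro mult_right_mono, auto)
  qed
  also have "\<dots> < \<infinity>" by (subst nn_integral_cmult_indicator) (auto simp: emeasure_Q ennreal_mult_less_top)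
  finally show ?thesis .
qed

lemma P_integrable: "integrable lborel P"
  unfolding P_eq by (rule integrable_product_L2) (use left_fin right_fin in auto)

lemma per_P_bound: "(\<integral>\<^sup>+\<xi>\<in>Q. ennreal ((norm (per P \<xi>))\<^sup>2) \<partial>lborel) \<le> ennreal B * (\<integral>\<^sup>+\<xi>. ennreal ((norm (right \<xi>))\<^sup>2) \<partial>lborel)"
  unfolding P_eq by (rule nn_integral_Q_per_square_le[OF BP_left]) measurable

lemma per_P_fin: "(\<integral>\<^sup>+\<xi>\<in>Q. ennreal ((norm (per P \<xi>))\<^sup>2) \<partial>lborel) < \<infinity>"
  using per_P_bound by (rule le_less_trans) (use right_fin in \<open>simp add: ennreal_mult_less_top\<close>)

lemma per_P_integrable: "integrable MQ (\<lambda>\<eta>. (norm (per P \<eta>))\<^sup>2)"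
proof (rule integrableI_bounded)
  show "(\<lambda>\<eta>. (norm (per P \<eta>))\<^sup>2) \<in> borel_measurable MQ" by (intro MQ_measurable) measurable
qed (use per_P_fin in \<open>simp add: nn_integral_MQ\<close>)

lemma per_P_indicator_bound:
  assumes [measurable]: "A \<in> sets borel"
  shows "(\<integral>\<^sup>+\<xi>\<in>Q. ennreal ((norm (per (\<lambda>\<eta>. P \<eta> * indicator A \<eta>) \<xi>))\<^sup>2) \<partial>lborel) \<le> ennreal B * (\<integral>\<^sup>+\<eta>. ennreal ((norm (right \<eta>))\<^sup>2) * indicator A \<eta> \<partial>lborel)"
proof -
  have e: "(\<lambda>\<eta>. P \<eta> * indicator A \<eta>) = (\<lambda>\<eta>. left \<eta> * (right \<eta> * indicator A \<eta>))" unfolding P_eq by (simp add: mult.assoc)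
  have "(\<integral>\<^sup>+\<xi>\<in>Q. ennreal ((norm (per (\<lambda>\<eta>. P \<eta> * indicator A \<eta>) \<xi>))\<^sup>2) \<partial>lborel) \<le> ennreal B * (\<integral>\<^sup>+\<eta>. ennreal ((norm (right \<eta> * indicator A \<eta>))\<^sup>2) \<partial>lborel)"
    unfolding e by (rule nn_integral_Q_per_square_le[OF BP_left]) measurable
  also have "(\<integral>\<^sup>+\<eta>. ennreal ((norm (right \<eta> * indicator A \<eta>))\<^sup>2) \<partial>lborel) = (\<integral>\<^sup>+\<eta>. ennreal ((norm (right \<eta>))\<^sup>2) * indicator A \<eta> \<partial>lborel)"
    by (intro nn_integral_cong) (auto simp: indicator_def)
  finally show ?thesis .
qed

lemma not_Q_subset: "\<rho> \<le> pi \<Longrightarrow> - Q \<subseteq> - ball (0 :: real ^ 'd) \<rho>"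
  using norm_ge_if_not_Q by (fastforce simp: not_less)

lemma lshift_not_Q: "\<eta> \<in> Q \<Longrightarrow> l \<noteq> 0 \<Longrightarrow> lshift l \<eta> \<notin> Q"
  using Q_ex1[of \<eta>] by (metis add.right_neutral lat_simps(4) scaleR_zero_right)

text \<open>If \<eta> lies in Q but not in the ball, no translate of it lies in the ball: the
  nonzero shifts leave Q and so have norm at least pi \<ge> \<rho>. Cutting the symbol off outside
  the ball therefore does not change its periodization at \<eta>.\<close>

lemma per_P_outside:
  assumes "\<rho> \<le> pi"
  shows "(\<integral>\<^sup>+\<eta>\<in>Q - ball 0 \<rho>. ennreal ((norm (per P \<eta>))\<^sup>2) \<partial>lborel) \<le> ennreal B * (\<integral>\<^sup>+\<eta>. ennreal ((norm (right \<eta>))\<^sup>2) * indicator (- ball 0 \<rho>) \<eta> \<partial>lborel)"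
proof -
  have "(\<integral>\<^sup>+\<eta>\<in>Q - ball 0 \<rho>. ennreal ((norm (per P \<eta>))\<^sup>2) \<partial>lborel) \<le> (\<integral>\<^sup>+\<xi>\<in>Q. ennreal ((norm (per (\<lambda>\<eta>. P \<eta> * indicator (- ball 0 \<rho>) \<eta>) \<xi>))\<^sup>2) \<partial>lborel)"
  proof (rule nn_integral_mono)
    fix \<eta> :: "real ^ 'd"
    show "ennreal ((norm (per P \<eta>))\<^sup>2) * indicator (Q - ball 0 \<rho>) \<eta> \<le> ennreal ((norm (per (\<lambda>\<eta>. P \<eta> * indicator (- ball 0 \<rho>) \<eta>) \<eta>))\<^sup>2) * indicator Q \<eta>"
    proof (cases "\<eta> \<in> Q - ball 0 \<rho>")
      case True
      have "lshift l \<eta> \<in> - ball 0 \<rho>" for l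
        using True lshift_not_Q[of \<eta> l] not_Q_subset[OF assms] by (cases "l = 0") (auto simp: lat_simps)
      then show ?thesis using True by (simp add: per_def)
    qed simp
  qed
  also have "\<dots> \<le> ennreal B * (\<integral>\<^sup>+\<eta>. ennreal ((norm (right \<eta>))\<^sup>2) * indicator (- ball 0 \<rho>) \<eta> \<partial>lborel)"
    by (rule per_P_indicator_bound) simp
  finally show ?thesis .
qed

text \<open>Only l = 0 keeps a point of Q in Q; all other terms are aliases. The identity is an
  almost everywhere one because \<open>per\<close> is the sum of its series only where that series
  is absolutely summable.\<close>

lemma per_P_split: "AE \<eta> in lborel. \<eta> \<in> Q \<longrightarrow> per P \<eta> = P \<eta> + per (\<lambda>\<eta>. P \<eta> * indicator (- Q) \<eta>) \<eta>"
  using integral_tile(1)[OF P_integrable]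
proof eventually_elim
  case (elim \<eta>)
  show ?case
  proof
    assume Q: "\<eta> \<in> Q"
    let ?C = "count_space (UNIV :: (int ^ 'd) set)"
    have i: "integrable ?C (\<lambda>l. P (lshift l \<eta>))" using elim Q by blast
    have iff: "lshift l \<eta> \<in> Q \<longleftrightarrow> l = 0" for l using Q lshift_not_Q[OF Q, of l] by (auto simp: lat_simps)
    have s: "(LINT l|?C. (if lshift l \<eta> \<in> Q then P \<eta> else 0)) = P \<eta>"
      by (rule integral_lattice_single[of _ 0]) (rule iff)
    have i2: "integrable ?C (\<lambda>l. P (lshift l \<eta>) * indicator (- Q) (lshift l \<eta>))"
      by (rule Bochner_Integration.integrable_bound[OF i]) (auto simp: norm_mult indicator_def)
    have "P (lshift l \<eta>) - P (lshift l \<eta>) * indicator (- Q) (lshift l \<eta>) = (if lshift l \<eta> \<in> Q then P \<eta> else 0)" for l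
      using iff[of l] by (auto simp: lat_simps indicator_def)
    then have "(LINT l|?C. P (lshift l \<eta>)) - (LINT l|?C. P (lshift l \<eta>) * indicator (- Q) (lshift l \<eta>)) = P \<eta>"
      unfolding Bochner_Integration.integral_diff[OF i i2, symmetric] using s by simp
    then show "per P \<eta> = P \<eta> + per (\<lambda>\<eta>. P \<eta> * indicator (- Q) \<eta>) \<eta>" unfolding per_def by (simp add: algebra_simps)
  qed
qed

lemma left_bound: "AE \<eta> in lborel. norm (left \<eta>) \<le> sqrt B"
  using BP_left
proof eventually_elim
  case (elim \<eta>)
  have "ennreal ((norm (left \<eta>))\<^sup>2) = (\<integral>\<^sup>+l. ennreal ((norm (left (lshift l \<eta>)))\<^sup>2) * indicator {0} l \<partial>count_space UNIV)"
    by (subst nn_integral_count_space'[of "{0}"]) (auto simp: lat_simps)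
  also have "\<dots> \<le> (\<integral>\<^sup>+l. ennreal ((norm (left (lshift l \<eta>)))\<^sup>2) \<partial>count_space UNIV)"
    by (intro nn_integral_mono) (auto simp: indicator_def)
  finally have "ennreal ((norm (left \<eta>))\<^sup>2) \<le> ennreal B" using elim by (rule order_trans)
  then have "(norm (left \<eta>))\<^sup>2 \<le> B" using B by simp
  then show ?case by (rule real_le_rsqrt)
qed

text \<open>The discrepancy between the periodized symbol and its expected limit conj \<phi>hat(0)
  uhat, in the lattice frequency.\<close>

definition "diff \<eta> = per P \<eta> - cnj (p 0) * U ((1 / h) *\<^sub>R \<eta>)"

lemma diff_measurable [measurable]: "diff \<in> borel_measurable borel"
  unfolding diff_def by measurable

text \<open>Inside the ball the coefficient is small by \<delta>; in the rest of Q it is bounded by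
  a constant; the aliases are bounded through (BP) by the mass of \<open>right\<close> off Q. Only
  the first part sees the full mass, the others see the tail. The bracket in the condition on
  \<delta> stems from \<open>norm_U_eq\<close>.\<close>

lemma diff_Q:
  assumes N: "\<bar>s\<bar> \<le> real N" and \<rho>: "\<rho> \<le> pi" and \<delta>: "\<And>\<eta>. norm \<eta> < \<rho> \<Longrightarrow> norm (p \<eta> - p 0) * bracket \<eta> powr s \<le> \<delta>"
  shows "(\<integral>\<^sup>+\<eta>\<in>Q. ennreal ((norm (diff \<eta>))\<^sup>2) \<partial>lborel) \<le>
    ennreal (2 * \<delta>\<^sup>2) * (\<integral>\<^sup>+\<eta>. ennreal ((norm (right \<eta>))\<^sup>2) \<partial>lborel)
    + ennreal (2 * (sqrt B + norm (p 0) * (1 + pi * CARD('d)) ^ N)\<^sup>2 + 2 * B) * (\<integral>\<^sup>+\<eta>. ennreal ((norm (right \<eta>))\<^sup>2) * indicator (- ball 0 \<rho>) \<eta> \<partial>lborel)"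
proof -
  \<comment> \<open>The root of B bounds \<open>left\<close> almost everywhere, and on Q, where the
    norm is at most pi d, the power of the bracket is at most (1 + pi d)^N.\<close>
  define K where "K = sqrt B + norm (p 0) * (1 + pi * CARD('d)) ^ N"
  have K0: "K \<ge> 0" unfolding K_def using B by simp
  let ?r = "\<lambda>\<eta>. ennreal ((norm (right \<eta>))\<^sup>2)" and ?T = "\<lambda>\<eta>. ennreal ((norm (per (\<lambda>\<eta>. P \<eta> * indicator (- Q) \<eta>) \<eta>))\<^sup>2)"
  have "AE \<eta> in lborel. ennreal ((norm (diff \<eta>))\<^sup>2) * indicator Q \<eta> \<le> ennreal (2 * \<delta>\<^sup>2) * ?r \<eta> + (ennreal (2 * K\<^sup>2) * (?r \<eta> * indicator (- ball 0 \<rho>) \<eta>) + 2 * (?T \<eta> * indicator Q \<eta>))"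
    using per_P_split left_bound
  proof eventually_elim
    case (elim \<eta>)
    show ?case
    proof (cases "\<eta> \<in> Q")
      case True
      let ?m = "(cnj (p \<eta>) - cnj (p 0)) * U ((1 / h) *\<^sub>R \<eta>)"
      have "diff \<eta> = ?m + per (\<lambda>\<eta>. P \<eta> * indicator (- Q) \<eta>) \<eta>"
        using elim True unfolding diff_def by (simp add: sampled_symbol_def algebra_simps)
      then have "norm (diff \<eta>) \<le> norm ?m + norm (per (\<lambda>\<eta>. P \<eta> * indicator (- Q) \<eta>) \<eta>)"
        by (simp only: norm_triangle_ineq)
      then have 1: "ennreal ((norm (diff \<eta>))\<^sup>2) \<le> 2 * ennreal ((norm ?m)\<^sup>2) + 2 * ?T \<eta>"
        by (intro ennreal_square_sum_le) auto
      have m: "norm ?m = (norm (p \<eta> - p 0) * bracket \<eta> powr s) * norm (right \<eta>)"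
        unfolding norm_mult norm_U_eq complex_cnj_diff[symmetric] complex_mod_cnj by simp
      have 2: "2 * ennreal ((norm ?m)\<^sup>2) \<le> ennreal (2 * \<delta>\<^sup>2) * ?r \<eta> + ennreal (2 * K\<^sup>2) * (?r \<eta> * indicator (- ball 0 \<rho>) \<eta>)"
      proof (cases "norm \<eta> < \<rho>")
        case True
        have "norm ?m \<le> \<delta> * norm (right \<eta>)" unfolding m by (rule mult_right_mono[OF \<delta>[OF True]]) simp
        then have "2 * (norm ?m)\<^sup>2 \<le> 2 * \<delta>\<^sup>2 * (norm (right \<eta>))\<^sup>2"
          using power_mono[of "norm ?m" "\<delta> * norm (right \<eta>)" 2] by (simp add: power_mult_distrib)
        then have "ennreal (2 * (norm ?m)\<^sup>2) \<le> ennreal (2 * \<delta>\<^sup>2 * (norm (right \<eta>))\<^sup>2)" by (rule ennreal_leI)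
        then have "2 * ennreal ((norm ?m)\<^sup>2) \<le> ennreal (2 * \<delta>\<^sup>2) * ?r \<eta>" by (simp add: ennreal_mult)
        then show ?thesis by (rule order_trans) simp
      next
        case False
        have "norm (p \<eta> - p 0) * bracket \<eta> powr s \<le> (norm (p \<eta>) + norm (p 0)) * bracket \<eta> powr s"
          by (intro mult_right_mono norm_triangle_ineq4) auto
        also have "\<dots> = norm (left \<eta>) + norm (p 0) * bracket \<eta> powr s"
          by (simp add: left_def norm_mult algebra_simps)
        also have "\<dots> \<le> sqrt B + norm (p 0) * (1 + norm \<eta>) ^ N"
          by (intro add_mono mult_left_mono bracket_powr_le N elim(2)) auto
        also have "\<dots> \<le> K" unfolding K_def using norm_Q_le[OF \<open>\<eta> \<in> Q\<close>]
          by (intro add_left_mono mult_left_mono power_mono) auto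
        finally have "norm ?m \<le> K * norm (right \<eta>)" unfolding m by (rule mult_right_mono) simp
        then have "2 * (norm ?m)\<^sup>2 \<le> 2 * K\<^sup>2 * (norm (right \<eta>))\<^sup>2"
          using power_mono[of "norm ?m" "K * norm (right \<eta>)" 2] by (simp add: power_mult_distrib)
        then have "ennreal (2 * (norm ?m)\<^sup>2) \<le> ennreal (2 * K\<^sup>2 * (norm (right \<eta>))\<^sup>2)" by (rule ennreal_leI)
        then have "2 * ennreal ((norm ?m)\<^sup>2) \<le> ennreal (2 * K\<^sup>2) * ?r \<eta>" by (simp add: ennreal_mult)
        moreover have "indicator (- ball 0 \<rho>) \<eta> = (1::ennreal)" using False by simp
        ultimately show ?thesis by (simp add: add_increasing)
      qed
      show ?thesis using order_trans[OF 1 add_right_mono[OF 2, of "2 * ?T \<eta>"]] True by (simp add: add.assoc)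
    qed simp
  qed
  then have "(\<integral>\<^sup>+\<eta>\<in>Q. ennreal ((norm (diff \<eta>))\<^sup>2) \<partial>lborel) \<le>
     (\<integral>\<^sup>+\<eta>. ennreal (2 * \<delta>\<^sup>2) * ?r \<eta> + (ennreal (2 * K\<^sup>2) * (?r \<eta> * indicator (- ball 0 \<rho>) \<eta>) + 2 * (?T \<eta> * indicator Q \<eta>)) \<partial>lborel)"
    by (rule nn_integral_mono_AE)
  also have "\<dots> = ennreal (2 * \<delta>\<^sup>2) * (\<integral>\<^sup>+\<eta>. ?r \<eta> \<partial>lborel) + (ennreal (2 * K\<^sup>2) * (\<integral>\<^sup>+\<eta>. ?r \<eta> * indicator (- ball 0 \<rho>) \<eta> \<partial>lborel) + 2 * (\<integral>\<^sup>+\<eta>\<in>Q. ?T \<eta> \<partial>lborel))"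
  proof -
    have [measurable]: "- ball (0 :: real ^ 'd) \<rho> \<in> sets borel" by simp
    show ?thesis by (subst nn_integral_add, measurable, subst nn_integral_add, measurable) (simp add: nn_integral_cmult)
  qed
  also have "(\<integral>\<^sup>+\<eta>\<in>Q. ?T \<eta> \<partial>lborel) \<le> ennreal B * (\<integral>\<^sup>+\<eta>. ?r \<eta> * indicator (- Q) \<eta> \<partial>lborel)"
    by (rule per_P_indicator_bound) simp
  also have "(\<integral>\<^sup>+\<eta>. ?r \<eta> * indicator (- Q) \<eta> \<partial>lborel) \<le> (\<integral>\<^sup>+\<eta>. ?r \<eta> * indicator (- ball 0 \<rho>) \<eta> \<partial>lborel)"
    using not_Q_subset[OF \<rho>] by (intro nn_integral_mono mult_left_mono) (auto simp: indicator_def)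
  finally have "(\<integral>\<^sup>+\<eta>\<in>Q. ennreal ((norm (diff \<eta>))\<^sup>2) \<partial>lborel) \<le>
    ennreal (2 * \<delta>\<^sup>2) * (\<integral>\<^sup>+\<eta>. ?r \<eta> \<partial>lborel) + (ennreal (2 * K\<^sup>2) * (\<integral>\<^sup>+\<eta>. ?r \<eta> * indicator (- ball 0 \<rho>) \<eta> \<partial>lborel) + 2 * (ennreal B * (\<integral>\<^sup>+\<eta>. ?r \<eta> * indicator (- ball 0 \<rho>) \<eta> \<partial>lborel)))"
    by (simp add: mult_left_mono add_left_mono)
  also have "2 * (ennreal B * (\<integral>\<^sup>+\<eta>. ?r \<eta> * indicator (- ball 0 \<rho>) \<eta> \<partial>lborel)) = ennreal (2 * B) * (\<integral>\<^sup>+\<eta>. ?r \<eta> * indicator (- ball 0 \<rho>) \<eta> \<partial>lborel)"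
    using B by (simp add: ennreal_mult mult.assoc)
  finally show ?thesis using B unfolding K_def by (simp add: ennreal_plus distrib_right)
qed

text \<open>Off Q no cancellation is available and the two parts of \<open>diff\<close> are bounded
  separately. The weight gains (2/r)^(2N) on the periodic part; on the other it absorbs the bracket
  and leaves the tail of \<open>right\<close>. The parameter r stands for \<epsilon>/h.\<close>

lemma weighted_diff:
  assumes N: "\<bar>s\<bar> \<le> real N" "CARD('d) \<le> N" and \<rho>: "\<rho> \<le> pi" and \<delta>: "\<And>\<eta>. norm \<eta> < \<rho> \<Longrightarrow> norm (p \<eta> - p 0) * bracket \<eta> powr s \<le> \<delta>"
    and r: "r \<ge> 1" and C: "C \<ge> 0" "\<And>\<xi> :: real ^ 'd. \<xi> \<in> Q \<Longrightarrow> (\<integral>\<^sup>+l. ennreal (1 / (1 + norm (lshift l \<xi>)) ^ (2 * N)) \<partial>count_space UNIV) \<le> ennreal C"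
  shows "weighted_sq r N diff \<le>
    ennreal (2 * \<delta>\<^sup>2 + 2 * (2 / r) ^ (2 * N) * C * B) * (\<integral>\<^sup>+\<eta>. ennreal ((norm (right \<eta>))\<^sup>2) \<partial>lborel)
    + ennreal (2 * (sqrt B + norm (p 0) * (1 + pi * CARD('d)) ^ N)\<^sup>2 + 2 * B + 2 * (norm (p 0))\<^sup>2) * (\<integral>\<^sup>+\<eta>. ennreal ((norm (right \<eta>))\<^sup>2) * indicator (- ball 0 \<rho>) \<eta> \<partial>lborel)"
proof -
  let ?r = "\<lambda>\<eta>. ennreal ((norm (right \<eta>))\<^sup>2)" and ?p = "\<lambda>\<eta>. ennreal ((norm (per P \<eta>) / (1 + norm (r *\<^sub>R \<eta>)) ^ N)\<^sup>2)"
  define I where "I = (\<integral>\<^sup>+\<eta>. ?r \<eta> \<partial>lborel)"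
  define J where "J = (\<integral>\<^sup>+\<eta>. ?r \<eta> * indicator (- ball 0 \<rho>) \<eta> \<partial>lborel)"
  define K where "K = 2 * (sqrt B + norm (p 0) * (1 + pi * CARD('d)) ^ N)\<^sup>2 + 2 * B"
  have K0: "K \<ge> 0" unfolding K_def using B by simp
  have [measurable]: "- Q \<in> sets (borel :: (real ^ 'd) measure)" by simp
  have le: "ennreal ((norm (diff \<eta>) / (1 + norm (r *\<^sub>R \<eta>)) ^ N)\<^sup>2) \<le>
     ennreal ((norm (diff \<eta>))\<^sup>2) * indicator Q \<eta> + (2 * (?p \<eta> * indicator (- Q) \<eta>) + ennreal (2 * (norm (p 0))\<^sup>2) * (?r \<eta> * indicator (- Q) \<eta>))" for \<eta>
  proof -
    let ?W = "(1 + norm (r *\<^sub>R \<eta>)) ^ N"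
    have W: "?W \<ge> 1" by (intro one_le_power) simp
    then have W0: "?W > 0" by linarith
    show ?thesis
    proof (cases "\<eta> \<in> Q")
      case True
      have "norm (diff \<eta>) / ?W \<le> norm (diff \<eta>) / 1" using W W0 by (intro divide_left_mono) auto
      then have "(norm (diff \<eta>) / ?W)\<^sup>2 \<le> (norm (diff \<eta>))\<^sup>2" using W0 by (intro power_mono) auto
      then show ?thesis using True by (simp add: ennreal_leI)
    next
      case False
      have "norm (U ((1 / h) *\<^sub>R \<eta>)) / ?W \<le> norm (right \<eta>)"
      proof -
        have "norm \<eta> \<le> norm (r *\<^sub>R \<eta>)" using r mult_right_mono[of 1 r "norm \<eta>"] by simp
        then have "(1 + norm \<eta>) ^ N \<le> ?W" by (intro power_mono) auto
        then have "bracket \<eta> powr s \<le> ?W" using bracket_powr_le[OF N(1), of \<eta>] by linarith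
        from mult_right_mono[OF this norm_ge_zero[of "right \<eta>"]] show ?thesis
          unfolding norm_U_eq using W0 by (simp add: pos_divide_le_eq mult.commute)
      qed
      from mult_left_mono[OF this norm_ge_zero[of "p 0"]]
      have u: "norm (cnj (p 0) * U ((1 / h) *\<^sub>R \<eta>)) / ?W \<le> norm (p 0) * norm (right \<eta>)" by (simp add: norm_mult)
      have "norm (diff \<eta>) / ?W \<le> (norm (per P \<eta>) + norm (cnj (p 0) * U ((1 / h) *\<^sub>R \<eta>))) / ?W"
        unfolding diff_def using W0 by (intro divide_right_mono norm_triangle_ineq4) auto
      then have "norm (diff \<eta>) / ?W \<le> norm (per P \<eta>) / ?W + norm (p 0) * norm (right \<eta>)" using u by (simp add: add_divide_distrib)
      then have "ennreal ((norm (diff \<eta>) / ?W)\<^sup>2) \<le> 2 * ?p \<eta> + 2 * ennreal ((norm (p 0) * norm (right \<eta>))\<^sup>2)"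
        using W0 by (intro ennreal_square_sum_le) auto
      also have "2 * ennreal ((norm (p 0) * norm (right \<eta>))\<^sup>2) = ennreal (2 * (norm (p 0))\<^sup>2) * ?r \<eta>"
        by (simp add: power_mult_distrib ennreal_mult mult.assoc)
      finally show ?thesis using False by simp
    qed
  qed
  have "weighted_sq r N diff \<le> (\<integral>\<^sup>+\<eta>. ennreal ((norm (diff \<eta>))\<^sup>2) * indicator Q \<eta> + (2 * (?p \<eta> * indicator (- Q) \<eta>) + ennreal (2 * (norm (p 0))\<^sup>2) * (?r \<eta> * indicator (- Q) \<eta>)) \<partial>lborel)"
    unfolding weighted_sq_def by (rule nn_integral_mono) (rule le)
  also have "\<dots> = (\<integral>\<^sup>+\<eta>\<in>Q. ennreal ((norm (diff \<eta>))\<^sup>2) \<partial>lborel) + (2 * (\<integral>\<^sup>+\<eta>. ?p \<eta> * indicator (- Q) \<eta> \<partial>lborel) + ennreal (2 * (norm (p 0))\<^sup>2) * (\<integral>\<^sup>+\<eta>. ?r \<eta> * indicator (- Q) \<eta> \<partial>lborel))"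
    by (subst nn_integral_add, measurable, subst nn_integral_add, measurable) (simp add: nn_integral_cmult)
  also have "\<dots> \<le> (ennreal (2 * \<delta>\<^sup>2) * I + ennreal K * J) + (2 * (ennreal ((2 / r) ^ (2 * N)) * ennreal C * (ennreal B * I)) + ennreal (2 * (norm (p 0))\<^sup>2) * J)"
  proof (intro add_mono mult_left_mono)
    show "(\<integral>\<^sup>+\<eta>\<in>Q. ennreal ((norm (diff \<eta>))\<^sup>2) \<partial>lborel) \<le> ennreal (2 * \<delta>\<^sup>2) * I + ennreal K * J"
      unfolding I_def J_def K_def by (rule diff_Q[OF N(1) \<rho> \<delta>])
    show "(\<integral>\<^sup>+\<eta>. ?r \<eta> * indicator (- Q) \<eta> \<partial>lborel) \<le> J"
      unfolding J_def using not_Q_subset[OF \<rho>] by (intro nn_integral_mono mult_left_mono) (auto simp: indicator_def)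
    \<comment> \<open>Off Q the norm is at least pi \<ge> 1, so 1 + |\<eta>| \<le> 2 |\<eta>|; this
      is the source of r / 2.\<close>
    have c: "(r / 2) * (1 + norm \<eta>) \<le> 1 + norm (r *\<^sub>R \<eta>)" if "\<eta> \<in> - Q" for \<eta> :: "real ^ 'd"
    proof -
      have "1 \<le> norm \<eta>" using norm_ge_if_not_Q[of \<eta>] that pi_ge_two by simp
      then have "(r / 2) * (1 + norm \<eta>) \<le> (r / 2) * (2 * norm \<eta>)" using r by (intro mult_left_mono) auto
      also have "\<dots> = norm (r *\<^sub>R \<eta>)" using r by simp
      finally show ?thesis by simp
    qed
    have r0: "r > 0" "r / 2 > 0" using r by auto
    have m1: "per P \<in> borel_measurable borel" and m2: "- Q \<in> sets (borel :: (real ^ 'd) measure)" by measurable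
    have "(\<integral>\<^sup>+\<eta>. ?p \<eta> * indicator (- Q) \<eta> \<partial>lborel) \<le> ennreal ((1 / (r / 2)) ^ (2 * N)) * ennreal C * (\<integral>\<^sup>+\<eta>\<in>Q. ennreal ((norm (per P \<eta>))\<^sup>2) \<partial>lborel)"
      by (rule weighted_sq_tile[OF m1 m2 per_lshift r0(1) C(2) c r0(2)])
    also have "\<dots> \<le> ennreal ((1 / (r / 2)) ^ (2 * N)) * ennreal C * (ennreal B * I)"
      unfolding I_def by (intro mult_left_mono per_P_bound) simp
    finally show "(\<integral>\<^sup>+\<eta>. ?p \<eta> * indicator (- Q) \<eta> \<partial>lborel) \<le> ennreal ((2 / r) ^ (2 * N)) * ennreal C * (ennreal B * I)" by simp
  qed auto
  also have "\<dots> = ennreal (2 * \<delta>\<^sup>2 + 2 * (2 / r) ^ (2 * N) * C * B) * I + ennreal (K + 2 * (norm (p 0))\<^sup>2) * J"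
  proof -
    have k: "(2 / r) ^ (2 * N) \<ge> 0" using r by simp
    have "ennreal (2 * \<delta>\<^sup>2 + 2 * (2 / r) ^ (2 * N) * C * B) = ennreal (2 * \<delta>\<^sup>2) + 2 * (ennreal ((2 / r) ^ (2 * N)) * ennreal C * ennreal B)"
      using k C(1) B by (subst ennreal_plus) (auto simp: ennreal_mult mult.assoc)
    moreover have "ennreal (K + 2 * (norm (p 0))\<^sup>2) = ennreal K + ennreal (2 * (norm (p 0))\<^sup>2)" using K0 by (intro ennreal_plus) auto
    ultimately show ?thesis by (simp only: distrib_right mult.assoc add.assoc add.commute add.left_commute)
  qed
  finally show ?thesis unfolding I_def J_def K_def .
qed

text \<open>For h \<le> \<epsilon> the weight (1 + |\<epsilon> \<xi>|)^N dominates the bracket of h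
  \<xi> to the power s, so dividing \<open>U\<close> by it leaves at most |\<nu>|.\<close>

lemma weighted_U:
  assumes N: "\<bar>s\<bar> \<le> real N" and e: "h \<le> \<epsilon>"
  shows "weighted_sq \<epsilon> N U \<le> (\<integral>\<^sup>+\<xi>. ennreal ((norm (\<nu> \<xi>))\<^sup>2) \<partial>lborel)"
  unfolding weighted_sq_def
proof (intro nn_integral_mono ennreal_leI power_mono)
  fix \<xi> :: "real ^ 'd"
  let ?W = "(1 + norm (\<epsilon> *\<^sub>R \<xi>)) ^ N"
  have W0: "?W > 0" by (intro zero_less_power one_plus_norm_pos)
  show "0 \<le> norm (U \<xi>) / ?W" using W0 by simp
  have "(1 + norm (h *\<^sub>R \<xi>)) ^ N \<le> ?W"
    using e h mult_right_mono[of h \<epsilon> "norm \<xi>"] by (intro power_mono) auto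
  then have "bracket (h *\<^sub>R \<xi>) powr s \<le> ?W" using bracket_powr_le[OF N, of "h *\<^sub>R \<xi>"] by linarith
  from mult_right_mono[OF this norm_ge_zero[of "\<nu> \<xi>"]]
  have "(bracket (h *\<^sub>R \<xi>) powr s * bracket (h *\<^sub>R \<xi>) powr (- s)) * norm (U \<xi>) \<le> ?W * norm (\<nu> \<xi>)"
    by (simp add: \<nu>_def norm_mult mult.assoc)
  then show "norm (U \<xi>) / ?W \<le> norm (\<nu> \<xi>)" unfolding bracket_powr_cancel using W0 by (simp add: pos_divide_le_eq mult.commute)
qed

end

lemma ennreal_tendsto_0I:
  fixes f :: "'a \<Rightarrow> ennreal"
  assumes "\<And>c. c > 0 \<Longrightarrow> \<forall>\<^sub>F x in F. f x \<le> ennreal c"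
  shows "(f \<longlongrightarrow> 0) F"
proof (rule order_tendstoI)
  fix a :: ennreal assume "0 < a"
  then obtain b where b: "0 < b" "b < a" using dense by blast
  obtain c where c: "c \<ge> 0" "b = ennreal c" using b(2) by (cases b) auto
  have "c > 0" using b(1) c by (cases "c = 0") auto
  from assms[OF this] show "\<forall>\<^sub>F x in F. f x < a"
    by eventually_elim (use b(2) c in auto)
qed simp

context sampling
begin

definition "sampled \<eta> = per P \<eta> / of_real (h ^ CARD('d))"

lemma sampled_measurable [measurable]: "sampled \<in> borel_measurable borel"
  unfolding sampled_def by measurable

lemma sampled_lshift: "sampled (lshift l \<eta>) = sampled \<eta>"
  by (simp add: sampled_def per_lshift)

lemma norm_sampled: "norm (sampled \<eta>) = norm (per P \<eta>) / h ^ CARD('d)"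
  using h by (simp add: sampled_def norm_divide norm_power)

lemma sampled_integrable: "integrable MQ (\<lambda>\<eta>. (norm (sampled \<eta>))\<^sup>2)"
  unfolding norm_sampled power_divide using per_P_integrable by simp

text \<open>The powers of h balance: |sampled|^2 carries h^(-2d), the rescaling of
  \<open>right\<close> carries h^d, and so does the norm on the lattice of spacing h.\<close>

lemma sampled_outside:
  assumes \<rho>: "\<rho> \<le> pi"
  shows "ennreal (h ^ CARD('d)) * (\<integral>\<^sup>+\<eta>\<in>Q - ball 0 \<rho>. ennreal ((norm (lattice_fourier (fcoef sampled) \<eta>))\<^sup>2) \<partial>lborel) \<le>
     ennreal B * (\<integral>\<^sup>+\<xi>. ennreal ((norm (\<nu> \<xi>))\<^sup>2) * indicator (- ball 0 \<rho>) (h *\<^sub>R \<xi>) \<partial>lborel)"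
proof -
  define H where "H = h ^ CARD('d)"
  have H: "H > 0" using h by (simp add: H_def)
  define X where "X = (\<integral>\<^sup>+\<eta>\<in>Q - ball 0 \<rho>. ennreal ((norm (per P \<eta>))\<^sup>2) \<partial>lborel)"
  define T where "T = (\<integral>\<^sup>+\<xi>. ennreal ((norm (\<nu> \<xi>))\<^sup>2) * indicator (- ball 0 \<rho>) (h *\<^sub>R \<xi>) \<partial>lborel)"
  have e: "ennreal ((norm (sampled \<eta>))\<^sup>2) = ennreal (1 / H\<^sup>2) * ennreal ((norm (per P \<eta>))\<^sup>2)" for \<eta>
    unfolding norm_sampled H_def[symmetric] power_divide by (subst ennreal_mult[symmetric]) auto
  have [measurable]: "Q - ball 0 \<rho> \<in> sets (borel :: (real ^ 'd) measure)" by simp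
  have m: "(\<lambda>\<eta>. ennreal ((norm (per P \<eta>))\<^sup>2) * indicator (Q - ball 0 \<rho>) \<eta>) \<in> borel_measurable lborel" by measurable
  have "(\<integral>\<^sup>+\<eta>\<in>Q - ball 0 \<rho>. ennreal ((norm (lattice_fourier (fcoef sampled) \<eta>))\<^sup>2) \<partial>lborel) =
    (\<integral>\<^sup>+\<eta>. ennreal (1 / H\<^sup>2) * (ennreal ((norm (per P \<eta>))\<^sup>2) * indicator (Q - ball 0 \<rho>) \<eta>) \<partial>lborel)"
  proof (rule nn_integral_cong_AE)
    show "AE \<eta> in lborel. ennreal ((norm (lattice_fourier (fcoef sampled) \<eta>))\<^sup>2) * indicator (Q - ball 0 \<rho>) \<eta> =
      ennreal (1 / H\<^sup>2) * (ennreal ((norm (per P \<eta>))\<^sup>2) * indicator (Q - ball 0 \<rho>) \<eta>)"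
      using lattice_fourier_AE(3)[OF sampled_measurable sampled_integrable sampled_lshift]
      by eventually_elim (simp only: e mult.assoc)
  qed
  also have "\<dots> = ennreal (1 / H\<^sup>2) * X" unfolding X_def by (rule nn_integral_cmult[OF m])
  finally have 1: "(\<integral>\<^sup>+\<eta>\<in>Q - ball 0 \<rho>. ennreal ((norm (lattice_fourier (fcoef sampled) \<eta>))\<^sup>2) \<partial>lborel) = ennreal (1 / H\<^sup>2) * X" .
  have q1: "ennreal H * ennreal (1 / H\<^sup>2) = ennreal (1 / H)" and q2: "ennreal (1 / H) * ennreal H = 1"
    using H by (simp_all add: ennreal_mult[symmetric] power2_eq_square)
  have "X \<le> ennreal B * (\<integral>\<^sup>+\<eta>. ennreal ((norm (right \<eta>))\<^sup>2) * indicator (- ball 0 \<rho>) \<eta> \<partial>lborel)"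
    unfolding X_def by (rule per_P_outside[OF \<rho>])
  also have "(\<integral>\<^sup>+\<eta>. ennreal ((norm (right \<eta>))\<^sup>2) * indicator (- ball 0 \<rho>) \<eta> \<partial>lborel) = ennreal H * T"
    unfolding T_def H_def by (rule right_scale) simp
  finally have "ennreal (1 / H) * X \<le> ennreal (1 / H) * (ennreal B * (ennreal H * T))" by (rule mult_left_mono) simp
  also have "\<dots> = (ennreal (1 / H) * ennreal H) * (ennreal B * T)" by (simp only: mult_ac)
  also have "\<dots> = ennreal B * T" by (simp only: q2 mult_1)
  finally show ?thesis unfolding 1 H_def[symmetric] T_def[symmetric] mult.assoc[symmetric] q1 .
qed

text \<open>\<open>weighted_diff\<close> at r = \<epsilon>/h, transported to the variable \<xi> =
  \<eta>/h; both sides acquire the factor h^d, which is positive and finite and cancels.\<close>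

lemma weighted_error:
  assumes N: "\<bar>s\<bar> \<le> real N" "CARD('d) \<le> N" and \<rho>: "\<rho> \<le> pi" and \<delta>: "\<And>\<eta>. norm \<eta> < \<rho> \<Longrightarrow> norm (p \<eta> - p 0) * bracket \<eta> powr s \<le> \<delta>"
    and e: "h \<le> \<epsilon>" and C: "C \<ge> 0" "\<And>\<xi> :: real ^ 'd. \<xi> \<in> Q \<Longrightarrow> (\<integral>\<^sup>+l. ennreal (1 / (1 + norm (lshift l \<xi>)) ^ (2 * N)) \<partial>count_space UNIV) \<le> ennreal C"
  shows "weighted_sq \<epsilon> N (\<lambda>\<xi>. diff (h *\<^sub>R \<xi>)) \<le>
    ennreal (2 * \<delta>\<^sup>2 + 2 * (2 / (\<epsilon> / h)) ^ (2 * N) * C * B) * (\<integral>\<^sup>+\<xi>. ennreal ((norm (\<nu> \<xi>))\<^sup>2) \<partial>lborel)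
    + ennreal (2 * (sqrt B + norm (p 0) * (1 + pi * CARD('d)) ^ N)\<^sup>2 + 2 * B + 2 * (norm (p 0))\<^sup>2) *
      (\<integral>\<^sup>+\<xi>. ennreal ((norm (\<nu> \<xi>))\<^sup>2) * indicator (- ball 0 \<rho>) (h *\<^sub>R \<xi>) \<partial>lborel)"
    (is "?W \<le> ?a * ?I + ?b * ?J")
proof -
  have r: "\<epsilon> / h \<ge> 1" using e h by simp
  have J: "(\<integral>\<^sup>+\<eta>. ennreal ((norm (right \<eta>))\<^sup>2) * indicator (- ball 0 \<rho>) \<eta> \<partial>lborel) = ennreal (h ^ CARD('d)) * ?J"
    by (rule right_scale) simp
  have "ennreal (h ^ CARD('d)) * ?W = weighted_sq (\<epsilon> / h) N diff"
    by (rule weighted_sq_scale) (use h in auto)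
  also have "\<dots> \<le> ?a * (ennreal (h ^ CARD('d)) * ?I) + ?b * (ennreal (h ^ CARD('d)) * ?J)"
    using weighted_diff[OF N \<rho> \<delta> r C] unfolding J right_L2 .
  also have "\<dots> = ennreal (h ^ CARD('d)) * (?a * ?I + ?b * ?J)" by (simp only: distrib_left mult_ac)
  finally show ?thesis using h by (subst (asm) ennreal_mult_le_mult_iff) auto
qed

end

lemma weighted_sq_add_finite:
  fixes f g :: "'a::euclidean_space \<Rightarrow> complex"
  assumes [measurable]: "f \<in> borel_measurable borel" "g \<in> borel_measurable borel"
    and fin: "weighted_sq \<epsilon> N f < \<infinity>" "weighted_sq \<epsilon> N g < \<infinity>"
  shows "weighted_sq \<epsilon> N (\<lambda>\<xi>. f \<xi> + c * g \<xi>) < \<infinity>"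
proof -
  let ?f = "\<lambda>\<xi>. ennreal ((norm (f \<xi>) / (1 + norm (\<epsilon> *\<^sub>R \<xi>)) ^ N)\<^sup>2)" and ?g = "\<lambda>\<xi>. ennreal ((norm (g \<xi>) / (1 + norm (\<epsilon> *\<^sub>R \<xi>)) ^ N)\<^sup>2)"
  have le: "ennreal ((norm (f \<xi> + c * g \<xi>) / (1 + norm (\<epsilon> *\<^sub>R \<xi>)) ^ N)\<^sup>2) \<le> 2 * ?f \<xi> + ennreal (2 * (norm c)\<^sup>2) * ?g \<xi>" for \<xi>
  proof -
    define W where "W = (1 + norm (\<epsilon> *\<^sub>R \<xi>)) ^ N"
    have W: "W > 0" unfolding W_def by (intro zero_less_power one_plus_norm_pos)
    have "norm (f \<xi> + c * g \<xi>) / W \<le> (norm (f \<xi>) + norm c * norm (g \<xi>)) / W"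
      using W norm_triangle_ineq[of "f \<xi>" "c * g \<xi>"] by (intro divide_right_mono) (simp_all add: norm_mult)
    then have "ennreal ((norm (f \<xi> + c * g \<xi>) / W)\<^sup>2) \<le> 2 * ennreal ((norm (f \<xi>) / W)\<^sup>2) + 2 * ennreal ((norm c * (norm (g \<xi>) / W))\<^sup>2)"
      using W by (intro ennreal_square_sum_le) (auto simp: add_divide_distrib)
    also have "2 * ennreal ((norm c * (norm (g \<xi>) / W))\<^sup>2) = ennreal (2 * (norm c)\<^sup>2) * ennreal ((norm (g \<xi>) / W)\<^sup>2)"
      by (simp only: power_mult_distrib[of "norm c"] ennreal_mult zero_le_power2 ennreal_numeral zero_le_numeral mult.assoc)
    finally show ?thesis unfolding W_def .
  qed
  have "weighted_sq \<epsilon> N (\<lambda>\<xi>. f \<xi> + c * g \<xi>) \<le> (\<integral>\<^sup>+\<xi>. 2 * ?f \<xi> + ennreal (2 * (norm c)\<^sup>2) * ?g \<xi> \<partial>lborel)"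
    unfolding weighted_sq_def by (rule nn_integral_mono) (rule le)
  also have "\<dots> = 2 * weighted_sq \<epsilon> N f + ennreal (2 * (norm c)\<^sup>2) * weighted_sq \<epsilon> N g"
    unfolding weighted_sq_def by (subst nn_integral_add, measurable) (simp add: nn_integral_cmult)
  also have "\<dots> < \<infinity>" using fin by (simp add: ennreal_mult_less_top)
  finally show ?thesis .
qed

section \<open>Passage to the limit along the two scales\<close>

lemma wform_tendsto_0:
  fixes a :: "(real ^ 'd::finite) \<times> (real ^ 'd) \<Rightarrow> complex" and f g :: "nat \<Rightarrow> real ^ 'd \<Rightarrow> complex"
  assumes a: "schwartz a" and m: "\<And>k. f k \<in> borel_measurable borel" "\<And>k. g k \<in> borel_measurable borel"
    and fin: "\<forall>\<^sub>F k in sequentially. weighted_sq (\<epsilon> k) N (f k) < \<infinity>" "\<forall>\<^sub>F k in sequentially. weighted_sq (\<epsilon> k) N (g k) < \<infinity>"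
    and e: "\<And>k. \<epsilon> k > 0" "\<forall>\<^sub>F k in sequentially. \<epsilon> k \<le> 1"
    and X: "X \<longlonglongrightarrow> 0" "\<forall>\<^sub>F k in sequentially. weighted_sq (\<epsilon> k) N (f k) * weighted_sq (\<epsilon> k) N (g k) \<le> ennreal K * X k"
  shows "(\<lambda>k. wform (\<epsilon> k) a (f k) (g k)) \<longlonglongrightarrow> 0"
proof -
  obtain C where C: "\<And>\<epsilon> f g. 0 < \<epsilon> \<Longrightarrow> \<epsilon> \<le> 1 \<Longrightarrow> f \<in> borel_measurable borel \<Longrightarrow> g \<in> borel_measurable borel \<Longrightarrow>
      weighted_sq \<epsilon> N f < \<infinity> \<Longrightarrow> weighted_sq \<epsilon> N g < \<infinity> \<Longrightarrow>
      integrable lborel (\<lambda>\<eta>. cnj (f \<eta>) * fourier (synth \<epsilon> a g) \<eta>) \<and>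
      (ennreal (norm (wform \<epsilon> a f g)))\<^sup>2 \<le> ennreal C * (weighted_sq \<epsilon> N f * weighted_sq \<epsilon> N g)"
    by (rule wform_bound[OF a]) (rule that)
  let ?n = "\<lambda>k. norm (wform (\<epsilon> k) a (f k) (g k))"
  have up: "\<forall>\<^sub>F k in sequentially. ennreal ((?n k)\<^sup>2) \<le> ennreal C * (ennreal K * X k)"
    using fin e(2) X(2)
  proof eventually_elim
    case (elim k)
    have "ennreal ((?n k)\<^sup>2) \<le> ennreal C * (weighted_sq (\<epsilon> k) N (f k) * weighted_sq (\<epsilon> k) N (g k))"
      using C[OF e(1) elim(3) m elim(1,2)] by (simp add: ennreal_power)
    also have "\<dots> \<le> ennreal C * (ennreal K * X k)" by (rule mult_left_mono[OF elim(4)]) simp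
    finally show ?case .
  qed
  have "(\<lambda>k. ennreal C * (ennreal K * X k)) \<longlonglongrightarrow> ennreal C * (ennreal K * 0)"
    by (intro ennreal_tendsto_cmult X) auto
  then have lim: "(\<lambda>k. ennreal C * (ennreal K * X k)) \<longlonglongrightarrow> 0" by simp
  have "(\<lambda>k. ennreal ((?n k)\<^sup>2)) \<longlonglongrightarrow> 0"
    by (rule tendsto_sandwich[OF always_eventually up tendsto_const lim]) simp
  then have "(\<lambda>k. ennreal ((?n k)\<^sup>2)) \<longlonglongrightarrow> ennreal 0" by simp
  then have "(\<lambda>k. (?n k)\<^sup>2) \<longlonglongrightarrow> 0" by (rule tendsto_ennrealD) auto
  from tendsto_real_sqrt[OF this] have "?n \<longlonglongrightarrow> 0" by simp
  then show ?thesis by (rule tendsto_norm_zero_cancel)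
qed

text \<open>\<open>p\<close>, \<open>s\<close> and \<open>B\<close> do not depend on k, and
  \<open>M\<close> bounds the mass of all \<nu> at once. This uniformity is what makes the estimates
  of a single sampling step usable in the limit.\<close>

locale sampling_sequence =
  fixes p :: "real ^ 'd::finite \<Rightarrow> complex" and U :: "nat \<Rightarrow> real ^ 'd \<Rightarrow> complex" and s B M :: real and h \<epsilon> :: "nat \<Rightarrow> real"
  assumes sampling: "\<And>k. sampling p (U k) s B (h k)"
    and e: "\<And>k. \<epsilon> k > 0" and e0: "\<epsilon> \<longlonglongrightarrow> 0" and ratio: "(\<lambda>k. h k / \<epsilon> k) \<longlonglongrightarrow> 0"
    and M: "M \<ge> 0" "\<And>k. (\<integral>\<^sup>+\<xi>. ennreal ((norm (sampling.\<nu> (U k) s (h k) \<xi>))\<^sup>2) \<partial>lborel) \<le> ennreal M"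
    and osc: "((\<lambda>R. limsup (\<lambda>k. \<integral>\<^sup>+\<xi>\<in>{\<xi>. norm \<xi> > R / \<epsilon> k}. ennreal ((norm (sampling.\<nu> (U k) s (h k) \<xi>))\<^sup>2) \<partial>lborel)) \<longlongrightarrow> 0) at_top"
    and p0: "isCont p 0"
begin

lemma h: "h k > 0" and B: "B > 0" and U_meas: "U k \<in> borel_measurable borel"
  using sampling[of k] by (auto simp: sampling_def)

text \<open>The region is |\<xi>| \<ge> R/\<epsilon>, written through h \<xi> and the radius h
  R/\<epsilon> to match the estimates of a single sampling step.\<close>

definition "tail k R = (\<integral>\<^sup>+\<xi>. ennreal ((norm (sampling.\<nu> (U k) s (h k) \<xi>))\<^sup>2) * indicator (- ball 0 (h k / \<epsilon> k * R)) (h k *\<^sub>R \<xi>) \<partial>lborel)"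

lemma tail_small:
  assumes "c > 0"
  obtains R where "R > 0" "\<And>R'. R' \<ge> R \<Longrightarrow> \<forall>\<^sub>F k in sequentially. tail k R' \<le> ennreal c"
proof -
  let ?t = "\<lambda>k R. \<integral>\<^sup>+\<xi>\<in>{\<xi>. norm \<xi> > R / \<epsilon> k}. ennreal ((norm (sampling.\<nu> (U k) s (h k) \<xi>))\<^sup>2) \<partial>lborel"
  have "\<forall>\<^sub>F R in at_top. limsup (\<lambda>k. ?t k R) < ennreal c"
    using order_tendstoD(2)[OF osc, of "ennreal c"] assms by simp
  then obtain R0 where R0: "\<And>R. R \<ge> R0 \<Longrightarrow> limsup (\<lambda>k. ?t k R) < ennreal c"
    unfolding eventually_at_top_linorder by blast
  show ?thesis
  \<comment> \<open>The tail has |\<xi>| \<ge> R'/\<epsilon>, the hypothesis a strict inequality;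
    passing to R'/2 makes it strict, since R' \<ge> 1 is positive. The other bound keeps R'/2 at
    least R0.\<close>
  proof (rule that[of "max 1 (2 * R0)"])
    fix R' assume R': "max 1 (2 * R0) \<le> R'"
    then have "limsup (\<lambda>k. ?t k (R' / 2)) < ennreal c" by (intro R0) simp
    from Limsup_lessD[OF this] show "\<forall>\<^sub>F k in sequentially. tail k R' \<le> ennreal c"
    proof eventually_elim
      case (elim k)
      have "tail k R' \<le> ?t k (R' / 2)" unfolding tail_def
      proof (intro nn_integral_mono mult_left_mono)
        fix \<xi> :: "real ^ 'd"
        have "R' / 2 / \<epsilon> k < norm \<xi>" if "h k / \<epsilon> k * R' \<le> norm (h k *\<^sub>R \<xi>)"
        proof -
          have "h k * (R' / \<epsilon> k) \<le> h k * norm \<xi>" using that h[of k] by simp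
          then have "R' / \<epsilon> k \<le> norm \<xi>" using h[of k] mult_le_cancel_left_pos by blast
          moreover have "R' / 2 / \<epsilon> k < R' / \<epsilon> k" using R' e[of k] by (intro divide_strict_right_mono) auto
          ultimately show ?thesis by linarith
        qed
        then show "(indicator (- ball 0 (h k / \<epsilon> k * R')) (h k *\<^sub>R \<xi>) :: ennreal) \<le> indicator {\<xi>. R' / 2 / \<epsilon> k < norm \<xi>} \<xi>"
          by (auto simp: indicator_def not_less)
      qed simp
      then show ?case using elim by simp
    qed
  qed simp
qed

lemma ratio_times: "(\<lambda>k. h k / \<epsilon> k * R) \<longlonglongrightarrow> 0"
  using tendsto_mult_right[OF ratio, of R] by simp

text \<open>For fixed R the radius h R/\<epsilon> is eventually below pi, so
  \<open>sampled_outside\<close> applies and bounds the discrete tail by B times the continuous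
  one.\<close>

lemma lattice_oscillatory_sampled:
  "lattice_oscillatory h \<epsilon> (\<lambda>k. fcoef (sampling.sampled p (U k) (h k)))"
  unfolding lattice_oscillatory_def
proof (intro conjI allI)
  show "in_l2 (fcoef (sampling.sampled p (U k) (h k)))" for k
    by (rule bessel[OF sampling.sampled_measurable[OF sampling] sampling.sampled_integrable[OF sampling]])
  show "((\<lambda>R. limsup (\<lambda>k. ennreal (h k ^ CARD('d)) *
         (\<integral>\<^sup>+\<xi>\<in>Q - ball 0 (h k / \<epsilon> k * R). ennreal ((norm (lattice_fourier (fcoef (sampling.sampled p (U k) (h k))) \<xi>))\<^sup>2) \<partial>lborel))) \<longlongrightarrow> 0) at_top"
  proof (rule ennreal_tendsto_0I)
    fix c :: real assume c: "c > 0"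
    obtain R where R: "\<And>R'. R' \<ge> R \<Longrightarrow> \<forall>\<^sub>F k in sequentially. tail k R' \<le> ennreal (c / B)"
      using tail_small[of "c / B"] c B by auto
    show "\<forall>\<^sub>F R in at_top. limsup (\<lambda>k. ennreal (h k ^ CARD('d)) *
         (\<integral>\<^sup>+\<xi>\<in>Q - ball 0 (h k / \<epsilon> k * R). ennreal ((norm (lattice_fourier (fcoef (sampling.sampled p (U k) (h k))) \<xi>))\<^sup>2) \<partial>lborel)) \<le> ennreal c"
      using eventually_ge_at_top[of R]
    proof eventually_elim
      case (elim R')
      have "\<forall>\<^sub>F k in sequentially. h k / \<epsilon> k * R' < pi" using order_tendstoD(2)[OF ratio_times, of pi R'] by simp
      with R[OF elim] have "\<forall>\<^sub>F k in sequentially. ennreal (h k ^ CARD('d)) *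
         (\<integral>\<^sup>+\<xi>\<in>Q - ball 0 (h k / \<epsilon> k * R'). ennreal ((norm (lattice_fourier (fcoef (sampling.sampled p (U k) (h k))) \<xi>))\<^sup>2) \<partial>lborel) \<le> ennreal c"
      proof eventually_elim
        case (elim k)
        have "ennreal (h k ^ CARD('d)) *
         (\<integral>\<^sup>+\<xi>\<in>Q - ball 0 (h k / \<epsilon> k * R'). ennreal ((norm (lattice_fourier (fcoef (sampling.sampled p (U k) (h k))) \<xi>))\<^sup>2) \<partial>lborel) \<le> ennreal B * tail k R'"
          unfolding tail_def using elim(2) by (intro sampling.sampled_outside[OF sampling]) simp
        also have "\<dots> \<le> ennreal B * ennreal (c / B)" using elim(1) by (rule mult_left_mono) simp
        also have "\<dots> = ennreal c" using B c by (simp add: ennreal_mult[symmetric])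
        finally show ?case .
      qed
      then show ?case by (rule Limsup_bounded)
    qed
  qed
qed

text \<open>Large enough for three purposes: at least |s| to absorb brackets, at least d to make the
  lattice sum converge, and positive so that (h/\<epsilon>)^(2N) tends to 0.\<close>

definition "weight = nat \<lceil>\<bar>s\<bar>\<rceil> + CARD('d)"

lemma weight: "\<bar>s\<bar> \<le> real weight" "CARD('d) \<le> weight" "weight > 0"
proof -
  have "\<bar>s\<bar> \<le> real (nat \<lceil>\<bar>s\<bar>\<rceil>)" by (rule real_nat_ceiling_ge)
  then show "\<bar>s\<bar> \<le> real weight" unfolding weight_def of_nat_add by linarith
qed (simp_all add: weight_def)

definition "error k \<xi> = sampling.diff p (U k) (h k) (h k *\<^sub>R \<xi>)"

lemma error_measurable: "error k \<in> borel_measurable borel"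
proof -
  have [measurable]: "sampling.diff p (U k) (h k) \<in> borel_measurable borel"
    by (rule sampling.diff_measurable[OF sampling])
  show ?thesis unfolding error_def by measurable
qed

lemma scale_le: "\<forall>\<^sub>F k in sequentially. h k \<le> \<epsilon> k"
proof -
  have "\<forall>\<^sub>F k in sequentially. h k / \<epsilon> k < 1" using order_tendstoD(2)[OF ratio, of 1] by simp
  then show ?thesis by eventually_elim (simp add: e)
qed

lemma weighted_U: "\<forall>\<^sub>F k in sequentially. weighted_sq (\<epsilon> k) weight (U k) \<le> ennreal M"
  using scale_le
proof eventually_elim
  case (elim k)
  from order_trans[OF sampling.weighted_U[OF sampling weight(1) elim] M(2)] show ?case .
qed

text \<open>Order of the choices: \<delta> is fixed and continuity at 0 gives \<rho>; then R comes
  from the oscillation hypothesis; last, k is so large that h R/\<epsilon> is below both \<rho> and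
  pi and the contribution of the other cells is small.\<close>

lemma weighted_error: "(\<lambda>k. weighted_sq (\<epsilon> k) weight (error k)) \<longlonglongrightarrow> 0"
proof (rule ennreal_tendsto_0I)
  fix c :: real assume c: "c > 0"
  let ?K = "2 * (sqrt B + norm (p 0) * (1 + pi * CARD('d)) ^ weight)\<^sup>2 + 2 * B + 2 * (norm (p 0))\<^sup>2"
  have K0: "?K \<ge> 0" using B by simp
  have "2 * weight \<ge> 2 * CARD('d)" using weight(2) by simp
  then obtain C where C: "C \<ge> 0" "\<And>\<xi> :: real ^ 'd. \<xi> \<in> Q \<Longrightarrow> (\<integral>\<^sup>+l. ennreal (1 / (1 + norm (lshift l \<xi>)) ^ (2 * weight)) \<partial>count_space UNIV) \<le> ennreal C"
    using lattice_sum_bound by blast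
  \<comment> \<open>The full mass gets the coefficient 2 \<theta>, one \<theta> from 2 \<delta>^2
    and one from the other cells, and contributes at most c/2; the tail contributes the other c/2.
    Adding 1 to \<open>M\<close> and \<open>?K\<close> keeps the denominators positive.\<close>
  define \<theta> where "\<theta> = c / (4 * (M + 1))"
  have \<theta>: "\<theta> > 0" using c M(1) by (simp add: \<theta>_def)
  define \<delta> where "\<delta> = sqrt (\<theta> / 2)"
  have \<delta>: "\<delta> > 0" "2 * \<delta>\<^sup>2 = \<theta>" using \<theta> by (simp_all add: \<delta>_def)
  have "isCont (\<lambda>\<eta>. norm (p \<eta> - p 0) * bracket \<eta> powr s) 0"
    unfolding bracket_def by (intro continuous_intros p0) auto
  then have "((\<lambda>\<eta>. norm (p \<eta> - p 0) * bracket \<eta> powr s) \<longlongrightarrow> norm (p 0 - p 0) * bracket (0 :: real ^ 'd) powr s) (nhds 0)"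
    using tendsto_at_iff_tendsto_nhds[of "\<lambda>\<eta>. norm (p \<eta> - p 0) * bracket \<eta> powr s" 0] unfolding isCont_def by blast
  from order_tendstoD(2)[OF this, of \<delta>] have "\<forall>\<^sub>F \<eta> in nhds 0. norm (p \<eta> - p 0) * bracket \<eta> powr s < \<delta>"
    using \<delta>(1) by simp
  then obtain \<rho> where \<rho>: "\<rho> > 0" "\<And>\<eta>. norm \<eta> < \<rho> \<Longrightarrow> norm (p \<eta> - p 0) * bracket \<eta> powr s < \<delta>"
    unfolding eventually_nhds_metric by (auto simp: dist_norm)
  obtain R where R: "\<forall>\<^sub>F k in sequentially. tail k R \<le> ennreal (c / (2 * (?K + 1)))"
    using tail_small[of "c / (2 * (?K + 1))"] c K0 by (metis add_nonneg_pos divide_pos_pos mult_pos_pos order_refl zero_less_numeral zero_less_one)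
  have "(\<lambda>k. 2 * (2 * (h k / \<epsilon> k)) ^ (2 * weight) * C * B) \<longlonglongrightarrow> 2 * (2 * 0) ^ (2 * weight) * C * B"
    by (intro tendsto_intros ratio)
  then have "(\<lambda>k. 2 * (2 * (h k / \<epsilon> k)) ^ (2 * weight) * C * B) \<longlonglongrightarrow> 0" using weight(3) by (simp add: zero_power)
  from order_tendstoD(2)[OF this \<theta>] order_tendstoD(2)[OF ratio_times pi_gt_zero, of R] order_tendstoD(2)[OF ratio_times \<rho>(1), of R] R scale_le
  show "\<forall>\<^sub>F k in sequentially. weighted_sq (\<epsilon> k) weight (error k) \<le> ennreal c"
  proof eventually_elim
    case (elim k)
    have x: "2 * (2 / (\<epsilon> k / h k)) ^ (2 * weight) * C * B < \<theta>" using elim(1) by simp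
    have x0: "0 \<le> 2 * (2 / (\<epsilon> k / h k)) ^ (2 * weight) * C * B" using C(1) B h[of k] e[of k] by simp
    let ?I = "\<integral>\<^sup>+\<xi>. ennreal ((norm (sampling.\<nu> (U k) s (h k) \<xi>))\<^sup>2) \<partial>lborel"
    have "weighted_sq (\<epsilon> k) weight (error k) \<le> ennreal (2 * \<delta>\<^sup>2 + 2 * (2 / (\<epsilon> k / h k)) ^ (2 * weight) * C * B) * ?I + ennreal ?K * tail k R"
      unfolding error_def tail_def
    proof (rule sampling.weighted_error[OF sampling weight(1,2) _ _ elim(5) C])
      show "h k / \<epsilon> k * R \<le> pi" using elim(2) by simp
      show "norm (p \<eta> - p 0) * bracket \<eta> powr s \<le> \<delta>" if "norm \<eta> < h k / \<epsilon> k * R" for \<eta>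
        using \<rho>(2)[of \<eta>] that elim(3) by linarith
    qed
    also have "\<dots> \<le> ennreal (2 * \<theta>) * ennreal M + ennreal ?K * ennreal (c / (2 * (?K + 1)))"
      using x \<delta>(2) M(2)[of k] elim(4) less_imp_le[OF B] by (intro add_mono mult_mono ennreal_leI) auto
    also have "\<dots> = ennreal (2 * \<theta> * M + ?K * (c / (2 * (?K + 1))))"
      using \<theta> M(1) K0 c by (simp only: ennreal_plus ennreal_mult mult_nonneg_nonneg less_imp_le zero_le_numeral divide_nonneg_nonneg add_nonneg_nonneg zero_le_one)
    also have "\<dots> \<le> ennreal c"
    proof (rule ennreal_leI)
      have 1: "2 * \<theta> * M \<le> c / 2" using M(1) c by (simp add: \<theta>_def field_simps)
      have 2: "y * (c / (2 * (y + 1))) \<le> c / 2" if "y \<ge> 0" for y :: real using that c by (simp add: field_simps)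
      show "2 * \<theta> * M + ?K * (c / (2 * (?K + 1))) \<le> c" using 1 2[OF K0] by linarith
    qed
    finally show ?case .
  qed
qed

text \<open>With w = error + c U in both slots, the three terms containing an error vanish in the
  limit by the form bound, and the fourth carries cnj c * c, the square of the modulus of p at
  0.\<close>

lemma wigner_difference:
  assumes a: "schwartz a"
  shows "(\<lambda>k. wform (\<epsilon> k) a (\<lambda>\<xi>. per (sampled_symbol p (h k) (U k)) (h k *\<^sub>R \<xi>)) (\<lambda>\<xi>. per (sampled_symbol p (h k) (U k)) (h k *\<^sub>R \<xi>))
     - of_real ((norm (p 0))\<^sup>2) * wform (\<epsilon> k) a (U k) (U k)) \<longlonglongrightarrow> 0"
proof -
  define c where "c = cnj (p 0)"
  have cc: "of_real ((norm (p 0))\<^sup>2) = cnj c * c" unfolding c_def by (simp only: complex_norm_square complex_cnj_cnj)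
  obtain C where C: "\<And>\<epsilon> f g. 0 < \<epsilon> \<Longrightarrow> \<epsilon> \<le> 1 \<Longrightarrow> f \<in> borel_measurable borel \<Longrightarrow> g \<in> borel_measurable borel \<Longrightarrow>
      weighted_sq \<epsilon> weight f < \<infinity> \<Longrightarrow> weighted_sq \<epsilon> weight g < \<infinity> \<Longrightarrow>
      integrable lborel (\<lambda>\<eta>. cnj (f \<eta>) * fourier (synth \<epsilon> a g) \<eta>) \<and>
      (ennreal (norm (wform \<epsilon> a f g)))\<^sup>2 \<le> ennreal C * (weighted_sq \<epsilon> weight f * weighted_sq \<epsilon> weight g)"
    by (rule wform_bound[OF a]) (rule that)
  have e1: "\<forall>\<^sub>F k in sequentially. \<epsilon> k \<le> 1"
    using order_tendstoD(2)[OF e0, of 1] by (simp add: eventually_mono[where P="\<lambda>k. \<epsilon> k < 1"])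
  have d1: "\<forall>\<^sub>F k in sequentially. weighted_sq (\<epsilon> k) weight (error k) \<le> 1"
    using order_tendstoD(2)[OF weighted_error, of 1] by (simp add: eventually_mono[where P="\<lambda>k. weighted_sq (\<epsilon> k) weight (error k) < 1"])
  have fd: "\<forall>\<^sub>F k in sequentially. weighted_sq (\<epsilon> k) weight (error k) < \<infinity>"
    using d1 by eventually_elim (simp add: le_less_trans)
  have fU: "\<forall>\<^sub>F k in sequentially. weighted_sq (\<epsilon> k) weight (U k) < \<infinity>"
    using weighted_U by eventually_elim (simp add: le_less_trans)
  note t0 = wform_tendsto_0[OF a _ _ _ _ e e1 weighted_error]
  have dd: "(\<lambda>k. wform (\<epsilon> k) a (error k) (error k)) \<longlonglongrightarrow> 0"
    by (rule t0[OF error_measurable error_measurable fd fd, of 1], use d1 in eventually_elim) (simp add: mult_left_le)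
  have du: "\<forall>\<^sub>F k in sequentially. weighted_sq (\<epsilon> k) weight (error k) * weighted_sq (\<epsilon> k) weight (U k) \<le> ennreal M * weighted_sq (\<epsilon> k) weight (error k)"
    using weighted_U by eventually_elim (subst mult.commute, rule mult_right_mono, auto)
  have dU: "(\<lambda>k. wform (\<epsilon> k) a (error k) (U k)) \<longlonglongrightarrow> 0"
    by (rule t0[OF error_measurable U_meas fd fU du])
  have Ud: "(\<lambda>k. wform (\<epsilon> k) a (U k) (error k)) \<longlonglongrightarrow> 0"
    using du by (intro t0[OF U_meas error_measurable fU fd, of M]) (simp add: mult.commute)
  have "(\<lambda>k. wform (\<epsilon> k) a (error k) (error k) + c * wform (\<epsilon> k) a (error k) (U k) + cnj c * wform (\<epsilon> k) a (U k) (error k)) \<longlonglongrightarrow> 0 + c * 0 + cnj c * 0"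
    by (intro tendsto_intros dd dU Ud)
  then have lim: "(\<lambda>k. wform (\<epsilon> k) a (error k) (error k) + c * wform (\<epsilon> k) a (error k) (U k) + cnj c * wform (\<epsilon> k) a (U k) (error k)) \<longlonglongrightarrow> 0" by simp
  show ?thesis
  proof (rule Lim_transform_eventually[OF lim])
    from e1 fd fU show "\<forall>\<^sub>F k in sequentially. wform (\<epsilon> k) a (error k) (error k) + c * wform (\<epsilon> k) a (error k) (U k) + cnj c * wform (\<epsilon> k) a (U k) (error k) =
      wform (\<epsilon> k) a (\<lambda>\<xi>. per (sampled_symbol p (h k) (U k)) (h k *\<^sub>R \<xi>)) (\<lambda>\<xi>. per (sampled_symbol p (h k) (U k)) (h k *\<^sub>R \<xi>))
     - of_real ((norm (p 0))\<^sup>2) * wform (\<epsilon> k) a (U k) (U k)"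
    proof eventually_elim
      case (elim k)
      let ?w = "\<lambda>\<xi>. error k \<xi> + c * U k \<xi>"
      note D = error_measurable[of k] elim(2) and V = U_meas[of k] elim(3)
      have w: "per (sampled_symbol p (h k) (U k)) (h k *\<^sub>R \<xi>) = ?w \<xi>" for \<xi>
        unfolding error_def sampling.diff_def[OF sampling] c_def using h[of k] by simp
      have W: "?w \<in> borel_measurable borel" "weighted_sq (\<epsilon> k) weight ?w < \<infinity>"
        using D(1) V(1) by measurable (rule weighted_sq_add_finite[OF D(1) V(1) D(2) V(2)])
      note I = C[OF e elim(1), THEN conjunct1]
      have "wform (\<epsilon> k) a ?w ?w = wform (\<epsilon> k) a (error k) ?w + cnj c * wform (\<epsilon> k) a (U k) ?w"
        by (rule wform_add_left[OF I[OF D(1) W(1) D(2) W(2)] I[OF V(1) W(1) V(2) W(2)]])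
      also have "wform (\<epsilon> k) a (error k) ?w = wform (\<epsilon> k) a (error k) (error k) + c * wform (\<epsilon> k) a (error k) (U k)"
        by (rule wform_add_right[OF a e D V I[OF D(1) D(1) D(2) D(2)] I[OF D(1) V(1) D(2) V(2)]])
      also have "wform (\<epsilon> k) a (U k) ?w = wform (\<epsilon> k) a (U k) (error k) + c * wform (\<epsilon> k) a (U k) (U k)"
        by (rule wform_add_right[OF a e D V I[OF V(1) D(1) V(2) D(2)] I[OF V(1) V(1) V(2) V(2)]])
      finally show ?case unfolding w cc by (simp add: algebra_simps)
    qed
  qed
qed

end

section \<open>Scaling of the limit measure and assembly of the theorem\<close>

lemma scale_measure_eq_density: "scale_measure r \<mu> = density \<mu> (\<lambda>_. r)"
  by (rule measure_eqI) (simp_all add: emeasure_density_const)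

text \<open>Integrability, temperedness and local finiteness are inherited from \<mu> by scaling.
  The value r = 0 is included, as \<phi>hat may vanish at 0; the limit is then the zero
  measure.\<close>

lemma tendsto_measure_scale:
  fixes T T' :: "nat \<Rightarrow> 'a::euclidean_space distribution"
  assumes r: "r \<ge> 0" and T: "tendsto_measure T \<mu>" and T': "\<And>k. tempered (T' k)"
    and lim: "\<And>a. schwartz a \<Longrightarrow> (\<lambda>k. T' k a - of_real r * T k a) \<longlonglongrightarrow> 0"
  shows "tendsto_measure T' (scale_measure (ennreal r) \<mu>)"
proof -
  let ?s = "scale_measure (ennreal r) \<mu>"
  have int: "integrable \<mu> a" if "schwartz a" for a using T that by (simp add: tendsto_measure_def)
  have int': "integrable ?s a" and val: "(LINT z|?s. a z) = of_real r * (LINT z|\<mu>. a z)" if a: "schwartz a" for a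
  proof -
    have m: "a \<in> borel_measurable \<mu>" using int[OF a] by (rule borel_measurable_integrable)
    show "integrable ?s a" unfolding scale_measure_eq_density
      using r int[OF a] by (subst integrable_density[OF m]) auto
    show "(LINT z|?s. a z) = of_real r * (LINT z|\<mu>. a z)" unfolding scale_measure_eq_density
      using r by (subst integral_density[OF m]) (auto simp: scaleR_conv_of_real)
  qed
  obtain C N where C: "\<And>f. schwartz f \<Longrightarrow> norm (LINT z|\<mu>. f z) \<le> C * schwartz_seminorm N f"
    using T unfolding tendsto_measure_def tendsto_tempered_def tempered_def by blast
  have tempered: "tempered (\<lambda>a. LINT z|?s. a z)" unfolding tempered_def
  proof (intro conjI allI impI)
    fix f g :: "'a \<Rightarrow> complex" assume "schwartz f" "schwartz g"
    then show "(LINT z|?s. f z + g z) = (LINT z|?s. f z) + (LINT z|?s. g z)"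
      by (intro Bochner_Integration.integral_add int')
  next
    show "(LINT z|?s. c * f z) = c * (LINT z|?s. f z)" for c and f :: "'a \<Rightarrow> complex" by (rule integral_mult_right_zero)
  next
    have "norm (LINT z|?s. f z) \<le> (r * C) * schwartz_seminorm N f" if f: "schwartz f" for f
      using mult_left_mono[OF C[OF f] r] r unfolding val[OF f] by (simp add: norm_mult mult.assoc)
    then show "\<exists>C N. \<forall>f. schwartz f \<longrightarrow> norm (LINT z|?s. f z) \<le> C * schwartz_seminorm N f" by blast
  qed
  have conv: "(\<lambda>k. T' k a) \<longlonglongrightarrow> (LINT z|?s. a z)" if a: "schwartz a" for a
  proof -
    have "(\<lambda>k. T k a) \<longlonglongrightarrow> (LINT z|\<mu>. a z)"
      using T a unfolding tendsto_measure_def tendsto_tempered_def by blast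
    from tendsto_add[OF lim[OF a] tendsto_mult_left[OF this, of "of_real r"]] show ?thesis
      unfolding val[OF a] by simp
  qed
  have "radon_measure ?s"
    using T by (auto simp: tendsto_measure_def radon_measure_def ennreal_mult_less_top)
  then show ?thesis
    using int' tempered conv T' by (simp add: tendsto_measure_def tendsto_tempered_def)
qed

text \<open>\<open>L2_norm\<close> is computed with the selected representative, whereas square
  integrability is known for some representative. It is moved across the null set before
  \<open>L2_fourier_bound\<close> is applied.\<close>

lemma L2_norm_fourier_bound:
  fixes v :: "(real ^ 'd::finite) distribution"
  assumes v: "in_L2 v" and G: "represents G (fourier_dist v)" and K: "L2_norm v \<le> K"
  shows "(\<integral>\<^sup>+\<xi>. ennreal ((norm (G \<xi>))\<^sup>2) \<partial>lborel) \<le> ennreal ((2 * pi) ^ CARD('d) * K\<^sup>2)"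
proof -
  obtain g where g: "represents g v" "integrable lborel (\<lambda>x. (norm (g x))\<^sup>2)"
    using v unfolding in_L2_def by blast
  note f = fun_of_represents[OF g(1)]
  have [measurable]: "fun_of v \<in> borel_measurable borel" using f by (simp add: represents_def)
  have "integrable lborel (\<lambda>x. (norm (fun_of v x))\<^sup>2)"
  proof (rule integrable_cong_AE_imp[OF g(2)])
    show "AE x in lborel. (norm (g x))\<^sup>2 = (norm (fun_of v x))\<^sup>2"
      using fun_of_AE[OF g(1)] by eventually_elim simp
  qed measurable
  from L2_fourier_bound[OF f this G]
  have "(\<integral>\<^sup>+\<xi>. ennreal ((norm (G \<xi>))\<^sup>2) \<partial>lborel) \<le> ennreal ((2 * pi) ^ CARD('d) * (L2_norm v)\<^sup>2)"
    unfolding L2_norm_def by (simp add: integral_nonneg_AE)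
  also have "\<dots> \<le> ennreal ((2 * pi) ^ CARD('d) * K\<^sup>2)"
    using K by (intro ennreal_leI mult_left_mono power_mono) (auto simp: L2_norm_def integral_nonneg_AE)
  finally show ?thesis .
qed

theorem theorem6p2:
  fixes \<phi> :: "(real ^ 'd::finite) distribution"
    and \<phi>hat :: "real ^ 'd \<Rightarrow> complex"
    and V :: "(real ^ 'd) set"
    and s :: real
    and h \<epsilon> :: "nat \<Rightarrow> real"
    and u :: "nat \<Rightarrow> (real ^ 'd) distribution"
  assumes "BP s \<phi>"
    and "represents \<phi>hat (fourier_dist \<phi>)"
    and "open V" and "0 \<in> V" and "continuous_on V \<phi>hat"
    and "is_scale h" and "is_scale \<epsilon>" and "(\<lambda>k. h k / \<epsilon> k) \<longlonglongrightarrow> 0"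
    and "\<And>k. sobolev (- s) (u k)"
    and "bounded_in_L2 (\<lambda>k. bracket_hD (h k) (- s) (u k))"
    and "oscillatory \<epsilon> (\<lambda>k. bracket_hD (h k) (- s) (u k))"
  shows "lattice_oscillatory h \<epsilon> (\<lambda>k. sample \<phi> (h k) (u k)) \<and>
    (\<forall>\<mu>. tendsto_measure (\<lambda>k. wigner (\<epsilon> k) (u k)) \<mu> \<longrightarrow>
       tendsto_measure (\<lambda>k. lattice_wigner (h k) (\<epsilon> k) (sample \<phi> (h k) (u k)))
         (scale_measure (ennreal ((norm (\<phi>hat 0))\<^sup>2)) \<mu>))"
proof -
  let ?r = "(norm (\<phi>hat 0))\<^sup>2"
  have h: "h k > 0" and e: "\<epsilon> k > 0" and e0: "\<epsilon> \<longlonglongrightarrow> 0" for k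
    using assms(6,7) by (auto simp: is_scale_def)
  have pm: "\<phi>hat \<in> borel_measurable borel" using assms(2) by (simp add: represents_def)
  obtain B where B: "B > 0"
    "AE \<xi> in lborel. (\<integral>\<^sup>+l. ennreal ((bracket (lshift l \<xi>) powr s * norm (\<phi>hat (lshift l \<xi>)))\<^sup>2) \<partial>count_space UNIV) \<le> ennreal B"
    by (rule BP_AE[OF assms(1,2)])
  have "\<exists>g. represents g (fourier_dist (u k))" for k
    using assms(9)[of k] unfolding sobolev_def by blast
  then obtain U where U: "\<And>k. represents (U k) (fourier_dist (u k))" by metis
  have Um: "U k \<in> borel_measurable borel" for k using U[of k] by (simp add: represents_def)
  define v where "v k = bracket_hD (h k) (- s) (u k)" for k
  define G where "G k \<xi> = of_real (bracket (h k *\<^sub>R \<xi>) powr (- s)) * U k \<xi>" for k \<xi>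
  have G: "represents (G k) (fourier_dist (v k))" for k
    unfolding G_def v_def by (rule represents_bracket_hD[OF U])
  have vL2: "in_L2 (v k)" for k using assms(10) by (simp add: bounded_in_L2_def v_def)
  obtain K where K: "\<And>k. L2_norm (v k) \<le> K"
    using assms(10) unfolding bounded_in_L2_def bdd_above_def v_def by auto
  define M where "M = (2 * pi) ^ CARD('d) * K\<^sup>2"
  have M: "(\<integral>\<^sup>+\<xi>. ennreal ((norm (G k \<xi>))\<^sup>2) \<partial>lborel) \<le> ennreal M" for k
    unfolding M_def by (rule L2_norm_fourier_bound[OF vL2 G K])
  have S: "sampling \<phi>hat (U k) s B (h k)" for k
  proof
    show "(\<integral>\<^sup>+\<xi>. ennreal ((norm (of_real (bracket (h k *\<^sub>R \<xi>) powr (- s)) * U k \<xi>))\<^sup>2) \<partial>lborel) < \<infinity>"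
      using M[of k] unfolding G_def by (rule le_less_trans) simp
  qed (use pm Um h B in auto)
  have \<nu>: "sampling.\<nu> (U k) s (h k) = G k" for k
    by (rule ext) (simp add: sampling.\<nu>_def[OF S] G_def)
  \<comment> \<open>The oscillation hypothesis is phrased with the selected representative of the
    transform; \<open>G\<close> is another one, so the integrals agree.\<close>
  have tail: "(\<integral>\<^sup>+\<xi>\<in>A. ennreal ((norm (fourier_fun (v k) \<xi>))\<^sup>2) \<partial>lborel) = (\<integral>\<^sup>+\<xi>\<in>A. ennreal ((norm (G k \<xi>))\<^sup>2) \<partial>lborel)" for A k
  proof (rule nn_integral_cong_AE)
    show "AE \<xi> in lborel. ennreal ((norm (fourier_fun (v k) \<xi>))\<^sup>2) * indicator A \<xi> = ennreal ((norm (G k \<xi>))\<^sup>2) * indicator A \<xi>"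
      using fun_of_AE[OF G[of k]] unfolding fourier_fun_def by eventually_elim simp
  qed
  interpret sampling_sequence \<phi>hat U s B M h \<epsilon>
  proof (rule sampling_sequence.intro)
    \<comment> \<open>Continuity near 0 is what gives the value at 0 a meaning: two representatives
      that are continuous near 0 agree there.\<close>
    show "isCont \<phi>hat 0" using assms(3,4,5) by (simp add: continuous_on_eq_continuous_at)
    show "((\<lambda>R. limsup (\<lambda>k. \<integral>\<^sup>+\<xi>\<in>{\<xi>. norm \<xi> > R / \<epsilon> k}. ennreal ((norm (sampling.\<nu> (U k) s (h k) \<xi>))\<^sup>2) \<partial>lborel)) \<longlongrightarrow> 0) at_top"
      using assms(11) unfolding \<nu> oscillatory_def v_def[symmetric] tail by simp
    show "M \<ge> 0" by (simp add: M_def)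
    show "(\<integral>\<^sup>+\<xi>. ennreal ((norm (sampling.\<nu> (U k) s (h k) \<xi>))\<^sup>2) \<partial>lborel) \<le> ennreal M" for k
      unfolding \<nu> by (rule M)
  qed (use S e e0 assms(8) in auto)
  have sample: "sample \<phi> (h k) (u k) = fcoef (sampling.sampled \<phi>hat (U k) (h k))" for k
  proof -
    have "sampling.sampled \<phi>hat (U k) (h k) = (\<lambda>\<eta>. per (sampled_symbol \<phi>hat (h k) (U k)) \<eta> / of_real (h k ^ CARD('d)))"
      by (rule ext) (rule sampling.sampled_def[OF S])
    then show ?thesis using sample_eq_fcoef[OF assms(2) U h sampling.P_integrable[OF S]] by simp
  qed
  have "tendsto_measure (\<lambda>k. lattice_wigner (h k) (\<epsilon> k) (sample \<phi> (h k) (u k))) (scale_measure (ennreal ?r) \<mu>)"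
    if \<mu>: "tendsto_measure (\<lambda>k. wigner (\<epsilon> k) (u k)) \<mu>" for \<mu>
  proof (rule tendsto_measure_scale[OF _ \<mu>])
    show "tempered (lattice_wigner (h k) (\<epsilon> k) (sample \<phi> (h k) (u k)))" for k
      unfolding sample
      by (rule tempered_lattice_wigner[OF sampling.sampled_measurable[OF S] sampling.sampled_integrable[OF S] sampling.sampled_lshift[OF S] h e])
  next
    fix a :: "(real ^ 'd) \<times> (real ^ 'd) \<Rightarrow> complex" assume a: "schwartz a"
    define D where "D = complex_of_real ((2 * pi) ^ (2 * CARD('d)))"
    let ?w = "\<lambda>k \<xi>. per (sampled_symbol \<phi>hat (h k) (U k)) (h k *\<^sub>R \<xi>)"
    have lim: "(\<lambda>k. (wform (\<epsilon> k) a (?w k) (?w k) - of_real ?r * wform (\<epsilon> k) a (U k) (U k)) * (1 / D)) \<longlonglongrightarrow> 0"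
      by (rule tendsto_mult_left_zero[OF wigner_difference[OF a]])
    have e1: "\<forall>\<^sub>F k in sequentially. \<epsilon> k < 1" using order_tendstoD(2)[OF e0, of 1] by simp
    show "(\<lambda>k. lattice_wigner (h k) (\<epsilon> k) (sample \<phi> (h k) (u k)) a - of_real ?r * wigner (\<epsilon> k) (u k) a) \<longlonglongrightarrow> 0"
    \<comment> \<open>Both Wigner transforms are values of the form only for large k: the lattice
      identity asks for \<epsilon> \<le> 1, and the weighted norm of \<open>U k\<close> is known to
      be finite once h \<le> \<epsilon>.\<close>
    proof (rule Lim_transform_eventually[OF lim])
      from e1 weighted_U show "\<forall>\<^sub>F k in sequentially. (wform (\<epsilon> k) a (?w k) (?w k) - of_real ?r * wform (\<epsilon> k) a (U k) (U k)) * (1 / D) =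
        lattice_wigner (h k) (\<epsilon> k) (sample \<phi> (h k) (u k)) a - of_real ?r * wigner (\<epsilon> k) (u k) a"
      proof eventually_elim
        case (elim k)
        have fin: "weighted_sq (\<epsilon> k) weight (U k) < \<infinity>" using elim(2) by (rule le_less_trans) simp
        have "wigner (\<epsilon> k) (u k) a = wform (\<epsilon> k) a (U k) (U k) / D"
          unfolding D_def by (rule wigner_eq_wform[OF U e a fin])
        moreover have "lattice_wigner (h k) (\<epsilon> k) (sample \<phi> (h k) (u k)) a = wform (\<epsilon> k) a (?w k) (?w k) / D"
          unfolding D_def sample_eq_fcoef[OF assms(2) U h sampling.P_integrable[OF S]]
          using elim(1) by (intro lattice_wigner_eq_wform[OF sampling.meas(4)[OF S] h e _ a sampling.per_P_integrable[OF S]]) simp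
        ultimately show ?case by (simp add: diff_divide_distrib)
      qed
    qed
  qed simp
  then show ?thesis unfolding sample using lattice_oscillatory_sampled by blast
qed

end
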